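(* Let $u\in C^\infty(\mathbb{R}^3)$ be a solution (in the sense defined in the context) of $$(-\Delta)^{\frac32}u=2e^{3u}\quad\text{in }\mathbb{R}^3,\qquad \int_{\mathbb{R}^3}e^{3u}\,dx<\infty.$$ Let $p=u-v$ be the polynomial described in the context, and let $g_u=e^{2u}|dx|^2$. Then the following are equivalent: (i) $u$ is a spherical solution, i.e. there exist $\lambda>0$ and $x_0\in\mathbb{R}^3$ such that $u(x)=\log\left(\frac{2\lambda}{1+\lambda^2|x-x_0|^2}\right)$ for all $x\in\mathbb{R}^3$; (ii) $\deg p=0$; (iii) $\lim_{|x|\to\infty}\Delta u(x)=0$; (iv) $u(x)=o(|x|^2)$ as $|x|\to\infty$; (v) $\liminf_{|x|\to\infty}R_{g_u}>-\infty$, where $R_{g_u}$ is the scalar curvature of $g_u$; (vi) $\pi^*g_u$ can be extended to a Riemannian metric on $\mathbb{S}^3$, where $\pi:\mathbb{S}^3\setminus\{\mathbf{s}\}\to\mathbb{R}^3$ is the stereographic projection and $\mathbf{s}\in\mathbb{S}^3$ is the south pole. Moreover, if $u$ is not a spherical solution, then there exists a constant $a>0$ such that $$\Delta u(x)\to -a\quad\text{as }|x|\to+\infty.$$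
   Context: For $\varphi$ in the Schwartz space $\mathcal{S}(\mathbb{R}^3)$, $(-\Delta)^{\frac12}\varphi$ is the function with Fourier transform $|\xi|\hat\varphi(\xi)$. Let $$L_{1/2}(\mathbb{R}^3)=\Big\{v\in L^1_{\mathrm{loc}}(\mathbb{R}^3):\int_{\mathbb{R}^3}\frac{|v(x)|}{1+|x|^4}\,dx<\infty\Big\}.$$ Given a tempered distribution $f$ on $\mathbb{R}^3$, a function $u$ is a solution of $(-\Delta)^{\frac32}u=f$ if $u\in W^{2,1}_{\mathrm{loc}}(\mathbb{R}^3)$, $\Delta u\in L_{1/2}(\mathbb{R}^3)$ and $$\int_{\mathbb{R}^3}(-\Delta u)\,(-\Delta)^{\frac12}\varphi\,dx=\langle f,\varphi\rangle\quad\text{for every }\varphi\in\mathcal{S}(\mathbb{R}^3).$$ For $u$ as in the claim, set $$v(x):=\frac1{\pi^2}\int_{\mathbb{R}^3}\log\left(\frac{|y|}{|x-y|}\right)e^{3u(y)}\,dy,\qquad p:=u-v;$$ then $p$ is a polynomial of degree $0$ (a constant) or $2$, bounded from above. $|dx|^2$ is the Euclidean metric. With $\mathbb{S}^3=\{x\in\mathbb{R}^4:|x|=1\}$ and $\mathbf{s}=(0,0,0,-1)$, the stereographic projection is $\pi(x',x_4)=\frac{x'}{1+x_4}$, $x'=(x_1,x_2,x_3)$. *)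

theory Defs
  imports "HOL-Analysis.Analysis" "HOL-Library.Landau_Symbols"
begin

section \<open>Iterated derivatives and smooth functions\<close>

definition dir_deriv ::
  "'a::euclidean_space \<Rightarrow> ('a \<Rightarrow> 'b::real_normed_vector) \<Rightarrow> 'a \<Rightarrow> 'b" where
  "dir_deriv b f x = frechet_derivative f (at x) b"

text \<open>A multi-index is a list of basis vectors, so its order is the length of the list.\<close>

definition iter_deriv ::
  "'a::euclidean_space list \<Rightarrow> ('a \<Rightarrow> 'b::real_normed_vector) \<Rightarrow> 'a \<Rightarrow> 'b" where
  "iter_deriv bs f = foldr dir_deriv bs f"

text \<open>On an open set this is \<open>C\<^sup>\<infinity>\<close>: differentiability of every iterated partial derivative makes
  all of them continuous, and the Frechet derivative at a point only depends on the germ of the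
  function there.\<close>

definition smooth_on :: "'a::euclidean_space set \<Rightarrow> ('a \<Rightarrow> 'b::real_normed_vector) \<Rightarrow> bool" where
  "smooth_on U f \<longleftrightarrow> open U \<and>
     (\<forall>bs\<in>lists Basis. \<forall>x\<in>U. iter_deriv bs f differentiable (at x))"

definition laplacian :: "('a::euclidean_space \<Rightarrow> real) \<Rightarrow> 'a \<Rightarrow> real" where
  "laplacian u x = (\<Sum>b\<in>Basis. iter_deriv [b, b] u x)"


section \<open>Local Sobolev spaces\<close>

definition L1_loc :: "('a::euclidean_space \<Rightarrow> real) \<Rightarrow> bool" where
  "L1_loc v \<longleftrightarrow> (\<forall>K. compact K \<longrightarrow> v absolutely_integrable_on K)"

definition test_function :: "('a::euclidean_space \<Rightarrow> real) \<Rightarrow> bool" where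
  "test_function \<phi> \<longleftrightarrow> smooth_on UNIV \<phi> \<and> compact (closure {x. \<phi> x \<noteq> 0})"

definition weak_deriv ::
  "'a::euclidean_space list \<Rightarrow> ('a \<Rightarrow> real) \<Rightarrow> ('a \<Rightarrow> real) \<Rightarrow> bool" where
  "weak_deriv bs u w \<longleftrightarrow> L1_loc u \<and> L1_loc w \<and>
     (\<forall>\<phi>. test_function \<phi> \<longrightarrow>
        (LINT x|lebesgue. u x * iter_deriv bs \<phi> x)
          = (-1) ^ length bs * (LINT x|lebesgue. w x * \<phi> x))"

definition W1_loc :: "nat \<Rightarrow> ('a::euclidean_space \<Rightarrow> real) \<Rightarrow> bool" where
  "W1_loc k u \<longleftrightarrow> (\<forall>bs\<in>lists Basis. length bs \<le> k \<longrightarrow> (\<exists>w. weak_deriv bs u w))"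

definition weak_laplacian :: "('a::euclidean_space \<Rightarrow> real) \<Rightarrow> ('a \<Rightarrow> real) \<Rightarrow> bool" where
  "weak_laplacian u w \<longleftrightarrow>
     (\<exists>H. (\<forall>b\<in>Basis. weak_deriv [b, b] u (H b)) \<and> (\<forall>x. w x = (\<Sum>b\<in>Basis. H b x)))"


section \<open>Schwartz functions, tempered distributions, the half Laplacian\<close>

definition schwartz :: "('a::euclidean_space \<Rightarrow> complex) \<Rightarrow> bool" where
  "schwartz \<phi> \<longleftrightarrow> smooth_on UNIV \<phi> \<and>
     (\<forall>k. \<forall>bs\<in>lists Basis. bounded (range (\<lambda>x. (1 + norm x) ^ k *\<^sub>R iter_deriv bs \<phi> x)))"

definition schwartz_norm :: "nat \<Rightarrow> ('a::euclidean_space \<Rightarrow> complex) \<Rightarrow> real" where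
  "schwartz_norm N \<phi> =
     Sup {(1 + norm x) ^ N * norm (iter_deriv bs \<phi> x) | x bs. bs \<in> lists Basis \<and> length bs \<le> N}"

definition tempered_distribution ::
  "(('a::euclidean_space \<Rightarrow> complex) \<Rightarrow> complex) \<Rightarrow> bool" where
  "tempered_distribution f \<longleftrightarrow>
     (\<forall>\<phi> \<psi>. schwartz \<phi> \<longrightarrow> schwartz \<psi> \<longrightarrow> f (\<lambda>x. \<phi> x + \<psi> x) = f \<phi> + f \<psi>) \<and>
     (\<forall>c \<phi>. schwartz \<phi> \<longrightarrow> f (\<lambda>x. c * \<phi> x) = c * f \<phi>) \<and>
     (\<exists>C N. \<forall>\<phi>. schwartz \<phi> \<longrightarrow> norm (f \<phi>) \<le> C * schwartz_norm N \<phi>)"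

definition distribution_of ::
  "('a::euclidean_space \<Rightarrow> real) \<Rightarrow> ('a \<Rightarrow> complex) \<Rightarrow> complex" where
  "distribution_of h \<phi> = (LINT x|lebesgue. complex_of_real (h x) * \<phi> x)"

definition fourier :: "('a::euclidean_space \<Rightarrow> complex) \<Rightarrow> 'a \<Rightarrow> complex" where
  "fourier \<phi> \<xi> = complex_of_real ((2 * pi) powr (- (real DIM('a) / 2))) *
     (LINT x|lebesgue. cis (- (x \<bullet> \<xi>)) * \<phi> x)"

text \<open>For a Schwartz function \<open>\<phi>\<close> on an \<open>n\<close>-dimensional space, the function with Fourier transform
  \<open>|\<xi>| * fourier \<phi> \<xi>\<close> is continuous and of order \<open>|x|\<close> to the power \<open>-(n+1)\<close> at infinity, hence
  integrable, so its Fourier transform is given by the integral above; continuity singles out one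
  function in its class modulo null sets.\<close>

definition half_laplacian :: "('a::euclidean_space \<Rightarrow> complex) \<Rightarrow> 'a \<Rightarrow> complex" where
  "half_laplacian \<phi> = (THE \<psi>. continuous_on UNIV \<psi> \<and> integrable lebesgue \<psi> \<and>
     (\<forall>\<xi>. fourier \<psi> \<xi> = complex_of_real (norm \<xi>) * fourier \<phi> \<xi>))"


section \<open>Solutions of the equation of order three\<close>

definition L_half :: "(real^3 \<Rightarrow> real) \<Rightarrow> bool" where
  "L_half v \<longleftrightarrow> L1_loc v \<and> integrable lebesgue (\<lambda>x. \<bar>v x\<bar> / (1 + norm x ^ 4))"

text \<open>The function \<open>w\<close> below is the weak Laplacian of \<open>u\<close>, which is unique up to null sets.\<close>

definition three_halves_laplace_solution ::
  "(real^3 \<Rightarrow> real) \<Rightarrow> ((real^3 \<Rightarrow> complex) \<Rightarrow> complex) \<Rightarrow> bool" where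
  "three_halves_laplace_solution u f \<longleftrightarrow> tempered_distribution f \<and> W1_loc 2 u \<and>
     (\<exists>w. weak_laplacian u w \<and> L_half w \<and>
        (\<forall>\<phi>. schwartz \<phi> \<longrightarrow>
           (LINT x|lebesgue. complex_of_real (- w x) * half_laplacian \<phi> x) = f \<phi>))"

definition log_potential :: "(real^3 \<Rightarrow> real) \<Rightarrow> real^3 \<Rightarrow> real" where
  "log_potential u x =
     1 / pi\<^sup>2 * (LINT y|lebesgue. ln (norm y / norm (x - y)) * exp (3 * u y))"

definition spherical_solution :: "(real^3 \<Rightarrow> real) \<Rightarrow> bool" where
  "spherical_solution u \<longleftrightarrow>
     (\<exists>l>0. \<exists>x0. \<forall>x. u x = ln (2 * l / (1 + l\<^sup>2 * (norm (x - x0))\<^sup>2)))"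


section \<open>Polynomial functions of several variables\<close>

definition polynomial_le :: "nat \<Rightarrow> (real^'n \<Rightarrow> real) \<Rightarrow> bool" where
  "polynomial_le d p \<longleftrightarrow>
     (\<exists>c. \<forall>x. p x = (\<Sum>\<alpha> | (\<Sum>i\<in>UNIV. \<alpha> i) \<le> d. c \<alpha> * (\<Prod>i\<in>UNIV. (x $ i) ^ \<alpha> i)))"

text \<open>Constants, including zero, have degree 0.\<close>

definition polynomial_degree :: "(real^'n \<Rightarrow> real) \<Rightarrow> nat" where
  "polynomial_degree p = (LEAST d. polynomial_le d p)"

definition is_polynomial :: "(real^'n \<Rightarrow> real) \<Rightarrow> bool" where
  "is_polynomial p \<longleftrightarrow> (\<exists>d. polynomial_le d p)"


section \<open>Scalar curvature of a Riemannian metric in global coordinates\<close>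

text \<open>A metric is given by its Gram matrix \<open>g x\<close> in the coordinate frame. The signs are such that
  round spheres have positive scalar curvature.\<close>

definition christoffel ::
  "(real^'n \<Rightarrow> real^'n^'n) \<Rightarrow> 'n \<Rightarrow> 'n \<Rightarrow> 'n \<Rightarrow> real^'n \<Rightarrow> real" where
  "christoffel g k i j x = 1/2 * (\<Sum>l\<in>UNIV. matrix_inv (g x) $ k $ l *
     (dir_deriv (axis i 1) (\<lambda>y. g y $ j $ l) x
      + dir_deriv (axis j 1) (\<lambda>y. g y $ i $ l) x
      - dir_deriv (axis l 1) (\<lambda>y. g y $ i $ j) x))"

text \<open>\<open>riemann g l k i j\<close> is the component \<open>l\<close> of \<open>R(\<partial>\<^sub>i, \<partial>\<^sub>j) \<partial>\<^sub>k\<close>.\<close>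

definition riemann ::
  "(real^'n \<Rightarrow> real^'n^'n) \<Rightarrow> 'n \<Rightarrow> 'n \<Rightarrow> 'n \<Rightarrow> 'n \<Rightarrow> real^'n \<Rightarrow> real" where
  "riemann g l k i j x =
     dir_deriv (axis i 1) (christoffel g l j k) x - dir_deriv (axis j 1) (christoffel g l i k) x
     + (\<Sum>p\<in>UNIV. christoffel g l i p x * christoffel g p j k x
                 - christoffel g l j p x * christoffel g p i k x)"

definition ricci :: "(real^'n \<Rightarrow> real^'n^'n) \<Rightarrow> 'n \<Rightarrow> 'n \<Rightarrow> real^'n \<Rightarrow> real" where
  "ricci g k j x = (\<Sum>i\<in>UNIV. riemann g i k i j x)"

definition scalar_curvature :: "(real^'n \<Rightarrow> real^'n^'n) \<Rightarrow> real^'n \<Rightarrow> real" where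
  "scalar_curvature g x = (\<Sum>k\<in>UNIV. \<Sum>j\<in>UNIV. matrix_inv (g x) $ k $ j * ricci g k j x)"

definition conformal_metric :: "(real^'n \<Rightarrow> real) \<Rightarrow> real^'n \<Rightarrow> real^'n^'n" where
  "conformal_metric u x = exp (2 * u x) *\<^sub>R mat 1"


section \<open>Riemannian metrics on the unit sphere\<close>

definition tangent_sphere :: "'a::euclidean_space \<Rightarrow> 'a set" where
  "tangent_sphere q = {v. q \<bullet> v = 0}"

text \<open>A section of the bundle of bilinear forms on an embedded submanifold is smooth iff it is
  induced by a smooth matrix field on a neighbourhood of the submanifold.\<close>

definition riemannian_metric_on_sphere ::
  "(real^'n \<Rightarrow> real^'n \<Rightarrow> real^'n \<Rightarrow> real) \<Rightarrow> bool" where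
  "riemannian_metric_on_sphere h \<longleftrightarrow>
     (\<exists>U G. sphere 0 1 \<subseteq> U \<and> smooth_on U (G :: real^'n \<Rightarrow> real^'n^'n) \<and>
        (\<forall>q\<in>sphere 0 1. \<forall>v\<in>tangent_sphere q. \<forall>w\<in>tangent_sphere q.
           h q v w = v \<bullet> (G q *v w))) \<and>
     (\<forall>q\<in>sphere 0 1. \<forall>v\<in>tangent_sphere q. \<forall>w\<in>tangent_sphere q. h q v w = h q w v) \<and>
     (\<forall>q\<in>sphere 0 1. \<forall>v\<in>tangent_sphere q. v \<noteq> 0 \<longrightarrow> h q v v > 0)"

definition south_pole :: "real^4" where
  "south_pole = - axis 4 1"

definition stereographic :: "real^4 \<Rightarrow> real^3" where
  "stereographic q = (1 / (1 + q $ 4)) *\<^sub>R vector [q $ 1, q $ 2, q $ 3]"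

text \<open>\<open>F\<close> is to be smooth on an open subset of the ambient space; for \<open>q\<close> in a submanifold and
  \<open>v\<close>, \<open>w\<close> tangent to it this is the pullback under the restriction of \<open>F\<close>.\<close>

definition pullback_metric ::
  "(real^'m \<Rightarrow> real^'n) \<Rightarrow> (real^'n \<Rightarrow> real^'n^'n) \<Rightarrow> real^'m \<Rightarrow> real^'m \<Rightarrow> real^'m \<Rightarrow> real" where
  "pullback_metric F g q v w =
     frechet_derivative F (at q) v \<bullet> (g (F q) *v frechet_derivative F (at q) w)"

definition extends_to_sphere :: "(real^4 \<Rightarrow> real^4 \<Rightarrow> real^4 \<Rightarrow> real) \<Rightarrow> bool" where
  "extends_to_sphere k \<longleftrightarrow>
     (\<exists>h. riemannian_metric_on_sphere h \<and>
        (\<forall>q\<in>sphere 0 1 - {south_pole}. \<forall>v\<in>tangent_sphere q. \<forall>w\<in>tangent_sphere q.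
           h q v w = k q v w))"

end

theory Submission
 imports Defs "HOL-Probability.Probability" "HOL-Real_Asymp.Real_Asymp"
begin

text \<open>Testing the equation with differences of heat kernels and inverting the half Laplacian gives
 \<open>- laplacian u x = L + 1/pi^2 * (LINT y. exp (3 * u y)/norm(x - y)^2)\<close> with a constant \<open>L\<close>. A doubling
 argument bounds \<open>u\<close> from above, so the potential vanishes at infinity and \<open>laplacian u\<close> tends to \<open>- L\<close>,
 where \<open>L \<ge> 0\<close>. Mean values over balls of radius \<open>R\<close> show that \<open>p\<close> is constant iff \<open>L = 0\<close>, and then the
 method of moving spheres for the resulting integral equation shows that \<open>u\<close> is spherical. If \<open>L > 0\<close>, then
 \<open>u\<close> is not \<open>o(|x|^2)\<close>. A lower bound of the scalar curvature would bound the gradient of \<open>u\<close>, and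
 a metric extending to the sphere forces \<open>u = - 2 ln |x| + O(1)\<close>; both are excluded.\<close>

text \<open>Why differences of heat kernels: the half Laplacian annihilates constants, so
  \<open>- laplacian u\<close> can be found only up to the constant \<open>L\<close>. Analytically,
  undoing the half Laplacian costs one integration in time, and the result is paired with a function
  that is integrable only against \<open>1/(1 + |y|^4)\<close>. A single heat kernel leaves decay of
  order three, one too few; the difference of two kernels gains exactly that order. No growth
  condition or upper bound of \<open>u\<close> is given beforehand, so \<open>p\<close> is
  controlled through means alone: \<open>t <= exp t\<close> turns integrability of
  \<open>exp (3 * u)\<close> into a bound for the mean of the positive part of \<open>p\<close>. In
  the integral equation for \<open>L = 0\<close> the mass \<open>pi^2 * \<alpha>\<close> is not
  known. Spheres can be moved outwards if \<open>\<alpha> <= 2\<close> and inwards if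
  \<open>\<alpha> >= 2\<close>. The inward motion excludes \<open>\<alpha> > 2\<close>; the outward
  motion has to stop at some centre, and stopping is possible only for
  \<open>\<alpha> = 2\<close>.\<close>

abbreviation L1 :: "('a::euclidean_space \<Rightarrow> 'b::{banach,second_countable_topology}) \<Rightarrow> bool"
 where "L1 \<equiv> integrable lborel"

text \<open>The definitions integrate over \<open>lebesgue\<close>, the proof over
  \<open>lborel\<close>: product measures and Fubini are at hand there, and a Borel integrand has
  the same integral for both.\<close>

abbreviation LI (binder "LINT " [0] 10)
 where "LI \<equiv> integral\<^sup>L lborel"

abbreviation NI (binder "NINT " [0] 10)
 where "NI \<equiv> nn_integral lborel"

abbreviation lborel2 where "lborel2 \<equiv> lborel \<Otimes>\<^sub>M lborel"

abbreviation wave :: "'a::euclidean_space \<Rightarrow> 'a \<Rightarrow> real \<Rightarrow> complex"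
 where "wave \<xi> y r \<equiv> cis (- (y \<bullet> \<xi>)) * complex_of_real r"

lemmas integrable_add = Bochner_Integration.integrable_add
 and integrable_bound = Bochner_Integration.integrable_bound
 and integrable_diff = Bochner_Integration.integrable_diff
 and integral_add = Bochner_Integration.integral_add
 and integral_diff = Bochner_Integration.integral_diff

section \<open>Analytic tools: smooth functions, integrals with a parameter, Gaussian
  integrals\<close>

section \<open>Smooth functions\<close>

lemma iter_deriv_Nil [simp]: "iter_deriv [] f = f" by(simp add: iter_deriv_def)

lemma iter_deriv_Cons [simp]: "iter_deriv (b # bs) f = dir_deriv b (iter_deriv bs f)"
 by(simp add: iter_deriv_def)

lemma iter_deriv_append: "iter_deriv (bs @ cs) f = iter_deriv bs (iter_deriv cs f)"
 by(simp add: iter_deriv_def)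

lemma dir_deriv_eqI: "(f has_derivative f') (at x) ==> dir_deriv b f x = f' b"
 unfolding dir_deriv_def using frechet_derivative_at by metis

text \<open>Both functions have the same derivatives in the relational sense, so the choice operator
  in \<open>frechet_derivative\<close> returns the same value for them, even at points where neither
  is differentiable.\<close>

lemma dir_deriv_cong_on:
 assumes "open U" "x : U" "!!y. y : U ==> f y = g y"
 shows "dir_deriv b f x = dir_deriv b g x"
proof -
 have "(f has_derivative f') (at x) \<longleftrightarrow> (g has_derivative f') (at x)" for f'
  using has_derivative_transform_within_open[of f f' x UNIV U g]
   has_derivative_transform_within_open[of g f' x UNIV U f] assms by auto
 thus ?thesis by(simp add: dir_deriv_def frechet_derivative_def)
qed

lemma differentiable_cong_on:
 assumes "open U" "x : U" "!!y. y : U ==> f y = g y" "f differentiable (at x)"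
 shows "g differentiable (at x)" using assms unfolding differentiable_def
 by(meson has_derivative_transform_within_open)

lemma has_real_derivative_dir_deriv:
 assumes "f differentiable (at(x + t *\<^sub>R b))"
 shows "((%t. f(x + t *\<^sub>R b)) has_vector_derivative dir_deriv b f (x + t *\<^sub>R b)) (at t)"
proof -
 have "(f has_derivative frechet_derivative f (at(x + t *\<^sub>R b))) (at(x + t *\<^sub>R b))"
  using assms frechet_derivative_works by blast
 moreover have "((%t. x + t *\<^sub>R b) has_vector_derivative b) (at t)"
  by(auto intro!: derivative_eq_intros)
 ultimately show ?thesis unfolding dir_deriv_def
  using vector_derivative_diff_chain_within[of "%t. x + t *\<^sub>R b" b t UNIV f]
  by(auto simp: o_def intro: has_derivative_at_withinI)
qed

lemma iter_deriv_closed: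
 assumes "open U" "f : F"
  and closed: "!!f b. f : F ==> b : Basis ==> EX g:F. ALL x:U. dir_deriv b f x = g x"
  and "bs : lists Basis"
 shows "EX g:F. ALL x:U. iter_deriv bs f x = g x" using assms(4)
proof(induction bs)
 case Nil
 thus ?case using assms(2) by auto
next
 case (Cons b bs)
 then obtain g where g: "g : F" "ALL x:U. iter_deriv bs f x = g x" by auto
 from Cons have "b : Basis" by auto
 then obtain h where h: "h : F" "ALL x:U. dir_deriv b g x = h x"
  using closed[OF g(1)] by blast
 have "iter_deriv (b # bs) f x = h x" if "x : U" for x
  using dir_deriv_cong_on[OF assms(1) that, of "iter_deriv bs f" g b] g h that by simp
 thus ?case using h(1) by blast
qed

text \<open>Coinduction: only first derivatives have to be computed, if some class of functions is
  stable under them. Stability is asked on \<open>U\<close> alone, so members may be given by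
  different formulas elsewhere.\<close>

lemma smooth_on_coinduct:
 assumes "open U" "f : F"
  and "!!f x. f : F ==> x : U ==> f differentiable (at x)"
  and "!!f b. f : F ==> b : Basis ==> EX g:F. ALL x:U. dir_deriv b f x = g x"
 shows "smooth_on U f" unfolding smooth_on_def
proof(intro conjI ballI)
 fix bs :: "'a list" and x assume bs: "bs : lists Basis" "x : U"
 then obtain g where "g : F" "ALL x:U. iter_deriv bs f x = g x"
  using iter_deriv_closed[OF assms(1,2,4)] by blast
 thus "iter_deriv bs f differentiable at x"
  using differentiable_cong_on[OF assms(1) bs(2), of g "iter_deriv bs f"] assms(3) bs by auto
qed fact

lemma smooth_on_open: "smooth_on U f ==> open U" by(simp add: smooth_on_def)

lemma smooth_on_iter_deriv:
 assumes "smooth_on U f" "bs : lists Basis"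
 shows "smooth_on U (iter_deriv bs f)" using assms unfolding smooth_on_def
 by(metis append_in_lists_conv iter_deriv_append)

lemma smooth_on_dir_deriv:
 assumes "smooth_on U f" "b : Basis"
 shows "smooth_on U (dir_deriv b f)"
 using smooth_on_iter_deriv[OF assms(1), of "[b]"] assms(2) by simp

lemma smooth_on_differentiable: "smooth_on U f ==> x : U ==> f differentiable (at x)"
 using iter_deriv_Nil unfolding smooth_on_def by(metis lists.Nil)

lemma smooth_on_has_derivative:
 "smooth_on U f ==> x : U ==> (f has_derivative (%b. dir_deriv b f x)) (at x)"
 using smooth_on_differentiable frechet_derivative_works unfolding dir_deriv_def by blast

lemma smooth_on_continuous_on: "smooth_on U f ==> continuous_on U f"
 by(meson continuous_at_imp_continuous_on differentiable_imp_continuous_within smooth_on_differentiable)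

text \<open>If \<open>h (Suc n)\<close> is the derivative of \<open>h n\<close> along the values of
  \<open>g\<close>, chain and product rule keep this algebra stable under partial derivatives.
  Carrying all derivatives of the outer function as one sequence avoids a formula for higher
  derivatives of compositions; the zero sequence yields sums and products.\<close>

inductive_set smooth_algebra ::
 "'a::euclidean_space set => (nat => real => real) => ('a => real) => ('a => real) set" for U h g where
 base: "smooth_on U f ==> f : smooth_algebra U h g"
| comp: "(%x. h n (g x)) : smooth_algebra U h g"
| add: "p : smooth_algebra U h g ==> q : smooth_algebra U h g ==> (%x. p x + q x) : smooth_algebra U h g"
| mult: "p : smooth_algebra U h g ==> q : smooth_algebra U h g ==> (%x. p x*q x) : smooth_algebra U h g"

lemma smooth_algebra_smooth:
 assumes g: "smooth_on U g" and h: "!!n x. x : U ==> (h n has_real_derivative h (Suc n) (g x)) (at(g x))"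
  and f: "f : smooth_algebra U h g"
 shows "smooth_on U f"
proof(rule smooth_on_coinduct[OF _ f])
 show "open U" using g smooth_on_open by auto
 have *: "(ALL x:U. f differentiable (at x)) &
   (ALL b:Basis. EX k:smooth_algebra U h g. ALL x:U. dir_deriv b f x = k x)"
  if "f : smooth_algebra U h g" for f using that
 proof induction
  case (base f)
  thus ?case
   using smooth_on_differentiable[OF base] smooth_algebra.base[OF smooth_on_dir_deriv[OF base]] by blast
 next
  case (comp n)
  have d: "((%x. h n (g x)) has_derivative (%b. h (Suc n) (g x)*dir_deriv b g x)) (at x)" if "x : U" for x
   using has_derivative_compose[OF smooth_on_has_derivative[OF g that] h[OF that, unfolded has_field_derivative_def]] .
  moreover have "(%x. h (Suc n) (g x)*dir_deriv b g x) : smooth_algebra U h g" if "b : Basis" for b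
   using smooth_algebra.base smooth_algebra.comp smooth_algebra.mult smooth_on_dir_deriv[OF g that] by blast
  ultimately show ?case using dir_deriv_eqI[OF d] by(auto simp: differentiable_def intro!: bexI)
 next
  case (add p q)
  show ?case
  proof(intro conjI ballI)
   fix b :: 'a assume "b : Basis"
   then obtain k l where k: "k : smooth_algebra U h g" "ALL x:U. dir_deriv b p x = k x"
    and l: "l : smooth_algebra U h g" "ALL x:U. dir_deriv b q x = l x"
    using add by blast
   have "dir_deriv b (%x. p x + q x) x = k x + l x" if "x : U" for x
    using dir_deriv_eqI[OF has_derivative_add[of p "frechet_derivative p (at x)" "at x" q "frechet_derivative q (at x)"], of b]
     add that k l by(simp add: frechet_derivative_works dir_deriv_def)
   thus "EX k:smooth_algebra U h g. ALL x:U. dir_deriv b (%x. p x + q x) x = k x"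
    using smooth_algebra.add[OF k(1) l(1)] by(auto intro!: bexI)
  qed(use add in auto)
 next
  case (mult p q)
  show ?case
  proof(intro conjI ballI)
   fix b :: 'a assume "b : Basis"
   then obtain k l where k: "k : smooth_algebra U h g" "ALL x:U. dir_deriv b p x = k x"
    and l: "l : smooth_algebra U h g" "ALL x:U. dir_deriv b q x = l x"
    using mult by blast
   have "dir_deriv b (%x. p x*q x) x = p x*l x + k x*q x" if "x : U" for x
    using dir_deriv_eqI[OF has_derivative_mult[of p "frechet_derivative p (at x)" x UNIV q "frechet_derivative q (at x)"], of b]
     mult that k l by(simp add: frechet_derivative_works dir_deriv_def)
   thus "EX k:smooth_algebra U h g. ALL x:U. dir_deriv b (%x. p x*q x) x = k x"
    using smooth_algebra.add[OF smooth_algebra.mult[OF mult.hyps(1) l(1)] smooth_algebra.mult[OF k(1) mult.hyps(2)]]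
    by(auto intro!: bexI)
  qed(use mult in \<open>auto intro!: differentiable_mult\<close>)
 qed
 show "!!f x. f : smooth_algebra U h g ==> x : U ==> f differentiable at x" using * by blast
 show "!!f b. f : smooth_algebra U h g ==> b : Basis ==> EX k:smooth_algebra U h g. ALL x:U. dir_deriv b f x = k x"
  using * by blast
qed

lemma smooth_on_const: "open U ==> smooth_on U (%x. c)"
 by(rule smooth_on_coinduct[where F="range (%c x. c)"])
  (auto simp: dir_deriv_eqI[OF has_derivative_const])

lemma smooth_on_bounded_linear:
 assumes "open U" "bounded_linear L"
 shows "smooth_on U L"
proof(rule smooth_on_coinduct[where F="insert L (range (%c x. c))"])
 show "f differentiable at x" if "f : insert L (range (%c x. c))" for f x
  using that assms(2) by(auto simp: bounded_linear_imp_differentiable)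
 show "EX g:insert L (range (%c x. c)). ALL x:U. dir_deriv b f x = g x" if "f : insert L (range (%c x. c))" for f b
 proof(cases "f = L")
  case True
  thus ?thesis using dir_deriv_eqI[OF bounded_linear_imp_has_derivative[OF assms(2)]] by auto
 next
  case False
  with that have "f : range (%c x. c)" by blast
  then obtain c where "f = (%x. c)" by(rule rangeE)
  hence "ALL x:U. dir_deriv b f x = 0" by(simp add: dir_deriv_eqI[OF has_derivative_const])
  thus ?thesis by(intro bexI[of _ "%x. 0"]) auto
 qed
qed(use assms in auto)

lemma smooth_on_comp:
 assumes g: "smooth_on U g" and h: "!!n x. x : U ==> (h n has_real_derivative h (Suc n) (g x)) (at(g x))"
 shows "smooth_on U (%x. h n (g x))"
 using smooth_algebra_smooth[of U g h] g h smooth_algebra.comp by blast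

lemma smooth_on_add:
 fixes f g :: "'a::euclidean_space => real"
 assumes "smooth_on U f" "smooth_on U g"
 shows "smooth_on U (%x. f x + g x)"
 by(rule smooth_algebra_smooth[OF assms(1), of "%n x. 0"])
  (simp, intro smooth_algebra.add smooth_algebra.base assms)

lemma smooth_on_mult:
 fixes f g :: "'a::euclidean_space => real"
 assumes "smooth_on U f" "smooth_on U g"
 shows "smooth_on U (%x. f x*g x)"
 by(rule smooth_algebra_smooth[OF assms(1), of "%n x. 0"])
  (simp, intro smooth_algebra.mult smooth_algebra.base assms)

lemma smooth_on_prod:
 fixes f :: "'i => 'a::euclidean_space => real"
 assumes "open U" "!!i. i : I ==> smooth_on U (f i)"
 shows "smooth_on U (%x. \<Prod>i\<in>I. f i x)" using assms(2)
 by(induction I rule: infinite_finite_induct) (auto simp: smooth_on_const assms(1) intro!: smooth_on_mult)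

lemma smooth_on_linear_compose:
 assumes f: "smooth_on U f" and L: "bounded_linear L"
 shows "smooth_on U (%x. L (f x))"
  and "bs : lists Basis ==> x : U ==> iter_deriv bs (%x. L (f x)) x = L (iter_deriv bs f x)"
proof -
 have d: "dir_deriv b (%x. L (g x)) x = L (dir_deriv b g x)" if "smooth_on U g" "x : U" for b x g
  using dir_deriv_eqI[OF bounded_linear.has_derivative[OF L smooth_on_has_derivative[OF that]]] .
 show "smooth_on U (%x. L (f x))"
 proof(rule smooth_on_coinduct[where F="{(%x. L (g x)) |g. smooth_on U g}"])
  show "h differentiable at x" if "h : {(%x. L (g x)) |g. smooth_on U g}" "x : U" for h x
   using that bounded_linear.has_derivative[OF L] smooth_on_has_derivative
   unfolding differentiable_def by blast
  show "EX g:{%x. L (g x) |g. smooth_on U g}. ALL x:U. dir_deriv b h x = g x"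
   if h: "h : {(%x. L (g x)) |g. smooth_on U g}" and b: "b : Basis" for h b
  proof -
   obtain g where g: "h = (%x. L (g x))" "smooth_on U g" using h by blast
   have "ALL x:U. dir_deriv b h x = L (dir_deriv b g x)" unfolding g(1) by(intro ballI d g)
   thus ?thesis using smooth_on_dir_deriv[OF g(2) b]
    by(intro bexI[of _ "%x. L (dir_deriv b g x)"]) auto
  qed
 qed(use f smooth_on_open in auto)
 show "iter_deriv bs (%x. L (f x)) x = L (iter_deriv bs f x)" if "bs : lists Basis" "x : U"
  using that
 proof(induction bs arbitrary: x)
  case (Cons b bs)
  thus ?case
   using dir_deriv_cong_on[OF smooth_on_open[OF f] \<open>x : U\<close>, of "iter_deriv bs (%x. L (f x))" "%x. L (iter_deriv bs f x)" b]
    d[OF smooth_on_iter_deriv[OF f], of bs x b] by auto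
 qed auto
qed

lemma smooth_on_exp: "smooth_on U g ==> smooth_on U (%x. exp(g x :: real))"
 using smooth_on_comp[of U g "%n. exp"] by(auto intro: DERIV_exp)

lemma smooth_on_inner: "open U ==> smooth_on U (%x. x \<bullet> b)"
 by(intro smooth_on_bounded_linear bounded_linear_inner_left)

lemma smooth_on_norm_sq:
 assumes "open U"
 shows "smooth_on U (%x::'a::euclidean_space. (norm x)^2)"
proof(rule smooth_on_coinduct[where F="insert (%x. (norm x)^2) {g. smooth_on U g}"])
 have d: "((%x::'a. (norm x)^2) has_derivative (%b. 2*(x \<bullet> b))) (at x)" for x :: 'a
  unfolding power2_norm_eq_inner by(auto intro!: derivative_eq_intros simp: inner_commute)
 show "h differentiable at x" if "h : insert (%x. (norm x)^2) {g. smooth_on U g}" "x : U" for h x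
  using that d smooth_on_differentiable unfolding differentiable_def by blast
 show "EX g:insert (%x. (norm x)^2) {g. smooth_on U g}. ALL x:U. dir_deriv b h x = g x"
  if "h : insert (%x. (norm x)^2) {g. smooth_on U g}" "b : Basis" for h b
 proof(cases "h = (%x. (norm x)^2)")
  case True
  have "smooth_on U (%x. 2*(x \<bullet> b))"
   by(intro smooth_on_mult smooth_on_const smooth_on_inner assms)
  thus ?thesis using True dir_deriv_eqI[OF d, of b] by auto
 next
  case False
  thus ?thesis using that smooth_on_dir_deriv by blast
 qed
qed(use assms in auto)

text \<open>The derivatives of \<open>1/t\<close> as one sequence, in the form that
  \<open>smooth_on_comp\<close> asks for; with \<open>ln\<close> put in front it is also the
  sequence of the logarithm.\<close>

lemma DERIV_fact_div_power:
 fixes t :: real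
 assumes t: "t ~= 0"
 shows "((%t. (-1)^k*fact k/t^Suc k) has_real_derivative (-1)^Suc k*fact(Suc k)/t^Suc (Suc k)) (at t)"
proof -
 have "((%t. inverse(t^Suc k)) has_real_derivative - (inverse(t^Suc k)*(of_nat(Suc k)*t^k)*inverse(t^Suc k))) (at t)"
  using t by(intro DERIV_inverse_fun[THEN DERIV_cong] DERIV_pow[THEN DERIV_cong]) (auto simp: power2_eq_square)
 moreover have "(-1)^k*fact k*- (inverse(t^Suc k)*(of_nat(Suc k)*t^k)*inverse(t^Suc k)) = (-1)^Suc k*fact(Suc k)/t^Suc (Suc k)"
  using t by(simp add: field_simps)
 ultimately show ?thesis
  using DERIV_cmult[of "%t. inverse(t^Suc k)" _ t UNIV "(-1)^k*fact k"] unfolding divide_inverse by metis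
qed

section \<open>Differentiation under the integral sign\<close>

lemma has_real_derivative_integral:
 fixes F F' :: "real => 'a => real"
 assumes d: "0 < \<delta>"
  and int: "!!t. \<bar>t - t0\<bar> < \<delta> ==> integrable M (F t)"
  and der: "!!t y. \<bar>t - t0\<bar> < \<delta> ==> y : space M ==> ((%t. F t y) has_real_derivative F' t y) (at t)"
  and bnd: "!!t y. \<bar>t - t0\<bar> < \<delta> ==> y : space M ==> \<bar>F' t y\<bar> <= B y"
  and B: "integrable M B"
 shows "((%t. (LINT y|M. F t y)) has_real_derivative (LINT y|M. F' t0 y)) (at t0)"
  and "integrable M (F' t0)"
proof -
 have lip: "\<bar>F (t0 + h) y - F t0 y\<bar> <= B y*\<bar>h\<bar>" if "\<bar>h\<bar> < \<delta>" "y : space M" for h y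
 proof -
  have "norm(F (t0 + h) y - F t0 y) <= B y*norm(t0 + h - t0)"
  proof(rule field_differentiable_bound[where S="{t0 - \<bar>h\<bar>..t0 + \<bar>h\<bar>}" and f' = "%t. F' t y"])
   fix t assume "t : {t0 - \<bar>h\<bar>..t0 + \<bar>h\<bar>}"
   hence t: "\<bar>t - t0\<bar> < \<delta>" using that by auto
   show "((%t. F t y) has_field_derivative F' t y) (at t within {t0 - \<bar>h\<bar>..t0 + \<bar>h\<bar>})"
    using der[OF t that(2)] has_field_derivative_at_within by blast
   show "norm(F' t y) <= B y" using bnd[OF t that(2)] by simp
  qed auto
  thus ?thesis by simp
 qed
 have lim: "((%n. (F (t0 + X n) y - F t0 y)/X n) \<longlonglongrightarrow> F' t0 y)"
  if "ALL n. X n ~= 0" "X \<longlonglongrightarrow> 0" "y : space M" for X y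
 proof -
  have "((%h. (F (t0 + h) y - F t0 y)/h) \<longlongrightarrow> F' t0 y) (at 0)"
   using der[of t0 y] d that by(simp add: DERIV_def)
  thus ?thesis unfolding tendsto_at_iff_sequentially using that by(auto simp: o_def)
 qed
 \<comment> \<open>Measurability of \<open>F' t0\<close> comes from writing it as the limit of
   difference quotients along one explicit null sequence. The offset 2 keeps \<open>X 0\<close>
   strictly inside the radius \<open>\<delta>\<close>.\<close>
 define X where "X n = \<delta>/real(n + 2)" for n
 have X: "ALL n. X n ~= 0" "X \<longlonglongrightarrow> 0" "\<bar>X n\<bar> < \<delta>" for n
  using d unfolding X_def by(auto simp: field_simps intro: add_pos_nonneg) real_asymp
 have meas: "F' t0 : borel_measurable M"
 proof(rule borel_measurable_LIMSEQ_real[OF lim[OF X(1,2)]])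
  fix i show "(%x. (F (t0 + X i) x - F t0 x)/X i) : borel_measurable M"
   using int[of "t0 + X i"] int[of t0] X(3) d by(intro borel_measurable_divide borel_measurable_diff) auto
 qed
 show "integrable M (F' t0)"
  by(rule integrable_bound[OF B meas]) (use bnd[of t0] d in \<open>fastforce intro!: AE_I2\<close>)
 show "((%t. (LINT y|M. F t y)) has_real_derivative (LINT y|M. F' t0 y)) (at t0)"
  unfolding DERIV_def tendsto_at_iff_sequentially
 proof(intro allI impI)
  fix Y :: "nat => real" assume Y0: "ALL i. Y i : UNIV - {0}" and Yl: "Y \<longlonglongrightarrow> 0"
  have "\<forall>\<^sub>F n in sequentially. \<bar>Y n\<bar> < \<delta>"
   using Yl d by(auto simp: tendsto_iff dist_real_def)
  then obtain N where N: "!!n. n >= N ==> \<bar>Y n\<bar> < \<delta>" unfolding eventually_sequentially by auto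
  define Z where "Z n = Y (n + N)" for n
  have Z: "ALL n. Z n ~= 0" "Z \<longlonglongrightarrow> 0" "!!n. \<bar>Z n\<bar> < \<delta>"
   using Y0 Yl N LIMSEQ_ignore_initial_segment unfolding Z_def by auto
  have "(%n. (LINT y|M. (F (t0 + Z n) y - F t0 y)/Z n)) \<longlonglongrightarrow> (LINT y|M. F' t0 y)"
  proof(rule integral_dominated_convergence[where w=B])
   fix i show "(%x. (F (t0 + Z i) x - F t0 x)/Z i) : borel_measurable M"
    using int[of "t0 + Z i"] int[of t0] Z(3) d by(intro borel_measurable_divide borel_measurable_diff) auto
   show "AE x in M. norm((F (t0 + Z i) x - F t0 x)/Z i) <= B x"
    using lip[of "Z i"] Z(1,3) by(auto intro!: AE_I2 simp: divide_simps)
   show "AE x in M. (%i. (F (t0 + Z i) x - F t0 x)/Z i) \<longlonglongrightarrow> F' t0 x"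
    by(intro AE_I2 lim[OF Z(1,2)])
  qed(use meas B in auto)
  moreover have "(LINT y|M. (F (t0 + Z n) y - F t0 y)/Z n) = ((LINT y|M. F (t0 + Z n) y) - (LINT y|M. F t0 y))/Z n" for n
   using int[of "t0 + Z n"] int[of t0] Z(3)[of n] d by simp
  ultimately have "(%n. ((LINT y|M. F (t0 + Y (n+N)) y) - (LINT y|M. F t0 y))/Y (n+N)) \<longlonglongrightarrow> (LINT y|M. F' t0 y)"
   unfolding Z_def by(simp only:)
  thus "((%h. ((LINT y|M. F (t0 + h) y) - (LINT y|M. F t0 y))/h) \<circ> Y) \<longlonglongrightarrow> (LINT y|M. F' t0 y)"
   unfolding o_def using LIMSEQ_offset[of "%n. ((LINT y|M. F (t0 + Y n) y) - (LINT y|M. F t0 y))/Y n" N] by simp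
 qed
qed

lemma integrable_indicator_cball: "L1(indicator(cball (c::'a::euclidean_space) r) :: 'a => real)"
 by(intro integrable_real_indicator) (auto simp: emeasure_lborel_cball_finite[unfolded infinity_ennreal_def])

text \<open>By translation invariance the integral of \<open>F (x + t b)\<close> does not depend on
  \<open>t\<close>; differentiating at \<open>t = 0\<close> under the integral sign gives the claim
  without boundary terms.\<close>

lemma integral_dir_deriv_eq_0:
 fixes F :: "'a::euclidean_space => real"
 assumes diff: "!!x. F differentiable (at x)" and cont: "continuous_on UNIV (dir_deriv b F)"
  and supp: "!!x. norm x >= R ==> F x = 0"
 shows "L1(dir_deriv b F)" "(LINT x. dir_deriv b F x) = 0"
proof -
 have contF: "continuous_on UNIV F"
  using diff differentiable_imp_continuous_within by(auto simp: continuous_on_eq_continuous_within)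
 have z: "dir_deriv b F x = 0" if "norm x > R" for x
 proof -
  have "open {x::'a. norm x > R}" by(simp add: open_Collect_less continuous_on_norm_id)
  hence "dir_deriv b F x = dir_deriv b (%x. 0) x"
   by(rule dir_deriv_cong_on) (use that supp in auto)
  thus ?thesis by(simp add: dir_deriv_eqI[OF has_derivative_const])
 qed
 have cpt: "compact (cball (0::'a) r)" for r by simp
 obtain C where C: "!!x. norm x <= R ==> \<bar>dir_deriv b F x\<bar> <= C"
  using compact_imp_bounded[OF compact_continuous_image[OF continuous_on_subset[OF cont subset_UNIV] cpt[of R]]]
  unfolding bounded_iff by(metis cball_def dist_0_norm image_eqI mem_Collect_eq real_norm_def)
 have C': "\<bar>dir_deriv b F x\<bar> <= max C 0" for x
  using C[of x] z[of x] by(cases "norm x <= R") auto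
 define B where "B x = max C 0*indicator (cball 0 (R + norm b)) x" for x :: 'a
 have B: "L1 B" unfolding B_def by(intro integrable_mult_right integrable_indicator_cball)
 have F: "L1 F"
 proof -
  have "L1 (%x. indicator (cball 0 R) x *\<^sub>R F x)"
   by(rule borel_integrable_compact) (use contF continuous_on_subset in auto)
  moreover have "(%x. indicator (cball 0 R) x *\<^sub>R F x) = F"
   by(rule ext) (use supp in \<open>auto simp: indicator_def\<close>)
  ultimately show ?thesis by simp
 qed
 have tr: "L1 (%x. F(x + t *\<^sub>R b))" "(LINT x. F(x + t *\<^sub>R b)) = (LINT x. F x)" for t
 proof -
  have m: "(+) (t *\<^sub>R b) : lborel \<rightarrow>\<^sub>M borel" "F : borel_measurable borel"
   using borel_measurable_integrable[OF F] by auto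
  show "L1 (%x. F(x + t *\<^sub>R b))"
   using integrable_distr_eq[OF m] F unfolding lborel_distr_plus by(simp add: add.commute)
  show "(LINT x. F(x + t *\<^sub>R b)) = (LINT x. F x)"
   using integral_distr[OF m] unfolding lborel_distr_plus by(simp add: add.commute)
 qed
 have d: "((%t. F(y + t *\<^sub>R b)) has_real_derivative dir_deriv b F (y + t *\<^sub>R b)) (at t)" for t y
  using has_real_derivative_dir_deriv[OF diff] by(simp add: has_real_derivative_iff_has_vector_derivative)
 have bd: "\<bar>dir_deriv b F (y + t *\<^sub>R b)\<bar> <= B y" if t: "\<bar>t - 0\<bar> < (1::real)" for t y
 proof -
  have "dir_deriv b F (y + t *\<^sub>R b) = 0" if y: "norm y > R + norm b"
  proof(rule z)
   have "norm(t *\<^sub>R b) <= norm b" using t by(simp add: mult_left_le_one_le)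
   thus "R < norm(y + t *\<^sub>R b)" using y norm_diff_ineq[of y "t *\<^sub>R b"] by linarith
  qed
  thus ?thesis
   unfolding B_def using C'[of "y + t *\<^sub>R b"] by(cases "norm y > R + norm b") (auto simp: indicator_def)
 qed
 note DI = has_real_derivative_integral[where \<delta>=1 and ?t0.0=0 and B=B and M=lborel
   and F="%t y. F(y + t *\<^sub>R b)" and F'="%t y. dir_deriv b F (y + t *\<^sub>R b)", OF _ tr(1) d bd B]
 have D: "((%t. (LINT y. F(y + t *\<^sub>R b))) has_real_derivative (LINT y. dir_deriv b F (y + 0 *\<^sub>R b))) (at 0)"
  and I: "L1 (%y. dir_deriv b F (y + 0 *\<^sub>R b))" using DI by simp_all
 show "L1(dir_deriv b F)" using I by simp
 have "((%t. (LINT y. F(y + t *\<^sub>R b))) has_real_derivative 0) (at 0)" unfolding tr by simp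
 thus "(LINT x. dir_deriv b F x) = 0" using D DERIV_unique by fastforce
qed

section \<open>Integrals over Euclidean space\<close>

lemma nn_integral_lborel_affine:
 fixes f :: "'a::euclidean_space => ennreal"
 assumes "f : borel_measurable borel" "c ~= 0"
 shows "(NINT x. f x) = ennreal(\<bar>c\<bar>^DIM('a))*(NINT x. f(t + c *\<^sub>R x))"
proof -
 have [measurable]: "f : borel_measurable borel" by fact
 have "(NINT x. f x)
   = (\<integral>\<^sup>+x. f x \<partial>density (distr lborel borel (%x. t + c *\<^sub>R x)) (%_. ennreal(\<bar>c\<bar>^DIM('a))))"
  using arg_cong[OF lborel_affine[OF assms(2), of t], of "%M. nn_integral M f"]
  by(simp add: ennreal_power)
 also have "... = ennreal(\<bar>c\<bar>^DIM('a))*(\<integral>\<^sup>+x. f x \<partial>distr lborel borel (%x. t + c *\<^sub>R x))"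
  by(simp add: nn_integral_density nn_integral_cmult)
 also have "(\<integral>\<^sup>+x. f x \<partial>distr lborel borel (%x. t + c *\<^sub>R x)) = (NINT x. f(t + c *\<^sub>R x))"
  by(rule nn_integral_distr) auto
 finally show ?thesis .
qed

lemma integrable_lborel_affine:
 fixes f :: "'a::euclidean_space => 'b::{banach, second_countable_topology}"
 assumes "L1 f" "c ~= 0"
 shows "L1 (%x. f(t + c *\<^sub>R x))"
proof -
 have f[measurable]: "f : borel_measurable borel" using assms borel_measurable_integrable by fastforce
 have "ennreal(\<bar>c\<bar>^DIM('a))*(NINT x. norm(f(t + c *\<^sub>R x))) < \<infinity>"
  using nn_integral_lborel_affine[of "%x. ennreal(norm(f x))" c t] assms
  by(simp add: integrable_iff_bounded)
 thus ?thesis using assms(2) by(auto simp: integrable_iff_bounded ennreal_mult_less_top)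
qed

lemma integral_lborel_affine:
 fixes f :: "'a::euclidean_space => 'b::{banach, second_countable_topology}"
 assumes "c ~= 0"
 shows "(LINT x. f x) = \<bar>c\<bar>^DIM('a) *\<^sub>R (LINT x. f(t + c *\<^sub>R x))"
proof(cases "L1 f")
 case True
 hence f[measurable]: "f : borel_measurable borel" using borel_measurable_integrable by fastforce
 have "(LINT x. f x)
   = (\<integral>x. f x \<partial>density (distr lborel borel (%x. t + c *\<^sub>R x)) (%_. ennreal(\<bar>c\<bar>^DIM('a))))"
  using arg_cong[OF lborel_affine[OF assms, of t], of "%M. integral\<^sup>L M f"]
  by(simp add: ennreal_power)
 also have "... = \<bar>c\<bar>^DIM('a) *\<^sub>R (\<integral>x. f x \<partial>distr lborel borel (%x. t + c *\<^sub>R x))"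
  by(subst integral_density) auto
 also have "(\<integral>x. f x \<partial>distr lborel borel (%x. t + c *\<^sub>R x)) = (LINT x. f(t + c *\<^sub>R x))"
  by(rule integral_distr) auto
 finally show ?thesis .
next
 case False
 have "~ L1 (%x. f(t + c *\<^sub>R x))"
 proof
  assume "L1 (%x. f(t + c *\<^sub>R x))"
  from integrable_lborel_affine[OF this, of "1/c" "- (1/c) *\<^sub>R t"] have "L1 f"
   using assms by(simp add: scaleR_diff_right)
  with False show False by simp
 qed
 with False show ?thesis by(simp add: not_integrable_integral_eq)
qed

lemma integral_translate:
 fixes f :: "'a::euclidean_space => 'b::{banach, second_countable_topology}"
 shows "(LINT x. f(t + x)) = (LINT x. f x)" "(LINT x. f(t - x)) = (LINT x. f x)"
 using integral_lborel_affine[of 1 f t] integral_lborel_affine[of "-1" f t] by simp_all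

lemma integrable_translate:
 fixes f :: "'a::euclidean_space => 'b::{banach, second_countable_topology}"
 shows "L1 (%x. f(t + x)) \<longleftrightarrow> L1 f"
  "L1 (%x. f(t - x)) \<longleftrightarrow> L1 f"
proof -
 show "L1 (%x. f(t + x)) \<longleftrightarrow> L1 f"
 proof
  assume "L1 f"
  from integrable_lborel_affine[OF this, of 1 t] show "L1 (%x. f(t + x))" by simp
 next
  assume "L1 (%x. f(t + x))"
  from integrable_lborel_affine[OF this, of 1 "-t"] show "L1 f" by simp
 qed
 show "L1 (%x. f(t - x)) \<longleftrightarrow> L1 f"
 proof
  assume "L1 f"
  from integrable_lborel_affine[OF this, of "-1" t] show "L1 (%x. f(t - x))" by simp
 next
  assume "L1 (%x. f(t - x))"
  from integrable_lborel_affine[OF this, of "-1" "t"] show "L1 f" by simp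
 qed
qed

lemma integral_lborel_prod:
 fixes f :: "'a::euclidean_space => real => 'b::{real_normed_field, banach, second_countable_topology}"
 assumes f: "!!b. b : Basis ==> L1(f b)"
 shows "L1 (%x. \<Prod>b\<in>Basis. f b (x \<bullet> b))"
  and "(LINT x. (\<Prod>b\<in>Basis. f b (x \<bullet> b))) = (\<Prod>b\<in>Basis. (LINT y. f b y))"
proof -
 interpret product_sigma_finite "%b::'a. lborel :: real measure" by standard
 have fm: "f b : borel_measurable borel" if "b : Basis" for b
  using f[OF that] borel_measurable_integrable by fastforce
 have [measurable]: "(%x. \<Prod>b\<in>Basis. f b (x \<bullet> b)) : borel_measurable (borel :: 'a measure)"
  using fm by(intro borel_measurable_prod) (auto intro: measurable_compose[OF _ fm])
 have *: "(\<Prod>b\<in>Basis. f b ((\<Sum>c\<in>Basis. y c *\<^sub>R c) \<bullet> b)) = (\<Prod>b\<in>Basis. f b (y b))" for y :: "'a => real"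
  by(intro prod.cong) (auto simp: inner_sum_left inner_Basis if_distrib[of "(*) _"] sum.delta cong: if_cong)
 show "L1 (%x. \<Prod>b\<in>Basis. f b (x \<bullet> b))"
  unfolding lborel_eq[where 'a='a] by(subst integrable_distr_eq) (auto simp: * intro!: product_integrable_prod f)
 show "(LINT x. (\<Prod>b\<in>Basis. f b (x \<bullet> b))) = (\<Prod>b\<in>Basis. (LINT y. f b y))"
  unfolding lborel_eq[where 'a='a] by(subst integral_distr) (auto simp: * intro!: product_integral_prod f)
qed

text \<open>The substitution \<open>y = sqrt (2 * s) * x\<close> turns this into the characteristic
  function of the standard normal distribution.\<close>

lemma fourier_gaussian_real:
 assumes s: "0 < s"
 shows "L1 (%y. cis(- (y*xi)) * complex_of_real(exp(- y\<^sup>2/(4 * s))))"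
  and "(LINT y. cis(- (y*xi)) * complex_of_real(exp(- y\<^sup>2/(4 * s))))
    = complex_of_real(sqrt(4*pi * s)*exp(- s*xi^2))"
proof -
 define f where "f y = cis(- (y*xi)) * complex_of_real(exp(- y\<^sup>2/(4 * s)))" for y
 define g where "g x = iexp ((- sqrt(2 * s)*xi)*x)" for x
 have [simp]: "sqrt(2 * s) ~= 0" "sqrt(2 * s) * sqrt(2 * s) = 2 * s" using s by auto
 have [measurable]: "g : borel_measurable borel" unfolding g_def by measurable
 have I: "L1 (%x. complex_of_real(std_normal_density x))"
  using integrable_normal_moment_nz_1 integrable_normal_density[of 1 0] by simp
 have J: "L1 (%x. std_normal_density x *\<^sub>R g x)"
  by(rule integrable_bound[OF I]) (auto simp: g_def normal_density_nonneg)
 have fg: "f(0 + sqrt(2 * s)*x) = sqrt(2*pi) *\<^sub>R (std_normal_density x *\<^sub>R g x)" for x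
  using s unfolding f_def g_def std_normal_density_def
  by(simp add: cis_conv_exp scaleR_conv_of_real power_mult_distrib real_sqrt_mult[symmetric] field_simps)
 have "L1 (%x. f(0 + sqrt(2 * s)*x))"
  unfolding fg using J by(intro integrable_scaleR_right)
 thus "L1 (%y. cis(- (y*xi)) * complex_of_real(exp(- y\<^sup>2/(4 * s))))"
  using lborel_integrable_real_affine_iff[of "sqrt(2 * s)" f 0] \<open>sqrt (2 * s) ~= 0\<close> unfolding f_def by blast
 have "(LINT x. std_normal_density x *\<^sub>R g x) = char std_normal_distribution (- sqrt(2 * s)*xi)"
  unfolding char_def g_def[symmetric] by(subst integral_density) (auto simp: normal_density_nonneg)
 also have "... = complex_of_real(exp(- s*xi^2))"
  unfolding char_std_normal_distribution using s by(simp add: power_mult_distrib)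
 finally have "(LINT x. f(0 + sqrt(2 * s)*x)) = sqrt(2*pi) *\<^sub>R complex_of_real (exp(- s*xi^2))"
  unfolding fg by(simp only: integral_scaleR_right)
 hence "(LINT y. f y) = sqrt(2 * s) *\<^sub>R sqrt (2*pi) *\<^sub>R complex_of_real (exp(- s*xi^2))"
  using lborel_integral_real_affine[of "sqrt(2 * s)" f 0] s by simp
 also have "... = complex_of_real(sqrt(2 * s) * sqrt(2*pi)*exp(- s*xi^2))"
  by(simp add: scaleR_conv_of_real)
 also have "sqrt(2 * s) * sqrt(2*pi) = sqrt(4*pi * s)" by(simp flip: real_sqrt_mult)
 finally show "(LINT y. cis(- (y*xi)) * complex_of_real(exp(- y\<^sup>2/(4 * s))))
    = complex_of_real(sqrt(4*pi * s)*exp(- s*xi^2))" unfolding f_def .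
qed

lemma norm_sq_Basis: "(norm(x::'a::euclidean_space))^2 = (\<Sum>b\<in>Basis. (x \<bullet> b)^2)"
 using euclidean_inner[of x x] by(simp add: dot_square_norm flip: power2_eq_square)

lemma cis_sum: "finite A ==> cis(\<Sum>a\<in>A. f a) = (\<Prod>a\<in>A. cis(f a))"
 by(induction A rule: finite_induct) (auto simp: cis_mult[symmetric])

lemma fourier_gaussian:
 fixes xi :: "'a::euclidean_space"
 assumes s: "0 < s"
 shows "L1 (%y. wave xi y (exp(- (norm y)\<^sup>2/(4 * s))))"
  and "(LINT y. wave xi y (exp(- (norm y)\<^sup>2/(4 * s))))
    = complex_of_real(sqrt(4*pi * s)^DIM('a)*exp(- s*(norm xi)^2))"
proof -
 have eq: "wave xi y (exp(- (norm y)\<^sup>2/(4 * s)))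
  = (\<Prod>b\<in>Basis. cis(- ((y \<bullet> b)*(xi \<bullet> b))) * complex_of_real(exp(- (y \<bullet> b)\<^sup>2/(4 * s))))" for y :: 'a
  unfolding prod.distrib norm_sq_Basis of_real_prod[symmetric]
  by(simp add: exp_sum[symmetric] cis_sum[symmetric] euclidean_inner[of y xi] sum_negf sum_divide_distrib)
 show "L1 (%y::'a. wave xi y (exp(- (norm y)\<^sup>2/(4 * s))))"
  unfolding eq by(intro integral_lborel_prod(1) fourier_gaussian_real s)
 show "(LINT y. wave xi y (exp(- (norm y)\<^sup>2/(4 * s))))
    = complex_of_real(sqrt(4*pi * s)^DIM('a)*exp(- s*(norm xi)^2))" unfolding eq
 proof(subst integral_lborel_prod(2)[OF fourier_gaussian_real(1)[OF s]])
  have "(\<Prod>b\<in>Basis. (LINT y. cis(- (y*(xi \<bullet> b))) * complex_of_real(exp(- y\<^sup>2/(4 * s)))))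
    = (\<Prod>b\<in>(Basis::'a set). complex_of_real(sqrt(4*pi * s)*exp(- s*(xi \<bullet> b)^2)))"
   by(intro prod.cong refl fourier_gaussian_real(2)[OF s])
  also have "... = complex_of_real(sqrt(4*pi * s)^DIM('a)*exp(\<Sum>b\<in>Basis. - s*(xi \<bullet> b)^2))"
   by(simp add: prod.distrib exp_sum)
  also have "(\<Sum>b\<in>Basis. - s*(xi \<bullet> b)^2) = - s*(norm xi)^2"
   unfolding norm_sq_Basis sum_distrib_left ..
  finally show "(\<Prod>b\<in>Basis. (LINT y. cis(- (y*(xi \<bullet> b))) * complex_of_real(exp(- y\<^sup>2/(4 * s)))))
    = complex_of_real(sqrt(4*pi * s)^DIM('a)*exp(- s*(norm xi)^2))" .
 qed
qed

lemma integral_gaussian: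
 assumes t: "0 < t"
 shows "L1 (%y::'a::euclidean_space. exp(- (t*norm y^2)))"
  and "(LINT y. exp(- (t*norm(y::'a)^2))) = sqrt(pi/t)^DIM('a)"
proof -
 have t4: "0 < 1/(4*t)" using t by simp
 have eq: "- (norm y)\<^sup>2/(4*(1/(4*t))) = - (t*norm y^2)" for y :: 'a using t by simp
 have i: "L1 (%y::'a. complex_of_real(exp(- (t*norm y^2))))"
  using fourier_gaussian(1)[OF t4, of "0::'a"] unfolding eq by simp
 thus "L1 (%y::'a::euclidean_space. exp(- (t*norm y^2)))"
  unfolding complex_of_real_integrable_eq .
 have "(LINT y. complex_of_real(exp(- (t*norm(y::'a)^2)))) = complex_of_real(sqrt(pi/t)^DIM('a))"
  using fourier_gaussian(2)[OF t4, of "0::'a"] unfolding eq by simp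
 thus "(LINT y. exp(- (t*norm(y::'a)^2))) = sqrt(pi/t)^DIM('a)"
  unfolding integral_complex_of_real by(rule of_real_eq_iff[THEN iffD1])
qed

lemma nn_integral_gaussian:
 assumes t: "0 < t"
 shows "(NINT y. ennreal(exp(- (t*norm(y::'a::euclidean_space)^2)))) = ennreal(sqrt(pi/t)^DIM('a))"
proof -
 have "(NINT y. ennreal(exp(- (t*norm(y::'a)^2)))) = ennreal(LINT y. exp(- (t*norm(y::'a)^2)))"
  by(rule nn_integral_eq_integral[OF integral_gaussian(1)[OF t]]) (rule AE_I2, rule exp_ge_zero)
 thus ?thesis unfolding integral_gaussian(2)[OF t] .
qed

text \<open>Writing \<open>|z|\<^sup>-\<^sup>2\<close> as the integral of \<open>exp (- t |z|\<^sup>2)\<close> over \<open>t > 0\<close> reduces radial integrals to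
 Gaussian ones.\<close>

lemma nn_integral_exp_Ioi:
 assumes "0 < a"
 shows "(NINT t. ennreal(exp(- (t*a)))*indicator {0..} t) = ennreal(1/a)"
proof -
 have lim: "((%t. - exp(- (t*a))/a) \<longlongrightarrow> 0) at_top"
  using assms by real_asymp
 have d: "((%t. - exp(- (t*a))/a) has_real_derivative exp (- (t*a))) (at t)" for t
  using assms by(auto intro!: derivative_eq_intros)
 show ?thesis
  using nn_integral_FTC_atLeast[of "%t. exp(- (t*a))" 0 "%t. - exp(- (t*a))/a" 0] lim d assms
  by simp
qed

lemma nn_integral_exp_moment1_Ioi:
 assumes "0 < a"
 shows "(NINT t. ennreal(t*exp(- (t*a)))*indicator {0..} t) = ennreal(1/a^2)"
proof -
 have lim: "((%t. - (t/a + 1/a^2)*exp(- (t*a))) \<longlongrightarrow> 0) at_top"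
  using assms by real_asymp
 have d: "((%t. - (t/a + 1/a^2)*exp(- (t*a))) has_real_derivative t*exp(- (t*a))) (at t)" for t
  using assms by(auto intro!: derivative_eq_intros simp: field_simps power2_eq_square)
 show ?thesis
  using nn_integral_FTC_atLeast[of "%t. t*exp(- (t*a))" 0 "%t. - (t/a + 1/a^2)*exp(- (t*a))" 0] lim d assms
  by simp
qed

lemma nn_integral_exp_moment2_Ioi:
 assumes "0 < a"
 shows "(NINT t. ennreal(t^2*exp(- (t*a)))*indicator {0..} t) = ennreal(2/a^3)"
proof -
 have lim: "((%t. - (t^2/a + 2*t/a^2 + 2/a^3)*exp(- (t*a))) \<longlongrightarrow> 0) at_top"
  using assms by real_asymp
 have d: "((%t. - (t^2/a + 2*t/a^2 + 2/a^3)*exp(- (t*a))) has_real_derivative t\<^sup>2*exp(- (t*a))) (at t)" for t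
  using assms by(auto intro!: derivative_eq_intros simp: field_simps power2_eq_square power3_eq_cube)
 show ?thesis
  using nn_integral_FTC_atLeast[of "%t. t^2*exp(- (t*a))" 0 "%t. - (t^2/a + 2*t/a^2 + 2/a^3)*exp(- (t*a))" 0] lim d assms
  by simp
qed

lemma nn_integral_powr_exp_Ioi:
 assumes "0 < a" "0 < q"
 shows "(NINT t. ennreal(t powr (q - 1)*exp(- (t*a)))*indicator {0..} t) = ennreal(Gamma q/a powr q)"
proof -
 define g where "g t = ennreal(t powr (q - 1)/exp t)*indicator {0..} t" for t :: real
 have [measurable]: "g : borel_measurable borel" unfolding g_def by measurable
 have "(NINT t. g t) = ennreal(Gamma q)"
  unfolding g_def by(rule nn_integral_has_integral_lebesgue'[OF _ Gamma_integral_real[OF assms(2)]]) auto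
 also have "(NINT t. g t) = ennreal a*(NINT t. g(a*t))"
  using nn_integral_lborel_affine[of g a 0] assms by simp
 also have "(NINT t. g(a*t)) = (NINT t. ennreal(a powr (q - 1))*(ennreal(t powr (q - 1)*exp(- (t*a)))*indicator {0..} t))"
 proof(intro nn_integral_cong)
  fix t :: real
  show "g(a*t) = ennreal(a powr (q - 1))*(ennreal(t powr (q - 1)*exp(- (t*a)))*indicator {0..} t)"
  proof(cases "0 <= t")
   case True
   hence "(a*t) powr (q - 1)/exp(a*t) = a powr (q - 1)*(t powr (q - 1)*exp(- (t*a)))"
    using assms by(simp add: powr_mult exp_minus divide_inverse mult.commute)
   thus ?thesis using True assms unfolding g_def by(simp flip: ennreal_mult)
  qed(use assms in \<open>auto simp: g_def indicator_def zero_le_mult_iff\<close>)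
 qed
 also have "... = ennreal(a powr (q - 1))*(NINT t. ennreal(t powr (q - 1)*exp(- (t*a)))*indicator {0..} t)"
  by(rule nn_integral_cmult) measurable
 finally have "ennreal a*(ennreal(a powr (q - 1))*(NINT t. ennreal(t powr (q - 1)*exp(- (t*a)))*indicator {0..} t))
   = ennreal(Gamma q)" .
 note this[symmetric]
 also have "ennreal a*(ennreal(a powr (q - 1))*(NINT t. ennreal(t powr (q - 1)*exp(- (t*a)))*indicator {0..} t))
   = ennreal(a*a powr (q - 1))*(NINT t. ennreal(t powr (q - 1)*exp(- (t*a)))*indicator {0..} t)"
  using assms by(simp add: ennreal_mult mult.assoc)
 also have "a*a powr (q - 1) = a powr q" using assms powr_add[of a 1 "q - 1"] by simp
 finally have *: "ennreal(Gamma q) = ennreal(a powr q)*(NINT t. ennreal(t powr (q - 1)*exp(- (t*a)))*indicator {0..} t)" .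
 have "ennreal(Gamma q/a powr q) = ennreal(1/a powr q)*ennreal(Gamma q)"
  by(subst ennreal_mult[symmetric]) (use assms Gamma_real_pos[of q] in \<open>auto simp: less_imp_le\<close>)
 also have "... = (ennreal(1/a powr q)*ennreal(a powr q))*(NINT t. ennreal(t powr (q - 1)*exp(- (t*a)))*indicator {0..} t)"
  unfolding * by(simp add: mult.assoc)
 also have "ennreal(1/a powr q)*ennreal(a powr q) = 1"
  by(subst ennreal_mult[symmetric]) (use assms in auto)
 finally show ?thesis by simp
qed

lemma sqrt_divide_power3:
 assumes "0 < c"
 shows "sqrt(pi/c)^3 = sqrt pi^3 * c powr (- (3/2))"
proof -
 have "c powr (3/2) = (c powr (1/2)) powr 3" by(simp add: powr_powr)
 also have "... = sqrt c^3" using assms by(simp add: powr_half_sqrt)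
 finally have "c powr (3/2) = sqrt c^3" .
 thus ?thesis unfolding real_sqrt_divide power_divide powr_minus by(simp only: divide_inverse)
qed

text \<open>With \<open>1/|z|^2\<close> written as an integral of Gaussians over \<open>t\<close>,
  Fubini leaves the integral of \<open>1 + t\<close> to the power \<open>-3/2\<close>. Only
  finiteness matters: this is the source of the local integrability of \<open>1/|z|^2\<close> in
  dimension three.\<close>

lemma nn_integral_inverse_square_gaussian:
 "(NINT z. ennreal(exp(- (norm(z::real^3))\<^sup>2)/norm z^2)) < \<infinity>"
proof -
 have "(NINT z. ennreal(exp(- (norm(z::real^3))\<^sup>2)/norm z^2))
  = (NINT z. (NINT t. ennreal(exp(- ((1 + t)*norm(z::real^3)^2)))*indicator {0..} t))"
 proof(rule nn_integral_cong_AE)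
  have "AE z::real^3 in lborel. z ~= 0" by(rule AE_lborel_singleton)
  thus "AE z::real^3 in lborel. ennreal(exp(- (norm z)\<^sup>2)/norm z^2)
    = (NINT t. ennreal(exp(- ((1 + t)*norm z^2)))*indicator {0..} t)"
  proof eventually_elim
   case (elim z)
   hence p: "0 < norm z^2" by simp
   have "(NINT t. ennreal(exp(- ((1 + t)*norm z^2)))*indicator {0..} t)
    = (NINT t. ennreal(exp(- (norm z)\<^sup>2))*(ennreal(exp(- (t*norm z^2)))*indicator {0..} t))"
    by(intro nn_integral_cong) (auto simp: indicator_def algebra_simps exp_add exp_diff exp_minus divide_inverse simp flip: ennreal_mult)
   also have "... = ennreal(exp(- (norm z)\<^sup>2))*ennreal(1/norm z^2)"
    by(subst nn_integral_cmult) (simp_all add: nn_integral_exp_Ioi[OF p] del: mult_minus_left)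
   finally show ?case by(simp flip: ennreal_mult)
  qed
 qed
 also have "... = (NINT t. (NINT z. ennreal(exp(- ((1 + t)*norm(z::real^3)^2)))*indicator {0..} t))"
  by(rule lborel_pair.Fubini') measurable
 also have "... = (NINT t. ennreal(sqrt pi^3*(1 + t) powr (- (3/2)))*indicator {0..} t)"
 proof(intro nn_integral_cong)
  fix t :: real
  show "(NINT z. ennreal(exp(- ((1 + t)*norm(z::real^3)^2)))*indicator {0..} t)
   = ennreal(sqrt pi^3*(1 + t) powr (- (3/2)))*indicator {0..} t"
  proof(cases "t >= 0")
   case True
   hence "sqrt(pi/(1 + t))^3 = sqrt pi^3*(1 + t) powr (- (3/2))"
    by(intro sqrt_divide_power3) simp
   thus ?thesis using True nn_integral_gaussian[of "1 + t", where 'a="real^3"] by simp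
  qed simp
 qed
 also have "... = ennreal(0 - (- 2 * sqrt pi^3*(1 + 0) powr (- (1/2))))"
 proof(rule nn_integral_FTC_atLeast)
  show "((%t. - 2 * sqrt pi^3*(1 + t) powr (- (1/2))) \<longlongrightarrow> 0) at_top" by real_asymp
  show "((%t. - 2 * sqrt pi^3*(1 + t) powr (- (1/2))) has_real_derivative sqrt pi^3*(1 + t) powr (- (3/2))) (at t)" if "0 <= t" for t
   using that by(auto intro!: derivative_eq_intros)
 qed auto
 finally show ?thesis by simp
qed

text \<open>The same method with the first moment in \<open>t\<close>, which produces the square in
  the denominator; what remains is a multiple of \<open>Gamma (1/2)\<close>.\<close>

lemma nn_integral_inverse_fourth:
 "(NINT z. ennreal(1/(1 + norm(z::real^3)^2)^2)) < \<infinity>"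
proof -
 have "(NINT z. ennreal(1/(1 + norm(z::real^3)^2)^2))
  = (NINT z. (NINT t. ennreal(t*exp(- (t*(1 + norm(z::real^3)^2))))*indicator {0..} t))"
  by(intro nn_integral_cong nn_integral_exp_moment1_Ioi[symmetric]) (simp add: add_pos_nonneg)
 also have "... = (NINT t. (NINT z. ennreal(t*exp(- (t*(1 + norm(z::real^3)^2))))*indicator {0..} t))"
  by(rule lborel_pair.Fubini') measurable
 also have "... = (NINT t. ennreal(sqrt pi^3)*(ennreal(t powr (1/2 - 1)*exp(- (t*1)))*indicator {0..} t))"
 proof(intro nn_integral_cong_AE)
  have "AE t::real in lborel. t ~= 0" by(rule AE_lborel_singleton)
  thus "AE t in lborel. (NINT z. ennreal(t*exp(- (t*(1 + norm(z::real^3)^2))))*indicator {0..} t)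
   = ennreal(sqrt pi^3)*(ennreal(t powr (1/2 - 1)*exp(- (t*1)))*indicator {0..} t)"
  proof eventually_elim
   case (elim t)
   show ?case
   proof(cases "t > 0")
    case True
    have "(NINT z. ennreal(t*exp(- (t*(1 + norm(z::real^3)^2))))*indicator {0..} t)
     = (NINT z. ennreal(t*exp(- t))*ennreal(exp(- (t*norm(z::real^3)^2))))"
     using True by(intro nn_integral_cong) (auto simp: algebra_simps exp_diff exp_minus divide_inverse simp flip: ennreal_mult)
    also have "... = ennreal(t*exp(- t))*ennreal(sqrt(pi/t)^3)"
     using nn_integral_gaussian[OF True, where 'a="real^3"] by(subst nn_integral_cmult) simp_all
    also have "t*exp(- t) * sqrt(pi/t)^3 = sqrt pi^3*(t powr (1/2 - 1)*exp(- (t*1)))"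
    proof -
     have "t * sqrt(pi/t)^3 = sqrt pi^3*(t powr 1*t powr (- (3/2)))"
      unfolding sqrt_divide_power3[OF True] using True by simp
     also have "t powr 1*t powr (- (3/2)) = t powr (1/2 - 1)"
      unfolding powr_add[symmetric] by simp
     finally show ?thesis by(simp add: algebra_simps)
    qed
    hence "ennreal(t*exp(- t))*ennreal(sqrt(pi/t)^3) = ennreal(sqrt pi^3)*(ennreal(t powr (1/2 - 1)*exp(- (t*1)))*indicator {0..} t)"
     using True by(simp flip: ennreal_mult)
    finally show ?thesis .
   qed(use elim in auto)
  qed
 qed
 also have "... = ennreal(sqrt pi^3)*(NINT t. ennreal(t powr (1/2 - 1)*exp(- (t*1)))*indicator {0..} t)"
  by(rule nn_integral_cmult) measurable
 also have "... = ennreal(sqrt pi^3)*ennreal(Gamma(1/2)/1 powr (1/2))"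
  by(subst nn_integral_powr_exp_Ioi) auto
 also have "... < \<infinity>" by(subst ennreal_mult[symmetric]) (auto simp: less_imp_le)
 finally show ?thesis .
qed

lemma integrable_inverse_fourth: "L1 (%z::real^3. 1/(1 + norm z^2)^2)"
 using nn_integral_inverse_fourth by(simp add: integrable_iff_bounded abs_of_nonneg)

lemma integrable_inverse_square_ball:
 "L1 (%z. indicator (cball x R) z/norm(y - z :: real^3)^2)"
proof -
 define h :: "real^3 => real" where "h z = indicator (cball 0 1) z/norm z^2" for z
 have h1: "L1 h"
 proof(rule integrable_bound)
  show "L1 (%z::real^3. exp 1*(exp(- (norm z)\<^sup>2)/norm z^2))"
   using nn_integral_inverse_square_gaussian by(intro integrable_mult_right) (simp add: integrable_iff_bounded)
  have "indicator (cball 0 1) z <= exp 1*exp(- (norm z)\<^sup>2)" for z :: "real^3"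
   by(auto simp: indicator_def power_le_one simp flip: exp_add)
  thus "AE x in lborel. norm(h x) <= norm(exp 1*(exp(- (norm x)\<^sup>2)/norm x^2))"
   unfolding h_def by(intro AE_I2) (auto simp: divide_right_mono)
  have "h : borel_measurable borel" unfolding h_def
   by(intro borel_measurable_divide borel_measurable_indicator borel_measurable_power borel_measurable_norm) auto
  thus "h : borel_measurable lborel" by simp
 qed
 \<comment> \<open>A ball of radius \<open>r\<close> around the singularity \<open>y\<close>
   contains \<open>cball x R\<close>, and rescaling by \<open>r\<close> reduces it to the unit ball
   at the origin. The summand 1 only keeps \<open>r\<close> positive.\<close>
 define r where "r = \<bar>R\<bar> + norm(x - y) + 1"
 have r: "r > 0" unfolding r_def by(intro add_nonneg_pos) auto
 have "L1 (%z. h((-(1/r)) *\<^sub>R y + (1/r) *\<^sub>R z))"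
  using integrable_lborel_affine[OF h1, of "1/r" "-(1/r) *\<^sub>R y"] r by auto
 hence i: "L1 (%z. h((1/r) *\<^sub>R (z - y))/r^2)"
  by(intro integrable_divide) (simp add: algebra_simps)
 show ?thesis
 proof(rule integrable_bound[OF i])
  show "AE z in lborel. norm(indicator (cball x R) z/norm(y - z)^2) <= norm(h((1/r) *\<^sub>R (z - y))/r^2)"
  proof(intro AE_I2)
   fix z :: "real^3"
   have "norm(z - y) <= r" if "z : cball x R"
    using that norm_triangle_ineq[of "z - x" "x - y"] unfolding r_def by(simp add: dist_norm norm_minus_commute)
   thus "norm(indicator (cball x R) z/norm(y - z)^2) <= norm(h((1/r) *\<^sub>R (z - y))/r^2)"
    using r unfolding h_def by(auto simp: indicator_def norm_minus_commute power_mult_distrib power_divide)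
  qed
  have "(%z. indicator (cball x R) z/norm(y - z)^2) : borel_measurable borel"
   by(intro borel_measurable_divide borel_measurable_indicator borel_measurable_power borel_measurable_norm) auto
  thus "(%z. indicator (cball x R) z/norm(y - z)^2) : borel_measurable lborel" by simp
 qed
qed

section \<open>Inversion of the half Laplacian on differences of heat kernels\<close>

section \<open>The heat kernel\<close>

definition heat :: "real => real^3 => real" where
 "heat s z = exp(- (norm z^2/(4 * s)))/sqrt(4*pi * s)^3"

text \<open>The kernel solves the heat equation, so this time derivative is also its Laplacian, and
  it is used in that role: minus its average over \<open>half_measure\<close> will be the half
  Laplacian.\<close>

definition heat_dt :: "real => real^3 => real" where
 "heat_dt s z = heat s z*(norm z^2/(4 * s^2) - 3/(2 * s))"

lemma heat_nonneg: "0 < s ==> 0 <= heat s z" by(simp add: heat_def)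

lemma heat_uminus [simp]: "heat s (- z) = heat s z" "heat_dt s (- z) = heat_dt s z"
 by(simp_all add: heat_def heat_dt_def)

lemma heat_has_derivative:
 assumes s: "0 < s"
 shows "((%s. heat s z) has_real_derivative heat_dt s z) (at s)"
proof -
 have eq: "heat s z = exp(- (norm z^2/(4 * s)) - 3/2*(ln(4*pi) + ln s))" if "0 < s" for s
 proof -
  have "sqrt(4*pi * s) = exp(1/2*ln(4*pi * s))"
   using that by(simp add: powr_half_sqrt[symmetric] powr_def)
  also have "ln(4*pi * s) = ln(4*pi) + ln s" using that by(simp add: ln_mult)
  finally have "sqrt(4*pi * s)^3 = exp(3/2*(ln(4*pi) + ln s))"
   by(simp flip: exp_of_nat_mult)
  thus ?thesis unfolding heat_def by(simp add: exp_diff)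
 qed
 have "((%s. exp(- (norm z^2/(4 * s)) - 3/2*(ln(4*pi) + ln s))) has_real_derivative
   exp(- (norm z^2/(4 * s)) - 3/2*(ln(4*pi) + ln s))*(norm z^2/(4 * s^2) - 3/(2 * s))) (at s)"
 proof -
  have 1: "((%s. (norm z)^2/(4 * s)) has_real_derivative - (norm z^2/(4 * s^2))) (at s)"
   using s by(auto intro!: derivative_eq_intros simp: power2_eq_square)
  have 2: "((%s. 3/2*(ln(4*pi) + ln s)) has_real_derivative 3/(2 * s)) (at s)"
   using s by(auto intro!: derivative_eq_intros)
  show ?thesis by(rule DERIV_cong[OF DERIV_fun_exp[OF DERIV_diff[OF DERIV_minus[OF 1] 2]]]) simp
 qed
 hence "((%s. exp(- (norm z^2/(4 * s)) - 3/2*(ln(4*pi) + ln s))) has_real_derivative heat_dt s z) (at s)"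
  unfolding heat_dt_def eq[OF s] .
 thus ?thesis
  by(rule has_field_derivative_transform_within_open[of _ _ _ "{0<..}"]) (use s eq in auto)
qed

lemma continuous_on_heat: "continuous_on UNIV (heat s)" "continuous_on UNIV (heat_dt s)"
 unfolding heat_def heat_dt_def divide_inverse
 by(intro continuous_on_mult continuous_on_exp continuous_on_const continuous_on_norm continuous_on_id
   continuous_on_power continuous_on_minus continuous_on_diff)+

lemma heat_measurable [measurable]:
 assumes [measurable]: "f : borel_measurable M" "g : borel_measurable M"
 shows "(%x. heat (f x) (g x)) : borel_measurable M" "(%x. heat_dt (f x) (g x)) : borel_measurable M"
 unfolding heat_def heat_dt_def by measurable

text \<open>A single term of the exponential series at \<open>1 + t\<close>. The factorials hidden
  in the constants of the kernel bounds come from here.\<close>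

lemma exp_neg_mult_power_le:
 fixes t :: real
 assumes "0 <= t"
 shows "exp(- t)*(1 + t)^n <= fact n*exp 1"
proof -
 have "(\<Sum>k\<in>{n}. (1 + t)^k /\<^sub>R fact k) <= (\<Sum>k. (1 + t)^k /\<^sub>R fact k)"
  by(rule sum_le_suminf[OF summable_exp_generic]) (use assms in auto)
 hence "(1 + t)^n/fact n <= exp(1 + t)"
  unfolding exp_def by(simp add: divide_inverse mult.commute)
 hence "(1 + t)^n <= fact n*exp(1 + t)" by(simp add: divide_le_eq mult.commute)
 hence "exp(- t)*(1 + t)^n <= exp(- t)*(fact n*exp(1 + t))" by(intro mult_left_mono) auto
 also have "... = fact n*exp 1" by(simp add: exp_add exp_minus)
 finally show ?thesis .
qed

lemma heat_le_exp:
 assumes "0 < s"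
 shows "heat s z <= exp(- (norm z^2/(4 * s)))/sqrt s^3"
proof -
 have "sqrt s <= sqrt(4*pi * s)" using assms pi_gt3 by(simp add: real_sqrt_le_mono)
 thus ?thesis unfolding heat_def using assms
  by(intro divide_left_mono power_mono mult_pos_pos zero_less_power) auto
qed

text \<open>With \<open>t = |z|^2/(4 s)\<close> the parabolic size \<open>s + |z|^2\<close> costs
  only a power of \<open>s\<close> and a power of \<open>1 + t\<close>, and the latter is absorbed
  by \<open>exp (- t)\<close>. This is the mechanism of the bounds in terms of
  \<open>s + |z|^2\<close>.\<close>

lemma heat_arg_le:
 assumes "0 < s"
 shows "s + norm z^2 <= 4 * s*(1 + norm z^2/(4 * s))"
 using assms by(simp add: field_simps)

lemma heat_le:
 assumes s: "0 < s"
 shows "heat s z <= 16*exp 1/sqrt(s + norm z^2)^3"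
proof -
 define t where "t = norm z^2/(4 * s)"
 have t: "0 <= t" unfolding t_def using s by simp
 have p: "0 < s + norm z^2" using s by(simp add: add_pos_nonneg)
 have "sqrt(s + norm z^2) <= sqrt(4 * s*(1 + t))"
  using heat_arg_le[OF s, of z] unfolding t_def by(rule real_sqrt_le_mono)
 also have "... = 2 * sqrt s * sqrt(1 + t)" by(simp add: real_sqrt_mult)
 finally have "sqrt(s + norm z^2)^3 <= (2 * sqrt s * sqrt(1 + t))^3"
  by(rule power_mono) (use p in auto)
 also have "... = 8 * sqrt s^3*((1 + t) * sqrt(1 + t))"
 proof -
  have "sqrt(1 + t)^3 = (1 + t) * sqrt(1 + t)" using t by(simp add: power3_eq_cube)
  thus ?thesis by(simp add: power_mult_distrib)
 qed
 also have "... <= 8 * sqrt s^3*(1 + t)^2"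
 proof -
  have "sqrt(1 + t) <= 1 + t" using t by(intro real_le_lsqrt) (auto simp: power2_eq_square algebra_simps)
  thus ?thesis using t s unfolding power2_eq_square by(intro mult_left_mono) auto
 qed
 finally have "heat s z * sqrt(s + norm z^2)^3 <= (exp(- t)/sqrt s^3)*(8 * sqrt s^3*(1 + t)^2)"
  using heat_le_exp[OF s, of z] heat_nonneg[OF s, of z] p unfolding t_def by(intro mult_mono) auto
 also have "... = 8*(exp(- t)*(1 + t)^2)" using s by simp
 also have "... <= 16*exp 1" using exp_neg_mult_power_le[OF t, of 2] by simp
 finally show ?thesis using p by(simp add: field_simps)
qed

text \<open>Away from the diagonal the kernel vanishes like \<open>sqrt s\<close> even relative to
  the weight \<open>|z|^(-4)\<close>, so it remains an approximate identity for functions that are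
  integrable only against that weight.\<close>

lemma heat_le_fourth:
 assumes s: "0 < s"
 shows "heat s z*norm z^4 <= 32*exp 1 * sqrt s"
proof -
 define t where "t = norm z^2/(4 * s)"
 have t: "0 <= t" unfolding t_def using s by simp
 have "4 * s*t = norm z^2" unfolding t_def using s by simp
 hence n4: "norm z^4 = (4 * s*t)^2" by(simp flip: power_mult)
 have "heat s z*norm z^4 <= (exp(- t)/sqrt s^3)*norm z^4"
  using heat_le_exp[OF s, of z] unfolding t_def by(intro mult_right_mono) auto
 also have "... = (exp(- t)/sqrt s^3)*(4 * s*t)^2" unfolding n4 ..
 also have "... = 16 * sqrt s*(exp(- t)*t^2)"
 proof -
  obtain r where r: "0 < r" "s = r^2" using s by(metis real_sqrt_gt_zero real_sqrt_pow2 less_imp_le)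
  hence "sqrt s = r" by simp
  thus ?thesis using r(1) unfolding r(2) by(simp add: field_simps eval_nat_numeral)
 qed
 also have "... <= 16 * sqrt s*(exp(- t)*(1 + t)^2)"
  using t s by(intro mult_left_mono power_mono) auto
 also have "... <= 16 * sqrt s*(2*exp 1)"
  using exp_neg_mult_power_le[OF t, of 2] s by(intro mult_left_mono) auto
 finally show ?thesis by(simp add: ac_simps)
qed

lemma heat_dt_le:
 assumes s: "0 < s"
 shows "\<bar>heat_dt s z\<bar> <= 192*exp 1/(sqrt s*(s + norm z^2)^2)"
proof -
 define t where "t = norm z^2/(4 * s)"
 have t: "0 <= t" unfolding t_def using s by simp
 have p: "0 < s + norm z^2" using s by(simp add: add_pos_nonneg)
 have "(norm z)^2/(4 * s^2) - 3/(2 * s) = (t - 3/2)/s"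
  unfolding t_def using s by(simp add: field_simps power2_eq_square)
 hence "\<bar>heat_dt s z\<bar> = heat s z*(\<bar>t - 3/2\<bar>/s)"
  unfolding heat_dt_def using s heat_nonneg[OF s, of z] by(simp add: abs_mult)
 also have "... <= (exp(- t)/sqrt s^3)*(2*(1 + t)/s)"
  using heat_le_exp[OF s, of z] heat_nonneg[OF s, of z] t s unfolding t_def[symmetric]
  by(intro mult_mono divide_right_mono) auto
 finally have 1: "\<bar>heat_dt s z\<bar> <= (exp(- t)/sqrt s^3)*(2*(1 + t)/s)" .
 have 2: "(s + norm z^2)^2 <= (4 * s*(1 + t))^2"
  using heat_arg_le[OF s, of z] p unfolding t_def by(intro power_mono) auto
 have "\<bar>heat_dt s z\<bar>*(sqrt s*(s + norm z^2)^2) <= ((exp(- t)/sqrt s^3)*(2*(1 + t)/s))*(sqrt s*(4 * s*(1 + t))^2)"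
  using s t p by(intro mult_mono 1 2 mult_nonneg_nonneg) auto
 also have "... = 32*(exp(- t)*(1 + t)^3)"
 proof -
  obtain r where r: "0 < r" "s = r^2" using s by(metis real_sqrt_gt_zero real_sqrt_pow2 less_imp_le)
  hence "sqrt s = r" by simp
  thus ?thesis using r(1) unfolding r(2) by(simp add: divide_simps) (simp add: eval_nat_numeral)
 qed
 also have "... <= 192*exp 1" using exp_neg_mult_power_le[OF t, of 3] by(simp add: fact_numeral)
 finally show ?thesis using p s by(simp add: field_simps)
qed

lemma norm_sq_add_scaleR:
 "(norm(z + r *\<^sub>R v))^2 = norm z^2 + 2*r*(z \<bullet> v) + r^2*norm v^2"
 unfolding power2_norm_eq_inner by(simp add: inner_add inner_commute algebra_simps power2_eq_square)

text \<open>In parabolic scaling \<open>heat\<close> has order -3; the time derivative contributes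
  -2 and the space derivative -1, which makes the third power of \<open>s + |w|^2\<close>. The
  constant is \<open>256 * 5!\<close>.\<close>

lemma heat_dt_grad:
 assumes s: "0 < s"
 obtains g where "((%r. heat_dt s (z + r *\<^sub>R v)) has_real_derivative g) (at r)"
  "\<bar>g\<bar> <= 30720*exp 1*norm v/(s + norm(z + r *\<^sub>R v)^2)^3"
proof -
 define w where "w = z + r *\<^sub>R v"
 define g where "g = heat s w*(2*(w \<bullet> v))*(1/(4 * s^2) - (norm w^2/(4 * s^2) - 3/(2 * s))/(4 * s))"
 have q: "((%r. (norm(z + r *\<^sub>R v))^2) has_real_derivative 2*(w \<bullet> v)) (at r)"
  unfolding norm_sq_add_scaleR w_def
  by(auto intro!: derivative_eq_intros simp: inner_add_left power2_norm_eq_inner)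
 have "((%r. heat_dt s (z + r *\<^sub>R v)) has_real_derivative g) (at r)"
 proof -
  define F where "F q = exp(- (q/(4 * s)))/sqrt(4*pi * s)^3*(q/(4 * s^2) - 3/(2 * s))" for q
  have "(F has_real_derivative exp (- (norm w^2/(4 * s)))/sqrt(4*pi * s)^3 *
    (1/(4 * s^2) - (norm w^2/(4 * s^2) - 3/(2 * s))/(4 * s))) (at(norm w^2))"
  proof -
   have d: "((%q. exp(- (c*q))*A*(q*B - E)) has_real_derivative exp (- (c*q))*A*(B - (q*B - E) * c)) (at q)"
    for c A B E q :: real by(auto intro!: derivative_eq_intros simp: algebra_simps)
   have F: "F = (%q. exp(- ((1/(4 * s))*q))*(1/sqrt(4*pi * s)^3)*(q*(1/(4 * s^2)) - 3/(2 * s)))"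
    by(simp add: F_def fun_eq_iff)
   show ?thesis unfolding F by(rule DERIV_cong[OF d]) simp
  qed
  from DERIV_chain2[of F _ "%r. (norm(z + r *\<^sub>R v))^2", OF this[unfolded w_def] q]
  show ?thesis unfolding g_def heat_dt_def heat_def F_def w_def by(simp add: mult_ac)
 qed
 moreover have "\<bar>g\<bar> <= 30720*exp 1*norm v/(s + norm w^2)^3"
 proof -
  define t where "t = norm w^2/(4 * s)"
  have t: "0 <= t" unfolding t_def using s by simp
  have p: "0 < s + norm w^2" using s by(simp add: add_pos_nonneg)
  have nw: "norm w = 2 * sqrt s * sqrt t"
   unfolding t_def using s by(simp add: real_sqrt_divide real_sqrt_mult)
  have "1/(4 * s^2) - (norm w^2/(4 * s^2) - 3/(2 * s))/(4 * s) = (5/8 - t/4)/s^2"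
   unfolding t_def using s by(simp add: field_simps power2_eq_square)
  hence "\<bar>g\<bar> = heat s w*(2*\<bar>w \<bullet> v\<bar>)*(\<bar>5/8 - t/4\<bar>/s^2)"
   unfolding g_def using heat_nonneg[OF s, of w] by(simp add: abs_mult)
  also have "... <= (exp(- t)/sqrt s^3)*(2*(norm w*norm v))*((1 + t)/s^2)"
   using heat_le_exp[OF s, of w] heat_nonneg[OF s, of w] t s Cauchy_Schwarz_ineq2[of w v] unfolding t_def[symmetric]
   by(intro mult_mono divide_right_mono mult_nonneg_nonneg) auto
  also have "... = 4*norm v * (exp(- t)*(1 + t) * sqrt t)/s^3"
  proof -
   obtain r where r: "0 < r" "s = r^2" using s by(metis real_sqrt_gt_zero real_sqrt_pow2 less_imp_le)
   hence "sqrt s = r" by simp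
   thus ?thesis using r(1) unfolding nw r(2) by(simp add: divide_simps) (simp add: eval_nat_numeral)
  qed
  also have "... <= 4*norm v * (exp(- t)*(1 + t)*(1 + t))/s^3"
  proof -
   have "sqrt t <= 1 + t" using t by(intro real_le_lsqrt) (auto simp: power2_eq_square algebra_simps)
   thus ?thesis using s t by(intro divide_right_mono mult_left_mono) auto
  qed
  finally have 1: "\<bar>g\<bar> <= 4*norm v * (exp(- t)*(1 + t)*(1 + t))/s^3" .
  have 2: "(s + norm w^2)^3 <= (4 * s*(1 + t))^3"
   using heat_arg_le[OF s, of w] p unfolding t_def by(intro power_mono) auto
  have "\<bar>g\<bar>*(s + norm w^2)^3 <= (4*norm v * (exp(- t)*(1 + t)*(1 + t))/s^3)*(4 * s*(1 + t))^3"
   using s t p by(intro mult_mono 1 2) auto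
  also have "... = 256*norm v * (exp(- t)*(1 + t)^5)"
   using s by(simp add: divide_simps power_mult_distrib) (simp add: eval_nat_numeral)
  also have "... <= 256*norm v * (fact 5*exp 1)"
   using exp_neg_mult_power_le[OF t, of 5] by(intro mult_left_mono) auto
  also have "... = 30720*exp 1*norm v" by(simp add: fact_numeral)
  finally show ?thesis using p by(simp add: field_simps)
 qed
 ultimately show thesis using that unfolding w_def by blast
qed

text \<open>The mean value theorem along the segment from \<open>b\<close> to \<open>a\<close>
  trades the difference for one more space derivative, hence one more parabolic order than
  \<open>heat_dt_le\<close> offers for a single kernel.\<close>

lemma heat_dt_diff_bound:
 assumes s0: "0 < s0"
 obtains C where "0 <= C" "!!s y. s0 <= s ==> \<bar>heat_dt s (a - y) - heat_dt s (b - y)\<bar> <= C/(s + norm y^2)^3"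
proof -
 define R where "R = norm a + norm b"
 \<comment> \<open>The segment stays within distance \<open>R\<close> of the origin, so
   \<open>|y| <= R + |w r|\<close>, and the surplus \<open>2 R^2\<close> is at most
   \<open>(2 R^2/s0) * s\<close>. Hence \<open>s + |y|^2 <= M * (s + |w r|^2)\<close> along the
   whole segment.\<close>
 define M where "M = 2 + 2 * R^2/s0"
 define C where "C = 30720*exp 1*norm(a - b)*M^3"
 have M: "2 <= M" unfolding M_def using s0 by simp
 have "\<bar>heat_dt s (a - y) - heat_dt s (b - y)\<bar> <= C/(s + norm y^2)^3" if s: "s0 <= s" for s y
 proof -
  have sp: "0 < s" using s s0 by simp
  have py: "0 < s + norm y^2" using sp by(simp add: add_pos_nonneg)
  define w where "w r = (b - y) + r *\<^sub>R (a - b)" for r :: real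
  have "ALL r. EX g. ((%r. heat_dt s ((b - y) + r *\<^sub>R (a - b))) has_real_derivative g) (at r) &
   \<bar>g\<bar> <= 30720*exp 1*norm(a - b)/(s + norm(w r)^2)^3"
  proof
   fix r
   obtain g where "((%r. heat_dt s ((b - y) + r *\<^sub>R (a - b))) has_real_derivative g) (at r)"
    "\<bar>g\<bar> <= 30720*exp 1*norm(a - b)/(s + (norm((b - y) + r *\<^sub>R (a - b)))^2)^3"
    by(rule heat_dt_grad[OF sp, of "b - y" "a - b" r])
   thus "EX g. ((%r. heat_dt s ((b - y) + r *\<^sub>R (a - b))) has_real_derivative g) (at r) &
    \<bar>g\<bar> <= 30720*exp 1*norm(a - b)/(s + norm(w r)^2)^3"
    unfolding w_def by blast
  qed
  then obtain g where g: "!!r. ((%r. heat_dt s ((b - y) + r *\<^sub>R (a - b))) has_real_derivative g r) (at r)"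
   "!!r. \<bar>g r\<bar> <= 30720*exp 1*norm(a - b)/(s + norm(w r)^2)^3"
   by(auto dest!: choice)
  have gb: "\<bar>g r\<bar> <= C/(s + norm y^2)^3" if r: "r : {0..1}" for r
  proof -
   have pw: "0 < s + norm(w r)^2" using sp by(simp add: add_pos_nonneg)
   have "y = ((1 - r) *\<^sub>R b + r *\<^sub>R a) - w r" unfolding w_def by(simp add: algebra_simps)
   hence "norm y <= norm((1 - r) *\<^sub>R b + r *\<^sub>R a) + norm(w r)" using norm_triangle_ineq4 by metis
   also have "norm((1 - r) *\<^sub>R b + r *\<^sub>R a) <= (1 - r)*norm b + r*norm a"
    using norm_triangle_ineq[of "(1 - r) *\<^sub>R b" "r *\<^sub>R a"] r by simp
   also have "... <= 1*norm b + 1*norm a" using r by(intro add_mono mult_right_mono) auto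
   finally have "norm y <= R + norm(w r)" unfolding R_def by simp
   hence "(norm y)^2 <= (R + norm(w r))^2" by(intro power_mono) auto
   also have "... <= 2 * R^2 + 2*norm(w r)^2"
    using zero_le_power2[of "R - norm(w r)"] by(simp add: power2_eq_square algebra_simps)
   also have "2 * R^2 <= (2 * R^2/s0) * s"
    proof -
     have "(2 * R^2/s0) * s0 <= (2 * R^2/s0) * s" using s s0 by(intro mult_left_mono) auto
     thus ?thesis using s0 by simp
    qed
   finally have a: "(norm y)^2 <= 2 * R^2/s0 * s + 2*norm(w r)^2" by simp
   have "s + norm y^2 <= M*(s + norm(w r)^2)"
   proof -
    have e: "M*(s + norm(w r)^2) = 2 * s + 2*norm(w r)^2 + 2 * R^2/s0 * s + 2 * R^2/s0*norm(w r)^2"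
     unfolding M_def by(simp only: algebra_simps)
    have "0 <= 2 * R^2/s0*norm(w r)^2" using s0 by simp
    thus ?thesis using a sp unfolding e by linarith
   qed
   hence "(s + norm y^2)^3 <= (M*(s + norm(w r)^2))^3" using py by(intro power_mono) auto
   hence "(s + norm y^2)^3 <= M^3*(s + norm(w r)^2)^3" by(simp add: power_mult_distrib)
   hence "30720*exp 1*norm(a - b)*(s + norm y^2)^3
     <= 30720*exp 1*norm(a - b)*(M^3*(s + norm(w r)^2)^3)"
    by(intro mult_left_mono) auto
   hence "30720*exp 1*norm(a - b)/(s + norm(w r)^2)^3 <= C/(s + norm y^2)^3"
    unfolding C_def using py pw by(simp add: pos_divide_le_eq pos_le_divide_eq mult_ac)
   thus ?thesis using g(2)[of r] by linarith
  qed
  have "norm(heat_dt s ((b - y) + 1 *\<^sub>R (a - b)) - heat_dt s ((b - y) + 0 *\<^sub>R (a - b))) <= C/(s + norm y^2)^3*norm(1 - 0 :: real)"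
  proof(rule field_differentiable_bound[where S="{0..1}" and f'=g])
   fix r :: real assume "r : {0..1}"
   show "((%r. heat_dt s ((b - y) + r *\<^sub>R (a - b))) has_field_derivative g r) (at r within {0..1})"
    using g(1) has_field_derivative_at_within by blast
  qed(use gb in auto)
  thus ?thesis by simp
 qed
 moreover have "0 <= C" unfolding C_def using M by simp
 ultimately show thesis using that by blast
qed

lemma heat_has_integral:
 assumes "0 < s"
 shows "L1 (%y. heat s (x - y))" "(LINT y. heat s (x - y)) = 1"
proof -
 have p: "0 < 1/(4 * s)" using assms by simp
 have e: "exp(- (1/(4 * s)*norm z^2))/sqrt(4*pi * s)^3 = heat s z" for z
  by(simp add: heat_def)
 have "L1(heat s)"
  using integrable_divide[OF integral_gaussian(1)[OF p, where 'a="real^3"], of "sqrt(4*pi * s)^3"] unfolding e by simp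
 thus "L1 (%y. heat s (x - y))" using integrable_translate(2) by blast
 have "(LINT z. exp(- (1/(4 * s)*norm(z::real^3)^2))/sqrt(4*pi * s)^3) = 1"
  using integral_gaussian(2)[OF p, where 'a="real^3"] assms by(simp add: mult_ac)
 hence "LI(heat s) = 1" unfolding e by simp
 thus "(LINT y. heat s (x - y)) = 1" using integral_translate(2)[of "heat s" x] by simp
qed

lemma fourier_heat:
 assumes s: "0 < s"
 shows "L1 (%y. wave xi y (heat s y))"
  and "(LINT y. wave xi y (heat s y)) = complex_of_real(exp(- (s*(norm xi)^2)))"
proof -
 have e: "wave xi y (exp(- (norm y)\<^sup>2/(4 * s)))/complex_of_real(sqrt(4*pi * s)^3)
   = wave xi y (heat s y)" for y :: "real^3" by(simp add: heat_def)
 show "L1 (%y. wave xi y (heat s y))"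
  using integrable_divide[OF fourier_gaussian(1)[OF s, of xi], of "complex_of_real(sqrt(4*pi * s)^3)"] unfolding e by simp
 have "(LINT y. wave xi y (exp(- (norm y)\<^sup>2/(4 * s)))/complex_of_real(sqrt(4*pi * s)^3))
  = complex_of_real(exp(- (s*(norm xi)^2)))"
  unfolding integral_divide_zero fourier_gaussian(2)[OF s, of xi] using s by simp
 thus "(LINT y. wave xi y (heat s y)) = complex_of_real(exp(- (s*(norm xi)^2)))"
  unfolding e .
qed

section \<open>Fractional integration of order one half\<close>

lemma nn_integral_FTC_einterval:
 fixes f F :: "real => real" and a b :: ereal
 assumes "a < b"
  and F: "!!x. a < ereal x ==> ereal x < b ==> (F has_real_derivative f x) (at x)"
  and f: "!!x. a < ereal x ==> ereal x < b ==> isCont f x"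
  and f0: "!!x. a < ereal x ==> ereal x < b ==> 0 <= f x"
  and A: "((F \<circ> real_of_ereal) \<longlongrightarrow> A) (at_right a)"
  and B: "((F \<circ> real_of_ereal) \<longlongrightarrow> B) (at_left b)"
 shows "(NINT x. ennreal(f x)*indicator (einterval a b) x) = ennreal(B - A)"
proof -
 note I = interval_integral_FTC_nonneg[OF assms(1) F f _ A B]
 have ae: "AE x in lborel. a < ereal x --> ereal x < b --> 0 <= f x" using f0 by auto
 have i: "L1 (%x. indicator (einterval a b) x *\<^sub>R f x)"
  using I(1)[OF _ _ _ _ ae] by(simp add: set_integrable_def)
 have v: "(LINT x. indicator (einterval a b) x *\<^sub>R f x) = B - A"
  using I(2)[OF _ _ _ _ ae] less_imp_le[OF assms(1)] by(simp add: interval_lebesgue_integral_def set_lebesgue_integral_def)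
 have "(NINT x. ennreal(f x)*indicator (einterval a b) x)
   = (NINT x. ennreal(indicator (einterval a b) x *\<^sub>R f x))"
  by(intro nn_integral_cong) (auto simp: indicator_def)
 also have "... = ennreal(B - A)" unfolding v[symmetric]
  by(rule nn_integral_eq_integral[OF i]) (use f0 in \<open>auto simp: indicator_def einterval_def\<close>)
 finally show ?thesis .
qed

lemma nn_integral_FTC_Ioi:
 fixes f F :: "real => real"
 assumes "!!x. 0 < x ==> (F has_real_derivative f x) (at x)"
  and "!!x. 0 < x ==> isCont f x" "!!x. 0 < x ==> 0 <= f x"
  and A: "(F \<longlongrightarrow> A) (at_right 0)" and B: "(F \<longlongrightarrow> B) at_top"
 shows "(NINT x. ennreal(f x)*indicator {0<..} x) = ennreal(B - A)"
proof -
 have e: "einterval 0 \<infinity> = {0<..}" by(auto simp: einterval_def)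
 have "(NINT x. ennreal(f x)*indicator (einterval 0 \<infinity>) x) = ennreal(B - A)"
 proof(rule nn_integral_FTC_einterval)
  show "((F \<circ> real_of_ereal) \<longlongrightarrow> A) (at_right 0)"
   using A by(simp add: zero_ereal_def ereal_tendsto_simps)
  show "((F \<circ> real_of_ereal) \<longlongrightarrow> B) (at_left \<infinity>)"
   using B by(simp add: ereal_tendsto_simps)
 qed(use assms in auto)
 thus ?thesis unfolding e .
qed

text \<open>The Laplace transform of this measure is \<open>q\<close> to the power
  \<open>-1/2\<close>, so averaging the heat semigroup over it gives the inverse of the half
  Laplacian. The normalisation \<open>1/sqrt pi\<close> is \<open>1/Gamma (1/2)\<close>.\<close>

definition half_measure :: "real measure" where
 "half_measure = density lborel (%t. ennreal(indicator {0<..} t/sqrt(pi*t)))"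

lemma sets_half_measure [simp, measurable_cong]: "sets half_measure = sets borel"
 by(simp add: half_measure_def)

lemma space_half_measure [simp]: "space half_measure = UNIV" by(simp add: half_measure_def)

lemma half_measure_density_measurable [measurable]:
 "(%t. ennreal(indicator {0<..} t/sqrt(pi*t))) : borel_measurable borel"
 by measurable

lemma nn_integral_half_measure:
 assumes "f : borel_measurable borel"
 shows "(\<integral>\<^sup>+t. f t \<partial>half_measure) = (NINT t. ennreal(indicator {0<..} t/sqrt(pi*t))*f t)"
 unfolding half_measure_def using assms by(intro nn_integral_density) auto

lemma sigma_finite_half_measure: "sigma_finite_measure half_measure"
proof -
 have "sigma_finite_measure (density lborel (%t::real. ennreal(indicator {0<..} t/sqrt(pi*t))))"
  by(subst sigma_finite_measure.sigma_finite_iff_density_finite[OF lborel.sigma_finite_measure_axioms]) auto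
 thus ?thesis unfolding half_measure_def .
qed

interpretation half: sigma_finite_measure half_measure by(rule sigma_finite_half_measure)

interpretation half_pair: pair_sigma_finite half_measure half_measure
 by(simp add: pair_sigma_finite_def sigma_finite_half_measure)

interpretation lborel_half: pair_sigma_finite "lborel :: (real^3) measure" half_measure
 by(simp add: pair_sigma_finite_def sigma_finite_half_measure lborel.sigma_finite_measure_axioms)

lemma AE_half_measure_pos: "AE t in half_measure. 0 < t"
 unfolding half_measure_def by(subst AE_density) (auto simp: indicator_def)

text \<open>The density of \<open>half_measure\<close> convolved with itself is 1 on the positive
  axis. This is the Beta value \<open>B(1/2, 1/2) = pi\<close>; an antiderivative is an
  arcsine.\<close>

lemma nn_integral_beta_half:
 assumes r: "0 < r"
 shows "(NINT t. ennreal(indicator {0<..} t/sqrt(pi*t))*ennreal(indicator {0<..} (r - t)/sqrt(pi*(r - t)))) = 1"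
proof -
 define f where "f t = 1/(pi * sqrt(t*(r - t)))" for t
 define F where "F t = arcsin ((2*t - r)/r)/pi" for t
 have "(NINT t. ennreal(indicator {0<..} t/sqrt(pi*t))*ennreal(indicator {0<..} (r - t)/sqrt(pi*(r - t))))
  = (NINT t. ennreal(f t)*indicator (einterval 0 r) t)"
 proof(intro nn_integral_cong)
  fix t
  show "ennreal(indicator {0<..} t/sqrt(pi*t))*ennreal(indicator {0<..} (r - t)/sqrt(pi*(r - t)))
   = ennreal(f t)*indicator (einterval 0 r) t"
  proof(cases "0 < t & t < r")
   case True
   hence "sqrt(pi*t) * sqrt(pi*(r - t)) = pi * sqrt(t*(r - t))"
    by(simp add: real_sqrt_mult)
   thus ?thesis using True by(simp add: f_def einterval_def flip: ennreal_mult)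
  qed(auto simp: einterval_def indicator_def)
 qed
 also have "... = ennreal(1/2 - (- 1/2))"
 proof(rule nn_integral_FTC_einterval)
  fix t assume "0 < ereal t" "ereal t < ereal r"
  hence t: "0 < t" "t < r" by auto
  have b: "-1 < (2*t - r)/r" "(2*t - r)/r < 1" using t r by(auto simp: field_simps)
  have "1 - ((2*t - r)/r)^2 = 4*(t*(r - t))/r^2"
   using r by(simp add: power2_eq_square field_simps)
  hence sq: "sqrt(1 - ((2*t - r)/r)^2) = 2 * sqrt(t*(r - t))/r"
   using r by(simp add: real_sqrt_divide real_sqrt_mult)
  have "((%t. arcsin ((2*t - r)/r)) has_real_derivative inverse (sqrt(1 - ((2*t - r)/r)^2))*(2/r)) (at t)"
   by(rule DERIV_chain2[of arcsin _ "%t. (2*t - r)/r", OF DERIV_arcsin[OF b]])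
    (use r in \<open>auto intro!: derivative_eq_intros\<close>)
  from DERIV_cdivide[OF this, of pi] show "(F has_real_derivative f t) (at t)"
   unfolding F_def f_def sq using r t by(simp add: mult.commute)
  show "isCont f t" unfolding f_def using t by(intro continuous_intros) auto
  show "0 <= f t" unfolding f_def using t by simp
 next
  have c: "continuous_on {0..r} F" unfolding F_def
   using r by(intro continuous_intros) (auto simp: field_simps)
  have F: "F 0 = - 1/2" "F r = 1/2" unfolding F_def using r by auto
  have "(F \<longlongrightarrow> F 0) (at_right 0)"
   using c r by(simp add: continuous_on_Icc_at_rightD)
  moreover have "(F \<longlongrightarrow> F r) (at_left r)"
   using c r by(simp add: continuous_on_Icc_at_leftD)
  ultimately have "(F \<longlongrightarrow> - 1/2) (at_right 0)" "(F \<longlongrightarrow> 1/2) (at_left r)" unfolding F by auto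
  thus "((F \<circ> real_of_ereal) \<longlongrightarrow> - 1/2) (at_right 0)" "((F \<circ> real_of_ereal) \<longlongrightarrow> 1/2) (at_left (ereal r))"
   by(simp_all add: zero_ereal_def ereal_tendsto_simps)
 qed(use r in auto)
 finally show ?thesis by simp
qed

text \<open>Two integrations of order one half make one ordinary integration; this is the identity
  that undoes the half Laplacian on heat kernels.\<close>

lemma nn_integral_half_measure_conv:
 assumes F[measurable]: "F : borel_measurable borel"
 shows "(\<integral>\<^sup>+r. (\<integral>\<^sup>+t. F(r + t) \<partial>half_measure) \<partial>half_measure) = (NINT q. indicator {0<..} q*F q)"
proof -
 define h where "h t = ennreal(indicator {0<..} t/sqrt(pi*t))" for t :: real
 have [measurable]: "h : borel_measurable borel" unfolding h_def by measurable
 have "(\<integral>\<^sup>+r. (\<integral>\<^sup>+t. F(r + t) \<partial>half_measure) \<partial>half_measure) = (NINT r. h r*(NINT t. h t*F(r + t)))"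
  unfolding h_def by(simp add: nn_integral_half_measure)
 also have "... = (NINT r. (NINT t. h r*(h t*F(r + t))))"
  by(intro nn_integral_cong nn_integral_cmult[symmetric]) measurable
 also have "... = (NINT r. (NINT q. h r*(h(q - r)*F q)))"
 proof(rule nn_integral_cong)
  fix r :: real
  have "(%q. h r*(h(q - r)*F q)) : borel_measurable borel" by measurable
  from nn_integral_lborel_affine[OF this, of 1 r]
  show "(NINT t. h r*(h t*F(r + t))) = (NINT q. h r*(h(q - r)*F q))" by simp
 qed
 also have "... = (NINT q. (NINT r. h r*(h(q - r)*F q)))"
  by(rule lborel_pair.Fubini') measurable
 also have "... = (NINT q. (NINT r. h r*h(q - r))*F q)"
  unfolding mult.assoc[symmetric] by(intro nn_integral_cong nn_integral_multc) measurable
 also have "... = (NINT q. indicator {0<..} q*F q)"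
 proof(intro nn_integral_cong)
  fix q :: real
  show "(NINT r. h r*h(q - r))*F q = indicator {0<..} q*F q"
  proof(cases "0 < q")
   case True
   thus ?thesis using nn_integral_beta_half[OF True] by(simp add: h_def)
  next
   case False
   hence "h r*h(q - r) = 0" for r by(auto simp: h_def indicator_def)
   hence "(NINT r. h r*h(q - r)) = 0" by(simp only: nn_integral_0_iff_AE nn_integral_const) simp
   thus ?thesis using False by simp
  qed
 qed
 finally show ?thesis .
qed

lemma nn_integral_half_measure_powr:
 assumes a: "0 < a"
 shows "(\<integral>\<^sup>+r. ennreal(1/sqrt(r + a)^3) \<partial>half_measure) = ennreal(2/(sqrt pi*a))"
proof -
 define f where "f r = 1/(sqrt(pi*r) * sqrt(r + a)^3)" for r
 define F where "F r = 2/(sqrt pi*a) * sqrt(r/(r + a))" for r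
 have "(\<integral>\<^sup>+r. ennreal(1/sqrt(r + a)^3) \<partial>half_measure) = (NINT r. ennreal(f r)*indicator {0<..} r)"
  by(subst nn_integral_half_measure)
   (auto simp: f_def indicator_def a intro!: nn_integral_cong simp flip: ennreal_mult')
 also have "... = ennreal(2/(sqrt pi*a) - 0)"
 proof(rule nn_integral_FTC_Ioi)
  fix r :: real assume r: "0 < r"
  define x y where "x = sqrt r" and "y = sqrt(r + a)"
  have xy: "0 < x" "0 < y" "x^2 = r" "y^2 = r + a" using r a by(auto simp: x_def y_def)
  have q: "((%r. r/(r + a)) has_real_derivative a/(r + a)^2) (at r)"
   using r a by(auto intro!: derivative_eq_intros simp: power2_eq_square)
  have "((%r. sqrt(r/(r + a))) has_real_derivative inverse (sqrt(r/(r + a)))/2*(a/(r + a)^2)) (at r)"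
   by(rule DERIV_chain2[OF DERIV_real_sqrt q]) (use r a in simp)
  from DERIV_cmult[OF this, of "2/(sqrt pi*a)"]
  have "(F has_real_derivative 2/(sqrt pi*a)*(inverse(sqrt(r/(r + a)))/2*(a/(r + a)^2))) (at r)"
   unfolding F_def .
  moreover have "2/(sqrt pi*a)*(inverse(sqrt(r/(r + a)))/2*(a/(r + a)^2)) = f r"
  proof -
   have 1: "sqrt(r/(r + a)) = x/y" by(simp add: x_def y_def real_sqrt_divide)
   have 2: "f r = 1/(sqrt pi*x*y^3)" by(simp add: f_def x_def y_def real_sqrt_mult)
   show ?thesis unfolding 1 2 unfolding xy(4)[symmetric] using xy(1,2) a
    by(simp add: divide_simps) (simp add: eval_nat_numeral)
  qed
  ultimately show "(F has_real_derivative f r) (at r)" by simp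
  show "isCont f r" unfolding f_def using r a by(intro continuous_intros) auto
  show "0 <= f r" unfolding f_def using r a by simp
 next
  have "isCont F 0" unfolding F_def using a by(intro continuous_intros) auto
  hence "(F \<longlongrightarrow> F 0) (at_right 0)" by(simp add: isCont_def filterlim_at_split)
  thus "(F \<longlongrightarrow> 0) (at_right 0)" by(simp add: F_def)
  have "((%r. r/(r + a)) \<longlongrightarrow> 1) at_top" using a by real_asymp
  from tendsto_mult[OF tendsto_const tendsto_real_sqrt[OF this], of "2/(sqrt pi*a)"]
  show "(F \<longlongrightarrow> 2/(sqrt pi*a)) at_top" unfolding F_def by simp
 qed
 finally show ?thesis by simp
qed

text \<open>The kernel of the inverse half Laplacian in dimension three, a Riesz kernel. Its
  constant \<open>1/(2 * pi^2)\<close> and the factor 2 of the equation make the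
  \<open>1/pi^2\<close> of all later potentials.\<close>

lemma nn_integral_half_measure_heat:
 assumes z: "z ~= 0"
 shows "(\<integral>\<^sup>+r. ennreal(heat r z) \<partial>half_measure) = ennreal(1/(2*pi^2*norm z^2))"
proof -
 define q where "q = norm z^2"
 have q: "0 < q" unfolding q_def using z by simp
 define f where "f r = exp(- (q/(4*r)))/(8*pi^2*r^2)" for r
 define F where "F r = exp(- (q/(4*r)))/(2*pi^2*q)" for r
 have "(\<integral>\<^sup>+r. ennreal(heat r z) \<partial>half_measure) = (NINT r. ennreal(indicator {0<..} r/sqrt(pi*r))*ennreal(heat r z))"
  by(rule nn_integral_half_measure) measurable
 also have "... = (NINT r. ennreal(f r)*indicator {0<..} r)"
 proof(intro nn_integral_cong)
  fix r :: real
  show "ennreal(indicator {0<..} r/sqrt(pi*r))*ennreal(heat r z) = ennreal(f r)*indicator {0<..} r"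
  proof(cases "0 < r")
   case True
   define x where "x = sqrt(pi*r)"
   have x: "0 < x" "x^2 = pi*r" using True by(auto simp: x_def)
   have "sqrt(4*pi*r) = 2*x" by(simp add: x_def real_sqrt_mult)
   hence "1/x*heat r z = exp(- (q/(4*r)))/(8*(x^2)^2)"
    using x(1) unfolding heat_def q_def by(simp add: power_mult_distrib eval_nat_numeral)
   also have "... = f r" unfolding x f_def by(simp add: power_mult_distrib)
   finally show ?thesis using True heat_nonneg[OF True, of z] unfolding x_def by(simp flip: ennreal_mult)
  qed simp
 qed
 also have "... = ennreal(1/(2*pi^2*q) - 0)"
 proof(rule nn_integral_FTC_Ioi)
  fix r :: real assume r: "0 < r"
  have 1: "((%r. - (q/(4*r))) has_real_derivative q/(4*r^2)) (at r)"
   using r by(auto intro!: derivative_eq_intros simp: power2_eq_square)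
  have "(F has_real_derivative exp (- (q/(4*r)))*(q/(4*r^2))/(2*pi^2*q)) (at r)"
   unfolding F_def by(rule DERIV_cdivide[OF DERIV_fun_exp[OF 1]])
  thus "(F has_real_derivative f r) (at r)" unfolding f_def using q r by(simp add: mult_ac)
  show "isCont f r" unfolding f_def using r by(intro continuous_intros) auto
  show "0 <= f r" unfolding f_def by simp
 next
  have "((%r. exp(- (q/(4*r)))) \<longlongrightarrow> 0) (at_right 0)" using q by real_asymp
  from tendsto_divide[OF this tendsto_const, of "2*pi^2*q"] show "(F \<longlongrightarrow> 0) (at_right 0)"
   unfolding F_def using q by simp
  have "((%r. exp(- (q/(4*r)))) \<longlongrightarrow> 1) at_top" using q by real_asymp
  from tendsto_divide[OF this tendsto_const, of "2*pi^2*q"] show "(F \<longlongrightarrow> 1/(2*pi^2*q)) at_top"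
   unfolding F_def using q by simp
 qed
 finally show ?thesis unfolding q_def by simp
qed

lemma nn_integral_half_measure_exp:
 assumes q: "0 < q"
 shows "(\<integral>\<^sup>+t. ennreal(exp(- (t*q))) \<partial>half_measure) = ennreal(1/sqrt q)"
proof -
 have "(\<integral>\<^sup>+t. ennreal(exp(- (t*q))) \<partial>half_measure)
  = (NINT t. ennreal(1/sqrt pi)*(ennreal(t powr (1/2 - 1)*exp(- (t*q)))*indicator {0..} t))"
 proof(subst nn_integral_half_measure, measurable, intro nn_integral_cong_AE)
  have "AE t::real in lborel. t ~= 0" by(rule AE_lborel_singleton)
  thus "AE t in lborel. ennreal(indicator {0<..} t/sqrt(pi*t))*ennreal(exp(- (t*q)))
   = ennreal(1/sqrt pi)*(ennreal(t powr (1/2 - 1)*exp(- (t*q)))*indicator {0..} t)"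
  proof eventually_elim
   case (elim t)
   show ?case
   proof(cases "0 < t")
    case True
    have "t powr (1/2 - 1) = 1/sqrt t" using True powr_minus_divide[of t "1/2"] by(simp add: powr_half_sqrt)
    thus ?thesis using True by(simp add: real_sqrt_mult flip: ennreal_mult)
   qed(use elim in auto)
  qed
 qed
 also have "... = ennreal(1/sqrt pi)*ennreal(Gamma(1/2)/q powr (1/2))"
 proof(subst nn_integral_cmult)
  have "(NINT t. ennreal(t powr (1/2 - 1)*exp(- (t*q)))*indicator {0..} t) = ennreal(Gamma(1/2)/q powr (1/2))"
   by(rule nn_integral_powr_exp_Ioi[OF q]) simp
  thus "ennreal(1/sqrt pi)*(NINT t. ennreal(t powr (1/2 - 1)*exp(- (t*q)))*indicator {0..} t)
    = ennreal(1/sqrt pi)*ennreal(Gamma(1/2)/q powr (1/2))" by(rule arg_cong)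
 qed measurable
 also have "... = ennreal(1/sqrt q)"
  using q by(simp add: Gamma_one_half_real powr_half_sqrt flip: ennreal_mult)
 finally show ?thesis .
qed

lemma half_integrable_bounded:
 fixes f :: "real => 'b::{banach, second_countable_topology}"
 assumes [measurable]: "f : borel_measurable borel" and a: "0 < a"
  and bnd: "!!r. 0 < r ==> norm(f r) <= C/sqrt(r + a)^3"
 shows "integrable half_measure f"
proof(rule integrable_bound)
 show "integrable half_measure (%r. C*(1/sqrt(r + a)^3))"
 proof(intro integrable_mult_right)
  have "(\<integral>\<^sup>+r. ennreal(norm(1/sqrt(r + a)^3)) \<partial>half_measure) = (\<integral>\<^sup>+r. ennreal(1/sqrt(r + a)^3) \<partial>half_measure)"
   by(intro nn_integral_cong_AE eventually_mono[OF AE_half_measure_pos]) (use a in auto)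
  thus "integrable half_measure (%r. 1/sqrt(r + a)^3)"
   using nn_integral_half_measure_powr[OF a] by(simp add: integrable_iff_bounded)
 qed
 show "AE r in half_measure. norm(f r) <= norm(C*(1/sqrt(r + a)^3))"
 proof(rule eventually_mono[OF AE_half_measure_pos])
  fix r :: real assume "0 < r"
  from bnd[OF this] show "norm(f r) <= norm(C*(1/sqrt(r + a)^3))"
   using abs_ge_self[of "C/sqrt(r + a)^3"] by simp
 qed
qed simp

section \<open>The heat kernel as an approximate identity\<close>

text \<open>The function may grow, subject only to the integrability that \<open>L_half\<close>
  grants. Near \<open>x\<close> continuity is used; at distance \<open>d\<close> or more the kernel
  is at most a multiple of \<open>sqrt s/(1 + |y|^4)\<close>.\<close>

lemma heat_approximate_identity:
 fixes g :: "real^3 => 'b::{banach, second_countable_topology}"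
 assumes g[measurable]: "g : borel_measurable borel"
  and int: "L1 (%y. norm(g y)/(1 + norm y^4))"
  and cont: "isCont g x" and S: "!!n. 0 < S n" "S \<longlonglongrightarrow> 0"
 shows "!!n. L1 (%y. heat (S n) (x - y) *\<^sub>R g y)"
  and "(%n. (LINT y. heat (S n) (x - y) *\<^sub>R g y)) \<longlonglongrightarrow> g x"
proof -
 \<comment> \<open>Chosen such that \<open>1 + |y|^4 <= K d * |x - y|^4\<close> whenever
   \<open>|x - y| >= d\<close>. The 8 comes from
   \<open>(a + b)^4 <= 8 * (a^4 + b^4)\<close>.\<close>
 define K where "K d = 9 + (1 + 8*norm x^4)/d^4" for d :: real
 have K: "1 + norm y^4 <= K d*norm(x - y)^4" if d: "0 < d" "d <= norm(x - y)" for d y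
 proof -
  have "norm y <= norm x + norm(x - y)" using norm_triangle_ineq4[of x "x - y"] by simp
  hence "norm y^4 <= (norm x + norm(x - y))^4" by(intro power_mono) auto
  also have "... <= 8*norm x^4 + 8*norm(x - y)^4"
  proof -
   define a b where "a = norm x" and "b = norm(x - y)"
   have "(a + b)^2 <= 2*(a^2 + b^2)" using zero_le_power2[of "a - b"] by(simp add: power2_eq_square algebra_simps)
   hence "((a + b)^2)^2 <= (2*(a^2 + b^2))^2" by(intro power_mono) auto
   also have "... <= 8*((a^2)^2 + (b^2)^2)" using zero_le_power2[of "a^2 - b^2"] by(simp add: power2_eq_square algebra_simps)
   finally show ?thesis unfolding a_def b_def by(simp flip: power_mult)
  qed
  finally have "1 + norm y^4 <= (1 + 8*norm x^4)*1 + 8*norm(x - y)^4" by simp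
  also have "... <= (1 + 8*norm x^4)*(norm(x - y)^4/d^4) + 9*norm(x - y)^4"
  proof(intro add_mono mult_left_mono)
   have "d^4 <= norm(x - y)^4" using d by(intro power_mono) auto
   thus "1 <= norm(x - y)^4/d^4" using d by simp
  qed auto
  also have "... = K d*norm(x - y)^4" unfolding K_def by(simp add: algebra_simps add_divide_distrib)
  finally show ?thesis .
 qed
 have Kpos: "0 < K d" if "0 < d" for d unfolding K_def using that by(intro add_pos_nonneg) auto
 have tail: "heat s (x - y) <= 32*exp 1*K d * sqrt s/(1 + norm y^4)" if s: "0 < s" and d: "0 < d" "d <= norm(x - y)" for s d y
 proof -
  have n: "0 < norm(x - y)" using d by linarith
  have p: "0 < 1 + norm y^4" by(simp add: add_pos_nonneg)
  have "heat s (x - y)*(1 + norm y^4) <= heat s (x - y)*(K d*norm(x - y)^4)"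
   using K[OF d] heat_nonneg[OF s] by(intro mult_left_mono) auto
  also have "... = K d*(heat s (x - y)*norm(x - y)^4)" by simp
  also have "... <= K d*(32*exp 1 * sqrt s)"
   using heat_le_fourth[OF s, of "x - y"] Kpos[OF d(1)] by(intro mult_left_mono) auto
  finally show ?thesis using p by(simp add: pos_le_divide_eq mult_ac)
 qed
 \<comment> \<open>A majorant of \<open>|g y - g x|/(1 + |y|^4)\<close> that is independent of
   \<open>s\<close>; the second summand pays for the constant \<open>g x\<close>.\<close>
 define G where "G y = norm(g y)/(1 + norm y^4) + norm(g x)*(9/(1 + norm y^2)^2)" for y
 have G: "L1 G"
 proof -
  have "L1 (%y::real^3. norm(g x)*(9/(1 + norm y^2)^2))"
   using integrable_mult_right[OF integrable_inverse_fourth, of "norm(g x)*9"] by simp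
  with int show ?thesis unfolding G_def by(rule integrable_add)
 qed
 have G0: "0 <= G y" for y unfolding G_def by(intro add_nonneg_nonneg) auto
 have diffG: "norm(g y - g x)/(1 + norm y^4) <= G y" for y
 proof -
  have "(1 + norm y^2)^2 <= 9*(1 + norm y^4)"
  proof -
   define q where "q = norm y^2"
   have "(1 + q)^2 <= 2*(1 + q^2)" using zero_le_power2[of "q - 1"] by(simp add: power2_eq_square algebra_simps)
   also have "... <= 9*(1 + q^2)" by(intro mult_right_mono) (auto simp: add_nonneg_nonneg)
   also have "q^2 = norm y^4" unfolding q_def by(simp flip: power_mult)
   finally show ?thesis unfolding q_def .
  qed
  moreover have "0 < (1 + norm y^2)^2" "0 < 1 + norm y^4"
   by(intro zero_less_power add_pos_nonneg, auto)+
  ultimately have "1/(1 + norm y^4) <= 9/(1 + norm y^2)^2"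
   by(simp add: pos_divide_le_eq pos_le_divide_eq)
  hence "norm(g x)*(1/(1 + norm y^4)) <= norm(g x)*(9/(1 + norm y^2)^2)" by(intro mult_left_mono) auto
  moreover have "norm(g y - g x)/(1 + norm y^4) <= (norm(g y) + norm(g x))/(1 + norm y^4)"
   by(intro divide_right_mono norm_triangle_ineq4) auto
  ultimately show ?thesis unfolding G_def by(simp add: add_divide_distrib)
 qed
 have ub: "norm(heat s (x - y) *\<^sub>R (g y - g x)) <= e*heat s (x - y) + 32*exp 1*K d * sqrt s*G y"
  if s: "0 < s" and d: "0 < d" and e: "0 <= e" "!!y. norm(x - y) < d ==> norm(g y - g x) <= e" for s d e y
 proof(cases "norm(x - y) < d")
  case True
  have "norm(heat s (x - y) *\<^sub>R (g y - g x)) = heat s (x - y)*norm(g y - g x)" using heat_nonneg[OF s] by simp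
  also have "... <= heat s (x - y)*e" using e(2)[OF True] heat_nonneg[OF s] by(intro mult_left_mono) auto
  finally show ?thesis using G0[of y] Kpos[OF d] s by(simp add: mult.commute add_increasing2)
 next
  case False
  hence dl: "d <= norm(x - y)" by simp
  have "norm(heat s (x - y) *\<^sub>R (g y - g x)) = heat s (x - y)*norm(g y - g x)" using heat_nonneg[OF s] by simp
  also have "... <= 32*exp 1*K d * sqrt s/(1 + norm y^4)*norm(g y - g x)"
   by(intro mult_right_mono tail[OF s d dl]) auto
  also have "... = 32*exp 1*K d * sqrt s*(norm(g y - g x)/(1 + norm y^4))" by simp
  also have "... <= 32*exp 1*K d * sqrt s*G y" using diffG[of y] Kpos[OF d] s by(intro mult_left_mono) auto
  finally show ?thesis using e heat_nonneg[OF s, of "x - y"] by(simp add: add_increasing)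
 qed
 have hx: "(%y. heat s (x - y) *\<^sub>R (g y - g x)) : borel_measurable lborel" for s by measurable
 have i0: "L1 (%y. heat s (x - y) *\<^sub>R (g y - g x))"
  and b0: "norm(LINT y. heat s (x - y) *\<^sub>R (g y - g x)) <= e + 32*exp 1*K d * sqrt s*LI G"
  if s: "0 < s" and d: "0 < d" and e: "0 <= e" "!!y. norm(x - y) < d ==> norm(g y - g x) <= e" for s d e
 proof -
  have iB: "L1 (%y. e*heat s (x - y) + 32*exp 1*K d * sqrt s*G y)"
   by(intro integrable_add integrable_mult_right heat_has_integral[OF s] G)
  show i: "L1 (%y. heat s (x - y) *\<^sub>R (g y - g x))"
   by(rule integrable_bound[OF iB hx])
    (intro AE_I2 order_trans[OF ub[OF s d e] abs_ge_self[THEN order_trans]], auto)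
  have "norm(LINT y. heat s (x - y) *\<^sub>R (g y - g x)) <= (LINT y. norm(heat s (x - y) *\<^sub>R (g y - g x)))"
   by(rule integral_norm_bound)
  also have "... <= (LINT y. e*heat s (x - y) + 32*exp 1*K d * sqrt s*G y)"
   by(rule integral_mono[OF integrable_norm[OF i] iB ub[OF s d e]])
  also have "... = e*(LINT y. heat s (x - y)) + 32*exp 1*K d * sqrt s*LI G"
   by(subst integral_add) (auto intro: G heat_has_integral(1)[OF s])
  finally show "norm(LINT y. heat s (x - y) *\<^sub>R (g y - g x)) <= e + 32*exp 1*K d * sqrt s*LI G"
   by(simp add: heat_has_integral(2)[OF s])
 qed
 have ex: "EX d>0. ALL y. norm(x - y) < d --> norm(g y - g x) <= e" if "0 < e" for e
  using cont that unfolding continuous_at_eps_delta by(metis dist_norm norm_minus_commute less_imp_le)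
 have i1: "L1 (%y. heat (S n) (x - y) *\<^sub>R (g y - g x))" for n
 proof -
  obtain d where d: "0 < d" "!!y. norm(x - y) < d ==> norm(g y - g x) <= 1" using ex[OF zero_less_one] by blast
  show ?thesis by(rule i0[OF S(1) d(1) zero_le_one d(2)])
 qed
 have ic: "L1 (%y. heat (S n) (x - y) *\<^sub>R g x)" for n
  by(intro integrable_scaleR_left heat_has_integral(1)[OF S(1)])
 have e: "heat (S n) (x - y) *\<^sub>R (g y - g x) + heat (S n) (x - y) *\<^sub>R g x = heat (S n) (x - y) *\<^sub>R g y" for n y
  by(simp add: algebra_simps)
 show ig: "L1 (%y. heat (S n) (x - y) *\<^sub>R g y)" for n
  using integrable_add[OF i1 ic, of n n] unfolding e .
 have "(LINT y. heat (S n) (x - y) *\<^sub>R g y) - g x = (LINT y. heat (S n) (x - y) *\<^sub>R (g y - g x))" for n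
  using integral_add[OF i1 ic, of n n] unfolding e by(simp add: heat_has_integral[OF S(1)])
 moreover have "(%n. (LINT y. heat (S n) (x - y) *\<^sub>R (g y - g x))) \<longlonglongrightarrow> 0"
 proof(rule LIMSEQ_I)
  fix e :: real assume "0 < e"
  hence e2: "0 < e/2" by simp
  obtain d where d: "0 < d" "!!y. norm(x - y) < d ==> norm(g y - g x) <= e/2" using ex[OF e2] by blast
  have "(%n. 32*exp 1*K d * sqrt(S n)*LI G) \<longlonglongrightarrow> 32*exp 1*K d * sqrt 0*LI G"
   by(intro tendsto_intros S)
  hence "\<forall>\<^sub>F n in sequentially. 32*exp 1*K d * sqrt(S n)*LI G < e/2"
   by(rule order_tendstoD(2)) (use e2 in simp)
  then obtain N where N: "!!n. n >= N ==> 32*exp 1*K d * sqrt(S n)*LI G < e/2"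
   unfolding eventually_sequentially by blast
  show "EX no. ALL n>=no. norm((LINT y. heat (S n) (x - y) *\<^sub>R (g y - g x)) - 0) < e"
  proof(intro exI allI impI)
   fix n assume n: "N <= n"
   show "norm((LINT y. heat (S n) (x - y) *\<^sub>R (g y - g x)) - 0) < e"
    using b0[OF S(1)[of n] d(1) less_imp_le[OF e2] d(2)] N[OF n] by simp
  qed
 qed
 ultimately have "(%n. (LINT y. heat (S n) (x - y) *\<^sub>R g y) - g x) \<longlonglongrightarrow> 0" by simp
 thus "(%n. (LINT y. heat (S n) (x - y) *\<^sub>R g y)) \<longlonglongrightarrow> g x" using Lim_null by blast
qed

section \<open>Injectivity of the Fourier transform on continuous integrable functions\<close>

lemma cis_measurable [measurable]:
 assumes "f : borel_measurable M"
 shows "(%x. cis(f x)) : borel_measurable M"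
 by(rule borel_measurable_continuous_on[OF _ assms]) (auto simp: cis_conv_exp intro!: continuous_intros)

text \<open>Gaussian summation: the vanishing transform is integrated against a Gaussian in
  \<open>xi\<close>, Fubini turns this into a heat average of \<open>psi\<close>, and
  \<open>s -> 0\<close> recovers the value at the point.\<close>

lemma continuous_fourier_eq_0:
 fixes psi :: "real^3 => complex"
 assumes c: "continuous_on UNIV psi" and i: "L1 psi"
  and z: "!!xi. (LINT x. cis(- (x \<bullet> xi))*psi x) = 0"
 shows "psi x0 = 0"
proof -
 have [measurable]: "psi : borel_measurable borel" using c by(rule borel_measurable_continuous_onI)
 define S where "S n = 1/real(Suc n)" for n
 have S: "0 < S n" "S \<longlonglongrightarrow> 0" for n
  unfolding S_def using LIMSEQ_inverse_real_of_nat by(auto simp: inverse_eq_divide)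
 have int: "L1 (%y. norm(psi y)/(1 + norm y^4))"
 proof(rule integrable_bound[OF i])
  show "AE x in lborel. norm(norm(psi x)/(1 + norm x^4)) <= norm(psi x)"
   by(intro AE_I2) (simp add: divide_le_eq mult_left_le_one_le add_pos_nonneg algebra_simps)
 qed measurable
 have zero: "(LINT y. heat s (x0 - y) *\<^sub>R psi y) = 0" if s: "0 < s" for s
 proof -
  define w where "w xi = complex_of_real(exp(- (norm xi)\<^sup>2/(4*(1/(4 * s)))))" for xi :: "real^3"
  have w: "w xi = complex_of_real(exp(- (s*(norm xi)^2)))" for xi unfolding w_def using s by(simp add: mult.commute)
  have p: "0 < 1/(4 * s)" using s by simp
  have [measurable]: "w : borel_measurable borel" unfolding w_def by measurable
  have iw: "L1 w" using fourier_gaussian(1)[OF p, of "0::real^3"] unfolding w_def by simp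
  have ip: "integrable lborel2 (%(xi, y). w xi*psi y)"
  proof(rule lborel_pair.Fubini_integrable)
   show "L1 (%xi. (LINT y. norm(case (xi, y) of (xi, y) => w xi*psi y)))"
    using iw by(simp add: norm_mult)
   show "AE xi in lborel. L1 (%y. case (xi, y) of (xi, y) => w xi*psi y)"
    using i by simp
  qed measurable
  have int2: "integrable lborel2 (%(xi, y). w xi * cis((x0 - y) \<bullet> xi)*psi y)"
   by(rule integrable_bound[OF ip]) (auto simp: norm_mult split_beta')
  have "(LINT xi. (LINT y. w xi * cis((x0 - y) \<bullet> xi)*psi y)) = 0"
  proof -
   have "(LINT y. w xi * cis((x0 - y) \<bullet> xi)*psi y) = 0" for xi
   proof -
    have "w xi * cis((x0 - y) \<bullet> xi)*psi y = (w xi * cis(x0 \<bullet> xi))*(cis(- (y \<bullet> xi))*psi y)" for y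
    proof -
     have "cis((x0 - y) \<bullet> xi) = cis(x0 \<bullet> xi) * cis(- (y \<bullet> xi))"
      by(simp add: inner_diff_left cis_mult)
     thus ?thesis by(simp only: ac_simps)
    qed
    thus ?thesis by(simp only: integral_mult_right_zero z mult_zero_right)
   qed
   thus ?thesis by simp
  qed
  moreover have "(LINT xi. (LINT y. w xi * cis((x0 - y) \<bullet> xi)*psi y))
    = (LINT y. (LINT xi. w xi * cis((x0 - y) \<bullet> xi)*psi y))"
   by(rule lborel_pair.Fubini_integral[OF int2, symmetric])
  moreover have "(LINT xi. w xi * cis((x0 - y) \<bullet> xi)*psi y) = complex_of_real(sqrt(pi/s)^3 * sqrt(4*pi * s)^3)*(heat s (x0 - y) *\<^sub>R psi y)" for y
  proof -
   have "(LINT xi. w xi * cis((x0 - y) \<bullet> xi)*psi y) = (LINT xi. cis(- (xi \<bullet> (y - x0)))*w xi)*psi y"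
    by(subst integral_mult_left_zero[symmetric]) (auto simp: inner_diff inner_commute mult.commute intro!: Bochner_Integration.integral_cong)
   also have "(LINT xi. cis(- (xi \<bullet> (y - x0)))*w xi) = complex_of_real(sqrt(4*pi*(1/(4 * s)))^3*exp(- (1/(4 * s))*norm(y - x0)^2))"
    using fourier_gaussian(2)[OF p, of "y - x0"] unfolding w_def by simp
   also have "sqrt(4*pi*(1/(4 * s)))^3*exp(- (1/(4 * s))*norm(y - x0)^2)
     = sqrt(pi/s)^3 * sqrt(4*pi * s)^3*heat s (x0 - y)"
    unfolding heat_def using s by(simp add: norm_minus_commute)
   finally show ?thesis by(simp add: scaleR_conv_of_real mult.assoc)
  qed
  ultimately have "complex_of_real(sqrt(pi/s)^3 * sqrt(4*pi * s)^3)*(LINT y. heat s (x0 - y) *\<^sub>R psi y) = 0"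
   by(simp only: integral_mult_right_zero)
  thus ?thesis using s by simp
 qed
 have "isCont psi x0" using c by(simp add: continuous_on_eq_continuous_at)
 from heat_approximate_identity(2)[OF _ int this S]
 have "(%n. (LINT y. heat (S n) (x0 - y) *\<^sub>R psi y)) \<longlonglongrightarrow> psi x0" by simp
 hence "(%n. 0 :: complex) \<longlonglongrightarrow> psi x0" unfolding zero[OF S(1)] .
 thus ?thesis using LIMSEQ_unique tendsto_const by blast
qed

section \<open>The half Laplacian of differences of heat kernels\<close>

text \<open>Polynomials times translates of the Gaussian of parameter \<open>s\<close>. The class is
  stable under derivatives and decays rapidly, which together make its members Schwartz
  functions.\<close>

inductive_set heat_span :: "real => (real^3 => real) set" for s where
 base: "(%x. heat s (a - x)) : heat_span s"
| coord: "f : heat_span s ==> (%x. (x \<bullet> b)*f x) : heat_span s"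
| scale: "f : heat_span s ==> (%x. c*f x) : heat_span s"
| add: "f : heat_span s ==> g : heat_span s ==> (%x. f x + g x) : heat_span s"

lemma heat_space_derivative:
 assumes s: "0 < s"
 shows "((%x. heat s (a - x)) has_derivative (%e. ((a - x) \<bullet> e)/(2 * s)*heat s (a - x))) (at x)"
proof -
 have 1: "((%x. (norm(a - x))^2) has_derivative (%e. - 2*((a - x) \<bullet> e))) (at x)"
  unfolding power2_norm_eq_inner by(auto intro!: derivative_eq_intros simp: inner_commute)
 have 2: "((%q. exp(- (q/(4 * s)))/sqrt(4*pi * s)^3) has_derivative
   (*) (- (1/(4 * s))*(exp(- (q/(4 * s)))/sqrt(4*pi * s)^3))) (at q)" for q
 proof -
  have "((%q. - (q/(4 * s))) has_real_derivative - (1/(4 * s))) (at q)"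
   using s by(auto intro!: derivative_eq_intros)
  from DERIV_cdivide[OF DERIV_fun_exp[OF this], of "sqrt(4*pi * s)^3"]
  show ?thesis unfolding has_field_derivative_def by(rule has_derivative_eq_rhs) (simp add: fun_eq_iff)
 qed
 show ?thesis unfolding heat_def
  by(rule has_derivative_eq_rhs[OF has_derivative_compose[OF 1 2]]) (simp add: fun_eq_iff)
qed

lemma heat_span_smooth:
 assumes s: "0 < s" and f: "f : heat_span s"
 shows "!!x. f differentiable (at x)" "!!b. EX g:heat_span s. ALL x. dir_deriv b f x = g x"
proof -
 have *: "(ALL x. f differentiable (at x)) & (ALL b. (%x. dir_deriv b f x) : heat_span s)"
  using f
 proof induction
  case (base a)
  have "dir_deriv e (%x. heat s (a - x)) x = ((a \<bullet> e)/(2 * s))*heat s (a - x) + (- 1/(2 * s))*((x \<bullet> e)*heat s (a - x))" for x e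
   unfolding dir_deriv_eqI[OF heat_space_derivative[OF s]] inner_diff_left diff_divide_distrib left_diff_distrib by simp
  moreover have "(%x. ((a \<bullet> e)/(2 * s))*heat s (a - x) + (- 1/(2 * s))*((x \<bullet> e)*heat s (a - x))) : heat_span s" for e
   by(intro heat_span.intros)
  ultimately show ?case using differentiableI[OF heat_space_derivative[OF s]] by simp
 next
  case (coord f b)
  have d: "((%x. (x \<bullet> b)*f x) has_derivative (%e. (x \<bullet> b)*frechet_derivative f (at x) e + (e \<bullet> b)*f x)) (at x)" for x
   using coord by(intro has_derivative_mult) (auto simp: frechet_derivative_works intro!: derivative_eq_intros)
  have "(%x. (x \<bullet> b)*dir_deriv e f x + (e \<bullet> b)*f x) : heat_span s" for e
   using coord by(intro heat_span.intros) auto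
  thus ?case using d dir_deriv_eqI[OF d] by(auto simp: differentiable_def dir_deriv_def)
 next
  case (scale f c)
  have d: "((%x. c*f x) has_derivative (%e. c*frechet_derivative f (at x) e)) (at x)" for x
   using scale by(intro has_derivative_mult_right) (auto simp: frechet_derivative_works)
  have "(%x. c*dir_deriv e f x) : heat_span s" for e
   using scale by(intro heat_span.intros) auto
  thus ?case using d dir_deriv_eqI[OF d] by(auto simp: differentiable_def dir_deriv_def)
 next
  case (add f g)
  have d: "((%x. f x + g x) has_derivative (%e. frechet_derivative f (at x) e + frechet_derivative g (at x) e)) (at x)" for x
   using add by(intro has_derivative_add) (auto simp: frechet_derivative_works)
  have "(%x. dir_deriv e f x + dir_deriv e g x) : heat_span s" for e
   using add by(intro heat_span.intros) auto
  thus ?case using d dir_deriv_eqI[OF d] by(auto simp: differentiable_def dir_deriv_def)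
 qed
 show "!!x. f differentiable (at x)" using * by blast
 show "!!b. EX g:heat_span s. ALL x. dir_deriv b f x = g x" using * by blast
qed

lemma heat_span_rapid:
 assumes s: "0 < s" and f: "f : heat_span s"
 shows "EX C. ALL x. (1 + norm x)^k*\<bar>f x\<bar> <= C" using f
proof(induction arbitrary: k)
 case (base a)
 define M where "M = 1 + norm a"
 have M: "1 <= M" unfolding M_def by simp
 have "(1 + norm x)^k*\<bar>heat s (a - x)\<bar> <= (M*(1 + 4 * s))^k*(fact k*exp 1)/sqrt s^3" for x
 proof -
  define t where "t = norm(a - x)^2/(4 * s)"
  have t: "0 <= t" unfolding t_def using s by simp
  have "norm x <= norm a + norm(a - x)" using norm_triangle_ineq4[of a "a - x"] by simp
  moreover have "0 <= norm a*norm(a - x)" by simp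
  moreover have "M*(1 + norm(a - x)) = 1 + norm(a - x) + norm a + norm a*norm(a - x)"
   unfolding M_def by(simp add: algebra_simps)
  ultimately have "1 + norm x <= M*(1 + norm(a - x))" by linarith
  note this
  also have "M*(1 + norm(a - x)) <= M*((1 + 4 * s)*(1 + t))"
  proof(rule mult_left_mono)
   have "(norm(a - x))^2 = 4 * s*t" unfolding t_def using s by simp
   moreover have "0 <= 1 + 4 * s + t" using s t by simp
   moreover have "norm(a - x) <= 4 * s + t + 4 * s*t"
   proof(cases "norm(a - x) <= 4 * s")
    case False
    have "norm(a - x)*(4 * s) <= norm(a - x)*norm(a - x)" using False by(intro mult_left_mono) auto
    hence "norm(a - x) <= norm(a - x)^2/(4 * s)" using s by(simp add: power2_eq_square pos_le_divide_eq)
    hence "norm(a - x) <= t" unfolding t_def .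
    moreover have "0 <= 4 * s*t" using s t by simp
    ultimately show ?thesis using s by linarith
   qed(use s t in \<open>auto intro: add_increasing2\<close>)
   ultimately show "1 + norm(a - x) <= (1 + 4 * s)*(1 + t)" by(simp add: algebra_simps)
  qed(use M in auto)
  finally have "(1 + norm x)^k <= (M*(1 + 4 * s)*(1 + t))^k" by(intro power_mono) (auto simp: mult.assoc)
  hence "(1 + norm x)^k*\<bar>heat s (a - x)\<bar> <= (M*(1 + 4 * s)*(1 + t))^k*(exp(- t)/sqrt s^3)"
   using heat_le_exp[OF s, of "a - x"] heat_nonneg[OF s, of "a - x"] M s t unfolding t_def[symmetric]
   by(intro mult_mono) auto
  also have "... = (M*(1 + 4 * s))^k*(exp(- t)*(1 + t)^k)/sqrt s^3"
   by(simp add: power_mult_distrib)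
  also have "... <= (M*(1 + 4 * s))^k*(fact k*exp 1)/sqrt s^3"
   using exp_neg_mult_power_le[OF t, of k] M s by(intro divide_right_mono mult_left_mono) auto
  finally show ?thesis .
 qed
 thus ?case by blast
next
 case (coord f b)
 from coord.IH[of "Suc k"] obtain C where C: "!!x. (1 + norm x)^Suc k*\<bar>f x\<bar> <= C" by blast
 have "(1 + norm x)^k*\<bar>(x \<bullet> b)*f x\<bar> <= norm b*C" for x
 proof -
  have "\<bar>x \<bullet> b\<bar> <= norm x*norm b" by(rule Cauchy_Schwarz_ineq2)
  also have "... <= norm b*(1 + norm x)" by(simp add: algebra_simps)
  finally have "(1 + norm x)^k*(\<bar>x \<bullet> b\<bar>*\<bar>f x\<bar>) <= (1 + norm x)^k*(norm b*(1 + norm x)*\<bar>f x\<bar>)"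
   by(intro mult_left_mono mult_right_mono) auto
  also have "... = norm b*((1 + norm x)^Suc k*\<bar>f x\<bar>)" by simp
  also have "... <= norm b*C" using C by(intro mult_left_mono) auto
  finally show ?thesis by(simp add: abs_mult)
 qed
 thus ?case by blast
next
 case (scale f c)
 from scale.IH[of k] obtain C where C: "!!x. (1 + norm x)^k*\<bar>f x\<bar> <= C" by blast
 have "(1 + norm x)^k*\<bar>c*f x\<bar> <= \<bar>c\<bar>*C" for x
  using mult_left_mono[OF C, of "\<bar>c\<bar>"] by(simp add: abs_mult mult.left_commute)
 thus ?case by blast
next
 case (add f g)
 from add.IH(1)[of k] add.IH(2)[of k] obtain C D where
  C: "!!x. (1 + norm x)^k*\<bar>f x\<bar> <= C" and D: "!!x. (1 + norm x)^k*\<bar>g x\<bar> <= D" by blast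
 have "(1 + norm x)^k*\<bar>f x + g x\<bar> <= C + D" for x
 proof -
  have "(1 + norm x)^k*\<bar>f x + g x\<bar> <= (1 + norm x)^k*(\<bar>f x\<bar> + \<bar>g x\<bar>)"
   by(intro mult_left_mono) auto
  thus ?thesis using C[of x] D[of x] by(simp add: distrib_left)
 qed
 thus ?case by blast
qed

lemma heat_span_schwartz:
 assumes s: "0 < s" and f: "f : heat_span s"
 shows "schwartz (%x. complex_of_real(f x))"
proof -
 have sm: "smooth_on UNIV f"
  by(rule smooth_on_coinduct[OF _ f]) (auto intro: heat_span_smooth[OF s])
 show ?thesis unfolding schwartz_def
 proof(intro conjI allI ballI)
  show "smooth_on UNIV (%x. complex_of_real(f x))"
   by(rule smooth_on_linear_compose(1)[OF sm bounded_linear_of_real])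
  fix k and bs :: "(real^3) list" assume bs: "bs : lists Basis"
  obtain g where g: "g : heat_span s" "!!x. iter_deriv bs f x = g x"
   using iter_deriv_closed[OF open_UNIV f _ bs] heat_span_smooth(2)[OF s] by blast
  obtain C where C: "!!x. (1 + norm x)^k*\<bar>g x\<bar> <= C" using heat_span_rapid[OF s g(1)] by blast
  show "bounded (range (%x. (1 + norm x)^k *\<^sub>R iter_deriv bs (%x. complex_of_real(f x)) x))"
   unfolding bounded_iff
  proof(intro exI ballI)
   fix y assume "y : range (%x. (1 + norm x)^k *\<^sub>R iter_deriv bs (%x. complex_of_real(f x)) x)"
   then obtain x where "y = (1 + norm x)^k *\<^sub>R iter_deriv bs (%x. complex_of_real(f x)) x" by blast
   hence "norm y = (1 + norm x)^k*\<bar>g x\<bar>"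
    using smooth_on_linear_compose(2)[OF sm bounded_linear_of_real[where 'a=complex] bs, of x] g(2)[of x] by simp
   thus "norm y <= C" using C by simp
  qed
 qed
qed

definition heat_diff :: "real^3 => real^3 => real => real^3 => real" where
 "heat_diff a b s y = heat s (a - y) - heat s (b - y)"

definition heat_diff_dt :: "real^3 => real^3 => real => real^3 => real" where
 "heat_diff_dt a b s y = heat_dt s (a - y) - heat_dt s (b - y)"

text \<open>The half Laplacian written as minus the Laplacian composed with the inverse half
  Laplacian: \<open>heat_diff_dt\<close> is the Laplacian, the average over
  \<open>half_measure\<close> is the inverse. Agreement with \<open>half_laplacian\<close> is proved
  on the Fourier side.\<close>

definition heat_diff_half :: "real^3 => real^3 => real => real^3 => real" where
 "heat_diff_half a b s y = - (LINT t|half_measure. heat_diff_dt a b (s + t) y)"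

lemma heat_diff_measurable [measurable]:
 assumes [measurable]: "f : borel_measurable M" "g : borel_measurable M"
 shows "(%x. heat_diff a b (f x) (g x)) : borel_measurable M"
  "(%x. heat_diff_dt a b (f x) (g x)) : borel_measurable M"
 unfolding heat_diff_def heat_diff_dt_def by measurable

lemma heat_diff_half_measurable [measurable]:
 assumes [measurable]: "f : borel_measurable M" "g : borel_measurable M"
 shows "(%x. heat_diff_half a b (f x) (g x)) : borel_measurable M"
proof -
 have "(%p. - (LINT t|half_measure. heat_diff_dt a b (fst p + t) (snd p))) : borel_measurable (borel \<Otimes>\<^sub>M borel)"
  by(intro borel_measurable_uminus half.borel_measurable_lebesgue_integral) measurable
 from measurable_compose[OF measurable_Pair[OF assms] this]
 show ?thesis unfolding heat_diff_half_def by simp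
qed

lemma heat_diff_schwartz: "0 < s ==> schwartz (%y. complex_of_real(heat_diff a b s y))"
proof -
 assume "0 < s"
 have "(%y. heat s (a - y) + (-1)*heat s (b - y)) : heat_span s" by(intro heat_span.intros)
 from heat_span_schwartz[OF \<open>0 < s\<close> this] show ?thesis by(simp add: heat_diff_def)
qed

lemma heat_diff_has_derivative:
 "0 < s ==> ((%s. heat_diff a b s y) has_real_derivative heat_diff_dt a b s y) (at s)"
 unfolding heat_diff_def heat_diff_dt_def by(intro DERIV_diff heat_has_derivative)

lemma heat_diff_dt_bound:
 assumes "0 < s0"
 obtains C where "0 <= C" "!!s y. s0 <= s ==> \<bar>heat_diff_dt a b s y\<bar> <= C/(s + norm y^2)^3"
 unfolding heat_diff_dt_def using heat_dt_diff_bound[OF assms] by metis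

lemma tendsto_heat_at_top: "((%s. heat s z) \<longlongrightarrow> 0) at_top"
proof(rule tendsto_sandwich[of "%_. 0"])
 show "\<forall>\<^sub>F s in at_top. 0 <= heat s z" using eventually_gt_at_top[of 0] by eventually_elim (rule heat_nonneg)
 show "\<forall>\<^sub>F s in at_top. heat s z <= 1/sqrt s^3"
  using eventually_gt_at_top[of 0]
 proof eventually_elim
  case (elim s)
  have "exp(- (norm z^2/(4 * s)))/sqrt s^3 <= 1/sqrt s^3"
   using elim by(intro divide_right_mono) auto
  thus ?case using heat_le_exp[OF elim, of z] by linarith
 qed
 show "((%s. 1/sqrt s^3) \<longlongrightarrow> 0) at_top" by real_asymp
qed auto

lemma nn_integral_cube_tail:
 assumes "0 < c"
 shows "(NINT r. ennreal(1/(r + c)^3)*indicator {0<..} r) = ennreal(1/(2 * c^2))"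
proof -
 have "(NINT r. ennreal(1/(r + c)^3)*indicator {0<..} r) = ennreal(0 - (- 1/(2 * c^2)))"
 proof(rule nn_integral_FTC_Ioi[where F="%r. - 1/(2*(r + c)^2)"])
  fix r :: real assume r: "0 < r"
  thus "((%r. - 1/(2*(r + c)^2)) has_real_derivative 1/(r + c)^3) (at r)"
   using assms by(auto intro!: derivative_eq_intros simp: divide_simps) (simp add: eval_nat_numeral algebra_simps)
  show "isCont (%r. 1/(r + c)^3) r" using r assms by(intro continuous_intros) auto
  show "0 <= 1/(r + c)^3" using r assms by simp
 next
  have "isCont (%r. - 1/(2*(r + c)^2)) 0" using assms by(intro continuous_intros) auto
  thus "((%r. - 1/(2*(r + c)^2)) \<longlongrightarrow> - 1/(2 * c^2)) (at_right 0)"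
   by(simp add: isCont_def filterlim_at_split)
  show "((%r. - 1/(2*(r + c)^2)) \<longlongrightarrow> 0) at_top" by real_asymp
 qed
 thus ?thesis by simp
qed

text \<open>Integrating the bound of order six once in time leaves order four, the weight of
  \<open>L_half\<close>. The fundamental theorem applies on the half line because the kernels vanish
  as time tends to infinity.\<close>

lemma heat_diff_dt_tail:
 assumes s: "0 < s" and C: "!!t y. s <= t ==> \<bar>heat_diff_dt a b t y\<bar> <= C/(t + norm y^2)^3" "0 <= C"
 shows "(NINT r. indicator {0<..} r*ennreal \<bar>heat_diff_dt a b (s + r) y\<bar>) <= ennreal(C/(2*(s + norm y^2)^2))"
  "L1 (%r. indicator {0<..} r*heat_diff_dt a b (s + r) y)"
  "(LINT r. indicator {0<..} r*heat_diff_dt a b (s + r) y) = - heat_diff a b s y"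
  "\<bar>heat_diff a b s y\<bar> <= C/(2*(s + norm y^2)^2)"
proof -
 define c where "c = s + norm y^2"
 have c: "0 < c" unfolding c_def using s by(simp add: add_pos_nonneg)
 have "(NINT r. indicator {0<..} r*ennreal \<bar>heat_diff_dt a b (s + r) y\<bar>)
   <= (NINT r. ennreal C*(ennreal(1/(r + c)^3)*indicator {0<..} r))"
 proof(rule nn_integral_mono)
  fix r :: real
  show "indicator {0<..} r*ennreal \<bar>heat_diff_dt a b (s + r) y\<bar> <= ennreal C*(ennreal(1/(r + c)^3)*indicator {0<..} r)"
  proof(cases "0 < r")
   case True
   hence "\<bar>heat_diff_dt a b (s + r) y\<bar> <= C*(1/(r + c)^3)"
    using C(1)[of "s + r" y] by(simp add: c_def ac_simps)
   thus ?thesis using True C(2) c by(simp flip: ennreal_mult)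
  qed simp
 qed
 also have "... = ennreal C*ennreal(1/(2 * c^2))"
  by(subst nn_integral_cmult) (auto simp: nn_integral_cube_tail[OF c])
 also have "... = ennreal(C/(2 * c^2))" using C(2) by(simp flip: ennreal_mult)
 finally show 1: "(NINT r. indicator {0<..} r*ennreal \<bar>heat_diff_dt a b (s + r) y\<bar>) <= ennreal(C/(2*(s + norm y^2)^2))"
  unfolding c_def .
 have e: "ennreal(norm(indicator {0<..} r*heat_diff_dt a b (s + r) y)) = indicator {0<..} r*ennreal \<bar>heat_diff_dt a b (s + r) y\<bar>" for r
  by(auto simp: indicator_def)
 show 2: "L1 (%r. indicator {0<..} r*heat_diff_dt a b (s + r) y)"
  unfolding integrable_iff_bounded e using 1 by(auto intro: le_less_trans)
 have ei: "einterval 0 \<infinity> = {0<..}" by(auto simp: einterval_def)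
 have dd: "((%r. heat_diff a b (s + r) y) has_real_derivative heat_diff_dt a b (s + r) y) (at r)" if "- s < r" for r
  using DERIV_shift[of "%s. heat_diff a b s y" "heat_diff_dt a b (s + r) y" r s] heat_diff_has_derivative[of "s + r"] that
  by(simp add: add.commute)
 have "(LBINT r=0..\<infinity>. heat_diff_dt a b (s + r) y) = 0 - heat_diff a b s y"
 proof(rule interval_integral_FTC_integrable[where F="%r. heat_diff a b (s + r) y"])
  show "((%r. heat_diff a b (s + r) y) has_vector_derivative heat_diff_dt a b (s + r) y) (at r)" if "0 < ereal r" "ereal r < \<infinity>" for r
   using dd[of r] that s by(simp add: has_real_derivative_iff_has_vector_derivative)
  show "isCont (%r. heat_diff_dt a b (s + r) y) r" if r: "0 < ereal r" "ereal r < \<infinity>" for r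
   unfolding heat_diff_dt_def heat_dt_def heat_def using r s by(intro continuous_intros) auto
  show "set_integrable lborel (einterval 0 \<infinity>) (%r. heat_diff_dt a b (s + r) y)"
   unfolding set_integrable_def ei using 2 by simp
  have "isCont (%r. heat_diff a b (s + r) y) 0" using DERIV_isCont[OF dd[of 0]] s by simp
  hence "((%r. heat_diff a b (s + r) y) \<longlongrightarrow> heat_diff a b s y) (at_right 0)"
   by(simp add: isCont_def filterlim_at_split)
  thus "(((%r. heat_diff a b (s + r) y) \<circ> real_of_ereal) \<longlongrightarrow> heat_diff a b s y) (at_right 0)"
   by(simp add: zero_ereal_def ereal_tendsto_simps)
  have "((%s. heat_diff a b s y) \<longlongrightarrow> 0 - 0) at_top"
   unfolding heat_diff_def by(intro tendsto_diff tendsto_heat_at_top)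
  hence "((%r. heat_diff a b (s + r) y) \<longlongrightarrow> 0) at_top"
   by(intro filterlim_compose[OF _ filterlim_tendsto_add_at_top[OF tendsto_const filterlim_ident]]) simp
  thus "(((%r. heat_diff a b (s + r) y) \<circ> real_of_ereal) \<longlongrightarrow> 0) (at_left \<infinity>)"
   by(simp add: ereal_tendsto_simps)
 qed simp
 thus 3: "(LINT r. indicator {0<..} r*heat_diff_dt a b (s + r) y) = - heat_diff a b s y"
  by(simp add: interval_lebesgue_integral_def set_lebesgue_integral_def ei)
 have "ennreal(norm(LINT r. indicator {0<..} r*heat_diff_dt a b (s + r) y))
   <= (NINT r. norm(indicator {0<..} r*heat_diff_dt a b (s + r) y))"
  by(rule integral_norm_bound_ennreal[OF 2])
 also have "... <= ennreal(C/(2*(s + norm y^2)^2))" unfolding e by(rule 1)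
 finally show "\<bar>heat_diff a b s y\<bar> <= C/(2*(s + norm y^2)^2)"
  unfolding 3 using C(2) by(simp add: ennreal_le_iff)
qed

lemma heat_diff_dt_half_bound:
 assumes s: "0 < s" and C: "!!t y. s <= t ==> \<bar>heat_diff_dt a b t y\<bar> <= C/(t + norm y^2)^3" "0 <= C"
 shows "(\<integral>\<^sup>+t. ennreal \<bar>heat_diff_dt a b (s + t) y\<bar> \<partial>half_measure) <= ennreal(2*C/(sqrt pi * sqrt s*(s + norm y^2)^2))"
  "integrable half_measure (%t. heat_diff_dt a b (s + t) y)"
  "\<bar>heat_diff_half a b s y\<bar> <= 2*C/(sqrt pi * sqrt s*(s + norm y^2)^2)"
proof -
 define c where "c = s + norm y^2"
 have c: "0 < c" "s <= c" unfolding c_def using s by(simp_all add: add_pos_nonneg)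
 have b: "\<bar>heat_diff_dt a b (s + t) y\<bar> <= C/(sqrt s * c)*(1/sqrt(t + c)^3)" if t: "0 < t" for t
 proof -
  \<comment> \<open>Of the six factors \<open>sqrt (t + c)\<close> three are kept for the integral
    over \<open>t\<close>; the others are bounded below by \<open>sqrt s * c\<close>. Together with
    the \<open>1/c\<close> from the integral this keeps the full decay of order four in
    \<open>y\<close>.\<close>
  have "(s + t + norm y^2)^3 = (sqrt(t + c) * sqrt(t + c))^3" using c t by(simp add: c_def ac_simps)
  also have "... = sqrt(t + c)*(t + c) * sqrt(t + c)^3"
   using c t by(simp add: power_mult_distrib power3_eq_cube)
  finally have e: "(s + t + norm y^2)^3 = sqrt(t + c)*(t + c) * sqrt(t + c)^3" .
  have "sqrt s * c * sqrt(t + c)^3 <= sqrt(t + c)*(t + c) * sqrt(t + c)^3"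
   using c t s by(intro mult_right_mono mult_mono) auto
  hence "C/(s + t + norm y^2)^3 <= C/(sqrt s * c * sqrt(t + c)^3)"
   unfolding e using c t s C(2) by(intro divide_left_mono mult_pos_pos) auto
  thus ?thesis using C(1)[of "s + t" y] t by simp
 qed
 have "(\<integral>\<^sup>+t. ennreal \<bar>heat_diff_dt a b (s + t) y\<bar> \<partial>half_measure)
   <= (\<integral>\<^sup>+t. ennreal(C/(sqrt s * c))*ennreal(1/sqrt(t + c)^3) \<partial>half_measure)"
 proof(rule nn_integral_mono_AE, rule eventually_mono[OF AE_half_measure_pos])
  fix t :: real assume "0 < t"
  thus "ennreal \<bar>heat_diff_dt a b (s + t) y\<bar> <= ennreal(C/(sqrt s * c))*ennreal(1/sqrt(t + c)^3)"
   using b[of t] c s C(2) by(subst ennreal_mult[symmetric]) auto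
 qed
 also have "... = ennreal(C/(sqrt s * c))*ennreal(2/(sqrt pi * c))"
  by(subst nn_integral_cmult) (auto simp: nn_integral_half_measure_powr[OF c(1)])
 also have "... = ennreal(2*C/(sqrt pi * sqrt s * c^2))"
  using c s C(2) by(subst ennreal_mult[symmetric]) (auto simp: power2_eq_square mult_ac)
 finally show 1: "(\<integral>\<^sup>+t. ennreal \<bar>heat_diff_dt a b (s + t) y\<bar> \<partial>half_measure) <= ennreal(2*C/(sqrt pi * sqrt s*(s + norm y^2)^2))"
  unfolding c_def .
 show 2: "integrable half_measure (%t. heat_diff_dt a b (s + t) y)"
 proof(rule integrableI_bounded)
  show "(%t. heat_diff_dt a b (s + t) y) : borel_measurable half_measure" by measurable
  have "(\<integral>\<^sup>+t. ennreal(norm(heat_diff_dt a b (s + t) y)) \<partial>half_measure) <= ennreal(2*C/(sqrt pi * sqrt s*(s + norm y^2)^2))"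
   using 1 by simp
  thus "(\<integral>\<^sup>+t. ennreal(norm(heat_diff_dt a b (s + t) y)) \<partial>half_measure) < \<infinity>"
   by(rule le_less_trans) simp
 qed
 have "ennreal(norm(LINT t|half_measure. heat_diff_dt a b (s + t) y)) <= (\<integral>\<^sup>+t. norm(heat_diff_dt a b (s + t) y) \<partial>half_measure)"
  by(rule integral_norm_bound_ennreal[OF 2])
 also have "... <= ennreal(2*C/(sqrt pi * sqrt s*(s + norm y^2)^2))" using 1 by simp
 finally show "\<bar>heat_diff_half a b s y\<bar> <= 2*C/(sqrt pi * sqrt s*(s + norm y^2)^2)"
  unfolding heat_diff_half_def using C(2) s by(subst (asm) ennreal_le_iff) auto
qed

lemma inverse_fourth_le:
 assumes s: "0 < s"
 obtains M where "0 < M" "!!y :: real^3. 1/(s + norm y^2)^2 <= M/(1 + norm y^2)^2"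
  "!!y :: real^3. 1/(s + norm y^2)^2 <= M/(1 + norm y^4)"
proof -
 define k where "k = 1 + 1/s"
 have k: "1 <= k" "1 <= k * s" unfolding k_def using s by(auto simp: field_simps)
 have q: "(1 + norm y^2)^2 <= k^2*(s + norm y^2)^2" for y :: "real^3"
 proof -
  have "1*norm y^2 <= k*norm y^2" using k by(intro mult_right_mono) auto
  hence "1 + norm y^2 <= k*(s + norm y^2)" using k by(simp add: distrib_left)
  hence "(1 + norm y^2)^2 <= (k*(s + norm y^2))^2" by(intro power_mono) auto
  thus ?thesis by(simp add: power_mult_distrib)
 qed
 have f: "1 + norm y^4 <= (1 + norm y^2)^2" for y :: "real^3"
 proof -
  have "norm y^4 = (norm y^2)^2" by(simp flip: power_mult)
  thus ?thesis by(simp add: power2_sum)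
 qed
 have p: "0 < (s + norm y^2)^2" "0 < (1 + norm y^2)^2" "0 < 1 + norm y^4" for y :: "real^3"
 proof -
  show "0 < (s + norm y^2)^2" using s by(intro zero_less_power add_pos_nonneg) simp_all
  show "0 < (1 + norm y^2)^2" by(intro zero_less_power add_pos_nonneg) simp_all
  show "0 < 1 + norm y^4" by(intro add_pos_nonneg) simp_all
 qed
 show thesis
 proof(rule that[of "k^2"])
  show "0 < k^2" using k by simp
  show "1/(s + norm y^2)^2 <= k^2/(1 + norm y^2)^2" for y :: "real^3"
   using q[of y] p[of y] by(simp add: pos_divide_le_eq pos_le_divide_eq)
  show "1/(s + norm y^2)^2 <= k^2/(1 + norm y^4)" for y :: "real^3"
   using order_trans[OF f[of y] q[of y]] p[of y] by(simp add: pos_divide_le_eq pos_le_divide_eq)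
 qed
qed

lemma integrable_inverse_fourth_shift:
 assumes "0 < s"
 shows "L1 (%y::real^3. 1/(s + norm y^2)^2)"
proof -
 obtain M where M: "0 < M" "!!y :: real^3. 1/(s + norm y^2)^2 <= M/(1 + norm y^2)^2"
  by(rule inverse_fourth_le[OF assms]) blast
 show ?thesis
 proof(rule integrable_bound[OF integrable_mult_right[OF integrable_inverse_fourth, of M]])
  show "AE y :: real^3 in lborel. norm(1/(s + norm y^2)^2) <= norm(M*(1/(1 + norm y^2)^2))"
   using M by(intro AE_I2) (simp add: abs_of_nonneg)
 qed simp
qed

text \<open>\<open>half_laplacian\<close> selects the continuous representative, so continuity is
  part of identifying it.\<close>

lemma continuous_on_heat_diff_half:
 assumes s: "0 < s"
 shows "continuous_on UNIV (heat_diff_half a b s)"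
proof -
 obtain C where C: "0 <= C" "!!t y. s <= t ==> \<bar>heat_diff_dt a b t y\<bar> <= C/(t + norm y^2)^3"
  by(rule heat_diff_dt_bound[OF s]) blast
 have "isCont (heat_diff_half a b s) y" for y unfolding continuous_at_sequentially
 proof(intro allI impI)
  fix X assume X: "X \<longlonglongrightarrow> y"
  have "(%n. (LINT t|half_measure. heat_diff_dt a b (s + t) (X n))) \<longlonglongrightarrow> (LINT t|half_measure. heat_diff_dt a b (s + t) y)"
  proof(rule integral_dominated_convergence[where w="%t. C/(sqrt s^3)*(1/sqrt(t + s)^3)"])
   show "integrable half_measure (%t. C/(sqrt s^3)*(1/sqrt(t + s)^3))"
    by(intro integrable_mult_right half_integrable_bounded[OF _ s, where C=1]) (use s in auto)
   show "AE t in half_measure. (%n. heat_diff_dt a b (s + t) (X n)) \<longlonglongrightarrow> heat_diff_dt a b (s + t) y"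
   proof(intro AE_I2)
    fix t
    have "continuous_on UNIV (heat_diff_dt a b (s + t))" unfolding heat_diff_dt_def
     by(intro continuous_on_diff continuous_on_compose2[OF continuous_on_heat(2)] continuous_intros) auto
    hence "isCont (heat_diff_dt a b (s + t)) y" by(simp add: continuous_on_eq_continuous_at)
    thus "(%n. heat_diff_dt a b (s + t) (X n)) \<longlonglongrightarrow> heat_diff_dt a b (s + t) y"
     by(rule isCont_tendsto_compose[OF _ X])
   qed
   show "AE t in half_measure. norm(heat_diff_dt a b (s + t) (X n)) <= C/(sqrt s^3)*(1/sqrt(t + s)^3)" for n
   proof(rule eventually_mono[OF AE_half_measure_pos])
    fix t :: real assume t: "0 < t"
    have "sqrt s^3 * sqrt(t + s)^3 <= sqrt(t + s)^3 * sqrt(t + s)^3"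
     using s t by(intro mult_right_mono power_mono) auto
    also have "... = (t + s)^3" using s t by(simp flip: power_mult_distrib)
    also have "... <= (s + t + norm(X n)^2)^3" using s t by(intro power_mono) auto
    finally have "C/(s + t + norm(X n)^2)^3 <= C/(sqrt s^3 * sqrt(t + s)^3)"
     using s t C(1) by(intro divide_left_mono mult_pos_pos zero_less_power) (auto intro: add_pos_nonneg)
    thus "norm(heat_diff_dt a b (s + t) (X n)) <= C/(sqrt s^3)*(1/sqrt(t + s)^3)"
     using C(2)[of "s + t" "X n"] t by simp
   qed
  qed measurable
  thus "(heat_diff_half a b s \<circ> X) \<longlonglongrightarrow> heat_diff_half a b s y"
   unfolding heat_diff_half_def o_def by(intro tendsto_minus)
 qed
 thus ?thesis by(simp add: continuous_on_eq_continuous_at)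
qed

lemma fourier_heat_dt:
 assumes s: "0 < s"
 shows "L1 (%y. wave xi y (heat_dt s y))" and "(LINT y. wave xi y (heat_dt s y))
   = - complex_of_real((norm xi)^2*exp(- (s*(norm xi)^2)))"
proof -
 define B where "B y = 192*exp 1/sqrt(s/2)*(1/(s/2 + norm y^2)^2)" for y :: "real^3"
 have B: "L1 B"
  unfolding B_def by(intro integrable_mult_right integrable_inverse_fourth_shift) (use s in auto)
 have tp: "s/2 <= t" "0 < t" if "\<bar>t - s\<bar> < s/2" for t using that s by(auto simp: abs_if split: if_splits)
 have dom: "\<bar>heat_dt t y\<bar> <= B y" if "\<bar>t - s\<bar> < s/2" for t y
 proof -
  have "sqrt(s/2)*(s/2 + norm y^2)^2 <= sqrt t*(t + norm y^2)^2"
   using tp[OF that] s by(intro mult_mono power_mono) auto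
  moreover have pos: "0 < sqrt(s/2)*(s/2 + norm y^2)^2"
   using s by(intro mult_pos_pos zero_less_power add_pos_nonneg) auto
  ultimately have "192*exp 1/(sqrt t*(t + norm y^2)^2) <= 192*exp 1/(sqrt(s/2)*(s/2 + norm y^2)^2)"
   using mult_pos_pos[OF less_le_trans[OF pos] pos] by(intro divide_left_mono) auto
  thus ?thesis using heat_dt_le[OF tp(2)[OF that], of y] unfolding B_def by simp
 qed
 \<comment> \<open>Real and imaginary part in one statement: \<open>k\<close> is the trigonometric
   factor and \<open>v\<close> the resulting value, which is 0 for the sine because the transform is
   real.\<close>
 have I: "L1 (%y. k (y \<bullet> xi)*heat t y)" "(LINT y. k (y \<bullet> xi)*heat t y) = v t"
  if "0 < t" and k: "(k = cos & v = (%t. exp(- (t*(norm xi)^2)))) \<or> (k = (%x. - sin x) & v = (%t. 0))" for t k v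
 proof -
  have re: "Re (wave xi y (heat t y)) = cos(y \<bullet> xi)*heat t y"
   and im: "Im (wave xi y (heat t y)) = - sin(y \<bullet> xi)*heat t y" for y by simp_all
  note J = fourier_heat[OF that(1), of xi]
  show "L1 (%y. k (y \<bullet> xi)*heat t y)"
   using k integrable_Re[OF J(1)] integrable_Im[OF J(1)] unfolding re im by auto
  show "(LINT y. k (y \<bullet> xi)*heat t y) = v t"
   using k integral_Re[OF J(1)] integral_Im[OF J(1)] J(2) unfolding re im by auto
 qed
 have D: "((%t. (LINT y. k (y \<bullet> xi)*heat t y)) has_real_derivative (LINT y. k (y \<bullet> xi)*heat_dt s y)) (at s)"
  "L1 (%y. k (y \<bullet> xi)*heat_dt s y)"
  if k: "k = cos \<or> k = (%x. - sin x)" for k :: "real => real"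
 proof -
  have k1: "\<bar>k x\<bar> <= 1" for x using k by auto
  have 1: "L1 (%y. k (y \<bullet> xi)*heat t y)" if "\<bar>t - s\<bar> < s/2" for t
   using k I(1)[OF tp(2)[OF that]] by blast
  have 2: "((%t. k (y \<bullet> xi)*heat t y) has_real_derivative k (y \<bullet> xi)*heat_dt t y) (at t)" if "\<bar>t - s\<bar> < s/2" for t y
   by(intro DERIV_cmult heat_has_derivative tp(2)[OF that])
  have 3: "\<bar>k (y \<bullet> xi)*heat_dt t y\<bar> <= B y" if "\<bar>t - s\<bar> < s/2" for t y
  proof -
   have "\<bar>k (y \<bullet> xi)\<bar>*\<bar>heat_dt t y\<bar> <= 1*B y" using k1 dom[OF that] by(intro mult_mono) auto
   thus ?thesis by(simp add: abs_mult)
  qed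
  have s2: "0 < s/2" using s by simp
  note L = has_real_derivative_integral[OF s2 1 2 3 B]
  show "((%t. (LINT y. k (y \<bullet> xi)*heat t y)) has_real_derivative (LINT y. k (y \<bullet> xi)*heat_dt s y)) (at s)"
   by(rule L(1))
  show "L1 (%y. k (y \<bullet> xi)*heat_dt s y)" by(rule L(2))
 qed
 have c: "(LINT y. cos(y \<bullet> xi)*heat_dt s y) = - ((norm xi)^2*exp(- (s*(norm xi)^2)))"
 proof -
  have "((%t. exp(- (t*(norm xi)^2))) has_real_derivative (LINT y. cos(y \<bullet> xi)*heat_dt s y)) (at s)"
   by(rule has_field_derivative_transform_within_open[OF D(1), of cos "{0<..}"]) (use s I(2) in auto)
  moreover have "((%t. exp(- (t*(norm xi)^2))) has_real_derivative - ((norm xi)^2*exp(- (s*(norm xi)^2)))) (at s)"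
   by(auto intro!: derivative_eq_intros)
  ultimately show ?thesis by(rule DERIV_unique)
 qed
 have si: "(LINT y. - sin(y \<bullet> xi)*heat_dt s y) = 0"
 proof -
  have "((%t. 0) has_real_derivative (LINT y. - sin(y \<bullet> xi)*heat_dt s y)) (at s)"
   by(rule has_field_derivative_transform_within_open[OF D(1), of "%x. - sin x" "{0<..}"])
    (use s I(2)[of _ "%x. - sin x" "%t. 0"] in auto)
  thus ?thesis using DERIV_unique DERIV_const by blast
 qed
 have dec: "wave xi y (heat_dt s y)
  = complex_of_real(cos(y \<bullet> xi)*heat_dt s y) + \<i> * complex_of_real(- sin(y \<bullet> xi)*heat_dt s y)" for y
  by(simp add: complex_eq_iff)
 have i1: "L1 (%y. complex_of_real(cos(y \<bullet> xi)*heat_dt s y))"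
  using D(2)[of cos, OF disjI1[OF refl]] by(simp only: complex_of_real_integrable_eq)
 have i2: "L1 (%y. \<i> * complex_of_real(- sin(y \<bullet> xi)*heat_dt s y))"
  by(intro integrable_mult_right)
   (simp only: complex_of_real_integrable_eq D(2)[of "%x. - sin x", OF disjI2[OF refl]])
 show "L1 (%y. wave xi y (heat_dt s y))" unfolding dec by(rule integrable_add[OF i1 i2])
 have "(LINT y. complex_of_real(cos(y \<bullet> xi)*heat_dt s y) + \<i> * complex_of_real(- sin(y \<bullet> xi)*heat_dt s y))
  = (LINT y. complex_of_real(cos(y \<bullet> xi)*heat_dt s y)) + (LINT y. \<i> * complex_of_real(- sin(y \<bullet> xi)*heat_dt s y))"
  by(rule integral_add[OF i1 i2])
 also have "... = - complex_of_real((norm xi)^2*exp(- (s*(norm xi)^2)))"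
  unfolding integral_mult_right_zero integral_complex_of_real c si by simp
 finally show "(LINT y. wave xi y (heat_dt s y))
   = - complex_of_real((norm xi)^2*exp(- (s*(norm xi)^2)))" unfolding dec .
qed

lemma fourier_heat_translate:
 assumes s: "0 < s"
 shows "L1 (%y. wave xi y (heat s (a - y)))" and "(LINT y. wave xi y (heat s (a - y)))
   = wave xi a (exp(- (s*(norm xi)^2)))"
  and "L1 (%y. wave xi y (heat_dt s (a - y)))"
  and "(LINT y. wave xi y (heat_dt s (a - y)))
   = - (wave xi a ((norm xi)^2*exp(- (s*(norm xi)^2))))"
proof -
 have e: "cis(- ((a - z) \<bullet> xi)) * complex_of_real(h(a - (a - z))) = cis(- (a \<bullet> xi))*(cis(- (z \<bullet> (- xi))) * complex_of_real(h z))"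
  for z and h :: "real^3 => real"
 proof -
  have "cis(- ((a - z) \<bullet> xi)) = cis(- (a \<bullet> xi)) * cis(- (z \<bullet> (- xi)))"
   by(simp add: cis_mult inner_diff_left)
  thus ?thesis by simp
 qed
 have *: "L1 (%y. wave xi y (h(a - y)))"
  "(LINT y. wave xi y (h(a - y))) = cis(- (a \<bullet> xi)) * v"
  if h: "L1 (%y. cis(- (y \<bullet> (- xi))) * complex_of_real(h y))"
   "(LINT y. cis(- (y \<bullet> (- xi))) * complex_of_real(h y)) = v" for h :: "real^3 => real" and v
 proof -
  have "L1 (%z. cis(- ((a - z) \<bullet> xi)) * complex_of_real(h(a - (a - z))))"
   unfolding e by(rule integrable_mult_right[OF h(1)])
  thus "L1 (%y. wave xi y (h(a - y)))"
   using integrable_translate(2)[of "%y. wave xi y (h(a - y))" a] by blast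
  show "(LINT y. wave xi y (h(a - y))) = cis(- (a \<bullet> xi)) * v"
   using integral_translate(2)[of "%y. wave xi y (h(a - y))" a, symmetric]
   unfolding e integral_mult_right_zero h(2) .
 qed
 show "L1 (%y. wave xi y (heat s (a - y)))"
  by(rule *(1)[OF fourier_heat[OF s, of "- xi"]])
 show "(LINT y. wave xi y (heat s (a - y))) = wave xi a (exp(- (s*(norm xi)^2)))"
  using *(2)[OF fourier_heat[OF s, of "- xi"]] by simp
 show "L1 (%y. wave xi y (heat_dt s (a - y)))"
  by(rule *(1)[OF fourier_heat_dt[OF s, of "- xi"]])
 show "(LINT y. wave xi y (heat_dt s (a - y)))
   = - (wave xi a ((norm xi)^2*exp(- (s*(norm xi)^2))))"
  using *(2)[OF fourier_heat_dt[OF s, of "- xi"]] by simp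
qed

lemma fourier_lborel: "f : borel_measurable borel ==>
  fourier f xi = complex_of_real((2*pi) powr (- (real DIM('a)/2)))*(LINT x. cis(- (x \<bullet> xi))*f(x :: 'a :: euclidean_space))"
 unfolding fourier_def by(subst integral_completion) (auto intro: measurable_compose)

text \<open>After Fubini, the average over \<open>half_measure\<close> turns the symbol
  \<open>q = |xi|^2\<close> of minus the Laplacian into \<open>q * q^(-1/2) = |xi|\<close>. The
  bound for differences supplies the integrability for Fubini.\<close>

lemma fourier_heat_diff_half:
 assumes s: "0 < s"
 shows "L1(heat_diff_half a b s)" and "(LINT y. wave xi y (heat_diff_half a b s y))
   = complex_of_real(norm xi)*(LINT y. wave xi y (heat_diff a b s y))"
proof -
 obtain C where C: "0 <= C" "!!t y. s <= t ==> \<bar>heat_diff_dt a b t y\<bar> <= C/(t + norm y^2)^3"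
  by(rule heat_diff_dt_bound[OF s]) blast
 note hb = heat_diff_dt_half_bound[OF s C(2,1)]
 define c where "c = 2*C/(sqrt pi * sqrt s)"
 have ci: "L1 (%y::real^3. c*(1/(s + norm y^2)^2))"
  by(intro integrable_mult_right integrable_inverse_fourth_shift s)
 have ce: "2*C/(sqrt pi * sqrt s*(s + norm y^2)^2) = c*(1/(s + norm y^2)^2)" for y :: "real^3"
  unfolding c_def by simp
 have c0: "0 <= c" unfolding c_def using C(1) s by simp
 show "L1(heat_diff_half a b s)"
 proof(rule integrable_bound[OF ci])
  show "AE y in lborel. norm(heat_diff_half a b s y) <= norm(c*(1/(s + norm y^2)^2))"
   using hb(3) c0 unfolding ce by(intro AE_I2) (simp add: abs_of_nonneg)
 qed measurable
 define F where "F = (%(y, t). wave xi y (heat_diff_dt a b (s + t) y))"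
 have [measurable]: "F : borel_measurable (lborel \<Otimes>\<^sub>M half_measure)"
  unfolding F_def split_beta' by measurable
 have iF: "integrable (lborel \<Otimes>\<^sub>M half_measure) F"
 proof(rule lborel_half.Fubini_integrable)
  show "L1 (%y. (LINT t|half_measure. norm(F(y, t))))"
  proof(rule integrable_bound[OF ci])
   show "(%y. (LINT t|half_measure. norm(F(y, t)))) : borel_measurable lborel"
    by(intro half.borel_measurable_lebesgue_integral) measurable
   show "AE y in lborel. norm(LINT t|half_measure. norm(F(y, t))) <= norm(c*(1/(s + norm y^2)^2))"
   proof(rule AE_I2)
    fix y
    have "(LINT t|half_measure. norm(F(y, t))) = (LINT t|half_measure. \<bar>heat_diff_dt a b (s + t) y\<bar>)"
     unfolding F_def by(simp add: norm_mult)
    also have "... <= c*(1/(s + norm y^2)^2)"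
    proof -
     have "ennreal(LINT t|half_measure. \<bar>heat_diff_dt a b (s + t) y\<bar>) = (\<integral>\<^sup>+t. ennreal \<bar>heat_diff_dt a b (s + t) y\<bar> \<partial>half_measure)"
      by(rule nn_integral_eq_integral[symmetric]) (use integrable_norm[OF hb(2)] in auto)
     also have "... <= ennreal(c*(1/(s + norm y^2)^2))" using hb(1) unfolding ce .
     finally show ?thesis using c0 by(subst (asm) ennreal_le_iff) auto
    qed
    finally show "norm(LINT t|half_measure. norm(F(y, t))) <= norm(c*(1/(s + norm y^2)^2))"
     using c0 by(simp add: abs_of_nonneg)
   qed
  qed
  show "AE y in lborel. integrable half_measure (%t. F(y, t))"
  proof(rule AE_I2)
   fix y
   show "integrable half_measure (%t. F(y, t))"
    unfolding F_def using integrable_mult_right[OF integrable_of_real[OF hb(2)], of "cis(- (y \<bullet> xi))"] by simp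
  qed
 qed measurable
 define q where "q = (norm xi)^2"
 define \<gamma> where "\<gamma> = cis(- (a \<bullet> xi)) - cis(- (b \<bullet> xi))"
 have Fy: "(LINT t|half_measure. F(y, t)) = - (wave xi y (heat_diff_half a b s y))" for y
  unfolding F_def heat_diff_half_def by(simp add: integral_complex_of_real)
 have Ft: "(LINT y. F(y, t)) = - (\<gamma> * complex_of_real(q*exp(- (s*q)))) * complex_of_real(exp(- (t*q)))" if "0 < t" for t
 proof -
  have st: "0 < s + t" using s that by simp
  have "(LINT y. F(y, t)) = (LINT y. wave xi y (heat_dt (s + t) (a - y)) - wave xi y (heat_dt (s + t) (b - y)))"
   unfolding F_def heat_diff_dt_def by(simp add: algebra_simps)
  also have "... = - (wave xi a (q*exp(- ((s + t)*q)))) - - (wave xi b (q*exp(- ((s + t)*q))))"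
   using integral_diff[OF fourier_heat_translate(3)[OF st, of xi a] fourier_heat_translate(3)[OF st, of xi b]]
   unfolding fourier_heat_translate(4)[OF st] q_def .
  also have "... = - (\<gamma> * complex_of_real(q*exp(- (s*q)))) * complex_of_real(exp(- (t*q)))"
   unfolding \<gamma>_def by(simp add: algebra_simps exp_add exp_diff exp_minus divide_inverse)
  finally show ?thesis .
 qed
 \<comment> \<open>For \<open>xi = 0\<close> the integral over \<open>half_measure\<close> diverges
   and has the default value 0; its factor \<open>q\<close> is 0 as well.\<close>
 have sq: "complex_of_real(q*exp(- (s*q)))*(LINT t|half_measure. complex_of_real(exp(- (t*q)))) = complex_of_real(norm xi*exp(- (s*q)))"
 proof(cases "xi = 0")
  case False
  hence q: "0 < q" unfolding q_def by simp
  have "(LINT t|half_measure. exp(- (t*q))) = 1/sqrt q"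
   using nn_integral_half_measure_exp[OF q] q by(intro integral_eq_nn_integral[THEN trans]) auto
  moreover have "q*(1/sqrt q) = norm xi" unfolding q_def using False by(simp add: power2_eq_square)
  ultimately show ?thesis unfolding integral_complex_of_real of_real_mult[symmetric] of_real_eq_iff by(metis mult.commute mult.assoc)
 qed(simp add: q_def)
 have "(LINT y. (LINT t|half_measure. F(y, t))) = (LINT t|half_measure. (LINT y. F(y, t)))"
  using lborel_half.Fubini_integral[of "%y t. F(y, t)"] iF by simp
 also have "... = (LINT t|half_measure. - (\<gamma> * complex_of_real(q*exp(- (s*q)))) * complex_of_real(exp(- (t*q))))"
 proof(rule integral_cong_AE)
  show "(%t. (LINT y. F(y, t))) : borel_measurable half_measure"
   by(intro lborel.borel_measurable_lebesgue_integral) measurable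
  show "AE t in half_measure. (LINT y. F(y, t)) = - (\<gamma> * complex_of_real(q*exp(- (s*q)))) * complex_of_real(exp(- (t*q)))"
   by(rule eventually_mono[OF AE_half_measure_pos Ft])
 qed measurable
 also have "... = - (\<gamma> * complex_of_real(norm xi*exp(- (s*q))))"
  unfolding integral_mult_right_zero using sq by(simp add: mult.assoc)
 finally have 1: "(LINT y. wave xi y (heat_diff_half a b s y)) = \<gamma> * complex_of_real(norm xi*exp(- (s*q)))"
  unfolding Fy by simp
 have "(LINT y. wave xi y (heat_diff a b s y))
   = (LINT y. wave xi y (heat s (a - y)) - wave xi y (heat s (b - y)))"
  unfolding heat_diff_def by(simp add: algebra_simps)
 also have "... = wave xi a (exp(- (s*q))) - wave xi b (exp(- (s*q)))"
  using integral_diff[OF fourier_heat_translate(1)[OF s, of xi a] fourier_heat_translate(1)[OF s, of xi b]]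
  unfolding fourier_heat_translate(2)[OF s] q_def .
 finally have 2: "(LINT y. wave xi y (heat_diff a b s y)) = \<gamma> * complex_of_real(exp(- (s*q)))"
  unfolding \<gamma>_def by(simp add: algebra_simps)
 show "(LINT y. wave xi y (heat_diff_half a b s y))
   = complex_of_real(norm xi)*(LINT y. wave xi y (heat_diff a b s y))"
  unfolding 1 2 by simp
qed

text \<open>The description in \<open>half_laplacian\<close> determines one function because a
  continuous integrable function with vanishing Fourier transform is 0.\<close>

lemma half_laplacian_heat_diff:
 assumes s: "0 < s"
 shows "half_laplacian (%y. complex_of_real(heat_diff a b s y)) = (%y. complex_of_real(heat_diff_half a b s y))"
 unfolding half_laplacian_def
proof(rule the_equality)
 let ?psi = "%y. complex_of_real(heat_diff_half a b s y)"
 let ?phi = "%y. complex_of_real(heat_diff a b s y)"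
 have c: "continuous_on UNIV ?psi" by(intro continuous_intros continuous_on_heat_diff_half[OF s])
 have i: "L1 ?psi" using fourier_heat_diff_half(1)[OF s] by(rule integrable_of_real)
 have m: "?psi : borel_measurable borel" "?phi : borel_measurable borel" by measurable
 have f: "fourier ?psi xi = complex_of_real(norm xi)*fourier ?phi xi" for xi
  unfolding fourier_lborel[OF m(1)] fourier_lborel[OF m(2)] fourier_heat_diff_half(2)[OF s] by simp
 show "continuous_on UNIV ?psi & integrable lebesgue ?psi & (\<forall>xi. fourier ?psi xi = complex_of_real(norm xi)*fourier ?phi xi)"
  using c i f by(simp add: integrable_completion)
 fix psi' :: "real^3 => complex"
 assume *: "continuous_on UNIV psi' & integrable lebesgue psi' & (\<forall>xi. fourier psi' xi = complex_of_real(norm xi)*fourier ?phi xi)"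
 hence m': "psi' : borel_measurable borel" by(intro borel_measurable_continuous_onI) auto
 have i': "L1 psi'" using * m' by(simp add: integrable_completion)
 show "psi' = ?psi"
 proof
  fix x0
  have "psi' x0 - ?psi x0 = 0"
  proof(rule continuous_fourier_eq_0)
   show "continuous_on UNIV (%x. psi' x - ?psi x)" using * c by(intro continuous_on_diff) auto
   show "L1 (%x. psi' x - ?psi x)" using i i' by(rule integrable_diff[rotated])
   fix xi
   have "L1 (%x. cis(- (x \<bullet> xi)) * k x)" if "L1 k" for k :: "real^3 => complex"
    by(rule integrable_bound[OF that]) (use borel_measurable_integrable[OF that] in \<open>auto simp: norm_mult\<close>)
   hence "(LINT x. cis(- (x \<bullet> xi))*(psi' x - ?psi x))
     = (LINT x. cis(- (x \<bullet> xi))*psi' x) - (LINT x. cis(- (x \<bullet> xi))*?psi x)"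
    unfolding right_diff_distrib using i i' by(intro integral_diff) auto
   moreover have "fourier psi' xi = fourier ?psi xi" using * f by simp
   ultimately show "(LINT x. cis(- (x \<bullet> xi))*(psi' x - ?psi x)) = 0"
    unfolding fourier_lborel[OF m(1)] fourier_lborel[OF m'] by simp
  qed
  thus "psi' x0 = ?psi x0" by simp
 qed
qed

section \<open>Inverting the half Laplacian\<close>

text \<open>The convolution identity as an equality of measures, so that it also serves signed
  integrands.\<close>

lemma distr_half_measure_add:
 "distr (half_measure \<Otimes>\<^sub>M half_measure) borel (%(r, t). r + t) = density lborel (indicator {0<..})"
proof(rule measure_eqI)
 fix A :: "real set" assume "A : sets(distr (half_measure \<Otimes>\<^sub>M half_measure) borel (%(r, t). r + t))"
 hence [measurable]: "A : sets borel" by simp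
 have "emeasure (distr (half_measure \<Otimes>\<^sub>M half_measure) borel (%(r, t). r + t)) A
   = (\<integral>\<^sup>+p. indicator A (fst p + snd p) \<partial>(half_measure \<Otimes>\<^sub>M half_measure))"
  by(subst nn_integral_indicator[symmetric], simp, subst nn_integral_distr) (auto simp: split_beta')
 also have "... = (\<integral>\<^sup>+r. (\<integral>\<^sup>+t. indicator A (r + t) \<partial>half_measure) \<partial>half_measure)"
  by(subst half.nn_integral_fst[symmetric]) auto
 also have "... = (NINT q. indicator {0<..} q*indicator A q)"
  by(rule nn_integral_half_measure_conv) measurable
 also have "... = emeasure (density lborel (indicator {0<..})) A"
  by(subst emeasure_density) auto
 finally show "emeasure (distr (half_measure \<Otimes>\<^sub>M half_measure) borel (%(r, t). r + t)) A = emeasure (density lborel (indicator {0<..})) A" .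
qed simp

lemma integral_half_measure_conv:
 fixes F :: "real => real"
 assumes [measurable]: "F : borel_measurable borel" and i: "L1 (%q. indicator {0<..} q*F q)"
 shows "(LINT r|half_measure. (LINT t|half_measure. F(r + t))) = (LINT q. indicator {0<..} q*F q)"
proof -
 have ind: "density lborel (indicator {0<..}) = density lborel (%q::real. ennreal(indicator {0<..} q))"
  by(rule density_cong) (auto simp: indicator_def)
 have i2: "integrable (density lborel (indicator {0<..})) F"
  unfolding ind using i by(subst integrable_density) auto
 hence i3: "integrable (half_measure \<Otimes>\<^sub>M half_measure) (%(r, t). F(r + t))"
  unfolding distr_half_measure_add[symmetric] by(subst (asm) integrable_distr_eq) (auto simp: split_beta')
 have "(LINT r|half_measure. (LINT t|half_measure. F(r + t))) = (\<integral>p. (case p of (r, t) => F(r + t)) \<partial>(half_measure \<Otimes>\<^sub>M half_measure))"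
  using half_pair.integral_fst'[OF i3] by simp
 also have "... = integral\<^sup>L (density lborel (indicator {0<..})) F"
  unfolding distr_half_measure_add[symmetric] by(subst integral_distr) (auto simp: split_beta')
 also have "... = (LINT q. indicator {0<..} q*F q)"
  unfolding ind by(subst integral_density) auto
 finally show ?thesis .
qed

text \<open>The heat-regularised Riesz kernel: it tends to \<open>1/(2 * pi^2 * |z|^2)\<close> as
  \<open>s -> 0\<close> and is dominated by a multiple of \<open>1/|z|^2\<close> uniformly in
  \<open>s\<close>.\<close>

definition heat_potential :: "real => real^3 => real" where
 "heat_potential s z = (LINT r|half_measure. heat (s + r) z)"

lemma heat_potential_bound:
 assumes "0 < s" and z: "z ~= 0"
 shows "\<bar>heat_potential s z\<bar> <= 32*exp 1/(sqrt pi*norm z^2)"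
proof -
 have q: "0 < norm z^2" using z by simp
 have b: "heat (s + r) z <= 16*exp 1*(1/sqrt(r + norm z^2)^3)" "0 <= heat (s + r) z" if "0 < r" for r
 proof -
  have sr: "0 < s + r" using that assms by simp
  have "sqrt(r + norm z^2)^3 <= sqrt(s + r + norm z^2)^3"
   using that assms by(intro power_mono) auto
  moreover have pos: "0 < sqrt(r + norm z^2)^3" using add_pos_pos[OF that q] by simp
  ultimately have "16*exp 1/sqrt(s + r + norm z^2)^3 <= 16*exp 1/sqrt(r + norm z^2)^3"
   using mult_pos_pos[OF less_le_trans[OF pos] pos] by(intro divide_left_mono) auto
  thus "heat (s + r) z <= 16*exp 1*(1/sqrt(r + norm z^2)^3)" using heat_le[OF sr, of z] by simp
  show "0 <= heat (s + r) z" by(rule heat_nonneg[OF sr])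
 qed
 have "ennreal \<bar>heat_potential s z\<bar> <= (\<integral>\<^sup>+r. ennreal(norm(heat (s + r) z)) \<partial>half_measure)"
 proof(cases "integrable half_measure (%r. heat (s + r) z)")
  case True
  from integral_norm_bound_ennreal[OF True] show ?thesis unfolding heat_potential_def by simp
 qed(simp add: heat_potential_def not_integrable_integral_eq)
 also have "... <= (\<integral>\<^sup>+r. ennreal(16*exp 1)*ennreal(1/sqrt(r + norm z^2)^3) \<partial>half_measure)"
 proof(rule nn_integral_mono_AE, rule eventually_mono[OF AE_half_measure_pos])
  fix r :: real assume r: "0 < r"
  show "ennreal(norm(heat (s + r) z)) <= ennreal(16*exp 1)*ennreal(1/sqrt(r + norm z^2)^3)"
   using b[OF r] r by(subst ennreal_mult[symmetric]) auto
 qed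
 also have "... = ennreal(16*exp 1)*ennreal(2/(sqrt pi*norm z^2))"
  by(subst nn_integral_cmult) (auto simp: nn_integral_half_measure_powr[OF q])
 also have "... = ennreal(32*exp 1/(sqrt pi*norm z^2))"
  by(subst ennreal_mult[symmetric]) auto
 finally show ?thesis by(subst (asm) ennreal_le_iff) auto
qed

lemma integrable_heat_half:
 assumes s: "0 < s"
 shows "integrable half_measure (%r. heat (s + r) z)"
proof(rule half_integrable_bounded[OF _ s, where C="16*exp 1"])
 fix r :: real assume r: "0 < r"
 have sr: "0 < s + r" using r s by simp
 have pos: "0 < sqrt(r + s)^3" using r s by simp
 have "sqrt(r + s)^3 <= sqrt(s + r + norm z^2)^3" using r s by(intro power_mono) auto
 hence "16*exp 1/sqrt(s + r + norm z^2)^3 <= 16*exp 1/sqrt(r + s)^3"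
  using mult_pos_pos[OF less_le_trans[OF pos] pos] by(intro divide_left_mono) auto
 thus "norm(heat (s + r) z) <= 16*exp 1/sqrt(r + s)^3"
  using heat_le[OF sr, of z] heat_nonneg[OF sr, of z] by simp
qed measurable

lemma heat_potential_tendsto:
 assumes z: "z ~= 0" and S: "!!n. 0 < S n" "S \<longlonglongrightarrow> 0"
 shows "(%n. heat_potential (S n) z) \<longlonglongrightarrow> 1/(2*pi^2*norm z^2)"
proof -
 have q: "0 < norm z^2" using z by simp
 have "(%n. (LINT r|half_measure. heat (S n + r) z)) \<longlonglongrightarrow> (LINT r|half_measure. heat r z)"
 proof(rule integral_dominated_convergence[where w="%r. 16*exp 1/sqrt(r + norm z^2)^3"])
  show "integrable half_measure (%r. 16*exp 1/sqrt(r + norm z^2)^3)"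
   by(rule half_integrable_bounded[OF _ q, where C="16*exp 1"]) auto
  show "AE r in half_measure. (%n. heat (S n + r) z) \<longlonglongrightarrow> heat r z"
  proof(rule eventually_mono[OF AE_half_measure_pos])
   fix r :: real assume r: "0 < r"
   have "isCont (%s. heat s z) r" by(rule DERIV_isCont[OF heat_has_derivative[OF r]])
   moreover have "(%n. S n + r) \<longlonglongrightarrow> r" using tendsto_add[OF S(2) tendsto_const[of r]] by simp
   ultimately show "(%n. heat (S n + r) z) \<longlonglongrightarrow> heat r z" by(rule isCont_tendsto_compose)
  qed
  show "AE r in half_measure. norm(heat (S n + r) z) <= 16*exp 1/sqrt(r + norm z^2)^3" for n
  proof(rule eventually_mono[OF AE_half_measure_pos])
   fix r :: real assume r: "0 < r"
   have sr: "0 < S n + r" using r S(1)[of n] by simp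
   have pos: "0 < sqrt(r + norm z^2)^3" using add_pos_pos[OF r q] by simp
   have "sqrt(r + norm z^2)^3 <= sqrt(S n + r + norm z^2)^3"
    using r S(1)[of n] by(intro power_mono) auto
   hence "16*exp 1/sqrt(S n + r + norm z^2)^3 <= 16*exp 1/sqrt(r + norm z^2)^3"
    using mult_pos_pos[OF less_le_trans[OF pos] pos] by(intro divide_left_mono) auto
   thus "norm(heat (S n + r) z) <= 16*exp 1/sqrt(r + norm z^2)^3"
    using heat_le[OF sr, of z] heat_nonneg[OF sr, of z] by simp
  qed
 qed measurable
 moreover have "(LINT r|half_measure. heat r z) = 1/(2*pi^2*norm z^2)"
  by(subst integral_eq_nn_integral)
   (auto simp: nn_integral_half_measure_heat[OF z] intro!: eventually_mono[OF AE_half_measure_pos] heat_nonneg)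
 ultimately show ?thesis unfolding heat_potential_def by simp
qed

lemma integrable_div_norm_sq:
 fixes f :: "real^3 => real"
 assumes c: "continuous_on UNIV f" and i: "L1 f"
 shows "L1 (%y. f y/norm(x - y)^2)"
proof -
 have [measurable]: "f : borel_measurable borel" by(rule borel_measurable_continuous_onI[OF c])
 obtain M where M: "!!y. y : cball x 1 ==> \<bar>f y\<bar> <= M"
 proof -
  have "compact (f ` cball x 1)"
   using c continuous_on_subset by(intro compact_continuous_image compact_cball) auto
  hence "bounded (f ` cball x 1)" by(rule compact_imp_bounded)
  then obtain M where "ALL y:f ` cball x 1. norm y <= M" unfolding bounded_iff by blast
  hence "\<bar>f y\<bar> <= M" if "y : cball x 1" for y using that by(simp add: image_iff)
  thus thesis by(rule that)
 qed
 have M0: "0 <= M" using M[of x] by auto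
 have iB: "L1 (%y. M*(indicator (cball x 1) y/norm(x - y)^2) + \<bar>f y\<bar>)"
  by(intro integrable_add integrable_mult_right integrable_inverse_square_ball) (use i in auto)
 show ?thesis
 proof(rule integrable_bound[OF iB])
  show "AE y in lborel. norm(f y/norm(x - y)^2) <= norm(M*(indicator (cball x 1) y/norm(x - y)^2) + \<bar>f y\<bar>)"
  proof(rule AE_I2)
   fix y
   show "norm(f y/norm(x - y)^2) <= norm(M*(indicator (cball x 1) y/norm(x - y)^2) + \<bar>f y\<bar>)"
   proof(cases "y : cball x 1")
    case True
    hence "\<bar>f y\<bar>/norm(x - y)^2 <= M/norm(x - y)^2" by(intro divide_right_mono M) auto
    moreover have "0 <= M*(indicator (cball x 1) y/norm(x - y)^2)" using M0 by simp
    ultimately show ?thesis using True by simp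
   next
    case False
    hence "1 <= norm(x - y)^2" by(simp add: dist_norm)
    hence "\<bar>f y\<bar>/norm(x - y)^2 <= \<bar>f y\<bar>/1" by(intro divide_left_mono) auto
    thus ?thesis using False by simp
   qed
  qed
 qed measurable
qed

text \<open>Testing at the times \<open>s + r\<close> and averaging over \<open>r\<close> undoes the
  half Laplacian on the left and produces regularised Riesz kernels on the right; then
  \<open>s -> 0\<close>. Only differences of \<open>W\<close> are determined, as the test functions
  have integral 0.\<close>

theorem half_laplacian_solution_potential:
 fixes W f :: "real^3 => real"
 assumes W: "continuous_on UNIV W" "L1 (%y. \<bar>W y\<bar>/(1 + norm y^4))"
  and f: "continuous_on UNIV f" "L1 f"
  and eq: "!!phi a b s. phi = (%y. complex_of_real(heat_diff a b s y)) ==> 0 < s ==>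
   (LINT x. complex_of_real(W x)*half_laplacian phi x) = (LINT x. complex_of_real(2*f x)*phi x)"
 shows "W a - W b = 1/pi^2*((LINT y. f y/norm(a - y)^2) - (LINT y. f y/norm(b - y)^2))"
proof -
 have [measurable]: "W : borel_measurable borel" "f : borel_measurable borel"
  by(rule borel_measurable_continuous_onI; fact)+
 have eq1: "(LINT y. W y*heat_diff_half a b s y) = 2*(LINT y. f y*heat_diff a b s y)" if s: "0 < s" for s
 proof -
  have "complex_of_real(LINT y. W y*heat_diff_half a b s y) = complex_of_real(LINT y. 2*f y*heat_diff a b s y)"
   using eq[OF refl s, of a b] unfolding half_laplacian_heat_diff[OF s]
   by(simp flip: integral_complex_of_real)
  thus ?thesis unfolding of_real_eq_iff by(simp add: mult.assoc)
 qed
 have main: "(LINT y. W y*heat_diff a b s y) = 2*(LINT y. f y*(heat_potential s (a - y) - heat_potential s (b - y)))"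
  if s: "0 < s" for s
 proof -
  obtain C where C: "0 <= C" "!!t y. s <= t ==> \<bar>heat_diff_dt a b t y\<bar> <= C/(t + norm y^2)^3"
   by(rule heat_diff_dt_bound[OF s]) blast
  note tail = heat_diff_dt_tail[OF s C(2,1)]
  obtain M where M: "0 < M" "!!y :: real^3. 1/(s + norm y^2)^2 <= M/(1 + norm y^4)"
   by(rule inverse_fourth_le[OF s]) blast
  \<comment> \<open>The convolution identity is applied to absolute values first, since Fubini
    against \<open>W\<close> needs a bound of order four for the averaged half Laplacian.\<close>
  have half_nn: "(\<integral>\<^sup>+r. ennreal \<bar>heat_diff_half a b (s + r) y\<bar> \<partial>half_measure) <= ennreal(C/(2*(s + norm y^2)^2))" for y
  proof -
   have "(\<integral>\<^sup>+r. ennreal \<bar>heat_diff_half a b (s + r) y\<bar> \<partial>half_measure)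
    <= (\<integral>\<^sup>+r. (\<integral>\<^sup>+t. ennreal \<bar>heat_diff_dt a b (s + (r + t)) y\<bar> \<partial>half_measure) \<partial>half_measure)"
   proof(rule nn_integral_mono)
    fix r
    show "ennreal \<bar>heat_diff_half a b (s + r) y\<bar> <= (\<integral>\<^sup>+t. ennreal \<bar>heat_diff_dt a b (s + (r + t)) y\<bar> \<partial>half_measure)"
    proof(cases "integrable half_measure (%t. heat_diff_dt a b (s + r + t) y)")
     case True
     from integral_norm_bound_ennreal[OF True] show ?thesis unfolding heat_diff_half_def by(simp add: add.assoc)
    qed(simp add: heat_diff_half_def not_integrable_integral_eq)
   qed
   also have "... = (NINT q. indicator {0<..} q*ennreal \<bar>heat_diff_dt a b (s + q) y\<bar>)"
    by(rule nn_integral_half_measure_conv) measurable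
   also note tail(1)
   finally show ?thesis .
  qed
  have half_i: "integrable half_measure (%r. heat_diff_half a b (s + r) y)" for y
   using le_less_trans[OF half_nn[of y]] by(intro integrableI_bounded) auto
  have half_int: "(LINT r|half_measure. heat_diff_half a b (s + r) y) = heat_diff a b s y" for y
  proof -
   have "(LINT r|half_measure. (LINT t|half_measure. heat_diff_dt a b (s + (r + t)) y))
     = (LINT q. indicator {0<..} q*heat_diff_dt a b (s + q) y)"
    by(rule integral_half_measure_conv[OF _ tail(2)]) measurable
   thus ?thesis using tail(3)[of y] unfolding heat_diff_half_def by(simp add: add.assoc)
  qed
  have iP: "integrable (lborel \<Otimes>\<^sub>M half_measure) (%(y, r). W y*heat_diff_half a b (s + r) y)"
  proof(rule lborel_half.Fubini_integrable)
   show "L1 (%y. (LINT r|half_measure. norm(case (y, r) of (y, r) => W y*heat_diff_half a b (s + r) y)))"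
   proof(rule integrable_bound[OF integrable_mult_right[OF W(2), of "C*M"]])
    show "(%y. (LINT r|half_measure. norm(case (y, r) of (y, r) => W y*heat_diff_half a b (s + r) y))) : borel_measurable lborel"
     by(intro half.borel_measurable_lebesgue_integral) measurable
    show "AE y in lborel. norm(LINT r|half_measure. norm(case (y, r) of (y, r) => W y*heat_diff_half a b (s + r) y))
      <= norm(C*M*(\<bar>W y\<bar>/(1 + norm y^4)))"
    proof(rule AE_I2)
     fix y :: "real^3"
     have p: "0 < (s + norm y^2)^2" using s by(intro zero_less_power add_pos_nonneg) auto
     have "ennreal(LINT r|half_measure. \<bar>heat_diff_half a b (s + r) y\<bar>) = (\<integral>\<^sup>+r. ennreal \<bar>heat_diff_half a b (s + r) y\<bar> \<partial>half_measure)"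
      by(rule nn_integral_eq_integral[symmetric]) (use integrable_norm[OF half_i] in auto)
     also note half_nn
     finally have "(LINT r|half_measure. \<bar>heat_diff_half a b (s + r) y\<bar>) <= C/(2*(s + norm y^2)^2)"
      using C(1) by(subst (asm) ennreal_le_iff) auto
     also have "... <= C*(1/(s + norm y^2)^2)" using C(1) p by(simp add: divide_simps)
     also have "... <= C*(M/(1 + norm y^4))" by(intro mult_left_mono M C)
     finally have "\<bar>W y\<bar>*(LINT r|half_measure. \<bar>heat_diff_half a b (s + r) y\<bar>) <= \<bar>W y\<bar>*(C*(M/(1 + norm y^4)))"
      by(intro mult_left_mono) auto
     moreover have "(LINT r|half_measure. norm(case (y, r) of (y, r) => W y*heat_diff_half a b (s + r) y)) = \<bar>W y\<bar>*(LINT r|half_measure. \<bar>heat_diff_half a b (s + r) y\<bar>)"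
      by(simp add: abs_mult)
     moreover have "0 <= \<bar>W y\<bar>*(LINT r|half_measure. \<bar>heat_diff_half a b (s + r) y\<bar>)" by simp
     ultimately show "norm(LINT r|half_measure. norm(case (y, r) of (y, r) => W y*heat_diff_half a b (s + r) y))
      <= norm(C*M*(\<bar>W y\<bar>/(1 + norm y^4)))"
      using C(1) M(1) by(simp add: mult_ac abs_mult)
    qed
   qed
   show "AE y in lborel. integrable half_measure (%r. case (y, r) of (y, r) => W y*heat_diff_half a b (s + r) y)"
    using half_i by(intro AE_I2) simp
  qed measurable
  have iQ: "integrable (lborel \<Otimes>\<^sub>M half_measure) (%(y, r). f y*heat_diff a b (s + r) y)"
  proof(rule integrable_bound)
   \<comment> \<open>Uniform in \<open>y\<close>, which suffices because \<open>f\<close> itself is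
     integrable. Of the four factors \<open>sqrt (r + s)\<close> one is given up to
     \<open>sqrt s\<close>; the other three are integrable over \<open>half_measure\<close>.\<close>
   define k where "k r = C/(2 * sqrt s)*(1/sqrt(r + s)^3)" for r
   have ik: "integrable half_measure k"
    unfolding k_def by(intro integrable_mult_right half_integrable_bounded[OF _ s, where C=1]) (use s in auto)
   have [measurable]: "k : borel_measurable borel" unfolding k_def by measurable
   show "integrable (lborel \<Otimes>\<^sub>M half_measure) (%(y, r). f y * k r)"
   proof(rule lborel_half.Fubini_integrable)
    show "L1 (%y. (LINT r|half_measure. norm(case (y, r) of (y, r) => f y * k r)))"
     using f(2) by(simp add: abs_mult)
    show "AE y in lborel. integrable half_measure (%r. case (y, r) of (y, r) => f y * k r)"
     using ik by simp
   qed measurable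
   have "AE p in (lborel :: (real^3) measure) \<Otimes>\<^sub>M half_measure. 0 < snd p"
   proof(rule lborel_half.AE_pair_measure)
    show "{p : space((lborel :: (real^3) measure) \<Otimes>\<^sub>M half_measure). 0 < snd p} : sets(lborel \<Otimes>\<^sub>M half_measure)"
     by measurable
   qed(use AE_half_measure_pos in auto)
   thus "AE p in lborel \<Otimes>\<^sub>M half_measure. norm(case p of (y, r) => f y*heat_diff a b (s + r) y) <= norm(case p of (y, r) => f y * k r)"
   proof eventually_elim
    case (elim p)
    obtain y r where p: "p = (y, r)" by(cases p)
    have r: "0 < r" using elim p by simp
    have sr: "0 < s + r" using r s by simp
    have "\<bar>heat_diff a b (s + r) y\<bar> <= C/(2*(s + r + norm y^2)^2)"
     by(rule heat_diff_dt_tail(4)[OF sr _ C(1)]) (use C(2) r in auto)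
    also have "... <= k r"
    proof -
     have pow4: "(x^2)^2 = x*x^3" for x :: real by(simp add: eval_nat_numeral)
     have "s + r = (sqrt(r + s))^2" using sr by(simp add: add.commute)
     hence "(s + r)^2 = ((sqrt(r + s))^2)^2" by(rule arg_cong)
     also have "... = sqrt(r + s) * sqrt(r + s)^3" by(rule pow4)
     finally have 1: "(s + r)^2 = sqrt(r + s) * sqrt(r + s)^3" .
     have "sqrt s * sqrt(r + s)^3 <= sqrt(r + s) * sqrt(r + s)^3" using s r by(intro mult_right_mono) auto
     also have "... <= (s + r + norm y^2)^2" unfolding 1[symmetric] using s r by(intro power_mono) auto
     finally have le: "2*(sqrt s * sqrt(r + s)^3) <= 2*(s + r + norm y^2)^2" by simp
     have pos: "0 < 2*(sqrt s * sqrt(r + s)^3)" using s r by simp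
     have "C/(2*(s + r + norm y^2)^2) <= C/(2*(sqrt s * sqrt(r + s)^3))"
      by(rule divide_left_mono[OF le C(1) mult_pos_pos[OF less_le_trans[OF pos le] pos]])
     thus ?thesis unfolding k_def by simp
    qed
    finally have "\<bar>f y\<bar>*\<bar>heat_diff a b (s + r) y\<bar> <= \<bar>f y\<bar>*\<bar>k r\<bar>" by(intro mult_left_mono) auto
    thus ?case unfolding p by(simp add: abs_mult)
   qed
  qed measurable
  have "(LINT y. W y*heat_diff a b s y) = (LINT y. (LINT r|half_measure. W y*heat_diff_half a b (s + r) y))"
   by(simp add: half_int)
  also have "... = (LINT r|half_measure. (LINT y. W y*heat_diff_half a b (s + r) y))"
   by(rule lborel_half.Fubini_integral[OF iP, symmetric])
  also have "... = (LINT r|half_measure. 2*(LINT y. f y*heat_diff a b (s + r) y))"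
  proof(rule integral_cong_AE)
   show "AE r in half_measure. (LINT y. W y*heat_diff_half a b (s + r) y) = 2*(LINT y. f y*heat_diff a b (s + r) y)"
    by(rule eventually_mono[OF AE_half_measure_pos]) (use eq1 s in auto)
  qed(intro borel_measurable_times borel_measurable_const lborel.borel_measurable_lebesgue_integral, measurable)+
  also have "... = 2*(LINT r|half_measure. (LINT y. f y*heat_diff a b (s + r) y))" by simp
  also have "(LINT r|half_measure. (LINT y. f y*heat_diff a b (s + r) y)) = (LINT y. (LINT r|half_measure. f y*heat_diff a b (s + r) y))"
   by(rule lborel_half.Fubini_integral[OF iQ])
  also have "... = (LINT y. f y*(heat_potential s (a - y) - heat_potential s (b - y)))"
   unfolding heat_diff_def heat_potential_def using integrable_heat_half[OF s] by simp
  finally show ?thesis .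
 qed
 define S where "S n = 1/real(Suc n)" for n
 have S: "0 < S n" "S \<longlonglongrightarrow> 0" for n
  unfolding S_def using LIMSEQ_inverse_real_of_nat by(auto simp: inverse_eq_divide)
 have W': "L1 (%y. norm(W y)/(1 + norm y^4))" using W(2) by simp
 have cW: "isCont W x" for x using W(1) by(simp add: continuous_on_eq_continuous_at)
 have L: "(%n. (LINT y. W y*heat_diff a b (S n) y)) \<longlonglongrightarrow> W a - W b"
 proof -
  note ha = heat_approximate_identity[where x=a, OF _ W' cW S, simplified]
  note hb = heat_approximate_identity[where x=b, OF _ W' cW S, simplified]
  have "(LINT y. W y*heat_diff a b (S n) y) = (LINT y. heat (S n) (a - y)*W y) - (LINT y. heat (S n) (b - y)*W y)" for n
   unfolding heat_diff_def using integral_diff[OF ha(1)[of n] hb(1)[of n]]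
   by(simp add: left_diff_distrib right_diff_distrib mult.commute)
  thus ?thesis using tendsto_diff[OF ha(2) hb(2)] by simp
 qed
 define K where "K x y = 32*exp 1/sqrt pi*(\<bar>f y\<bar>/norm(x - y)^2)" for x y
 have iK: "L1(K x)" for x
  unfolding K_def using integrable_norm[OF integrable_div_norm_sq[OF f, of x]]
  by(intro integrable_mult_right) simp
 have hp_meas [measurable]: "(%y. heat_potential s (x - y)) : borel_measurable borel" for s x
  unfolding heat_potential_def by(intro half.borel_measurable_lebesgue_integral) measurable
 have ae: "AE y in lborel. y ~= x" for x :: "real^3" by(rule AE_lborel_singleton)
 have dom: "AE y in lborel. norm(f y*heat_potential (S n) (x - y)) <= K x y" for x n
  using ae[of x]
 proof eventually_elim
  case (elim y)
  hence "x - y ~= 0" by simp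
  from mult_left_mono[OF heat_potential_bound[OF S(1) this, of n], of "\<bar>f y\<bar>"] show ?case
   unfolding K_def by(simp add: abs_mult mult_ac)
 qed
 have R: "(%n. (LINT y. f y*heat_potential (S n) (x - y))) \<longlonglongrightarrow> (LINT y. f y*(1/(2*pi^2*norm(x - y)^2)))" for x
 proof(rule integral_dominated_convergence[OF _ _ iK[of x]])
  show "AE y in lborel. (%n. f y*heat_potential (S n) (x - y)) \<longlonglongrightarrow> f y*(1/(2*pi^2*norm(x - y)^2))"
   using ae[of x]
  proof eventually_elim
   case (elim y)
   hence "x - y ~= 0" by simp
   from heat_potential_tendsto[OF this S] show ?case by(intro tendsto_intros)
  qed
 qed(use dom in auto)
 have iR: "L1 (%y. f y*heat_potential (S n) (x - y))" for n x
 proof(rule integrable_bound[OF iK[of x]])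
  show "AE y in lborel. norm(f y*heat_potential (S n) (x - y)) <= norm(K x y)"
   using dom[of n x] by eventually_elim simp
 qed measurable
 have "(LINT y. W y*heat_diff a b (S n) y) = 2*((LINT y. f y*heat_potential (S n) (a - y)) - (LINT y. f y*heat_potential (S n) (b - y)))" for n
  unfolding main[OF S(1)] right_diff_distrib[of "f _"] integral_diff[OF iR iR] ..
 hence "(%n. (LINT y. W y*heat_diff a b (S n) y)) \<longlonglongrightarrow>
   2*((LINT y. f y*(1/(2*pi^2*norm(a - y)^2))) - (LINT y. f y*(1/(2*pi^2*norm(b - y)^2))))"
  by(simp only:) (intro tendsto_mult tendsto_diff tendsto_const R)
 from LIMSEQ_unique[OF L this]
 have "W a - W b = 2*((LINT y. f y*(1/(2*pi^2*norm(a - y)^2))) - (LINT y. f y*(1/(2*pi^2*norm(b - y)^2))))" .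
 moreover have "(LINT y. f y*(1/(2*pi^2*norm(x - y)^2))) = 1/(2*pi^2)*(LINT y. f y/norm(x - y)^2)" for x
  by(subst integral_mult_right_zero[symmetric]) (simp add: field_simps)
 ultimately have "W a - W b = 2*(1/(2*pi^2)*(LINT y. f y/norm(a - y)^2)
   - 1/(2*pi^2)*(LINT y. f y/norm(b - y)^2))" by(simp only:)
 thus ?thesis by(simp add: right_diff_distrib)
qed

section \<open>From the weak equation to a pointwise formula for the Laplacian\<close>

section \<open>Smooth bump functions and the weak Laplacian of a smooth function\<close>

text \<open>The \<open>n\<close>-th derivative of \<open>exp (- 1/t)\<close> is
  \<open>bump_poly n\<close> at \<open>1/t\<close> times \<open>exp (- 1/t)\<close>; the factor
  \<open>[:0, 0, 1:]\<close> is the \<open>1/t^2\<close> from the chain rule.\<close>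

primrec bump_poly :: "nat => real poly" where "bump_poly 0 = 1"
| "bump_poly (Suc n) = [:0, 0, 1:]*(bump_poly n - pderiv (bump_poly n))"

definition bump_deriv :: "nat => real => real" where
 "bump_deriv n t = (if 0 < t then poly (bump_poly n) (1/t)*exp(- (1/t)) else 0)"

lemma poly_exp_tendsto_0: "((%x. poly q x*exp(- x)) \<longlongrightarrow> (0::real)) at_top"
proof -
 have "((%x. \<Sum>i\<le>degree q. coeff q i*(x^i/exp x)) \<longlongrightarrow> (\<Sum>i\<le>degree q. coeff q i*0)) at_top"
  by(intro tendsto_sum tendsto_mult tendsto_const tendsto_power_div_exp_0)
 thus ?thesis by(simp add: poly_altdef sum_distrib_right exp_minus divide_inverse mult.assoc)
qed

lemma bump_deriv_has_derivative: "(bump_deriv n has_real_derivative bump_deriv (Suc n) t) (at t)"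
proof -
 consider "0 < t" | "t < 0" | "t = 0" by linarith
 thus ?thesis
 proof cases
  case 1
  have i: "((%t. 1/t) has_real_derivative - (1/t^2)) (at t)"
   using 1 by(auto intro!: derivative_eq_intros simp: power2_eq_square)
  have "((%t. poly (bump_poly n) (1/t)*exp(- (1/t))) has_real_derivative
    poly (pderiv (bump_poly n)) (1/t)*(- (1/t^2))*exp(- (1/t)) + (exp(- (1/t))*(- (- (1/t^2))))*poly (bump_poly n) (1/t)) (at t)"
   by(rule DERIV_mult[OF DERIV_chain2[OF poly_DERIV i] DERIV_fun_exp[OF DERIV_minus[OF i]]])
  also have "poly (pderiv (bump_poly n)) (1/t)*(- (1/t^2))*exp(- (1/t)) + (exp(- (1/t))*(- (- (1/t^2))))*poly (bump_poly n) (1/t)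
   = bump_deriv (Suc n) t" using 1 by(simp add: bump_deriv_def algebra_simps power2_eq_square)
  finally show ?thesis
   by(rule has_field_derivative_transform_within_open[of _ _ _ "{0<..}"]) (use 1 in \<open>auto simp: bump_deriv_def\<close>)
 next
  case 2
  have "((%t. 0) has_real_derivative bump_deriv (Suc n) t) (at t)" using 2 by(simp add: bump_deriv_def)
  thus ?thesis
   by(rule has_field_derivative_transform_within_open[of _ _ _ "{..<0}"]) (use 2 in \<open>auto simp: bump_deriv_def\<close>)
 next
  case 3
  have "((%h. bump_deriv n h/h) \<longlongrightarrow> 0) (at 0)"
   unfolding filterlim_at_split
  proof
   have "\<forall>\<^sub>F h in at_left 0. bump_deriv n h/h = (0::real)"
    by(rule eventually_at_leftI[of "-1"]) (auto simp: bump_deriv_def)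
   thus "((%h. bump_deriv n h/h) \<longlongrightarrow> 0) (at_left 0)"
    by(rule tendsto_eventually)
   have "((%h::real. poly ([:0, 1:]*bump_poly n) (inverse h)*exp(- inverse h)) \<longlongrightarrow> 0) (at_right 0)"
    by(rule filterlim_compose[OF poly_exp_tendsto_0 filterlim_inverse_at_top_right])
   moreover have "\<forall>\<^sub>F h in at_right 0. poly ([:0, 1:]*bump_poly n) (inverse h)*exp(- inverse h) = bump_deriv n h/(h::real)"
    by(rule eventually_at_rightI[of 0 1]) (auto simp: bump_deriv_def divide_inverse)
   ultimately show "((%h. bump_deriv n h/h) \<longlongrightarrow> 0) (at_right 0)"
    by(rule Lim_transform_eventually)
  qed
  thus ?thesis using 3 by(simp add: DERIV_def bump_deriv_def)
 qed
qed

lemma smooth_on_bump: "smooth_on UNIV g ==> smooth_on UNIV (%x. bump_deriv 0 (g x))"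
 by(rule smooth_on_comp[where h=bump_deriv]) (auto intro: bump_deriv_has_derivative)

lemma bump_pos: "0 < t ==> 0 < bump_deriv 0 t" and bump_zero: "t <= 0 ==> bump_deriv 0 t = 0"
 and bump_nonneg: "0 <= bump_deriv 0 t" by(auto simp: bump_deriv_def)

definition box_bump :: "'a::euclidean_space => 'a => 'a => real" where
 "box_bump a c x = (\<Prod>b\<in>Basis. bump_deriv 0 (x \<bullet> b + - (a \<bullet> b))*bump_deriv 0 (c \<bullet> b + (- 1)*(x \<bullet> b)))"

lemma box_bump_smooth: "smooth_on UNIV (box_bump a c)" unfolding box_bump_def
 by(intro smooth_on_prod smooth_on_mult smooth_on_bump smooth_on_add smooth_on_inner smooth_on_const open_UNIV)

lemma box_bump_pos: "x : box a c ==> 0 < box_bump a c x"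
 unfolding box_bump_def by(intro prod_pos mult_pos_pos bump_pos) (auto simp: mem_box)

lemma box_bump_zero: "x \<notin> box a c ==> box_bump a c x = 0"
 unfolding box_bump_def by(rule prod_zero) (force simp: mem_box bump_zero not_less)+

lemma box_bump_nonneg: "0 <= box_bump a c x"
 using box_bump_pos[of x a c] box_bump_zero[of x a c] by force

text \<open>As \<open>n\<close> grows these test functions increase to the indicator of the open box
  and never exceed it, so dominated convergence applies at once.\<close>

definition box_cutoff :: "'a::euclidean_space => 'a => nat => 'a => real" where
 "box_cutoff a c n x = 1 + (- 1)*exp((- real n)*box_bump a c x)"

lemma box_cutoff_test: "test_function (box_cutoff a c n)" unfolding test_function_def
proof
 show "smooth_on UNIV (box_cutoff a c n)" unfolding box_cutoff_def
  by(intro smooth_on_add smooth_on_mult smooth_on_exp smooth_on_const box_bump_smooth open_UNIV)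
 have "{x. box_cutoff a c n x ~= 0} \<subseteq> box a c"
  using box_bump_zero[of _ a c] by(auto simp: box_cutoff_def)
 hence "bounded {x. box_cutoff a c n x ~= 0}" using bounded_box bounded_subset by blast
 thus "compact (closure {x. box_cutoff a c n x ~= 0})" by simp
qed

lemma box_cutoff_tendsto: "(%n. box_cutoff a c n x) \<longlonglongrightarrow> indicator (box a c) x"
proof(cases "x : box a c")
 case True
 have p: "0 < box_bump a c x" by(rule box_bump_pos[OF True])
 have "(%n. exp((- real n)*box_bump a c x)) \<longlonglongrightarrow> 0" using p by real_asymp
 from tendsto_add[OF tendsto_const tendsto_mult[OF tendsto_const this], of 1 "-1"]
 show ?thesis using True by(simp add: box_cutoff_def)
qed(simp add: box_cutoff_def box_bump_zero)

lemma box_cutoff_le: "\<bar>box_cutoff a c n x\<bar> <= indicator (box a c) x"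
proof(cases "x : box a c")
 case True
 have "exp((- real n)*box_bump a c x) <= 1" using box_bump_nonneg[of a c x] by simp
 thus ?thesis using True by(simp add: box_cutoff_def)
qed(simp add: box_cutoff_def box_bump_zero)

lemma test_function_vanishes:
 assumes "test_function (phi :: 'a::euclidean_space => real)"
 obtains R where "!!x bs. R <= norm x ==> iter_deriv bs phi x = 0"
proof -
 have "bounded {x. phi x ~= 0}"
  using assms compact_imp_bounded bounded_closure_image closure_subset bounded_subset unfolding test_function_def by metis
 then obtain R where R: "!!x. phi x ~= 0 ==> norm x <= R" unfolding bounded_iff by blast
 have o: "open {x::'a. R < norm x}" by(intro open_Collect_less continuous_intros)
 have "ALL x:{x. R < norm x}. iter_deriv bs phi x = 0" for bs
 proof(induction bs)
  case Nil
  thus ?case using R by fastforce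
 next
  case (Cons b bs)
  show ?case
  proof
   fix x assume x: "x : {x::'a. R < norm x}"
   have "dir_deriv b (iter_deriv bs phi) x = dir_deriv b (%x. 0) x"
    by(rule dir_deriv_cong_on[OF o x]) (use Cons in auto)
   thus "iter_deriv(b # bs) phi x = 0" by(simp add: dir_deriv_eqI[OF has_derivative_const])
  qed
 qed
 hence "iter_deriv bs phi x = 0" if "R + 1 <= norm x" for x bs using that by auto
 thus thesis by(rule that)
qed

text \<open>The function \<open>u * d phi - (d u) * phi\<close> has compact support and derivative
  \<open>u * dd phi - (dd u) * phi\<close>, so one vanishing integral moves both
  derivatives.\<close>

lemma integral_by_parts_second:
 fixes u phi :: "'a::euclidean_space => real"
 assumes u: "smooth_on UNIV u" and phi: "test_function phi" and b: "b : Basis"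
 shows "(LINT x. u x*iter_deriv [b, b] phi x) = (LINT x. iter_deriv [b, b] u x*phi x)"
proof -
 have sp: "smooth_on UNIV phi" using phi by(simp add: test_function_def)
 obtain R where R: "!!x bs. R <= norm x ==> iter_deriv bs phi x = 0" by(rule test_function_vanishes[OF phi]) blast
 note d = smooth_on_dir_deriv[OF _ b]
 define F where "F x = u x*dir_deriv b phi x + (- 1)*(dir_deriv b u x*phi x)" for x
 have sF: "smooth_on UNIV F"
  unfolding F_def by(intro smooth_on_add smooth_on_mult smooth_on_const open_UNIV u sp d)
 have dF: "dir_deriv b F x = u x*dir_deriv b (dir_deriv b phi) x - dir_deriv b (dir_deriv b u) x*phi x" for x
 proof -
  have "(F has_derivative (%e. (u x*dir_deriv e (dir_deriv b phi) x + dir_deriv e u x*dir_deriv b phi x)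
    + (- 1)*(dir_deriv b u x*dir_deriv e phi x + dir_deriv e (dir_deriv b u) x*phi x))) (at x)"
   unfolding F_def
   by(intro has_derivative_add has_derivative_mult has_derivative_mult_right smooth_on_has_derivative[where U=UNIV] u sp d) auto
  from dir_deriv_eqI[OF this, of b] show ?thesis by simp
 qed
 have F0: "F x = 0" if "R <= norm x" for x
  using R[OF that, of "[]"] R[OF that, of "[b]"] by(simp add: F_def)
 have "(LINT x. dir_deriv b F x) = 0" by(rule integral_dir_deriv_eq_0(2)[OF _ _ F0])
   (auto intro: smooth_on_differentiable[OF sF] smooth_on_continuous_on[OF d[OF sF]])
 moreover have i: "L1 (%x. f x*iter_deriv bs phi x)"
  if "smooth_on UNIV f" "bs : lists Basis" for f bs
 proof -
  have "L1 (%x. indicator (cball 0 R) x *\<^sub>R (f x*iter_deriv bs phi x))"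
   by(rule borel_integrable_compact)
    (auto intro!: continuous_on_mult continuous_on_subset[OF smooth_on_continuous_on[OF that(1)]]
     continuous_on_subset[OF smooth_on_continuous_on[OF smooth_on_iter_deriv[OF sp that(2)]]])
  moreover have "(%x. indicator (cball 0 R) x *\<^sub>R (f x*iter_deriv bs phi x)) = (%x. f x*iter_deriv bs phi x)"
   using R[of _ bs] by(auto simp: indicator_def fun_eq_iff)
  ultimately show ?thesis by(simp only:)
 qed
 ultimately show ?thesis
  unfolding dF using i[OF u, of "[b, b]"] i[OF d[OF d[OF u]], of "[]"] b by simp
qed

text \<open>Smooth cutoffs give vanishing integrals over all boxes; boxes are stable under
  intersection and generate the Borel sets, so the signed measure with density \<open>k\<close>
  vanishes locally.\<close>

lemma AE_eq_0_of_test_functions: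
 fixes k :: "'a::euclidean_space => real"
 assumes k: "L1_loc k" and z: "!!phi. test_function phi ==> (LINT x|lebesgue. k x*phi x) = 0"
 shows "AE x in lebesgue. k x = 0"
proof -
 have km: "set_integrable lebesgue (cbox a c) k" for a c using k by(simp add: L1_loc_def)
 have boxi: "set_integrable lebesgue (box a c) k" for a c
  by(rule set_integrable_subset[OF km[of a c]]) (auto simp: box_subset_cbox)
 have box0: "(LINT x|lebesgue. indicator (box a c) x * k x) = 0" for a c
 proof -
  have "(%n. LINT x|lebesgue. k x*box_cutoff a c n x) \<longlonglongrightarrow> (LINT x|lebesgue. indicator (box a c) x * k x)"
  proof(rule integral_dominated_convergence[where w="%x. \<bar>indicator (box a c) x * k x\<bar>"])
   show i: "integrable lebesgue (%x. \<bar>indicator (box a c) x * k x\<bar>)"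
    using boxi[of a c] by(intro integrable_abs) (simp add: set_integrable_def)
   show m: "(%x. indicator (box a c) x * k x) : borel_measurable lebesgue"
    using boxi[of a c] by(auto simp: set_integrable_def dest: borel_measurable_integrable)
   show "(%x. k x*box_cutoff a c n x) : borel_measurable lebesgue" for n
   proof -
    have "box_cutoff a c n : borel_measurable borel"
     using box_cutoff_test[of a c n] smooth_on_continuous_on
     by(intro borel_measurable_continuous_onI) (auto simp: test_function_def)
    hence "box_cutoff a c n : borel_measurable lebesgue" by(intro measurable_completion) simp
    from borel_measurable_times[OF m this] show ?thesis
    proof(rule measurable_cong[THEN iffD1, rotated])
     fix x
     show "indicator (box a c) x * k x*box_cutoff a c n x = k x*box_cutoff a c n x"
      using box_cutoff_le[of a c n x] by(auto simp: indicator_def split: if_splits)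
    qed
   qed
   show "AE x in lebesgue. (%n. k x*box_cutoff a c n x) \<longlonglongrightarrow> indicator (box a c) x * k x"
    using tendsto_mult[OF tendsto_const box_cutoff_tendsto] by(intro AE_I2) (simp add: mult.commute)
   show "AE x in lebesgue. norm(k x*box_cutoff a c n x) <= \<bar>indicator (box a c) x * k x\<bar>" for n
    using mult_left_mono[OF box_cutoff_le[of a c n], of "\<bar>k _\<bar>"] by(intro AE_I2) (simp add: abs_mult mult.commute)
  qed
  hence "(%n. 0 :: real) \<longlonglongrightarrow> (LINT x|lebesgue. indicator (box a c) x * k x)"
   using z[OF box_cutoff_test] by simp
  thus ?thesis using LIMSEQ_unique tendsto_const by blast
 qed
 have cell: "AE x in lebesgue. x : box (- (real n *\<^sub>R One)) (real n *\<^sub>R One) --> k x = 0" for n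
 proof -
  define B where "B = box (- (real n *\<^sub>R One)) (real n *\<^sub>R One :: 'a)"
  have Bi: "integrable lebesgue (%x. indicator B x * k x)"
   using boxi unfolding B_def set_integrable_def by simp
  \<comment> \<open>\<open>k\<close> is only Lebesgue measurable and only locally integrable; cut
    off to \<open>B\<close> it has an integrable Borel version \<open>g\<close>, to which the
    generator argument applies.\<close>
  obtain g where g[measurable]: "g : borel_measurable lborel" "AE x in lborel. indicator B x * k x = g x"
   using completion_ex_borel_measurable_real[OF borel_measurable_integrable[OF Bi]] by blast
  have gl: "AE x in lebesgue. indicator B x * k x = g x" using g(2) by(rule AE_completion)
  have gi: "L1 g"
  proof -
   have "integrable lebesgue g" using Bi gl g(1)
    by(subst integrable_cong_AE[of _ _ "%x. indicator B x * k x"]) (auto intro: measurable_completion)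
   thus ?thesis using g(1) by(simp add: integrable_completion)
  qed
  have gb: "(LINT x. indicator (box a c) x*g x) = 0" for a c
  proof -
   obtain a' c' where ac: "box a c \<inter> B = box a' c'" using box_Int_box unfolding B_def by blast
   have "(LINT x. indicator (box a c) x*g x) = (LINT x|lebesgue. indicator (box a c) x*g x)"
    by(rule integral_completion[symmetric]) measurable
   also have "... = (LINT x|lebesgue. indicator (box a' c') x * k x)"
   proof(rule integral_cong_AE)
    show "(%x. indicator (box a c) x*g x) : borel_measurable lebesgue" by(intro measurable_completion) measurable
    show "(%x. indicator (box a' c') x * k x) : borel_measurable lebesgue"
     using boxi[of a' c'] by(auto simp: set_integrable_def dest: borel_measurable_integrable)
    show "AE x in lebesgue. indicator (box a c) x*g x = indicator (box a' c') x * k x"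
     using gl unfolding ac[symmetric] by eventually_elim (auto simp: indicator_def)
   qed
   also have "... = 0" by(rule box0)
   finally show ?thesis .
  qed
  define G where "G A = (LINT x. indicator A x*g x)" for A
  have Gi: "L1 (%x. indicator A x*g x)" if "A : sets borel" for A
   using integrable_mult_indicator[of A lborel g] that gi by simp
  have GU: "G UNIV = 0"
  proof -
   have "(%m. G(box (- (real m *\<^sub>R One)) (real m *\<^sub>R One))) \<longlonglongrightarrow> G UNIV"
    unfolding G_def
   proof(rule integral_dominated_convergence[where w="%x. \<bar>g x\<bar>"])
    show "AE x in lborel. (%m. indicator (box (- (real m *\<^sub>R One)) (real m *\<^sub>R One)) x*g x) \<longlonglongrightarrow> indicator UNIV x*g x"
    proof(rule AE_I2, rule tendsto_eventually)
     fix x :: 'a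
     obtain N :: nat where N: "norm x < real N" using reals_Archimedean2 by blast
     have "x : box (- (real m *\<^sub>R One)) (real m *\<^sub>R One)" if "N <= m" for m
     proof -
      have "\<bar>x \<bullet> b\<bar> < real m" if "b : Basis" for b
       using Basis_le_norm[OF that, of x] N \<open>N <= m\<close> by linarith
      thus ?thesis by(auto simp: mem_box abs_less_iff minus_less_iff)
     qed
     thus "\<forall>\<^sub>F m in sequentially. indicator (box (- (real m *\<^sub>R One)) (real m *\<^sub>R One)) x*g x = indicator UNIV x*g x"
      by(intro eventually_sequentiallyI[of N]) simp
    qed
   qed(use gi in \<open>auto simp: indicator_def\<close>)
   hence "(%m. 0 :: real) \<longlonglongrightarrow> G UNIV" by(simp add: G_def gb)
   thus ?thesis using LIMSEQ_unique tendsto_const by blast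
  qed
  have G0: "G A = 0" if "A : sets borel" for A
  proof -
   have A: "A : sigma_sets UNIV (range (%(a, c). box a c :: 'a set))"
    using that by(simp add: borel_eq_box)
   have st: "Int_stable (range (%(a, c). box a c :: 'a set))" unfolding Int_stable_def
   proof(intro ballI)
    fix X Y :: "'a set" assume "X : range (%(a, c). box a c)" "Y : range (%(a, c). box a c)"
    then obtain a c a' c' where "X = box a c" "Y = box a' c'" by auto
    hence "X \<inter> Y = (%(a, c). box a c) (\<Sum>i\<in>Basis. max (a\<bullet>i) (a'\<bullet>i) *\<^sub>R i, \<Sum>i\<in>Basis. min (c\<bullet>i) (c'\<bullet>i) *\<^sub>R i)"
     by(simp add: box_Int_box)
    thus "X \<inter> Y : range (%(a, c). box a c)" by blast
   qed
   have Pw: "range (%(a, c). box a c :: 'a set) \<subseteq> Pow UNIV" by simp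
   from st Pw A show ?thesis
   proof(induction rule: sigma_sets_induct_disjoint)
    case (basic A)
    thus ?case using gb by(auto simp: G_def)
   next
    case (compl A)
    hence [measurable]: "A : sets borel" by(simp add: borel_eq_box)
    have "G(UNIV - A) = G UNIV - G A"
    proof -
     have "G UNIV - G A = (LINT x. indicator UNIV x*g x - indicator A x*g x)"
      unfolding G_def by(rule integral_diff[symmetric]) (rule Gi; simp)+
     also have "... = G(UNIV - A)"
      unfolding G_def by(intro Bochner_Integration.integral_cong) (auto simp: indicator_def)
     finally show ?thesis by simp
    qed
    thus ?case using compl GU by simp
   next
    case (union A)
    hence [measurable]: "A i : sets borel" for i by(auto simp: borel_eq_box)
    have "G(\<Union>i. A i) = (\<Sum>i. G(A i))"
    proof -
     have "set_integrable lborel (\<Union>i. A i) g"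
      using Gi[of "\<Union>i. A i"] by(simp add: set_integrable_def)
     moreover have "A i \<inter> A j = {}" if "i ~= j" for i j
      using union that by(auto simp: disjoint_family_on_def)
     ultimately show ?thesis
      using lebesgue_integral_countable_add[of A lborel g] by(simp add: G_def set_lebesgue_integral_def)
    qed
    thus ?case using union by simp
   qed(auto simp: G_def)
  qed
  have "AE x in lborel. g x = 0"
   by(rule sigma_finite_measure.density_zero[OF lborel.sigma_finite_measure_axioms gi]) (use G0 in \<open>auto simp: G_def set_lebesgue_integral_def\<close>)
  hence "AE x in lebesgue. g x = 0" by(rule AE_completion)
  with gl show ?thesis unfolding B_def[symmetric] by eventually_elim (auto simp: indicator_def split: if_splits)
 qed
 hence "AE x in lebesgue. ALL n. x : box (- (real n *\<^sub>R One)) (real n *\<^sub>R One) --> k x = 0"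
  using AE_all_countable[of "%n x. x : box (- (real n *\<^sub>R One)) (real n *\<^sub>R One) --> k x = 0" lebesgue] by blast
 thus ?thesis
 proof eventually_elim
  case (elim x)
  obtain N :: nat where N: "norm x < real N" using reals_Archimedean2 by blast
  have "\<bar>x \<bullet> b\<bar> < real N" if "b : Basis" for b
   using Basis_le_norm[OF that, of x] N by linarith
  hence "x : box (- (real N *\<^sub>R One)) (real N *\<^sub>R One)" by(auto simp: mem_box abs_less_iff minus_less_iff)
  thus ?case using elim by blast
 qed
qed

lemma L1_loc_continuous:
 assumes "continuous_on UNIV v"
 shows "L1_loc v" unfolding L1_loc_def
proof(intro allI impI)
 fix K :: "'a set" assume K: "compact K"
 have i: "L1 (%x. indicator K x *\<^sub>R v x)"
  by(rule borel_integrable_compact[OF K continuous_on_subset[OF assms subset_UNIV]])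
 thus "v absolutely_integrable_on K"
  unfolding set_integrable_def using integrable_completion[OF borel_measurable_integrable[OF i]] by blast
qed

lemma L1_loc_sum:
 fixes H :: "'i => 'a::euclidean_space => real"
 assumes "!!i. i : I ==> L1_loc (H i)"
 shows "L1_loc (%x. \<Sum>i\<in>I. H i x)"
proof -
 have "set_integrable lebesgue K (%x. \<Sum>i\<in>I. H i x)" if "compact K" for K
  using assms that unfolding L1_loc_def set_integrable_def scaleR_sum_right
  by(intro Bochner_Integration.integrable_sum) blast
 thus ?thesis by(simp add: L1_loc_def)
qed

lemma L1_loc_diff:
 assumes "L1_loc v" "L1_loc w"
 shows "L1_loc (%x. v x - w x)"
 using assms unfolding L1_loc_def by(auto intro: set_integral_diff(1))

lemma L1_loc_mult_test:
 fixes v psi :: "'a::euclidean_space => real"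
 assumes v: "L1_loc v" and c: "continuous_on UNIV psi" and z: "!!x. R <= norm x ==> psi x = 0"
 shows "integrable lebesgue (%x. v x*psi x)"
proof -
 have i: "integrable lebesgue (%x. indicator (cball 0 R) x * v x)"
  using v compact_cball unfolding L1_loc_def set_integrable_def by force
 have "bounded (psi ` cball 0 R)"
  by(intro compact_imp_bounded compact_continuous_image continuous_on_subset[OF c]) auto
 then obtain M where "ALL y:psi ` cball 0 R. norm y <= M" unfolding bounded_iff by blast
 hence M: "\<bar>psi x\<bar> <= M" if "x : cball 0 R" for x using that by(simp add: image_iff)
 have pm: "psi : borel_measurable lebesgue" using borel_measurable_continuous_onI[OF c] by(intro measurable_completion) simp
 have e: "(indicator (cball 0 R) x * v x)*psi x = v x*psi x" for x
  using z[of x] by(cases "x : cball 0 R") auto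
 have "integrable lebesgue (%x. (indicator (cball 0 R) x * v x)*psi x)"
 proof(rule integrable_bound[OF integrable_mult_left[OF i, of M]])
  show "(%x. (indicator (cball 0 R) x * v x)*psi x) : borel_measurable lebesgue"
   by(intro borel_measurable_times[OF borel_measurable_integrable[OF i] pm])
  show "AE x in lebesgue. norm((indicator (cball 0 R) x * v x)*psi x) <= norm((indicator (cball 0 R) x * v x)*M)"
  proof(rule AE_I2)
   fix x
   show "norm((indicator (cball 0 R) x * v x)*psi x) <= norm((indicator (cball 0 R) x * v x)*M)"
    using M[of x] by(cases "x : cball 0 R") (auto simp: abs_mult intro!: mult_left_mono)
  qed
 qed
 thus ?thesis unfolding e .
qed

lemma weak_laplacian_eq_laplacian:
 fixes u w :: "'a::euclidean_space => real"
 assumes u: "smooth_on UNIV u" and w: "weak_laplacian u w"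
 shows "AE x in lebesgue. w x = laplacian u x"
proof -
 obtain H where H: "!!b. b : Basis ==> weak_deriv [b, b] u (H b)" and wH: "!!x. w x = (\<Sum>b\<in>Basis. H b x)"
  using w unfolding weak_laplacian_def by blast
 have Hl: "L1_loc (H b)" if "b : Basis" for b using H[OF that] by(simp add: weak_deriv_def)
 have cd: "continuous_on UNIV (iter_deriv [b, b] u)" if "b : Basis" for b
  using smooth_on_continuous_on[OF smooth_on_iter_deriv[OF u, of "[b, b]"]] that by simp
 have cl: "continuous_on UNIV (laplacian u)"
  unfolding laplacian_def[abs_def] by(intro continuous_on_sum cd)
 have "AE x in lebesgue. w x - laplacian u x = 0"
 proof(rule AE_eq_0_of_test_functions)
  have "L1_loc w" unfolding wH[abs_def] by(rule L1_loc_sum[OF Hl])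
  thus "L1_loc (%x. w x - laplacian u x)" by(rule L1_loc_diff[OF _ L1_loc_continuous[OF cl]])
  fix phi :: "'a => real" assume phi: "test_function phi"
  obtain R where R: "!!x bs. R <= norm x ==> iter_deriv bs phi x = 0" by(rule test_function_vanishes[OF phi]) blast
  have cp: "continuous_on UNIV phi" using phi smooth_on_continuous_on by(auto simp: test_function_def)
  note i = L1_loc_mult_test[OF _ cp, of _ R]
  have z: "phi x = 0" if "R <= norm x" for x using R[OF that, of "[]"] by simp
  have each: "(LINT x|lebesgue. H b x*phi x) = (LINT x|lebesgue. iter_deriv [b, b] u x*phi x)" if b: "b : Basis" for b
  proof -
   have "(LINT x|lebesgue. H b x*phi x) = (LINT x|lebesgue. u x*iter_deriv [b, b] phi x)"
    using H[OF b] phi by(simp add: weak_deriv_def)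
   also have "... = (LINT x. u x*iter_deriv [b, b] phi x)"
   proof(rule integral_completion)
    have "continuous_on UNIV (%x. u x*iter_deriv [b, b] phi x)"
     using phi b by(intro continuous_on_mult smooth_on_continuous_on u smooth_on_iter_deriv) (auto simp: test_function_def)
    thus "(%x. u x*iter_deriv [b, b] phi x) : borel_measurable lborel"
     using borel_measurable_continuous_onI by auto
   qed
   also have "... = (LINT x. iter_deriv [b, b] u x*phi x)" by(rule integral_by_parts_second[OF u phi b])
   also have "... = (LINT x|lebesgue. iter_deriv [b, b] u x*phi x)"
   proof(rule integral_completion[symmetric])
    have "continuous_on UNIV (%x. iter_deriv [b, b] u x*phi x)" by(intro continuous_on_mult cd b cp)
    thus "(%x. iter_deriv [b, b] u x*phi x) : borel_measurable lborel"
     using borel_measurable_continuous_onI by auto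
   qed
   finally show ?thesis .
  qed
  have "(LINT x|lebesgue. (w x - laplacian u x)*phi x)
    = (LINT x|lebesgue. (\<Sum>b\<in>Basis. H b x*phi x - iter_deriv [b, b] u x*phi x))"
   by(simp add: wH laplacian_def sum_subtractf left_diff_distrib sum_distrib_right)
  also have "... = (\<Sum>b\<in>Basis. LINT x|lebesgue. H b x*phi x - iter_deriv [b, b] u x*phi x)"
  proof(rule Bochner_Integration.integral_sum)
   fix b :: 'a assume b: "b : Basis"
   show "integrable lebesgue (%x. H b x*phi x - iter_deriv [b, b] u x*phi x)"
    using i[OF Hl[OF b] z] i[OF L1_loc_continuous[OF cd[OF b]] z] by(rule integrable_diff)
  qed
  also have "... = (\<Sum>b\<in>(Basis::'a set). (0::real))"
  proof(rule sum.cong[OF refl])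
   fix b :: 'a assume b: "b : Basis"
   have "(LINT x|lebesgue. H b x*phi x - iter_deriv [b, b] u x*phi x)
    = (LINT x|lebesgue. H b x*phi x) - (LINT x|lebesgue. iter_deriv [b, b] u x*phi x)"
    using i[OF Hl[OF b] z] i[OF L1_loc_continuous[OF cd[OF b]] z] by(rule integral_diff)
   thus "(LINT x|lebesgue. H b x*phi x - iter_deriv [b, b] u x*phi x) = 0" using each[OF b] by simp
  qed
  finally show "(LINT x|lebesgue. (w x - laplacian u x)*phi x) = 0" by simp
 qed
 thus ?thesis by eventually_elim simp
qed

text \<open>The weak Laplacian in the notion of solution is replaced by the classical one, which is
  continuous. The differences obtained from the heat kernels, taken from the base point 0, then fix
  \<open>L\<close>.\<close>

theorem laplacian_eq_riesz_potential:
 fixes u :: "real^3 => real"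
 assumes u: "smooth_on UNIV u"
  and sol: "three_halves_laplace_solution u (distribution_of (%x. 2*exp(3*u x)))"
  and int: "L1 (%x. exp(3*u x))"
 obtains L where "!!x. - laplacian u x = L + 1/pi^2*(LINT y. exp(3*u y)/norm(x - y)^2)"
proof -
 obtain w where w: "weak_laplacian u w" "L_half w"
  and eq: "!!phi. schwartz phi ==> (LINT x|lebesgue. complex_of_real(- w x)*half_laplacian phi x) = distribution_of (%x. 2*exp(3*u x)) phi"
  using sol unfolding three_halves_laplace_solution_def by blast
 have ae: "AE x in lebesgue. w x = laplacian u x" by(rule weak_laplacian_eq_laplacian[OF u w(1)])
 have cd: "continuous_on UNIV (iter_deriv [b, b] u)" if "b : Basis" for b
  using smooth_on_continuous_on[OF smooth_on_iter_deriv[OF u, of "[b, b]"]] that by simp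
 have cl: "continuous_on UNIV (%x. - laplacian u x)"
  unfolding laplacian_def[abs_def] by(intro continuous_on_minus continuous_on_sum cd)
 have [measurable]: "(%x. - laplacian u x) : borel_measurable borel" by(rule borel_measurable_continuous_onI[OF cl])
 have cf: "continuous_on UNIV (%x. exp(3*u x))" by(intro continuous_intros smooth_on_continuous_on[OF u])
 have [measurable]: "(%x. exp(3*u x)) : borel_measurable borel" by(rule borel_measurable_continuous_onI[OF cf])
 have iW: "L1 (%y. \<bar>- laplacian u y\<bar>/(1 + norm y^4))"
 proof -
  have "integrable lebesgue (%y. \<bar>- laplacian u y\<bar>/(1 + norm y^4))"
  proof(rule integrable_cong_AE_imp)
   show "integrable lebesgue (%x. \<bar>w x\<bar>/(1 + norm x^4))" using w(2) by(simp add: L_half_def)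
   show "(%y. \<bar>- laplacian u y\<bar>/(1 + norm y^4)) : borel_measurable lebesgue"
    by(intro measurable_completion) measurable
   show "AE x in lebesgue. \<bar>w x\<bar>/(1 + norm x^4) = \<bar>- laplacian u x\<bar>/(1 + norm x^4)"
    using ae by eventually_elim simp
  qed
  thus ?thesis by(subst (asm) integrable_completion) measurable
 qed
 have eq': "(LINT x. complex_of_real(- laplacian u x)*half_laplacian phi x) = (LINT x. complex_of_real(2*exp(3*u x))*phi x)"
  if "phi = (%y. complex_of_real(heat_diff a b s y))" "0 < s" for phi a b s
 proof -
  have sch: "schwartz phi" unfolding that(1) by(rule heat_diff_schwartz[OF that(2)])
  have hl: "half_laplacian phi = (%y. complex_of_real(heat_diff_half a b s y))"
   unfolding that(1) by(rule half_laplacian_heat_diff[OF that(2)])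
  have "(LINT x. complex_of_real(- laplacian u x)*half_laplacian phi x) = (LINT x|lebesgue. complex_of_real(- laplacian u x)*half_laplacian phi x)"
   unfolding hl by(rule integral_completion[symmetric]) measurable
  also have "... = (LINT x|lebesgue. complex_of_real(- w x)*half_laplacian phi x)"
  proof(rule integral_cong_AE)
   have hm: "half_laplacian phi : borel_measurable lebesgue" unfolding hl by(intro measurable_completion) measurable
   show "(%x. complex_of_real(- laplacian u x)*half_laplacian phi x) : borel_measurable lebesgue"
    unfolding hl by(intro measurable_completion) measurable
   have "L1_loc w" using w(2) by(simp add: L_half_def)
   hence wi: "integrable lebesgue (%x. indicator (cball 0 (real n)) x *\<^sub>R w x)" for n
    using compact_cball unfolding L1_loc_def set_integrable_def by blast
   have "w : borel_measurable lebesgue"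
   proof(rule borel_measurable_LIMSEQ_real[where u="%n x. indicator (cball 0 (real n)) x *\<^sub>R w x", OF _ borel_measurable_integrable[OF wi]])
    fix x :: "real^3"
    obtain N :: nat where N: "norm x < real N" using reals_Archimedean2 by blast
    hence "\<forall>\<^sub>F n in sequentially. indicator (cball 0 (real n)) x *\<^sub>R w x = w x"
     by(intro eventually_sequentiallyI[of N]) auto
    thus "(%n. indicator (cball 0 (real n)) x *\<^sub>R w x) \<longlonglongrightarrow> w x" by(rule tendsto_eventually)
   qed
   thus "(%x. complex_of_real(- w x)*half_laplacian phi x) : borel_measurable lebesgue"
    using hm by measurable
   show "AE x in lebesgue. complex_of_real(- laplacian u x)*half_laplacian phi x = complex_of_real(- w x)*half_laplacian phi x"
    using ae by eventually_elim simp
  qed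
  also have "... = (LINT x|lebesgue. complex_of_real(2*exp(3*u x))*phi x)"
   using eq[OF sch] by(simp add: distribution_of_def)
  also have "... = (LINT x. complex_of_real(2*exp(3*u x))*phi x)"
   unfolding that(1) by(rule integral_completion) measurable
  finally show ?thesis .
 qed
 have diff: "- laplacian u x - - laplacian u 0 = 1/pi^2*((LINT y. exp(3*u y)/norm(x - y)^2) - (LINT y. exp(3*u y)/norm(0 - y)^2))" for x
  by(rule half_laplacian_solution_potential[OF cl iW cf int eq']) auto
 have "- laplacian u x = (- laplacian u 0 - 1/pi^2*(LINT y. exp(3*u y)/norm(0 - y)^2))
   + 1/pi^2*(LINT y. exp(3*u y)/norm(x - y)^2)" for x
  using diff[of x] unfolding right_diff_distrib by linarith
 thus thesis by(rule that)
qed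

section \<open>Mean values of the logarithmic potential and of \<open>p\<close>\<close>

section \<open>Weighted means over balls\<close>

definition mean_weight :: "real^3 => real" where "mean_weight y = max 0 (1 - (norm y)^2)"

text \<open>Its gradient is \<open>- mean_weight y * y\<close>, so the radial derivative of a mean
  becomes a mean of the Laplacian after integration by parts. It is continuously differentiable with
  support in the unit ball, and surface measures are avoided.\<close>

definition mean_primitive :: "real^3 => real" where
 "mean_primitive y = (mean_weight y)^2/4"

lemma mean_weight_bounds: "0 <= mean_weight y" "mean_weight y <= indicator (cball 0 1) y"
 by(auto simp: mean_weight_def indicator_def abs_square_le_1 power_le_one_iff not_le one_le_power less_imp_le)

lemma mean_weight_outside: "1 <= norm y ==> mean_weight y = 0"
 using one_le_power[of "norm y" 2] by(simp add: mean_weight_def)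

lemma continuous_on_mean_weight: "continuous_on UNIV mean_weight"
 unfolding mean_weight_def[abs_def] by(intro continuous_intros)

lemma mean_weight_measurable [measurable]: "mean_weight : borel_measurable borel"
 by(rule borel_measurable_continuous_onI[OF continuous_on_mean_weight])

lemma mean_primitive_bounds: "0 <= mean_primitive y" "mean_primitive y <= indicator (cball 0 1) y"
proof -
 show "0 <= mean_primitive y" by(simp add: mean_primitive_def)
 have "(mean_weight y)^2 <= (indicator (cball 0 1) y)^2" using mean_weight_bounds by(intro power_mono) auto
 also have "... = indicator (cball 0 1) y" by(simp add: indicator_def)
 finally show "mean_primitive y <= indicator (cball 0 1) y"
  using indicator_pos_le[of "cball 0 1" y, where 'a=real] unfolding mean_primitive_def by linarith
qed

lemma continuous_on_mean_primitive: "continuous_on UNIV mean_primitive"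
 unfolding mean_primitive_def[abs_def] by(intro continuous_intros continuous_on_mean_weight) auto

lemma mean_primitive_measurable [measurable]: "mean_primitive : borel_measurable borel"
 by(rule borel_measurable_continuous_onI[OF continuous_on_mean_primitive])

lemma mean_primitive_has_derivative:
 "(mean_primitive has_derivative (%b. - (mean_weight y*(y \<bullet> b)))) (at y)"
proof -
 define h where "h t = (max 0 t)^2/4" for t :: real
 have h: "(h has_real_derivative max 0 t/2) (at t)" for t
 proof -
  consider "0 < t" | "t < 0" | "t = 0" by linarith
  thus ?thesis
  proof cases
   case 1
   have "((%t. t^2/4) has_real_derivative max 0 t/2) (at t)"
    using 1 by(auto intro!: derivative_eq_intros)
   thus ?thesis
    by(rule has_field_derivative_transform_within_open[of _ _ _ "{0<..}"]) (use 1 in \<open>auto simp: h_def\<close>)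
  next
   case 2
   have "((%t. 0) has_real_derivative max 0 t/2) (at t)" using 2 by simp
   thus ?thesis
    by(rule has_field_derivative_transform_within_open[of _ _ _ "{..<0}"]) (use 2 in \<open>auto simp: h_def\<close>)
  next
   case 3
   have "((%k. h k/k) \<longlongrightarrow> 0) (at 0)"
   proof(rule Lim_null_comparison)
    show "\<forall>\<^sub>F k in at 0. norm(h k/k) <= \<bar>k\<bar>"
     by(rule always_eventually) (auto simp: h_def max_def power2_eq_square)
    show "((%k. \<bar>k\<bar>) \<longlongrightarrow> 0) (at(0::real))" by(intro tendsto_rabs_zero tendsto_ident_at)
   qed
   thus ?thesis using 3 by(simp add: DERIV_def h_def)
  qed
 qed
 have q: "((%y::real^3. 1 - (norm y)^2) has_derivative (%b. - 2*(y \<bullet> b))) (at y)"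
  unfolding power2_norm_eq_inner by(auto intro!: derivative_eq_intros simp: inner_commute)
 have "((%y. h(1 - (norm y)^2)) has_derivative (%b. max 0 (1 - (norm y)^2)/2*(- 2*(y \<bullet> b)))) (at y)"
  by(rule has_derivative_compose[OF q h[unfolded has_field_derivative_def]])
 thus ?thesis by(simp add: h_def mean_primitive_def[abs_def] mean_weight_def)
qed

text \<open>Not normalised: a constant \<open>c\<close> has the mean
  \<open>c * LI mean_weight\<close>.\<close>

definition weighted_mean :: "(real^3 => real) => real^3 => real => real" where
 "weighted_mean g x R = (LINT y. g(x + R *\<^sub>R y)*mean_weight y)"

lemma integrable_mult_ball:
 fixes g k :: "real^3 => real"
 assumes g: "continuous_on UNIV g" and k: "k : borel_measurable borel" "!!y. 0 <= k y" "!!y. k y <= indicator (cball 0 1) y"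
 shows "L1 (%y. g(x + R *\<^sub>R y) * k y)"
proof -
 have c: "continuous_on UNIV (%y. g(x + R *\<^sub>R y))"
  by(intro continuous_on_compose2[OF g] continuous_intros) auto
 have [measurable]: "(%y. g(x + R *\<^sub>R y)) : borel_measurable borel" by(rule borel_measurable_continuous_onI[OF c])
 have [measurable]: "k : borel_measurable borel" by(rule k)
 have i: "L1 (%y. indicator (cball 0 1) y *\<^sub>R g (x + R *\<^sub>R y))"
  by(rule borel_integrable_compact) (use c continuous_on_subset in auto)
 show ?thesis
 proof(rule integrable_bound[OF i])
  show "AE y in lborel. norm(g(x + R *\<^sub>R y) * k y) <= norm(indicator (cball 0 1) y *\<^sub>R g (x + R *\<^sub>R y))"
  proof(rule AE_I2)
   fix y
   have "\<bar>g(x + R *\<^sub>R y)\<bar>*\<bar>k y\<bar> <= \<bar>g(x + R *\<^sub>R y)\<bar>*indicator (cball 0 1) y"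
    using k(2,3)[of y] by(intro mult_left_mono) auto
   thus "norm(g(x + R *\<^sub>R y) * k y) <= norm(indicator (cball 0 1) y *\<^sub>R g (x + R *\<^sub>R y))"
    by(simp add: abs_mult mult.commute)
  qed
 qed measurable
qed

text \<open>Differentiation in \<open>r\<close> pairs the gradient of \<open>g\<close> with
  \<open>y * mean_weight y\<close>, minus the gradient of \<open>mean_primitive\<close>. Moving that
  gradient over differentiates \<open>g (x + r y)\<close> in \<open>y\<close> once more, whence the
  factor \<open>r\<close>.\<close>

lemma weighted_mean_has_derivative:
 assumes g: "smooth_on UNIV g"
 shows "((%r. weighted_mean g x r) has_real_derivative r*(LINT y. laplacian g (x + r *\<^sub>R y)*mean_primitive y)) (at r)"
proof -
 define G where "G b y = dir_deriv b g (x + r *\<^sub>R y)*((y \<bullet> b)*mean_weight y)" for b y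
 have cg: "continuous_on UNIV g" by(rule smooth_on_continuous_on[OF g])
 have cd: "continuous_on UNIV (dir_deriv b g)" if "b : Basis" for b
  by(rule smooth_on_continuous_on[OF smooth_on_dir_deriv[OF g that]])
 have diffg: "((%t. g(x + t *\<^sub>R y)) has_real_derivative (\<Sum>b\<in>Basis. dir_deriv b g (x + t *\<^sub>R y)*(y \<bullet> b))) (at t)" for t y
 proof -
  have d: "(g has_derivative (%e. dir_deriv e g (x + t *\<^sub>R y))) (at(x + t *\<^sub>R y))"
   by(rule smooth_on_has_derivative[OF g]) simp
  have "dir_deriv y g (x + t *\<^sub>R y) = (\<Sum>b\<in>Basis. (y \<bullet> b) *\<^sub>R dir_deriv b g (x + t *\<^sub>R y))"
  proof -
   interpret linear "%e. dir_deriv e g (x + t *\<^sub>R y)" by(rule has_derivative_linear[OF d])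
   have "dir_deriv (\<Sum>b\<in>Basis. (y \<bullet> b) *\<^sub>R b) g (x + t *\<^sub>R y) = (\<Sum>b\<in>Basis. (y \<bullet> b) *\<^sub>R dir_deriv b g (x + t *\<^sub>R y))"
    by(simp add: sum scale)
   thus ?thesis by(simp add: euclidean_representation)
  qed
  thus ?thesis
   using has_real_derivative_dir_deriv[OF smooth_on_differentiable[OF g UNIV_I], where x=x and t=t and b=y]
   by(simp add: has_real_derivative_iff_has_vector_derivative mult.commute)
 qed
 obtain M where M: "!!t y. \<bar>t - r\<bar> < 1 ==> norm y <= 1 ==> \<bar>\<Sum>b\<in>Basis. dir_deriv b g (x + t *\<^sub>R y)*(y \<bullet> b)\<bar> <= M"
 proof -
  define H where "H p = (\<Sum>b\<in>Basis. dir_deriv b g (x + fst p *\<^sub>R snd p)*(snd p \<bullet> b))" for p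
  have "compact (H ` (cball r 1 \<times> cball 0 1))" unfolding H_def
   by(intro compact_continuous_image compact_Times compact_cball)
    (auto intro!: continuous_intros continuous_on_compose2[OF cd])
  hence "bounded (H ` (cball r 1 \<times> cball 0 1))" by(rule compact_imp_bounded)
  then obtain M where M: "ALL z:H ` (cball r 1 \<times> cball 0 1). norm z <= M" unfolding bounded_iff by(rule exE)
  have "\<bar>\<Sum>b\<in>Basis. dir_deriv b g (x + t *\<^sub>R y)*(y \<bullet> b)\<bar> <= M" if "\<bar>t - r\<bar> < 1" "norm y <= 1" for t y
  proof -
   have "(t, y) : cball r 1 \<times> cball 0 1" using that by(simp add: dist_real_def)
   from bspec[OF M imageI[OF this]] show ?thesis by(simp add: H_def)
  qed
  thus thesis by(rule that)
 qed
 have D: "((%t. (LINT y. g(x + t *\<^sub>R y)*mean_weight y)) has_real_derivative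
   (LINT y. (\<Sum>b\<in>Basis. dir_deriv b g (x + r *\<^sub>R y)*(y \<bullet> b))*mean_weight y)) (at r)"
 proof(rule has_real_derivative_integral(1)[where \<delta>=1 and B="%y. M*indicator (cball 0 1) y"])
  show "L1 (%y. g(x + t *\<^sub>R y)*mean_weight y)" for t
   by(rule integrable_mult_ball[OF cg mean_weight_measurable mean_weight_bounds])
  show "((%t. g(x + t *\<^sub>R y)*mean_weight y) has_real_derivative (\<Sum>b\<in>Basis. dir_deriv b g (x + t *\<^sub>R y)*(y \<bullet> b))*mean_weight y) (at t)" for t y
   using DERIV_cmult_right[OF diffg] by blast
  show "\<bar>(\<Sum>b\<in>Basis. dir_deriv b g (x + t *\<^sub>R y)*(y \<bullet> b))*mean_weight y\<bar> <= M*indicator (cball 0 1) y" if "\<bar>t - r\<bar> < 1" for t y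
  proof(cases "norm y <= 1")
   case True
   have "0 <= M" using M[OF that, of 0] by simp
   hence "\<bar>\<Sum>b\<in>Basis. dir_deriv b g (x + t *\<^sub>R y)*(y \<bullet> b)\<bar>*mean_weight y <= M*indicator (cball 0 1) y"
    using M[OF that True] mean_weight_bounds[of y] by(intro mult_mono) auto
   thus ?thesis using mean_weight_bounds(1)[of y] by(simp add: abs_mult)
  qed(simp add: mean_weight_outside)
  show "L1 (%y::real^3. M*indicator (cball 0 1) y)"
   by(intro integrable_mult_right integrable_indicator_cball)
 qed auto
 have iG: "L1 (%y. dir_deriv b g (x + r *\<^sub>R y)*((y \<bullet> b)*mean_weight y))"
  and eG: "(LINT y. dir_deriv b g (x + r *\<^sub>R y)*((y \<bullet> b)*mean_weight y)) = r*(LINT y. iter_deriv [b, b] g (x + r *\<^sub>R y)*mean_primitive y)"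
  and iH: "L1 (%y. iter_deriv [b, b] g (x + r *\<^sub>R y)*mean_primitive y)"
  if b: "b : Basis" for b
 proof -
  have s2: "smooth_on UNIV (dir_deriv b g)" by(rule smooth_on_dir_deriv[OF g b])
  have c2: "continuous_on UNIV (dir_deriv b (dir_deriv b g))" by(rule smooth_on_continuous_on[OF smooth_on_dir_deriv[OF s2 b]])
  define F where "F y = dir_deriv b g (x + r *\<^sub>R y)*mean_primitive y" for y
  have dF: "(F has_derivative (%e. dir_deriv b g (x + r *\<^sub>R y)*- (mean_weight y*(y \<bullet> e)) + dir_deriv (r *\<^sub>R e) (dir_deriv b g) (x + r *\<^sub>R y)*mean_primitive y)) (at y)" for y
  proof -
   have "((%y. dir_deriv b g (x + r *\<^sub>R y)) has_derivative (%e. dir_deriv (r *\<^sub>R e) (dir_deriv b g) (x + r *\<^sub>R y))) (at y)"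
    by(rule has_derivative_compose[OF _ smooth_on_has_derivative[OF s2 UNIV_I]]) (auto intro!: derivative_eq_intros)
   from has_derivative_mult[OF this mean_primitive_has_derivative] show ?thesis unfolding F_def .
  qed
  have lin: "dir_deriv (r *\<^sub>R b) (dir_deriv b g) z = r*dir_deriv b (dir_deriv b g) z" for z
   using linear_cmul[OF has_derivative_linear[OF smooth_on_has_derivative[OF s2 UNIV_I, of z]], of r b] by simp
  have dFb: "dir_deriv b F = (%y. r*(iter_deriv [b, b] g (x + r *\<^sub>R y)*mean_primitive y) - dir_deriv b g (x + r *\<^sub>R y)*((y \<bullet> b)*mean_weight y))"
   using dir_deriv_eqI[OF dF, of b] by(auto simp: lin fun_eq_iff)
  show iH: "L1 (%y. iter_deriv [b, b] g (x + r *\<^sub>R y)*mean_primitive y)"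
   using integrable_mult_ball[OF c2 mean_primitive_measurable mean_primitive_bounds, of x r] by simp
  have cdF: "continuous_on UNIV (dir_deriv b F)" unfolding dFb using c2
   by(auto intro!: continuous_intros continuous_on_mean_primitive continuous_on_mean_weight continuous_on_compose2[OF c2]
     continuous_on_compose2[OF cd[OF b]])
  have F0: "F y = 0" if "1 <= norm y" for y
   using mean_weight_outside[OF that] by(simp add: F_def mean_primitive_def)
  have dd: "F differentiable (at y)" for y using dF by(auto simp: differentiable_def)
  note Z = integral_dir_deriv_eq_0[OF dd cdF F0]
  have "L1 (%y. r*(iter_deriv [b, b] g (x + r *\<^sub>R y)*mean_primitive y) - dir_deriv b F y)"
   by(intro integrable_diff integrable_mult_right iH Z(1))
  thus iG: "L1 (%y. dir_deriv b g (x + r *\<^sub>R y)*((y \<bullet> b)*mean_weight y))"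
   unfolding dFb by simp
  have "(LINT y. dir_deriv b F y) = r*(LINT y. iter_deriv [b, b] g (x + r *\<^sub>R y)*mean_primitive y)
    - (LINT y. dir_deriv b g (x + r *\<^sub>R y)*((y \<bullet> b)*mean_weight y))"
   unfolding dFb using integral_diff[OF integrable_mult_right[OF iH, of r] iG] by simp
  thus "(LINT y. dir_deriv b g (x + r *\<^sub>R y)*((y \<bullet> b)*mean_weight y)) = r*(LINT y. iter_deriv [b, b] g (x + r *\<^sub>R y)*mean_primitive y)"
   using Z(2) by simp
 qed
 have "(LINT y. (\<Sum>b\<in>Basis. dir_deriv b g (x + r *\<^sub>R y)*(y \<bullet> b))*mean_weight y)
   = (\<Sum>b\<in>Basis. (LINT y. dir_deriv b g (x + r *\<^sub>R y)*((y \<bullet> b)*mean_weight y)))"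
  unfolding sum_distrib_right mult.assoc by(rule Bochner_Integration.integral_sum[OF iG])
 also have "... = (\<Sum>b\<in>Basis. r*(LINT y. iter_deriv [b, b] g (x + r *\<^sub>R y)*mean_primitive y))"
  by(intro sum.cong eG refl)
 also have "... = r*(LINT y. laplacian g (x + r *\<^sub>R y)*mean_primitive y)"
  unfolding laplacian_def sum_distrib_right sum_distrib_left[symmetric]
  by(subst Bochner_Integration.integral_sum[OF iH]) auto
 finally show ?thesis using D unfolding weighted_mean_def by simp
qed

lemma laplacian_continuous_on: "smooth_on UNIV g ==> continuous_on UNIV (laplacian g)"
 unfolding laplacian_def[abs_def]
 by(intro continuous_on_sum smooth_on_continuous_on[OF smooth_on_iter_deriv]) auto

lemma weighted_mean_smooth:
 assumes g: "smooth_on UNIV g" and R: "0 <= R"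
 shows "integrable lborel2 (%(r, y). indicator {0..R} r*r*(laplacian g (x + r *\<^sub>R y)*mean_primitive y))"
  and "weighted_mean g x R - g x*LI mean_weight
   = (LINT p|lborel2. (case p of (r, y) => indicator {0..R} r*r*(laplacian g (x + r *\<^sub>R y)*mean_primitive y)))"
proof -
 have cl: "continuous_on UNIV (laplacian g)" by(rule laplacian_continuous_on[OF g])
 define F where "F = (%(r, y). indicator {0..R} r*r*(laplacian g (x + r *\<^sub>R y)*mean_primitive y))"
 define K where "K = {0..R} \<times> cball (0::real^3) 1"
 have K: "compact K" unfolding K_def by(intro compact_Times) auto
 have "L1 (%p. indicator K p *\<^sub>R (fst p*(laplacian g (x + fst p *\<^sub>R snd p)*mean_primitive(snd p))))"
  by(rule borel_integrable_compact[OF K])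
   (auto intro!: continuous_intros continuous_on_compose2[OF cl] continuous_on_compose2[OF continuous_on_mean_primitive])
 moreover have "(%p. indicator K p *\<^sub>R (fst p*(laplacian g (x + fst p *\<^sub>R snd p)*mean_primitive(snd p)))) = F"
  unfolding F_def K_def fun_eq_iff using mean_weight_outside
  by(auto simp: indicator_def split_beta' mean_primitive_def)
 ultimately show iF: "integrable lborel2 F" unfolding lborel_prod by simp
 define A where "A r = r*(LINT y. laplacian g (x + r *\<^sub>R y)*mean_primitive y)" for r
 have inner: "(LINT y. F(r, y)) = indicator {0..R} r*A r" for r
  unfolding F_def A_def by(simp add: mult.assoc)
 have "L1 (%r. (LINT y. F(r, y)))" by(rule lborel_pair.integrable_fst'[OF iF])
 hence si: "set_integrable lborel {0..R} A" unfolding inner set_integrable_def by simp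
 have "(A has_integral (weighted_mean g x R - weighted_mean g x 0)) {0..R}"
  unfolding A_def using weighted_mean_has_derivative[OF g]
  by(intro fundamental_theorem_of_calculus[OF R]) (auto simp: has_real_derivative_iff_has_vector_derivative[symmetric] intro: has_field_derivative_at_within)
 hence "(LINT r:{0..R}|lborel. A r) = weighted_mean g x R - weighted_mean g x 0"
  using set_borel_integral_eq_integral(2)[OF si] by(simp add: integral_unique)
 moreover have "(LINT r:{0..R}|lborel. A r) = integral\<^sup>L lborel2 F"
  using lborel_pair.integral_fst'[OF iF] unfolding inner set_lebesgue_integral_def by simp
 ultimately show "weighted_mean g x R - g x*LI mean_weight = integral\<^sup>L lborel2 F"
  by(simp add: weighted_mean_def)
qed

section \<open>The logarithmic potential\<close>

lemma abs_ln_le: "0 < t ==> \<bar>ln t\<bar> <= t + 1/t" for t :: real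
 using ln_le_minus_one[of t] ln_le_minus_one[of "1/t"] by(simp add: ln_div abs_le_iff)
  (smt (verit) divide_pos_pos)

text \<open>Together with \<open>abs_ln_le\<close> this dominates logarithmic singularities by
  inverse squares, the one singular kernel whose integrals are estimated directly.\<close>

lemma inverse_le_1_plus_square: "0 < t ==> 1/t <= 1 + 1/t^2" for t :: real
proof -
 assume t: "0 < t"
 have "0 <= (1/t - 1/2)^2" by simp
 thus ?thesis by(simp add: power2_diff power_divide power_one_over)
qed

definition log_kernel :: "real^3 => real^3 => real" where
 "log_kernel x y = ln(norm y/norm(x - y))"

lemma log_kernel_measurable [measurable]:
 assumes [measurable]: "g : borel_measurable M" "h : borel_measurable M"
 shows "(%x. log_kernel (g x) (h x)) : borel_measurable M"
 unfolding log_kernel_def by measurable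

lemma log_kernel_eq: "y ~= 0 ==> y ~= x ==> log_kernel x y = ln(norm y) - ln(norm(x - y))"
 unfolding log_kernel_def by(simp add: ln_div)

definition inverse_square_mass :: "real => real" where
 "inverse_square_mass R = (LINT z. indicator (cball 0 R) z/norm(z::real^3)^2)"

lemma inverse_square_mass_bound:
 fixes x c :: "real^3"
 assumes "norm(x - c) + R <= S"
 shows "(LINT y. indicator (cball c R) y/norm(x - y)^2) <= inverse_square_mass S"
proof -
 have "(LINT y. indicator (cball c R) y/norm(x - y)^2) <= (LINT y. indicator (cball x S) y/norm(x - y)^2)"
 proof(intro integral_mono integrable_inverse_square_ball divide_right_mono)
  fix y
  have "y : cball x S" if "y : cball c R"
   using that assms norm_triangle_ineq[of "x - c" "c - y"] by(simp add: dist_norm)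
  thus "indicator (cball c R) y <= (indicator (cball x S) y :: real)" by(auto simp: indicator_def)
 qed auto
 also have "... = (LINT z. indicator (cball x S) (x - z)/(norm(x - (x - z)))^2)"
  by(rule integral_translate(2)[symmetric])
 also have "... = inverse_square_mass S"
  unfolding inverse_square_mass_def by(intro Bochner_Integration.integral_cong) (auto simp: indicator_def dist_norm)
 finally show ?thesis .
qed

text \<open>A solution, with the equation integrated once: \<open>L\<close> is the limit of minus the Laplacian at infinity.\<close>

locale riesz_solution =
 fixes u :: "real^3 => real" and L :: real
 assumes smooth: "smooth_on UNIV u" and int_exp: "L1 (%x. exp(3*u x))"
  and lap: "!!x. - laplacian u x = L + 1/pi^2*(LINT y. exp(3*u y)/norm(x - y)^2)"
begin

definition f :: "real^3 => real" where "f y = exp(3*u y)"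

definition mass :: real where "mass = LI f"

text \<open>Normalised so that \<open>v\<close> is bounded below by
  \<open>- \<alpha> * ln (1 + |x|)\<close> up to a constant. Spherical solutions have the value 2,
  at which the logarithmic term in the moving sphere identity disappears.\<close>

definition \<alpha> :: real where "\<alpha> = mass/pi^2"

definition v :: "real^3 => real" where "v x = 1/pi^2*(LINT y. log_kernel x y*f y)"

definition p :: "real^3 => real" where "p x = u x - v x"

lemma u_continuous: "continuous_on UNIV u" by(rule smooth_on_continuous_on[OF smooth])

lemma u_measurable [measurable]: "u : borel_measurable borel"
 by(rule borel_measurable_continuous_onI[OF u_continuous])

lemma f_continuous: "continuous_on UNIV f"
 unfolding f_def[abs_def] by(intro continuous_intros u_continuous)

lemma f_measurable [measurable]: "f : borel_measurable borel"
 by(rule borel_measurable_continuous_onI[OF f_continuous])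

lemma f_pos: "0 < f y" by(simp add: f_def)

lemma f_integrable: "L1 f" using int_exp by(simp add: f_def[abs_def])

lemma mass_pos: "0 < mass"
proof -
 have "mass ~= 0"
 proof
  assume "mass = 0"
  hence "AE x in lborel. f x = 0"
   using integral_nonneg_eq_0_iff_AE[OF f_integrable] f_pos less_imp_le by(auto simp: mass_def)
  hence "AE x in (lborel :: (real^3) measure). False"
   by eventually_elim (use f_pos in \<open>auto simp: less_le\<close>)
  hence "emeasure (lborel :: (real^3) measure) UNIV = 0"
   by(subst (asm) AE_iff_measurable[of UNIV]) auto
  thus False by(simp add: emeasure_lborel_UNIV)
 qed
 moreover have "0 <= mass" unfolding mass_def using f_pos less_imp_le by(intro integral_nonneg_AE) auto
 ultimately show ?thesis by simp
qed

lemma alpha_pos: "0 < \<alpha>" unfolding \<alpha>_def using mass_pos by simp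

lemma log_potential_eq_v: "log_potential u x = v x"
proof -
 have "(LINT y|lebesgue. ln(norm y/norm(x - y))*exp(3*u y)) = (LINT y. log_kernel x y*f y)"
  unfolding log_kernel_def f_def by(rule integral_completion) measurable
 thus ?thesis by(simp add: log_potential_def v_def)
qed

lemma f_bounded_ball:
 obtains M where "0 < M" "!!y. y : cball c R ==> f y <= M"
proof -
 have "bounded (f ` cball c R)"
  by(intro compact_imp_bounded compact_continuous_image continuous_on_subset[OF f_continuous]) auto
 then obtain M where M: "ALL z:f ` cball c R. norm z <= M" unfolding bounded_iff by(rule exE)
 show thesis
 proof(rule that[of "\<bar>M\<bar> + 1"])
  fix y assume "y : cball c R"
  from bspec[OF M imageI[OF this]] show "f y <= \<bar>M\<bar> + 1" by simp
 qed simp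
qed

lemma riesz_integrable: "L1 (%y. f y/norm(x - y)^2)"
 by(rule integrable_div_norm_sq[OF f_continuous f_integrable])

lemma riesz_bounded_ball:
 obtains C where "!!x. x : cball 0 R ==> (LINT y. f y/norm(x - y)^2) <= C"
proof -
 obtain M where M: "0 < M" "!!y. y : cball 0 (R + 1) ==> f y <= M" using f_bounded_ball by blast
 show thesis
 proof(rule that)
  fix x :: "real^3" assume x: "x : cball 0 R"
  have "(LINT y. f y/norm(x - y)^2) <= (LINT y. M*(indicator (cball x 1) y/norm(x - y)^2) + f y)"
  proof(rule integral_mono[OF riesz_integrable])
   show "L1 (%y. M*(indicator (cball x 1) y/norm(x - y)^2) + f y)"
    by(intro integrable_add integrable_mult_right integrable_inverse_square_ball f_integrable)
   fix y
   show "f y/norm(x - y)^2 <= M*(indicator (cball x 1) y/norm(x - y)^2) + f y"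
   proof(cases "y : cball x 1")
    case True
    have "y : cball 0 (R + 1)" using True x norm_triangle_ineq4[of x "x - y"] by(simp add: dist_norm)
    hence "f y/norm(x - y)^2 <= M/norm(x - y)^2" by(intro divide_right_mono M) auto
    thus ?thesis using True f_pos[of y] by simp
   next
    case False
    hence "1 <= norm(x - y)^2" by(simp add: dist_norm)
    hence "f y/norm(x - y)^2 <= f y/1" using f_pos[of y] by(intro divide_left_mono) auto
    thus ?thesis using False by simp
   qed
  qed
  also have "... = M*(LINT y. indicator (cball x 1) y/norm(x - y)^2) + mass"
   unfolding mass_def
   by(subst integral_add) (auto intro!: integrable_inverse_square_ball f_integrable simp del: times_divide_eq_right)
  also have "... <= M*inverse_square_mass 1 + mass"
   using M(1) by(intro add_right_mono mult_left_mono inverse_square_mass_bound) auto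
  finally show "(LINT y. f y/norm(x - y)^2) <= M*inverse_square_mass 1 + mass" .
 qed
qed

text \<open>For \<open>|y| > 2 * \<rho>\<close> the quotient in the logarithm lies between
  \<open>1/2\<close> and 2, thanks to the \<open>|y|\<close> in its numerator; otherwise both
  logarithms are dominated by inverse squares.\<close>

lemma log_kernel_bound:
 assumes "norm x <= \<rho>" "1 <= \<rho>" "y ~= 0" "y ~= x"
 shows "\<bar>log_kernel x y\<bar> <= 1 + indicator (cball 0 (2*\<rho>)) y*(5*\<rho> + 2 + 1/norm y^2 + 1/norm(x - y)^2)"
proof(cases "norm y <= 2*\<rho>")
 case True
 have p: "0 < norm y" "0 < norm(x - y)" using assms by auto
 have "norm(x - y) <= 3*\<rho>" using norm_triangle_ineq4[of x y] assms(1) True by linarith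
 moreover have "\<bar>log_kernel x y\<bar> <= \<bar>ln(norm y)\<bar> + \<bar>ln(norm(x - y))\<bar>"
  unfolding log_kernel_eq[OF assms(3,4)] by simp
 ultimately show ?thesis
  using abs_ln_le[OF p(1)] abs_ln_le[OF p(2)] inverse_le_1_plus_square[OF p(1)] inverse_le_1_plus_square[OF p(2)] True by simp
next
 case False
 have p: "0 < norm y" "0 < norm(x - y)" using assms by auto
 have "norm x <= norm y/2" using False assms by simp
 hence b: "norm y/2 <= norm(x - y)" "norm(x - y) <= 2*norm y"
  using norm_triangle_ineq2[of y x] norm_triangle_ineq4[of x y] by(auto simp: norm_minus_commute)
 have "1/2 <= norm y/norm(x - y)" "norm y/norm(x - y) <= 2"
  using b p by(auto simp: field_simps)
 hence "ln(1/2) <= log_kernel x y" "log_kernel x y <= ln 2"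
  unfolding log_kernel_def using p by(subst ln_le_cancel_iff; simp)+
 moreover have "ln(1/2::real) = - ln 2" "ln(2::real) <= 1" using ln_2_less_1 by(auto simp: ln_div)
 ultimately show ?thesis using False by(simp add: abs_le_iff)
qed

lemma log_kernel_integral_bound:
 assumes "1 <= \<rho>"
 obtains C where "!!x. norm x <= \<rho> ==> L1 (%y. log_kernel x y*f y)"
  "!!x. norm x <= \<rho> ==> (LINT y. \<bar>log_kernel x y\<bar>*f y) <= C"
proof -
 obtain M where M: "0 < M" "!!y. y : cball 0 (2*\<rho>) ==> f y <= M" using f_bounded_ball by blast
 define B where "B x y = f y + M*((5*\<rho> + 2)*indicator (cball 0 (2*\<rho>)) y
  + indicator (cball 0 (2*\<rho>)) y/norm(0 - y)^2 + indicator (cball 0 (2*\<rho>)) y/norm(x - y)^2)" for x y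
 note ic = integrable_indicator_cball
 have iB: "L1(B x)" for x unfolding B_def
  by(intro integrable_add integrable_mult_right integrable_inverse_square_ball f_integrable ic)
 have bd: "AE y in lborel. \<bar>log_kernel x y\<bar>*f y <= B x y" if x: "norm x <= \<rho>" for x
  using AE_lborel_singleton[of "0::real^3"] AE_lborel_singleton[of x]
 proof eventually_elim
  case (elim y)
  have "\<bar>log_kernel x y\<bar>*f y <= (1 + indicator (cball 0 (2*\<rho>)) y*(5*\<rho> + 2 + 1/norm y^2 + 1/norm(x - y)^2))*f y"
   using log_kernel_bound[OF x assms elim] f_pos[of y] by(intro mult_right_mono) auto
  also have "... <= B x y"
  proof(cases "y : cball 0 (2*\<rho>)")
   case True
   have "(5*\<rho> + 2 + 1/norm y^2 + 1/norm(x - y)^2)*f y <= (5*\<rho> + 2 + 1/norm y^2 + 1/norm(x - y)^2)*M"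
    using assms by(intro mult_left_mono M True add_nonneg_nonneg) auto
   thus ?thesis using True unfolding B_def by(simp add: algebra_simps)
  qed(simp add: B_def)
  finally show ?case .
 qed
 have i: "L1 (%y. log_kernel x y*f y)" if x: "norm x <= \<rho>" for x
 proof(rule integrable_bound[OF iB[of x]])
  show "AE y in lborel. norm(log_kernel x y*f y) <= norm(B x y)" using bd[OF x]
  proof eventually_elim
   case (elim y)
   thus ?case using f_pos[of y] by(simp add: abs_mult)
  qed
 qed measurable
 define C where "C = mass + M*((5*\<rho> + 2)*measure lborel (cball (0::real^3) (2*\<rho>)) + inverse_square_mass (2*\<rho>) + inverse_square_mass (3*\<rho>))"
 have "(LINT y. \<bar>log_kernel x y\<bar>*f y) <= C" if x: "norm x <= \<rho>" for x
 proof -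
  have ia: "L1 (%y. \<bar>log_kernel x y\<bar>*f y)"
   using integrable_abs[OF i[OF x]] f_pos by(simp add: abs_mult abs_of_pos)
  have "(LINT y. \<bar>log_kernel x y\<bar>*f y) <= LI(B x)"
   by(rule integral_mono_AE[OF ia iB bd[OF x]])
  also have "... = mass + M*((5*\<rho> + 2)*measure lborel (cball (0::real^3) (2*\<rho>))
    + (LINT y. indicator (cball 0 (2*\<rho>)) y/norm(0 - y :: real^3)^2)
    + (LINT y. indicator (cball 0 (2*\<rho>)) y/norm(x - y)^2))" unfolding B_def mass_def
   by(subst integral_add integral_mult_right_zero |
     (intro integrable_add integrable_mult_right integrable_inverse_square_ball f_integrable ic; fail))+ simp
  also have "... <= C" unfolding C_def using M(1) x
   by(intro add_left_mono mult_left_mono add_mono inverse_square_mass_bound) auto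
  finally show ?thesis .
 qed
 with i show thesis by(rule that)
qed

lemma log_kernel_integrable: "L1 (%y. log_kernel x y*f y)"
 by(rule log_kernel_integral_bound[of "1 + norm x"]) auto

lemma v_measurable [measurable]: "v : borel_measurable borel"
proof -
 have "(%x. (LINT y. log_kernel x y*f y)) : borel_measurable borel"
  by(intro lborel.borel_measurable_lebesgue_integral) measurable
 thus ?thesis unfolding v_def[abs_def] by measurable
qed

lemma p_measurable [measurable]: "p : borel_measurable borel"
 unfolding p_def[abs_def] by measurable

text \<open>If \<open>|y| > 1\<close> then \<open>|x - y| <= |y| * (1 + |x|)\<close>, which bounds
  the kernel below by \<open>- ln (1 + |x|)\<close>; for the other \<open>y\<close> the singularity
  of \<open>ln |y|\<close> costs a constant.\<close>

lemma v_lower_bound: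
 obtains C where "0 <= C" "!!x. - \<alpha>*ln(1 + norm x) - C <= v x"
proof -
 obtain M where M: "0 < M" "!!y. y : cball 0 1 ==> f y <= M" using f_bounded_ball by blast
 define B where "B y = M*(2*indicator (cball 0 1) y + indicator (cball 0 1) y/norm(0 - y :: real^3)^2)" for y
 note ic = integrable_indicator_cball
 have iB: "L1 B"
  unfolding B_def by(intro integrable_add integrable_mult_right integrable_inverse_square_ball ic)
 have B0: "0 <= B y" for y unfolding B_def using M(1) by(intro mult_nonneg_nonneg add_nonneg_nonneg) auto
 have "- \<alpha>*ln(1 + norm x) - LI B/pi^2 <= v x" for x
 proof -
  have "(LINT y. - ln(1 + norm x)*f y - B y) <= (LINT y. log_kernel x y*f y)"
  proof(rule integral_mono_AE)
   show "L1 (%y. - ln(1 + norm x)*f y - B y)"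
    by(intro integrable_diff integrable_mult_right f_integrable iB)
   show "AE y in lborel. - ln(1 + norm x)*f y - B y <= log_kernel x y*f y"
    using AE_lborel_singleton[of "0::real^3"] AE_lborel_singleton[of x]
   proof eventually_elim
    case (elim y)
    have py: "0 < norm y" "0 < norm(x - y)" using elim by auto
    have tr: "ln(norm(x - y)) <= ln(norm x + norm y)"
     using py norm_triangle_ineq4[of x y] by(subst ln_le_cancel_iff) (auto simp: add_nonneg_pos)
    show ?case
    proof(cases "norm y <= 1")
     case True
     have "norm x + norm y <= 1 + norm x" using True by simp
     hence "ln(norm x + norm y) <= ln(1 + norm x)"
      using py by(subst ln_le_cancel_iff) (auto simp: add_nonneg_pos add_pos_nonneg)
     hence "- ln(1 + norm x) - \<bar>ln(norm y)\<bar> <= log_kernel x y"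
      unfolding log_kernel_eq[OF elim] using tr by linarith
     hence "(- ln(1 + norm x) - \<bar>ln(norm y)\<bar>)*f y <= log_kernel x y*f y"
      using f_pos[of y] by(intro mult_right_mono) auto
     moreover have "\<bar>ln(norm y)\<bar>*f y <= B y"
     proof -
      have "\<bar>ln(norm y)\<bar> <= 2 + 1/norm y^2"
       using abs_ln_le[OF py(1)] inverse_le_1_plus_square[OF py(1)] True by linarith
      hence "\<bar>ln(norm y)\<bar>*f y <= (2 + 1/norm y^2)*M"
       using M f_pos[of y] True by(intro mult_mono) (auto intro: less_imp_le)
      thus ?thesis using True unfolding B_def by(simp add: algebra_simps)
     qed
     ultimately show ?thesis by(simp add: algebra_simps)
    next
     case False
     have "norm x + norm y <= norm y*(1 + norm x)"
     proof -
      have "1*norm x <= norm y*norm x" using False by(intro mult_right_mono) auto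
      thus ?thesis by(simp add: algebra_simps)
     qed
     hence "ln(norm x + norm y) <= ln(norm y*(1 + norm x))"
      using py by(subst ln_le_cancel_iff) (auto simp: add_nonneg_pos add_pos_nonneg)
     also have "... = ln(norm y) + ln(1 + norm x)" using py by(intro ln_mult_pos) (auto simp: add_pos_nonneg)
     finally have "- ln(1 + norm x) <= log_kernel x y"
      unfolding log_kernel_eq[OF elim] using tr by linarith
     hence "- ln(1 + norm x)*f y <= log_kernel x y*f y"
      using f_pos[of y] by(intro mult_right_mono) auto
     thus ?thesis using B0[of y] by linarith
    qed
   qed
  qed(rule log_kernel_integrable)
  moreover have "(LINT y. - ln(1 + norm x)*f y - B y) = - ln(1 + norm x)*mass - LI B"
   unfolding mass_def by(subst integral_diff) (auto intro!: f_integrable iB)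
  ultimately have "(- ln(1 + norm x)*mass - LI B)/pi^2 <= (LINT y. log_kernel x y*f y)/pi^2"
   by(intro divide_right_mono) auto
  thus ?thesis unfolding v_def \<alpha>_def by(simp add: diff_divide_distrib mult.commute)
 qed
 moreover have "0 <= LI B/pi^2" using B0 by(intro divide_nonneg_nonneg integral_nonneg_AE) auto
 ultimately show thesis using that by blast
qed

text \<open>\<open>p = u - v\<close> is at most \<open>u\<close> plus a logarithm, and
  \<open>t <= exp t\<close> bounds \<open>u\<close> by a multiple of \<open>f\<close>. So the
  positive part of \<open>p\<close> is controlled by an integrable function although no upper bound
  of \<open>u\<close> is known yet.\<close>

lemma exp_p_bound:
 obtains K where "0 < K" "!!S z. norm z <= S - 1 ==> max 0 (p z) <= \<alpha>*ln S + K*f z"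
proof -
 obtain C where C: "0 <= C" "!!x. - \<alpha>*ln(1 + norm x) - C <= v x" using v_lower_bound by blast
 show thesis
 proof(rule that[of "exp(3*C)"])
  fix S :: real and z :: "real^3" assume z: "norm z <= S - 1"
  hence S: "1 <= S" using norm_ge_zero[of z] by linarith
  have "p z <= \<alpha>*ln S + exp(3*C)*f z"
  proof -
   have "ln(1 + norm z) <= ln S" using z S by(subst ln_le_cancel_iff) (auto simp: add_pos_nonneg)
   hence "\<alpha>*ln(1 + norm z) <= \<alpha>*ln S" using alpha_pos by simp
   moreover have "- (\<alpha>*ln(1 + norm z)) - C <= v z" using C(2)[of z] by simp
   moreover have "3*(u1 - v1) - 3*b <= 3*C1 + 3*u1" if "a <= b" "- a - C1 <= v1" for a b C1 u1 v1 :: real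
    using that by simp
   ultimately have "3*p z - 3*(\<alpha>*ln S) <= 3*C + 3*u z" unfolding p_def by blast
   note this
   also have "3*C + 3*u z <= exp(3*C + 3*u z)" using exp_ge_add_one_self[of "3*C + 3*u z"] by linarith
   also have "... = exp(3*C)*f z" by(simp add: exp_add f_def)
   finally have "3*(p z - \<alpha>*ln S) <= exp(3*C)*f z" by simp
   moreover have "0 <= exp(3*C)*f z" using f_pos[of z] by simp
   moreover have "a <= b + c" if "3*(a - b) <= c" "0 <= c" for a b c :: real using that by argo
   ultimately show ?thesis by blast
  qed
  moreover have "0 <= \<alpha>*ln S + exp(3*C)*f z"
   using alpha_pos S f_pos[of z] by(intro add_nonneg_nonneg mult_nonneg_nonneg) auto
  ultimately show "max 0 (p z) <= \<alpha>*ln S + exp(3*C)*f z" by simp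
 qed simp
qed

end

section \<open>The mean value property of the polynomial part\<close>

text \<open>The logarithmic kernel with its pole at \<open>c\<close> rounded off at scale
  \<open>e\<close>: the mean value formula for smooth functions applies to it, and
  \<open>e -> 0\<close> restores the kernel.\<close>

definition log_smoothed :: "real^3 => real => real^3 => real" where
 "log_smoothed c e z = ln(norm c) + (- (1/2))*ln(e^2 + norm(z - c)^2)"

lemma log_smoothed_smooth:
 assumes e: "e ~= 0"
 shows "smooth_on UNIV (log_smoothed c e)"
proof -
 define h :: "nat => real => real" where "h n t = (case n of 0 => ln t | Suc k => (-1)^k*fact k/t^Suc k)" for n t
 have h: "(h n has_real_derivative h (Suc n) t) (at t)" if t: "0 < t" for n t
 proof(cases n)
  case 0
  thus ?thesis using t by(auto simp: h_def[abs_def] intro!: derivative_eq_intros)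
 next
  case (Suc k)
  thus ?thesis using DERIV_fact_div_power[of t k] t by(simp add: h_def[abs_def])
 qed
 have sm: "smooth_on UNIV (%z. e^2 + norm(z - c)^2)"
 proof -
  have "(%z. e^2 + norm(z - c)^2) = (%z. (e^2 + norm c^2) + (norm z^2 + z \<bullet> (- 2 *\<^sub>R c)))"
   by(auto simp: fun_eq_iff power2_norm_eq_inner inner_diff inner_commute)
  thus ?thesis
   by(simp only:) (intro smooth_on_add smooth_on_const smooth_on_norm_sq smooth_on_inner open_UNIV)
 qed
 have "smooth_on UNIV (%z. h 0 (e^2 + norm(z - c)^2))"
  by(rule smooth_on_comp[where h=h, OF sm h]) (use e in \<open>simp add: add_pos_nonneg\<close>)
 hence "smooth_on UNIV (%z. ln(e^2 + norm(z - c)^2))" by(simp add: h_def)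
 thus ?thesis unfolding log_smoothed_def[abs_def]
  by(intro smooth_on_add smooth_on_mult smooth_on_const open_UNIV)
qed

text \<open>General coefficients, since one computation serves both the smoothed kernel with
  \<open>B = -1/2\<close> and the spherical solutions with \<open>B = -1\<close>.\<close>

lemma
 assumes e: "e ~= 0"
 shows dir_deriv_log_profile: "dir_deriv b (%z. A + B*ln(e^2 + norm(z - c)^2)) z = 2*B*((z - c) \<bullet> b)*inverse(e^2 + norm(z - c)^2)"
  and laplacian_log_profile: "laplacian (%z. A + B*ln(e^2 + norm(z - c)^2)) z = 2*B*((3*e^2 + norm(z - c :: real^3)^2)/(e^2 + norm(z - c)^2)^2)"
proof -
 define Q where "Q z = e^2 + norm(z - c)^2" for z
 have Q: "0 < Q z" for z unfolding Q_def using e by(intro add_pos_nonneg) auto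
 have dQ: "(Q has_derivative (%b. 2*((z - c) \<bullet> b))) (at z)" for z
  unfolding Q_def power2_norm_eq_inner by(auto intro!: derivative_eq_intros simp: inner_commute)
 have d1: "dir_deriv b (%z. A + B*ln(Q z)) = (%z. 2*B*((z - c) \<bullet> b)*inverse(Q z))" for b
 proof
  fix z
  have "((%z. ln(Q z)) has_derivative (%b. inverse(Q z)*(2*((z - c) \<bullet> b)))) (at z)"
   by(rule has_derivative_compose[OF dQ DERIV_ln[OF Q, unfolded has_field_derivative_def]])
  hence "((%z. A + B*ln(Q z)) has_derivative (%b. 0 + B*(inverse(Q z)*(2*((z - c) \<bullet> b))))) (at z)"
   by(intro has_derivative_add has_derivative_const has_derivative_mult_right)
  from dir_deriv_eqI[OF this, of b] show "dir_deriv b (%z. A + B*ln(Q z)) z = 2*B*((z - c) \<bullet> b)*inverse(Q z)" by simp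
 qed
 thus "dir_deriv b (%z. A + B*ln(e^2 + norm(z - c)^2)) z = 2*B*((z - c) \<bullet> b)*inverse(e^2 + norm(z - c)^2)"
  unfolding Q_def by metis
 have d2: "dir_deriv b (dir_deriv b (%z. A + B*ln(Q z))) z = 2*B*((b \<bullet> b)*inverse(Q z) - 2*((z - c) \<bullet> b)^2*(inverse(Q z))^2)" for b
 proof -
  have i: "((%z. inverse(Q z)) has_derivative (%b. - (inverse(Q z)*(2*((z - c) \<bullet> b))*inverse(Q z)))) (at z)"
  proof(rule has_derivative_eq_rhs)
   show "((%z. inverse(Q z)) has_derivative (%b. - (inverse(Q z)^Suc (Suc 0))*(2*((z - c) \<bullet> b)))) (at z)"
    using has_derivative_compose[OF dQ DERIV_inverse[unfolded has_field_derivative_def]] Q[of z] by simp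
  qed(simp add: fun_eq_iff mult_ac)
  have n: "((%z. 2*B*((z - c) \<bullet> b)) has_derivative (%e. 2*B*(e \<bullet> b))) (at z)"
   by(auto intro!: derivative_eq_intros)
  from dir_deriv_eqI[OF has_derivative_mult[OF n i], of b] show ?thesis
   unfolding d1 by(simp add: power2_eq_square algebra_simps)
 qed
 have "laplacian (%z. A + B*ln(Q z)) z = (\<Sum>b\<in>Basis. 2*B*(inverse(Q z) - 2*((z - c) \<bullet> b)^2*(inverse(Q z))^2))"
  unfolding laplacian_def by(intro sum.cong) (simp_all add: d2)
 also have "... = 2*B*(3*inverse(Q z) - 2*norm(z - c)^2*(inverse(Q z))^2)"
  unfolding norm_sq_Basis by(simp add: sum_subtractf flip: sum_distrib_left sum_distrib_right)
 also have "... = 2*B*((3*e^2 + norm(z - c)^2)/(Q z)^2)"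
 proof -
  have n: "(norm(z - c))^2 = Q z - e^2" by(simp add: Q_def)
  show ?thesis unfolding n using Q[of z] by(simp add: field_simps power2_eq_square)
 qed
 finally show "laplacian (%z. A + B*ln(e^2 + norm(z - c)^2)) z = 2*B*((3*e^2 + norm(z - c)^2)/(e^2 + norm(z - c)^2)^2)"
  unfolding Q_def .
qed

lemma laplacian_log_smoothed:
 assumes e: "e ~= 0"
 shows "laplacian (log_smoothed c e) z = - ((3*e^2 + norm(z - c)^2)/(e^2 + norm(z - c)^2)^2)"
proof -
 have "2*(- (1/2))*X = - X" for X :: real by simp
 thus ?thesis unfolding log_smoothed_def[abs_def] laplacian_log_profile[OF e] by(simp only:)
qed

text \<open>The integrand of the mean value formula with the Laplacian replaced by
  \<open>1/|z - c|^2\<close>, which in dimension three is minus the Laplacian of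
  \<open>log_kernel z c\<close> in \<open>z\<close>.\<close>

definition riesz_weight :: "real^3 => real => real \<times> (real^3) => real^3 => real" where
 "riesz_weight x R = (%(r, y) c. indicator {0..R} r*r*mean_primitive y/norm(x + r *\<^sub>R y - c)^2)"

lemma riesz_weight_nonneg: "0 <= riesz_weight x R q c"
 unfolding riesz_weight_def using mean_primitive_bounds(1)[of "snd q"]
 by(cases q) (auto simp: indicator_def intro!: divide_nonneg_nonneg mult_nonneg_nonneg)

lemma riesz_weight_measurable [measurable]:
 assumes [measurable]: "g : M \<rightarrow>\<^sub>M borel \<Otimes>\<^sub>M borel" "h : borel_measurable M"
 shows "(%x. riesz_weight a R (g x) (h x)) : borel_measurable M"
proof -
 have [measurable]: "(%x. fst (g x)) : borel_measurable M" "(%x. snd (g x)) : borel_measurable M"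
  by measurable
 show ?thesis unfolding riesz_weight_def split_beta' by measurable
qed

text \<open>Dominated convergence as the smoothing scale tends to 0: the Laplacians of the smoothed
  kernels are at most three times the limit kernel in absolute value.\<close>

lemma log_kernel_weighted_mean:
 assumes R: "0 < R" and c: "c ~= 0" "c ~= x" and i: "integrable lborel2 (%q. riesz_weight x R q c)"
 shows "weighted_mean (%z. log_kernel z c) x R - log_kernel x c*LI mean_weight
  = - (LINT q|lborel2. riesz_weight x R q c)"
proof -
 define e where "e n = 1/real(Suc n)" for n
 have e: "0 < e n" "e n <= 1" "e \<longlonglongrightarrow> 0" for n
  unfolding e_def using LIMSEQ_inverse_real_of_nat by(auto simp: inverse_eq_divide)
 have e0: "e n ~= 0" for n using e(1)[of n] by simp
 note ws = weighted_mean_smooth[OF log_smoothed_smooth[OF e0] less_imp_le[OF R], of c _ x]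
 have lim_ln: "(%n. log_smoothed c (e n) z) \<longlonglongrightarrow> log_kernel z c" if z: "z ~= c" for z
 proof -
  have "(%n. ln((e n)^2 + norm(z - c)^2)) \<longlonglongrightarrow> ln(0^2 + norm(z - c)^2)"
   using z by(intro tendsto_intros e(3)) auto
  from tendsto_add[OF tendsto_const tendsto_mult[OF tendsto_const this]]
  have "(%n. log_smoothed c (e n) z) \<longlonglongrightarrow> ln(norm c) + (- (1/2))*ln(0^2 + norm(z - c)^2)"
   unfolding log_smoothed_def .
  moreover have "ln(norm c) + (- (1/2))*ln(0^2 + norm(z - c)^2) = log_kernel z c"
   using z c(1) by(simp add: log_kernel_eq ln_realpow)
  ultimately show ?thesis by simp
 qed
 have ae: "AE y in lborel. x + R *\<^sub>R y ~= c"
  using AE_lborel_singleton[of "(1/R) *\<^sub>R (c - x)"]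
  by eventually_elim (use R in \<open>auto simp: algebra_simps\<close>)
 have L1: "(%n. weighted_mean (log_smoothed c (e n)) x R) \<longlonglongrightarrow> weighted_mean (%z. log_kernel z c) x R"
  unfolding weighted_mean_def
 proof(rule integral_dominated_convergence)
  define B where "B y = (\<bar>ln(norm c)\<bar> + 1 + 2*(norm x + R + norm c))*indicator (cball 0 1) y
    + indicator (cball 0 1) y/(norm((x + R *\<^sub>R y) - c))^2" for y
  note ic = integrable_indicator_cball
  have "L1 (%y. (indicator (cball x R) (x + R *\<^sub>R y) :: real)/(norm(c - (x + R *\<^sub>R y)))^2)"
   by(rule integrable_lborel_affine[OF integrable_inverse_square_ball]) (use R in auto)
  moreover have "indicator (cball x R) (x + R *\<^sub>R y) = (indicator (cball 0 1) y :: real)" for y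
   using R by(auto simp: indicator_def dist_norm mult_le_cancel_left)
  ultimately have "L1 (%y. indicator (cball 0 1) y/(norm((x + R *\<^sub>R y) - c))^2)"
   by(simp add: norm_minus_commute)
  thus "L1 B" unfolding B_def by(intro integrable_add integrable_mult_right ic)
  show "(%y. log_smoothed c (e n) (x + R *\<^sub>R y)*mean_weight y) : borel_measurable lborel" for n
   unfolding log_smoothed_def by measurable
  show "AE y in lborel. (%n. log_smoothed c (e n) (x + R *\<^sub>R y)*mean_weight y) \<longlonglongrightarrow> log_kernel (x + R *\<^sub>R y) c*mean_weight y"
   using ae by eventually_elim (intro tendsto_mult tendsto_const lim_ln)
  show "AE y in lborel. norm(log_smoothed c (e n) (x + R *\<^sub>R y)*mean_weight y) <= B y" for n
   using ae
  proof eventually_elim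
   case (elim y)
   show ?case
   proof(cases "norm y <= 1")
    case True
    define t where "t = norm(x + R *\<^sub>R y - c)"
    have t: "0 < t" using elim by(simp add: t_def)
    have "norm(R *\<^sub>R y) <= R" using True R by simp
    hence tS: "t <= norm x + R + norm c"
     unfolding t_def using norm_triangle_ineq4[of "x + R *\<^sub>R y" c] norm_triangle_ineq[of x "R *\<^sub>R y"] by linarith
    have "ln((e n)^2 + t^2) <= ln(1 + t^2)"
     using e(1,2)[of n] t by(subst ln_le_cancel_iff) (auto simp: power_le_one add_pos_pos)
    also have "... <= ln((1 + t)^2)" using t by(subst ln_le_cancel_iff) (auto simp: power2_sum add_pos_pos)
    also have "... = 2*ln(1 + t)" using t by(simp add: ln_realpow)
    also have "... <= 2*t" using ln_add_one_self_le_self[of t] t by simp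
    finally have 1: "ln((e n)^2 + t^2)/2 <= t" by simp
    have "2*ln t = ln(t^2)" using t by(simp add: ln_realpow)
    also have "... <= ln((e n)^2 + t^2)" using t by(subst ln_le_cancel_iff) (auto simp: add_nonneg_pos)
    finally have "- (t + 1/t) <= ln((e n)^2 + t^2)/2" using abs_ln_le[OF t] by linarith
    moreover have "0 <= 1/t^2" by simp
    ultimately have "\<bar>ln((e n)^2 + t^2)/2\<bar> <= t + (1 + 1/t^2)"
     using 1 inverse_le_1_plus_square[OF t] unfolding abs_le_iff by linarith
    hence "\<bar>log_smoothed c (e n) (x + R *\<^sub>R y)\<bar> <= \<bar>ln(norm c)\<bar> + (t + (1 + 1/t^2))"
     unfolding log_smoothed_def t_def by(simp add: abs_le_iff) linarith
    also have "... <= B y" unfolding B_def t_def[symmetric] using True tS t by simp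
    finally have "\<bar>log_smoothed c (e n) (x + R *\<^sub>R y)\<bar> <= B y" .
    hence "\<bar>log_smoothed c (e n) (x + R *\<^sub>R y)\<bar>*mean_weight y <= B y*1"
     using mean_weight_bounds[of y] True by(intro mult_mono) (auto intro: order_trans[OF abs_ge_zero])
    thus ?thesis using mean_weight_bounds(1)[of y] by(simp add: abs_mult)
   qed(simp add: mean_weight_outside B_def)
  qed
 qed measurable
 have L2: "(%n. (LINT q|lborel2. (case q of (r, y) => indicator {0..R} r*r*(laplacian (log_smoothed c (e n)) (x + r *\<^sub>R y)*mean_primitive y))))
   \<longlonglongrightarrow> (LINT q|lborel2. - riesz_weight x R q c)"
 proof(rule integral_dominated_convergence[where w="%q. 3*riesz_weight x R q c"])
  show "integrable lborel2 (%q. 3*riesz_weight x R q c)" by(intro integrable_mult_right i)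
  show "(%q. case q of (r, y) => indicator {0..R} r*r*(laplacian (log_smoothed c (e n)) (x + r *\<^sub>R y)*mean_primitive y)) : borel_measurable lborel2" for n
   using borel_measurable_integrable[OF ws(1)] .
  have ne: "AE q in lborel2. x + fst q *\<^sub>R snd q ~= c"
  proof(rule lborel_pair.AE_pair_measure)
   show "{q : space lborel2. x + fst q *\<^sub>R snd q ~= c} : sets lborel2" by measurable
   have "AE y in lborel. x + r *\<^sub>R y ~= c" for r
   proof(cases "r = 0")
    case False
    show ?thesis using AE_lborel_singleton[of "(1/r) *\<^sub>R (c - x)"]
     by eventually_elim (use False in \<open>auto simp: algebra_simps\<close>)
   qed(use c in auto)
   thus "AE r in lborel. AE y in lborel. x + fst (r, y) *\<^sub>R snd (r, y) ~= c" by simp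
  qed
  show "AE q in lborel2. norm(case q of (r, y) => indicator {0..R} r*r*(laplacian (log_smoothed c (e n)) (x + r *\<^sub>R y)*mean_primitive y)) <= 3*riesz_weight x R q c" for n
   using ne
  proof eventually_elim
   case (elim q)
   obtain r y where q: "q = (r, y)" by(cases q)
   define t where "t = norm(x + r *\<^sub>R y - c)^2"
   have t: "0 < t" using elim q by(simp add: t_def)
   have et: "0 < (e n)^2 + t" using t by(intro add_nonneg_pos) auto
   have "(3*(e n)^2 + t)/((e n)^2 + t)^2 <= (3*((e n)^2 + t))/((e n)^2 + t)^2"
    using t by(intro divide_right_mono) auto
   also have "... = 3/((e n)^2 + t)"
   proof -
    have "3*d/d^2 = 3/d" if "0 < d" for d :: real using that by(simp add: power2_eq_square)
    from this[OF et] show ?thesis .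
   qed
   also have "... <= 3/t" using t et by(intro divide_left_mono mult_pos_pos) auto
   finally have b: "(3*(e n)^2 + t)/((e n)^2 + t)^2 <= 3/t" .
   have b0: "0 <= (3*(e n)^2 + t)/((e n)^2 + t)^2" using t by(intro divide_nonneg_nonneg add_nonneg_nonneg) auto
   define w where "w = indicator {0..R} r*r*mean_primitive y"
   have w: "0 <= w" unfolding w_def using mean_primitive_bounds(1)[of y] by(auto simp: indicator_def)
   have "norm(indicator {0..R} r*r*(laplacian (log_smoothed c (e n)) (x + r *\<^sub>R y)*mean_primitive y)) = w*((3*(e n)^2 + t)/((e n)^2 + t)^2)"
   proof -
    have "indicator {0..R} r*r*(laplacian (log_smoothed c (e n)) (x + r *\<^sub>R y)*mean_primitive y) = - (w*((3*(e n)^2 + t)/((e n)^2 + t)^2))"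
     unfolding laplacian_log_smoothed[OF e0] w_def t_def by simp
    thus ?thesis using mult_nonneg_nonneg[OF w b0] by(simp only: norm_minus_cancel real_norm_def abs_minus_cancel abs_of_nonneg)
   qed
   also have "... <= w*(3/t)" using b w by(rule mult_left_mono)
   finally show ?case unfolding q by(simp add: riesz_weight_def w_def t_def mult_ac)
  qed
  show "AE q in lborel2. (%n. case q of (r, y) => indicator {0..R} r*r*(laplacian (log_smoothed c (e n)) (x + r *\<^sub>R y)*mean_primitive y)) \<longlonglongrightarrow> - riesz_weight x R q c"
   using ne
  proof eventually_elim
   case (elim q)
   obtain r y where q: "q = (r, y)" by(cases q)
   define t where "t = norm(x + r *\<^sub>R y - c)^2"
   have t: "0 < t" using elim q by(simp add: t_def)
   have "(%n. (3*(e n)^2 + t)/((e n)^2 + t)^2) \<longlonglongrightarrow> (3*0^2 + t)/(0^2 + t)^2"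
    by(intro tendsto_divide tendsto_add tendsto_mult tendsto_power tendsto_const e(3)) (use t in auto)
   hence l: "(%n. (3*(e n)^2 + t)/((e n)^2 + t)^2) \<longlonglongrightarrow> 1/t" using t by(simp add: power2_eq_square)
   have "(%n. indicator {0..R} r*r*(- ((3*(e n)^2 + t)/((e n)^2 + t)^2)*mean_primitive y)) \<longlonglongrightarrow> indicator {0..R} r*r*(- (1/t)*mean_primitive y)"
    by(intro tendsto_mult tendsto_minus tendsto_const l)
   thus ?case unfolding q t_def by(simp add: riesz_weight_def laplacian_log_smoothed[OF e0])
  qed
 qed measurable
 have "(%n. log_smoothed c (e n) x*LI mean_weight) \<longlonglongrightarrow> log_kernel x c*LI mean_weight"
  by(intro tendsto_mult tendsto_const lim_ln) (use c in auto)
 from tendsto_diff[OF L1 this] have "(%n. weighted_mean (log_smoothed c (e n)) x R - log_smoothed c (e n) x*LI mean_weight)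
   \<longlonglongrightarrow> weighted_mean (%z. log_kernel z c) x R - log_kernel x c*LI mean_weight" .
 from LIMSEQ_unique[OF this[unfolded ws(2)] L2] show ?thesis by simp
qed

context riesz_solution
begin

definition weight_mass :: real where "weight_mass = LI mean_weight"

text \<open>The half is the integral of \<open>r\<close> over \<open>{0..R}\<close> divided by
  \<open>R^2\<close>: constant Laplacian \<open>- L\<close> changes the mean over radius
  \<open>R\<close> by \<open>- mean_slope * R^2\<close>.\<close>

definition mean_slope :: real where "mean_slope = L*LI mean_primitive/2"

lemma riesz_weight_integrable:
 assumes "0 < R"
 shows "integrable (lborel2 \<Otimes>\<^sub>M lborel) (%(q, c). riesz_weight x R q c*f c)"
  and "integrable lborel2 (%q. (LINT c. riesz_weight x R q c*f c))"
proof -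
 obtain C where C: "!!z. z : cball 0 (norm x + R) ==> (LINT y. f y/norm(z - y)^2) <= C"
  using riesz_bounded_ball by blast
 define W where "W = (%(r, y). indicator {0..R} r*r*mean_primitive y)"
 have W0: "0 <= W q" for q unfolding W_def using mean_primitive_bounds(1) by(cases q) (auto simp: indicator_def)
 have e: "riesz_weight x R q c*f c = W q*(f c/norm(x + fst q *\<^sub>R snd q - c)^2)" for q c
  by(simp add: riesz_weight_def W_def split_beta')
 have ic: "L1 (%c. riesz_weight x R q c*f c)" for q
  unfolding e by(intro integrable_mult_right riesz_integrable)
 have ei: "(LINT c. riesz_weight x R q c*f c) = W q*(LINT c. f c/norm(x + fst q *\<^sub>R snd q - c)^2)" for q
  unfolding e by(rule integral_mult_right_zero)
 have bnd: "(LINT c. riesz_weight x R q c*f c) <= C*(R*(indicator {0..R} (fst q)*indicator (cball 0 1) (snd q)))" for q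
 proof(cases "fst q : {0..R} & norm(snd q) <= 1")
  case True
  have "norm(x + fst q *\<^sub>R snd q) <= norm x + norm(fst q *\<^sub>R snd q)" by(rule norm_triangle_ineq)
  also have "norm(fst q *\<^sub>R snd q) <= R*1" unfolding norm_scaleR using True assms by(intro mult_mono) auto
  finally have b: "(LINT y. f y/norm(x + fst q *\<^sub>R snd q - y)^2) <= C" by(intro C) simp
  have i0: "0 <= (LINT y. f y/norm(x + fst q *\<^sub>R snd q - y)^2)"
   using f_pos less_imp_le by(intro integral_nonneg_AE AE_I2 divide_nonneg_nonneg) auto
  have "W q <= R"
  proof -
   have "fst q*mean_primitive(snd q) <= R*1"
    using True mean_primitive_bounds[of "snd q"] assms by(intro mult_mono) (auto simp: indicator_def)
   thus ?thesis using True by(simp add: W_def split_beta')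
  qed
  hence "W q*(LINT y. f y/norm(x + fst q *\<^sub>R snd q - y)^2) <= R*C"
   using b i0 assms by(intro mult_mono) auto
  thus ?thesis unfolding ei using True by(simp add: mult.commute)
 next
  case False
  have "W q = 0"
   using False mean_weight_outside[of "snd q"] by(auto simp: W_def split_beta' indicator_def mean_primitive_def)
  thus ?thesis unfolding ei using False by(auto simp: indicator_def)
 qed
 have nn: "0 <= (LINT c. riesz_weight x R q c*f c)" for q
  using f_pos less_imp_le riesz_weight_nonneg by(intro integral_nonneg_AE AE_I2 mult_nonneg_nonneg) auto
 have iB: "integrable lborel2 (%q. C*(R*(indicator {0..R} (fst q)*indicator (cball (0::real^3) 1) (snd q))))"
 proof -
  have "integrable lborel2 (indicator({0..R} \<times> cball (0::real^3) 1) :: _ => real)"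
   unfolding lborel_prod
   by(rule integrable_real_indicator) (use emeasure_compact_finite[OF compact_Times[OF compact_Icc compact_cball], of 0 R "0::real^3" 1] in \<open>auto intro!: borel_closed closed_Times\<close>)
  moreover have "indicator({0..R} \<times> cball 0 1) = (%q. indicator {0..R} (fst q)*indicator (cball (0::real^3) 1) (snd q) :: real)"
   by(auto simp: fun_eq_iff indicator_def)
  ultimately have "integrable lborel2 (%q. indicator {0..R} (fst q)*indicator (cball (0::real^3) 1) (snd q) :: real)"
   by(simp only:)
  thus ?thesis by(intro integrable_mult_right)
 qed
 have m: "(%q. (LINT c. riesz_weight x R q c*f c)) : borel_measurable lborel2"
  by(intro lborel.borel_measurable_lebesgue_integral) measurable
 show i2: "integrable lborel2 (%q. (LINT c. riesz_weight x R q c*f c))"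
  by(rule integrable_bound[OF iB m]) (use bnd nn in \<open>auto intro!: AE_I2 intro: order_trans[OF _ abs_ge_self]\<close>)
 interpret T: pair_sigma_finite "(lborel :: real measure) \<Otimes>\<^sub>M (lborel :: (real^3) measure)" "lborel :: (real^3) measure"
  by(simp add: pair_sigma_finite_def lborel_pair.sigma_finite_measure_axioms lborel.sigma_finite_measure_axioms lborel_prod)
 show "integrable (lborel2 \<Otimes>\<^sub>M lborel) (%(q, c). riesz_weight x R q c*f c)"
 proof(rule T.Fubini_integrable)
  have "norm(riesz_weight x R q c*f c) = riesz_weight x R q c*f c" for q c
   using riesz_weight_nonneg f_pos[of c] by(simp add: abs_mult less_imp_le)
  thus "integrable lborel2 (%q. (LINT c. norm(case (q, c) of (q, c) => riesz_weight x R q c*f c)))"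
   using i2 by simp
  show "AE q in lborel2. L1 (%c. case (q, c) of (q, c) => riesz_weight x R q c*f c)"
   using ic by(intro AE_I2) simp
 qed measurable
qed

text \<open>The formula for a single pole, integrated over the poles \<open>c\<close> with density
  \<open>f\<close>. Almost every pole is admissible, because Fubini itself yields the integrability
  in \<open>q\<close> that the single formula requires.\<close>

lemma weighted_mean_v:
 assumes R: "0 < R"
 shows "L1 (%y. v (x + R *\<^sub>R y)*mean_weight y)"
  and "weighted_mean v x R - weight_mass * v x
   = - (1/pi^2*(LINT q|lborel2. (LINT c. riesz_weight x R q c*f c)))"
proof -
 interpret T: pair_sigma_finite "(lborel :: real measure) \<Otimes>\<^sub>M (lborel :: (real^3) measure)" "lborel :: (real^3) measure"
  by(simp add: pair_sigma_finite_def lborel_pair.sigma_finite_measure_axioms lborel.sigma_finite_measure_axioms lborel_prod)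
 note RW = riesz_weight_integrable[OF R, of x]
 define \<rho> where "\<rho> = norm x + R + 1"
 have \<rho>: "1 <= \<rho>" unfolding \<rho>_def using R by simp
 obtain C where C: "!!z. norm z <= \<rho> ==> L1 (%y. log_kernel z y*f y)"
  "!!z. norm z <= \<rho> ==> (LINT y. \<bar>log_kernel z y\<bar>*f y) <= C"
  using log_kernel_integral_bound[OF \<rho>] by blast
 have nz: "norm(x + R *\<^sub>R y) <= \<rho>" if "norm y <= 1" for y
 proof -
  have "norm(R *\<^sub>R y) <= R*1" using mult_left_mono[OF that, of R] R by simp
  thus ?thesis using norm_triangle_ineq[of x "R *\<^sub>R y"] unfolding \<rho>_def by linarith
 qed
 define H where "H = (%(y, c). (log_kernel (x + R *\<^sub>R y) c*f c)*mean_weight y)"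
 have [measurable]: "H : borel_measurable lborel2" unfolding H_def split_beta' by measurable
 note iw = integrable_indicator_cball
 have iH: "integrable lborel2 H"
 proof(rule lborel_pair.Fubini_integrable)
  show "L1 (%y. (LINT c. norm(H (y, c))))"
  proof(rule integrable_bound[OF integrable_mult_right[OF iw, of C]])
   show "(%y. (LINT c. norm(H (y, c)))) : borel_measurable lborel"
    by(intro lborel.borel_measurable_lebesgue_integral) measurable
   show "AE y in lborel. norm(LINT c. norm(H (y, c))) <= norm(C*indicator (cball 0 1) y)"
   proof(rule AE_I2)
    fix y
    have h: "norm(H (y, c)) = (\<bar>log_kernel (x + R *\<^sub>R y) c\<bar>*f c)*mean_weight y" for c
     using f_pos[of c] mean_weight_bounds(1)[of y] by(simp add: H_def abs_mult)
    show "norm(LINT c. norm(H (y, c))) <= norm(C*indicator (cball 0 1) y)"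
    proof(cases "norm y <= 1")
     case True
     have i0: "0 <= (LINT c. \<bar>log_kernel (x + R *\<^sub>R y) c\<bar>*f c)"
      using f_pos less_imp_le by(intro integral_nonneg_AE AE_I2 mult_nonneg_nonneg) auto
     have "(LINT c. \<bar>log_kernel (x + R *\<^sub>R y) c\<bar>*f c)*mean_weight y <= C*1"
      using C(2)[OF nz[OF True]] i0 mean_weight_bounds[of y] True by(intro mult_mono) auto
     moreover have "0 <= (LINT c. \<bar>log_kernel (x + R *\<^sub>R y) c\<bar>*f c)*mean_weight y"
      using i0 mean_weight_bounds(1) by(rule mult_nonneg_nonneg)
     ultimately show ?thesis unfolding h using True by simp
    next
     case False
     hence "norm(H (y, c)) = 0" for c unfolding h using mean_weight_outside[of y] by simp
     thus ?thesis by simp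
    qed
   qed
  qed
  show "AE y in lborel. L1 (%c. H (y, c))"
   using log_kernel_integrable by(intro AE_I2) (simp add: H_def)
 qed measurable
 have Hc: "(LINT c. H (y, c)) = pi^2*(v (x + R *\<^sub>R y)*mean_weight y)" for y
  unfolding H_def v_def by simp
 have "L1 (%y. (LINT c. H (y, c)))" by(rule lborel_pair.integrable_fst'[OF iH])
 thus "L1 (%y. v (x + R *\<^sub>R y)*mean_weight y)" unfolding Hc by simp
 have swap: "(LINT y. (LINT c. H (y, c))) = (LINT c. (LINT y. H (y, c)))"
  using lborel_pair.Fubini_integral[of "%y c. H (y, c)"] iH by simp
 have swap2: "(LINT q|lborel2. (LINT c. riesz_weight x R q c*f c)) = (LINT c. (LINT q|lborel2. riesz_weight x R q c*f c))"
  using T.Fubini_integral[OF RW(1)] by simp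
 have i3: "L1 (%c. (LINT q|lborel2. riesz_weight x R q c*f c))"
  by(rule T.integrable_snd[OF RW(1)])
 have "AE c in lborel. integrable lborel2 (%q. riesz_weight x R q c*f c)"
  by(rule T.AE_integrable_snd[OF RW(1)])
 hence key: "AE c in lborel. (LINT y. H (y, c)) = weight_mass*(log_kernel x c*f c) - (LINT q|lborel2. riesz_weight x R q c*f c)"
  using AE_lborel_singleton[of "0::real^3"] AE_lborel_singleton[of x]
 proof eventually_elim
  case (elim c)
  have fc: "f c ~= 0" using f_pos[of c] by simp
  have "integrable lborel2 (%q. riesz_weight x R q c*f c*(1/f c))"
   by(intro integrable_mult_left elim(1))
  hence "integrable lborel2 (%q. riesz_weight x R q c)" using fc by simp
  from log_kernel_weighted_mean[OF R elim(2,3) this]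
  have "weighted_mean (%z. log_kernel z c) x R*f c = (weight_mass*log_kernel x c - (LINT q|lborel2. riesz_weight x R q c))*f c"
   by(simp add: weight_mass_def mult.commute)
  moreover have "(LINT y. H (y, c)) = weighted_mean (%z. log_kernel z c) x R*f c"
   unfolding weighted_mean_def H_def by(subst integral_mult_left_zero[symmetric]) (simp add: mult_ac)
  ultimately show ?case by(simp add: algebra_simps)
 qed
 have "(LINT c. (LINT y. H (y, c))) = (LINT c. weight_mass*(log_kernel x c*f c) - (LINT q|lborel2. riesz_weight x R q c*f c))"
 proof(rule integral_cong_AE[OF _ _ key])
  show "(%c. (LINT y. H (y, c))) : borel_measurable lborel"
   by(intro lborel.borel_measurable_lebesgue_integral) measurable
  show "(%c. weight_mass*(log_kernel x c*f c) - (LINT q|lborel2. riesz_weight x R q c*f c)) : borel_measurable lborel"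
   using borel_measurable_integrable[OF i3] by measurable
 qed
 also have "... = weight_mass*(LINT c. log_kernel x c*f c) - (LINT c. (LINT q|lborel2. riesz_weight x R q c*f c))"
  by(subst integral_diff[OF integrable_mult_right[OF log_kernel_integrable] i3]) simp
 finally have "pi^2*weighted_mean v x R = weight_mass*(pi^2 * v x) - (LINT q|lborel2. (LINT c. riesz_weight x R q c*f c))"
  unfolding swap2 swap[symmetric] Hc by(simp add: weighted_mean_def v_def)
 thus "weighted_mean v x R - weight_mass * v x
   = - (1/pi^2*(LINT q|lborel2. (LINT c. riesz_weight x R q c*f c)))"
  by(simp add: field_simps)
qed

text \<open>The mean value formulas of \<open>u\<close> and \<open>v\<close> contain the same Riesz
  term; it cancels and only the contribution of \<open>L\<close> remains. So \<open>p\<close> is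
  handled like a function of constant Laplacian without being differentiated.\<close>

lemma weighted_mean_p:
 assumes R: "0 < R"
 shows "L1 (%y. p (x + R *\<^sub>R y)*mean_weight y)"
  and "weighted_mean p x R = weight_mass*p x - mean_slope * R^2"
proof -
 note mv = weighted_mean_v[OF R, of x]
 have iu: "L1 (%y. u (x + R *\<^sub>R y)*mean_weight y)"
  by(rule integrable_mult_ball[OF u_continuous mean_weight_measurable mean_weight_bounds])
 show "L1 (%y. p (x + R *\<^sub>R y)*mean_weight y)"
  unfolding p_def left_diff_distrib by(rule integrable_diff[OF iu mv(1)])
 define I where "I = (LINT q|lborel2. (LINT c. riesz_weight x R q c*f c))"
 define W where "W = (%(r, y). indicator {0..R} r*r*mean_primitive y)"
 have iW: "integrable lborel2 W"
 proof -
  have "L1 (%q. indicator ({0..R} \<times> cball (0::real^3) 1) q *\<^sub>R (fst q*mean_primitive(snd q)))"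
   by(rule borel_integrable_compact)
    (auto intro!: compact_Times continuous_intros continuous_on_compose2[OF continuous_on_mean_primitive])
  moreover have "(%q. indicator ({0..R} \<times> cball (0::real^3) 1) q *\<^sub>R (fst q*mean_primitive(snd q))) = W"
   unfolding W_def fun_eq_iff using mean_weight_outside by(auto simp: indicator_def split_beta' mean_primitive_def)
  ultimately show ?thesis unfolding lborel_prod by simp
 qed
 have IW: "integral\<^sup>L lborel2 W = R^2/2*LI mean_primitive"
 proof -
  have "integral\<^sup>L lborel2 W = (LINT r. (LINT y. W (r, y)))"
   by(rule lborel_pair.integral_fst'[OF iW, symmetric])
  also have "... = (LINT r. indicator {0..R} r*r)*LI mean_primitive" unfolding W_def by simp
  also have "(LINT r. indicator {0..R} r*r) = R^2/2"
  proof -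
   have "set_integrable lborel {0..R} (%r::real. r)"
    by(rule borel_integrable_atLeastAtMost') (intro continuous_intros)
   from set_borel_integral_eq_integral(2)[OF this] show ?thesis
    using ident_has_integral[of 0 R] R by(simp add: set_lebesgue_integral_def integral_unique)
  qed
  finally show ?thesis .
 qed
 have "weighted_mean u x R - u x*weight_mass
   = (LINT q|lborel2. (case q of (r, y) => indicator {0..R} r*r*(laplacian u (x + r *\<^sub>R y)*mean_primitive y)))"
  unfolding weight_mass_def by(rule weighted_mean_smooth(2)[OF smooth less_imp_le[OF R]])
 also have "... = (LINT q|lborel2. - (L*W q) - 1/pi^2*(LINT c. riesz_weight x R q c*f c))"
 proof(intro Bochner_Integration.integral_cong refl)
  fix q :: "real \<times> (real^3)"
  obtain r y where q: "q = (r, y)" by(cases q)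
  have "laplacian u (x + r *\<^sub>R y) = - L - 1/pi^2*(LINT c. f c/norm(x + r *\<^sub>R y - c)^2)"
   using lap[of "x + r *\<^sub>R y"] by(simp add: f_def)
  moreover have "(LINT c. riesz_weight x R q c*f c) = W q*(LINT c. f c/norm(x + r *\<^sub>R y - c)^2)"
   unfolding q riesz_weight_def W_def by(subst integral_mult_right_zero[symmetric]) (simp add: mult_ac)
  ultimately show "(case q of (r, y) => indicator {0..R} r*r*(laplacian u (x + r *\<^sub>R y)*mean_primitive y))
    = - (L*W q) - 1/pi^2*(LINT c. riesz_weight x R q c*f c)"
   unfolding q by(simp only: prod.case W_def) (simp add: right_diff_distrib left_diff_distrib mult_ac)
 qed
 also have "... = - (L*integral\<^sup>L lborel2 W) - 1/pi^2*I" unfolding I_def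
  by(subst integral_diff)
   (auto intro!: iW riesz_weight_integrable(2)[OF R] integrable_mult_right simp del: mult_minus_left times_divide_eq_left)
 finally have U: "weighted_mean u x R - weight_mass*u x = - (L*integral\<^sup>L lborel2 W) - 1/pi^2*I"
  by(simp add: mult.commute)
 have "weighted_mean p x R = weighted_mean u x R - weighted_mean v x R"
  unfolding weighted_mean_def p_def left_diff_distrib by(rule integral_diff[OF iu mv(1)])
 hence "weighted_mean p x R = weight_mass*p x - L*integral\<^sup>L lborel2 W"
  using U mv(2) unfolding I_def[symmetric] p_def by(simp add: algebra_simps)
 thus "weighted_mean p x R = weight_mass*p x - mean_slope * R^2"
  unfolding IW mean_slope_def by(simp add: mult_ac)
qed

end

section \<open>The case of a vanishing limit of the Laplacian\<close>

text \<open>The weight has Lipschitz constant 2, and a shift by at most 1 changes it only where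
  \<open>|y| < 2\<close>; there the weight spread to radius 4 is at least \<open>3/4\<close>. As the
  bound is again a weight, it integrates to a mean.\<close>

lemma mean_weight_difference:
 assumes "norm a <= 1"
 shows "\<bar>mean_weight(y - a) - mean_weight y\<bar> <= 3*norm a*mean_weight((1/4) *\<^sub>R y)"
proof(cases "norm y < 2")
 case True
 have e: "mean_weight z = 1 - (min 1 (norm z))^2" for z
 proof(cases "norm z <= 1")
  case True
  thus ?thesis using power_le_one[of "norm z" 2] by(simp add: mean_weight_def min_absorb2)
 qed(simp add: mean_weight_outside min_absorb1)
 define s t where "s = min 1 (norm y)" and "t = min 1 (norm(y - a))"
 have st: "0 <= s" "s <= 1" "0 <= t" "t <= 1" by(auto simp: s_def t_def)
 have "\<bar>s - t\<bar> <= norm a"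
  using norm_triangle_ineq3[of y "y - a"] norm_triangle_ineq3[of "y - a" y] by(auto simp: s_def t_def min_def)
 hence "\<bar>s - t\<bar>*(s + t) <= norm a*2" using st by(intro mult_mono) auto
 moreover have "mean_weight(y - a) - mean_weight y = (s - t)*(s + t)"
  unfolding e s_def[symmetric] t_def[symmetric] by(simp add: power2_eq_square algebra_simps)
 ultimately have "\<bar>mean_weight(y - a) - mean_weight y\<bar> <= norm a*2" using st by(simp add: abs_mult)
 also have "... <= norm a*(3*mean_weight((1/4) *\<^sub>R y))"
 proof(intro mult_left_mono norm_ge_zero)
  have "(norm((1/4) *\<^sub>R y))^2 <= (1/2)^2" using True by(intro power_mono) auto
  thus "2 <= 3*mean_weight((1/4) *\<^sub>R y)" by(simp add: mean_weight_def power2_eq_square max_def)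
 qed
 finally show ?thesis by simp
next
 case False
 have "1 <= norm(y - a)" using False assms norm_triangle_ineq2[of y a] by linarith
 thus ?thesis using False mean_weight_bounds(1) by(simp add: mean_weight_outside)
qed

context riesz_solution
begin

lemma mean_weight_integrable: "L1 mean_weight"
 using integrable_mult_ball[OF continuous_on_const mean_weight_measurable mean_weight_bounds, of 1] by simp

lemma weight_mass_pos: "0 < weight_mass"
proof -
 have "(LINT y. (3/4)*indicator (cball (0::real^3) (1/2)) y) <= weight_mass"
  unfolding weight_mass_def
 proof(rule integral_mono[OF _ mean_weight_integrable])
  show "L1 (%y. (3/4)*indicator (cball (0::real^3) (1/2)) y :: real)"
   by(intro integrable_mult_right integrable_indicator_cball)
  fix y :: "real^3"
  have "(norm y)^2 <= (1/2)^2" if "norm y <= 1/2" using that by(intro power_mono) auto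
  thus "(3/4)*indicator (cball 0 (1/2)) y <= mean_weight y"
   by(auto simp: mean_weight_def indicator_def power2_eq_square)
 qed
 moreover have "0 < measure lborel (cball (0::real^3) (1/2))" using content_cball_pos[of "1/2" "0::real^3"] by simp
 moreover have "(LINT y. (3/4)*indicator (cball (0::real^3) (1/2)) y) = (3/4)*measure lborel (cball (0::real^3) (1/2))" by simp
 ultimately show ?thesis by linarith
qed

lemma integrable_p_ball: "0 < R ==> L1 (%y. \<bar>p (x + R *\<^sub>R y)\<bar>*mean_weight y)"
 using integrable_abs[OF weighted_mean_p(1)[of R x]] mean_weight_bounds(1) by(simp add: abs_mult)

lemma f_affine_integrable: "R ~= 0 ==> L1 (%y. f(x + R *\<^sub>R y))"
 by(rule integrable_lborel_affine[OF f_integrable])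

text \<open>\<open>|p|\<close> is twice the positive part minus \<open>p\<close>: the first is
  bounded by \<open>exp_p_bound\<close>, and the mean of the second is known exactly.\<close>

lemma weighted_mean_abs_p:
 obtains C where "0 <= C" "!!R. 1 <= R ==> weighted_mean (%z. \<bar>p z\<bar>) 0 R <= C + mean_slope * R^2 + C*ln(R + 1)"
proof -
 obtain K where K: "0 < K" "!!S z. norm z <= S - 1 ==> max 0 (p z) <= \<alpha>*ln S + K*f z"
  by(rule exp_p_bound) (rule that)
 define C where "C = 2*K*mass + \<bar>weight_mass*p 0\<bar> + 2*\<alpha>*weight_mass"
 have C: "0 <= C" unfolding C_def using K(1) mass_pos alpha_pos weight_mass_pos by(intro add_nonneg_nonneg) auto
 have "weighted_mean (%z. \<bar>p z\<bar>) 0 R <= C + mean_slope * R^2 + C*ln(R + 1)" if R: "1 <= R" for R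
 proof -
  have R0: "0 < R" using R by simp
  define l where "l = ln(R + 1)"
  have l: "0 <= l" using R by(simp add: l_def)
  define G where "G y = 2*(\<alpha>*l)*mean_weight y + 2*K*f(0 + R *\<^sub>R y) - p (0 + R *\<^sub>R y)*mean_weight y" for y
  have fi: "L1 (%y. f(0 + R *\<^sub>R y))" by(rule f_affine_integrable) (use R in simp)
  note i = integrable_mult_right[OF mean_weight_integrable, of "2*(\<alpha>*l)"] integrable_mult_right[OF fi, of "2*K"] weighted_mean_p(1)[OF R0, of 0]
  have "weighted_mean (%z. \<bar>p z\<bar>) 0 R <= LI G" unfolding weighted_mean_def
  proof(rule integral_mono[OF integrable_p_ball[OF R0]])
   show "L1 G" unfolding G_def by(rule integrable_diff[OF integrable_add[OF i(1,2)] i(3)])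
   fix y :: "real^3"
   show "\<bar>p (0 + R *\<^sub>R y)\<bar>*mean_weight y <= G y"
   proof(cases "norm y <= 1")
    case True
    have "norm(0 + R *\<^sub>R y) <= (R + 1) - 1" using mult_left_mono[OF True, of R] R0 by simp
    from K(2)[OF this] have "\<bar>p (0 + R *\<^sub>R y)\<bar> <= 2*(\<alpha>*l) + 2*K*f(0 + R *\<^sub>R y) - p (0 + R *\<^sub>R y)"
     unfolding l_def by(auto simp: max_def split: if_splits)
    hence "\<bar>p (0 + R *\<^sub>R y)\<bar>*mean_weight y <= (2*(\<alpha>*l) + 2*K*f(0 + R *\<^sub>R y) - p (0 + R *\<^sub>R y))*mean_weight y"
     by(rule mult_right_mono[OF _ mean_weight_bounds(1)])
    moreover have "2*K*f(0 + R *\<^sub>R y)*mean_weight y <= 2*K*f(0 + R *\<^sub>R y)*1"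
     using K(1) f_pos[of "0 + R *\<^sub>R y"] mean_weight_bounds(2)[of y] True by(intro mult_left_mono) auto
    ultimately show ?thesis unfolding G_def by(simp add: algebra_simps)
   next
    case False
    thus ?thesis using K(1) f_pos[of "R *\<^sub>R y"] by(simp add: G_def mean_weight_outside)
   qed
  qed
  also have "... = 2*(\<alpha>*l)*weight_mass + 2*K*(LINT y. f(0 + R *\<^sub>R y)) - weighted_mean p 0 R"
   unfolding G_def weight_mass_def weighted_mean_def
   by(simp only: integral_diff[OF integrable_add[OF i(1,2)] i(3)]
     integral_add[OF i(1,2)] integral_mult_right_zero)
  finally have m: "weighted_mean (%z. \<bar>p z\<bar>) 0 R <= 2*(\<alpha>*l)*weight_mass + 2*K*(LINT y. f(0 + R *\<^sub>R y)) - (weight_mass*p 0 - mean_slope * R^2)"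
   unfolding weighted_mean_p(2)[OF R0] .
  have "(LINT y. f(0 + R *\<^sub>R y)) <= mass"
  proof -
   have "R^3*(LINT y. f(0 + R *\<^sub>R y)) = mass"
    unfolding mass_def using integral_lborel_affine[of R f 0] R0 by simp
   moreover have "1*(LINT y. f(0 + R *\<^sub>R y)) <= R^3*(LINT y. f(0 + R *\<^sub>R y))"
    using R f_pos less_imp_le by(intro mult_right_mono one_le_power integral_nonneg_AE AE_I2) auto
   ultimately show ?thesis by simp
  qed
  hence "2*K*(LINT y. f(0 + R *\<^sub>R y)) <= 2*K*mass" using K(1) by simp
  moreover have "2*(\<alpha>*l)*weight_mass <= C*l"
  proof -
   have "(2*\<alpha>*weight_mass)*l <= C*l" unfolding C_def using K(1) mass_pos l by(intro mult_right_mono) auto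
   thus ?thesis by(simp add: mult_ac)
  qed
  moreover have "2*K*mass - weight_mass*p 0 <= C" unfolding C_def using mult_pos_pos[OF alpha_pos weight_mass_pos] abs_ge_minus_self[of "weight_mass*p 0"] by linarith
  ultimately show ?thesis using m unfolding l_def by linarith
 qed
 with C show thesis by(rule that)
qed

lemma mean_primitive_mass_pos: "0 < LI mean_primitive"
proof -
 have i: "L1 mean_primitive"
  using integrable_mult_ball[OF continuous_on_const mean_primitive_measurable mean_primitive_bounds, of 1] by simp
 have "(LINT y. (9/64)*indicator (cball (0::real^3) (1/2)) y) <= LI mean_primitive"
 proof(rule integral_mono[OF _ i])
  show "L1 (%y. (9/64)*indicator (cball (0::real^3) (1/2)) y :: real)"
   by(intro integrable_mult_right integrable_indicator_cball)
  fix y :: "real^3"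
  have "(3/4)^2 <= (mean_weight y)^2" if "norm y <= 1/2"
  proof(rule power_mono)
   have "(norm y)^2 <= (1/2)^2" using that by(intro power_mono) auto
   thus "3/4 <= mean_weight y" by(simp add: mean_weight_def power2_eq_square)
  qed simp
  thus "(9/64)*indicator (cball 0 (1/2)) y <= mean_primitive y"
   by(auto simp: mean_primitive_def indicator_def power2_eq_square)
 qed
 moreover have "0 < measure lborel (cball (0::real^3) (1/2))" using content_cball_pos[of "1/2" "0::real^3"] by simp
 moreover have "(LINT y. (9/64)*indicator (cball (0::real^3) (1/2)) y) = (9/64)*measure lborel (cball (0::real^3) (1/2))" by simp
 ultimately show ?thesis by linarith
qed

lemma mean_slope_cases: "L = 0 ==> mean_slope = 0" "0 < L ==> 0 < mean_slope" "L < 0 ==> mean_slope < 0"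
 unfolding mean_slope_def using mean_primitive_mass_pos by(auto simp: mult_neg_pos)

text \<open>For \<open>L < 0\<close> the upper bound for the mean of \<open>|p|\<close> would tend
  to minus infinity.\<close>

lemma L_nonneg: "0 <= L"
proof(rule ccontr)
 assume "~ 0 <= L"
 hence s: "mean_slope < 0" using mean_slope_cases(3) by simp
 obtain C where C: "0 <= C" "!!R. 1 <= R ==> weighted_mean (%z. \<bar>p z\<bar>) 0 R <= C + mean_slope * R^2 + C*ln(R + 1)"
  by(rule weighted_mean_abs_p) (rule that)
 have "((%R. (C + C*ln(R + 1))/R^2) \<longlongrightarrow> 0) at_top" by real_asymp
 from order_tendstoD(2)[OF this, of "- mean_slope"] s
 have "\<forall>\<^sub>F R in at_top. (C + C*ln(R + 1))/R^2 < - mean_slope" by simp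
 with eventually_ge_at_top[of 1] have "\<forall>\<^sub>F R::real in at_top. False"
 proof eventually_elim
  case (elim R)
  have "C + C*ln(R + 1) < - mean_slope * R^2" using elim by(simp add: pos_divide_less_eq)
  moreover have "0 <= weighted_mean (%z. \<bar>p z\<bar>) 0 R"
   unfolding weighted_mean_def using mean_weight_bounds(1) by(intro integral_nonneg_AE AE_I2) simp
  ultimately show ?case using C(2)[OF elim(1)] by simp
 qed
 thus False by simp
qed

text \<open>Means centred at \<open>x\<close> and at 0 have the same quadratic term, so
  \<open>p x - p 0\<close> is a difference of means; shifting the weight costs \<open>|x|/R\<close>
  times a mean over radius \<open>4 * R\<close>. If that mean grows logarithmically, this is
  Liouville's theorem. The constant is \<open>3 * 4^3\<close>.\<close>

lemma p_difference_bound: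
 assumes x: "norm x <= R" and R: "0 < R"
 shows "weight_mass*\<bar>p x - p 0\<bar> <= 192*(norm x/R)*weighted_mean (%z. \<bar>p z\<bar>) 0 (4 * R)"
proof -
 define a where "a = (1/R) *\<^sub>R x"
 have Ra: "R *\<^sub>R a = x" "norm a = norm x/R" "norm a <= 1" using R x by(auto simp: a_def)
 have e: "p (x + R *\<^sub>R y)*mean_weight y = (%y. p (0 + R *\<^sub>R y)*mean_weight(y - a)) (a + y)" for y
  by(simp add: scaleR_add_right Ra)
 have i: "L1 (%y. p (0 + R *\<^sub>R y)*mean_weight(y - a))"
  using weighted_mean_p(1)[OF R, of x] unfolding e by(rule iffD1[OF integrable_translate(1)])
 have w: "weighted_mean p x R = (LINT y. p (0 + R *\<^sub>R y)*mean_weight(y - a))"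
  unfolding weighted_mean_def e by(rule integral_translate(1))
 have i4: "L1 (%y. \<bar>p (0 + R *\<^sub>R y)\<bar>*mean_weight((1/4) *\<^sub>R y))"
  using integrable_lborel_affine[OF integrable_p_ball[of "4 * R" 0], of "1/4" 0] R by simp
 have w4: "(LINT y. \<bar>p (0 + R *\<^sub>R y)\<bar>*mean_weight((1/4) *\<^sub>R y)) = 64*weighted_mean (%z. \<bar>p z\<bar>) 0 (4 * R)"
  using integral_lborel_affine[of 4 "%y. \<bar>p (0 + R *\<^sub>R y)\<bar>*mean_weight((1/4) *\<^sub>R y)" 0]
  by(simp add: weighted_mean_def mult.commute)
 have "weight_mass*(p x - p 0) = weighted_mean p x R - weighted_mean p 0 R"
  unfolding weighted_mean_p(2)[OF R] by(simp add: algebra_simps)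
 also have "... = (LINT y. p (0 + R *\<^sub>R y)*mean_weight(y - a) - p (0 + R *\<^sub>R y)*mean_weight y)"
  unfolding w by(simp only: weighted_mean_def integral_diff[OF i weighted_mean_p(1)[OF R]])
 finally have "weight_mass*\<bar>p x - p 0\<bar> = \<bar>(LINT y. p (0 + R *\<^sub>R y)*mean_weight(y - a) - p (0 + R *\<^sub>R y)*mean_weight y)\<bar>"
  using weight_mass_pos by(metis abs_mult abs_of_pos)
 also have "... <= (LINT y. \<bar>p (0 + R *\<^sub>R y)*mean_weight(y - a) - p (0 + R *\<^sub>R y)*mean_weight y\<bar>)"
  by(rule integral_abs_bound)
 also have "... <= (LINT y. 3*norm a*(\<bar>p (0 + R *\<^sub>R y)\<bar>*mean_weight((1/4) *\<^sub>R y)))"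
 proof(rule integral_mono)
  show "L1 (%y. \<bar>p (0 + R *\<^sub>R y)*mean_weight(y - a) - p (0 + R *\<^sub>R y)*mean_weight y\<bar>)"
   by(intro integrable_abs integrable_diff i weighted_mean_p(1)[OF R])
  show "\<bar>p (0 + R *\<^sub>R y)*mean_weight(y - a) - p (0 + R *\<^sub>R y)*mean_weight y\<bar> <= 3*norm a*(\<bar>p (0 + R *\<^sub>R y)\<bar>*mean_weight((1/4) *\<^sub>R y))" for y
   using mult_left_mono[OF mean_weight_difference[OF Ra(3), of y], of "\<bar>p (0 + R *\<^sub>R y)\<bar>"]
   by(simp add: abs_mult[symmetric] right_diff_distrib mult_ac)
 qed(intro integrable_mult_right i4)
 also have "... = 192*(norm x/R)*weighted_mean (%z. \<bar>p z\<bar>) 0 (4 * R)"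
  by(subst integral_mult_right_zero) (simp only: w4 Ra(2))
 finally show ?thesis .
qed

lemma p_constant:
 assumes "L = 0"
 shows "p x = p 0"
proof -
 obtain C where C: "0 <= C" "!!R. 1 <= R ==> weighted_mean (%z. \<bar>p z\<bar>) 0 R <= C + mean_slope * R^2 + C*ln(R + 1)"
  by(rule weighted_mean_abs_p) (rule that)
 have "((%R. 192*(norm x/R)*(C + C*ln(4 * R + 1))) \<longlongrightarrow> 0) at_top" by real_asymp
 moreover have "\<forall>\<^sub>F R in at_top. weight_mass*\<bar>p x - p 0\<bar> <= 192*(norm x/R)*(C + C*ln(4 * R + 1))"
  using eventually_ge_at_top[of "norm x"] eventually_ge_at_top[of 1]
 proof eventually_elim
  case (elim R)
  have "weight_mass*\<bar>p x - p 0\<bar> <= 192*(norm x/R)*weighted_mean (%z. \<bar>p z\<bar>) 0 (4 * R)"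
   using elim by(intro p_difference_bound) auto
  also have "... <= 192*(norm x/R)*(C + C*ln(4 * R + 1))"
   using C(2)[of "4 * R"] elim mean_slope_cases(1)[OF assms] by(intro mult_left_mono) auto
  finally show ?case .
 qed
 ultimately have "weight_mass*\<bar>p x - p 0\<bar> <= 0" by(rule tendsto_lowerbound) simp
 thus ?thesis using weight_mass_pos by(simp add: mult_le_0_iff)
qed

end

section \<open>Upper bound of \<open>u\<close> and limits at infinity\<close>

section \<open>Asymptotics at infinity\<close>

lemma inverse_square_mass_scale: "0 < s ==> inverse_square_mass s = s*inverse_square_mass 1"
 unfolding inverse_square_mass_def by(subst integral_lborel_affine[of s _ 0])
  (auto simp: indicator_def power_mult_distrib power3_eq_cube power2_eq_square abs_mult mult_le_cancel_left
    intro!: integral_cong simp flip: integral_mult_right_zero)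

lemma inverse_square_mass_nonneg: "0 <= inverse_square_mass s"
 unfolding inverse_square_mass_def by(intro integral_nonneg_AE AE_I2) simp

context riesz_solution
begin

text \<open>What can make \<open>v\<close> at \<open>x\<close> much larger than at points within
  distance 1 is mass of \<open>f\<close> close to \<open>x\<close>. The 3 is the radius 2 plus the
  distance 1; it also keeps the logarithm nonnegative on the ball.\<close>

definition near_potential :: "real^3 => real" where
 "near_potential x = (LINT c. indicator (cball x 2) c*ln(3/norm(x - c))*f c)"

lemma ln_inverse_le: "0 < s ==> 0 < t ==> t <= s ==> ln(3/t) <= ln(3/s) + s^2/t^2" for s t :: real
proof -
 assume st: "0 < s" "0 < t" "t <= s"
 have "ln(s/t) <= s/t" using ln_le_minus_one[of "s/t"] st by simp
 also have "... <= (s/t)^2" using st by(intro self_le_power) auto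
 finally show ?thesis using st by(simp add: ln_div power_divide)
qed

lemma near_potential_integrable: "L1 (%c. indicator (cball x 2) c*ln(3/norm(x - c))*f c)"
proof(rule integrable_bound[OF integrable_mult_right[OF riesz_integrable[of x], of 9]])
 show "AE c in lborel. norm(indicator (cball x 2) c*ln(3/norm(x - c))*f c) <= norm(9*(f c/norm(x - c)^2))"
  using AE_lborel_singleton[of x]
 proof eventually_elim
  case (elim c)
  show ?case
  proof(cases "norm(x - c) <= 2")
   case True
   have t: "0 < norm(x - c)" using elim by simp
   have "0 <= ln(3/norm(x - c))" using True t by(intro ln_ge_zero) simp
   moreover have "ln(3/norm(x - c)) <= 9/norm(x - c)^2"
    using ln_inverse_le[of 3 "norm(x - c)"] True t by simp
   ultimately have "\<bar>ln(3/norm(x - c))\<bar>*f c <= 9/norm(x - c)^2*f c"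
    using f_pos[of c] by(intro mult_right_mono) auto
   thus ?thesis using True f_pos[of c] by(simp add: abs_mult dist_norm)
  qed(simp add: dist_norm)
 qed
 have [measurable]: "cball x 2 : sets borel" by simp
 show "(%c. indicator (cball x 2) c*ln(3/norm(x - c))*f c) : borel_measurable lborel" by measurable
qed

lemma v_le_v_near:
 assumes y: "norm y <= 1"
 shows "v x <= v (x + y) + (\<alpha>*ln 2 + near_potential x/pi^2)"
proof -
 have "(LINT c. log_kernel x c*f c) - (LINT c. log_kernel (x + y) c*f c)
   = (LINT c. log_kernel x c*f c - log_kernel (x + y) c*f c)"
  by(rule integral_diff[OF log_kernel_integrable log_kernel_integrable, symmetric])
 also have "... <= (LINT c. ln 2*f c + indicator (cball x 2) c*ln(3/norm(x - c))*f c)"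
 proof(rule integral_mono_AE)
  show "AE c in lborel. log_kernel x c*f c - log_kernel (x + y) c*f c <= ln 2*f c + indicator (cball x 2) c*ln(3/norm(x - c))*f c"
   using AE_lborel_singleton[of "0::real^3"] AE_lborel_singleton[of x] AE_lborel_singleton[of "x + y"]
  proof eventually_elim
   case (elim c)
   have t: "0 < norm(x - c)" "0 < norm(x + y - c)" using elim by auto
   have le: "norm(x + y - c) <= norm(x - c) + 1"
    using norm_triangle_ineq[of "x - c" y] y by(simp add: algebra_simps)
   have "log_kernel x c - log_kernel (x + y) c = ln(norm(x + y - c)) - ln(norm(x - c))"
    using elim by(simp add: log_kernel_eq)
   also have "... <= ln 2 + indicator (cball x 2) c*ln(3/norm(x - c))"
   proof(cases "norm(x - c) <= 2")
    case True
    have "ln(norm(x + y - c)) <= ln 3" using le True t by(subst ln_le_cancel_iff) auto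
    moreover have "0 <= ln(2::real)" by simp
    moreover have "ln(3/norm(x - c)) = ln 3 - ln(norm(x - c))" using t by(simp add: ln_div)
    ultimately have "ln(norm(x + y - c)) - ln(norm(x - c)) <= ln 2 + 1*ln(3/norm(x - c))" by linarith
    thus ?thesis using True by(simp add: dist_norm)
   next
    case False
    have "ln(norm(x + y - c)) <= ln(2*norm(x - c))" using le False t by(subst ln_le_cancel_iff) auto
    thus ?thesis using False t by(simp add: ln_mult dist_norm)
   qed
   finally have "(log_kernel x c - log_kernel (x + y) c)*f c <= (ln 2 + indicator (cball x 2) c*ln(3/norm(x - c)))*f c"
    using f_pos[of c] by(intro mult_right_mono) auto
   thus ?case by(simp only: distrib_right left_diff_distrib)
  qed
 qed(intro integrable_diff integrable_add log_kernel_integrable near_potential_integrable integrable_mult_right f_integrable)+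
 also have "... = ln 2*mass + near_potential x" unfolding near_potential_def mass_def
  by(subst integral_add[OF integrable_mult_right[OF f_integrable] near_potential_integrable]) simp
 finally have "(LINT c. log_kernel x c*f c) <= (LINT c. log_kernel (x + y) c*f c) + (ln 2*mass + near_potential x)" by simp
 hence "1/pi^2*(LINT c. log_kernel x c*f c) <= 1/pi^2*((LINT c. log_kernel (x + y) c*f c) + (ln 2*mass + near_potential x))"
  by(rule mult_left_mono) simp
 thus ?thesis unfolding v_def \<alpha>_def by(simp add: distrib_left add_divide_distrib mult.commute)
qed

lemma weighted_mean_u:
 assumes R: "0 < R"
 shows "weighted_mean u x R = weighted_mean p x R + weighted_mean v x R"
proof -
 have "weighted_mean u x R = (LINT y. p (x + R *\<^sub>R y)*mean_weight y + v (x + R *\<^sub>R y)*mean_weight y)"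
  unfolding weighted_mean_def p_def by(simp add: distrib_right[symmetric])
 thus ?thesis
  by(simp only: integral_add[OF weighted_mean_p(1)[OF R] weighted_mean_v(1)[OF R]] weighted_mean_def)
qed

lemma weighted_mean_u_le:
 assumes R: "0 < R"
 shows "weighted_mean u x R <= weight_mass*u x - mean_slope * R^2"
proof -
 have "0 <= (LINT q|lborel2. (LINT c. riesz_weight x R q c*f c))"
  using f_pos less_imp_le riesz_weight_nonneg by(intro integral_nonneg_AE AE_I2 mult_nonneg_nonneg) auto
 hence "0 <= 1/pi^2*(LINT q|lborel2. (LINT c. riesz_weight x R q c*f c))" by simp
 hence "weighted_mean v x R <= weight_mass * v x" using weighted_mean_v(2)[OF R, of x] by linarith
 thus ?thesis unfolding weighted_mean_u[OF R] weighted_mean_p(2)[OF R] by(simp add: p_def algebra_simps)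
qed

text \<open>The mean of \<open>u\<close> over a unit ball is at most a third of the mass, since \<open>3 * u <= f\<close>.\<close>

lemma u_le_near_potential:
 obtains C where "!!x. u x <= C + near_potential x/pi^2"
proof
 fix x
 define h where "h = \<alpha>*ln 2 + near_potential x/pi^2"
 have iv: "L1 (%y. v (x + 1 *\<^sub>R y)*mean_weight y)" by(rule weighted_mean_v(1)) simp
 have "(v x - h)*weight_mass <= weighted_mean v x 1"
  unfolding weight_mass_def weighted_mean_def integral_mult_right_zero[symmetric]
 proof(rule integral_mono[OF integrable_mult_right[OF mean_weight_integrable] iv])
  fix y
  show "(v x - h)*mean_weight y <= v (x + 1 *\<^sub>R y)*mean_weight y"
  proof(cases "norm y <= 1")
   case True
   thus ?thesis using v_le_v_near[OF True, of x] mean_weight_bounds(1) by(intro mult_right_mono) (simp_all add: h_def)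
  qed(simp add: mean_weight_outside)
 qed
 moreover have "weighted_mean u x 1 <= mass/3"
 proof -
  have "weighted_mean u x 1 <= (LINT y. f(x + 1 *\<^sub>R y)/3)" unfolding weighted_mean_def
  proof(rule integral_mono[OF integrable_mult_ball[OF u_continuous mean_weight_measurable mean_weight_bounds]])
   show "L1 (%y. f(x + 1 *\<^sub>R y)/3)" using f_affine_integrable[of 1 x] by simp
   fix y
   have "3*u (x + 1 *\<^sub>R y) <= f(x + 1 *\<^sub>R y)" using exp_ge_add_one_self[of "3*u (x + 1 *\<^sub>R y)"] unfolding f_def by linarith
   hence "u (x + 1 *\<^sub>R y)*mean_weight y <= f(x + 1 *\<^sub>R y)/3*mean_weight y"
    using mean_weight_bounds(1) by(intro mult_right_mono) auto
   also have "... <= f(x + 1 *\<^sub>R y)/3*1"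
    using mean_weight_bounds(2)[of y] f_pos[of "x + 1 *\<^sub>R y"] by(intro mult_left_mono) (auto intro: order_trans[OF _ indicator_le_1])
   finally show "u (x + 1 *\<^sub>R y)*mean_weight y <= f(x + 1 *\<^sub>R y)/3" by simp
  qed
  thus ?thesis using integral_translate(1)[of f x] by(simp add: mass_def)
 qed
 ultimately have "weight_mass*u x <= mass/3 + mean_slope + h*weight_mass"
  using weighted_mean_u[of 1 x] weighted_mean_p(2)[of 1 x] by(simp add: p_def algebra_simps)
 hence "u x <= (mass/3 + mean_slope + h*weight_mass)/weight_mass"
  using weight_mass_pos by(simp add: pos_le_divide_eq mult.commute)
 also have "... = ((mass/3 + mean_slope)/weight_mass + \<alpha>*ln 2) + near_potential x/pi^2"
  using weight_mass_pos by(simp add: h_def add_divide_distrib)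
 finally show "u x <= ((mass/3 + mean_slope)/weight_mass + \<alpha>*ln 2) + near_potential x/pi^2" .
qed

definition tail :: "real => real" where "tail r = (LINT y. indicator {y. r <= norm y} y*f y)"

lemma integrable_indicator_f: "A : sets borel ==> L1 (%y. indicator A y*f y)"
 using integrable_mult_indicator[OF _ f_integrable, of A] by simp

lemma tail_tendsto: "(tail \<longlongrightarrow> 0) at_top"
proof -
 have "((%r. (LINT y. indicator {y. r <= norm y} y*f y)) \<longlongrightarrow> (\<integral>y. 0 \<partial>(lborel :: (real^3) measure))) at_top"
 proof(rule integral_dominated_convergence_at_top[where w=f])
  show "\<forall>\<^sub>F r in at_top. AE y in lborel. norm(indicator {y. r <= norm y} y*f y) <= f y"
   using f_pos less_imp_le by(intro always_eventually allI AE_I2) (auto simp: indicator_def)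
  show "AE y in lborel. ((%r. indicator {y. r <= norm y} y*f y) \<longlongrightarrow> 0) at_top"
  proof(rule AE_I2)
   fix y :: "real^3"
   show "((%r. indicator {y. r <= norm y} y*f y) \<longlongrightarrow> 0) at_top"
    by(rule tendsto_eventually) (use eventually_gt_at_top[of "norm y"] in eventually_elim, simp)
  qed
 qed(use f_integrable in auto)
 thus ?thesis unfolding tail_def[abs_def] by simp
qed

text \<open>The logarithm is cut at distance \<open>s\<close>: its value \<open>ln (3/s)\<close>
  there multiplies only tail mass, and the excess inside is paid by the pointwise bound
  \<open>M\<close>. So smallness of the tail can beat the logarithm.\<close>

lemma near_potential_le:
 assumes s: "0 < s" "s <= 2" and M: "!!y. y : cball x s ==> f y <= M"
 shows "near_potential x <= ln(3/s)*tail (norm x - 2) + M * s^3*inverse_square_mass 1"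
proof -
 have M0: "0 <= M" using M[of x] f_pos[of x] s by simp
 have l: "0 <= ln(3/s)" using s by(intro ln_ge_zero) simp
 have i: "L1 (%c. ln(3/s)*(indicator {y. norm x - 2 <= norm y} c*f c))"
  "L1 (%c. M * s^2*(indicator (cball x s) c/norm(x - c)^2))"
  by(intro integrable_mult_right integrable_indicator_f integrable_inverse_square_ball; measurable)+
 have "near_potential x <= (LINT c. ln(3/s)*(indicator {y. norm x - 2 <= norm y} c*f c) + M * s^2*(indicator (cball x s) c/norm(x - c)^2))"
  unfolding near_potential_def
 proof(rule integral_mono_AE[OF near_potential_integrable integrable_add[OF i]])
  show "AE c in lborel. indicator (cball x 2) c*ln(3/norm(x - c))*f c
   <= ln(3/s)*(indicator {y. norm x - 2 <= norm y} c*f c) + M * s^2*(indicator (cball x s) c/norm(x - c)^2)"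
   using AE_lborel_singleton[of x]
  proof eventually_elim
   case (elim c)
   have t: "0 < norm(x - c)" using elim by simp
   have tri: "norm x - 2 <= norm c" if "norm(x - c) <= 2" using that norm_triangle_ineq2[of x c] by simp
   consider "norm(x - c) <= s" | "s < norm(x - c)" "norm(x - c) <= 2" | "2 < norm(x - c)" by linarith
   thus ?case
   proof cases
    case 1
    have "ln(3/norm(x - c))*f c <= (ln(3/s) + s^2/norm(x - c)^2)*f c"
     using ln_inverse_le[OF s(1) t 1] f_pos[of c] by(intro mult_right_mono) auto
    also have "... <= ln(3/s)*f c + s^2/norm(x - c)^2*M"
     unfolding distrib_right using M[of c] 1 by(intro add_left_mono mult_left_mono) (auto simp: dist_norm)
    finally show ?thesis using 1 tri s by(simp add: dist_norm mult_ac)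
   next
    case 2
    have "ln(3/norm(x - c)) <= ln(3/s)" using 2 s t by(subst ln_le_cancel_iff) (auto simp: frac_le)
    hence "ln(3/norm(x - c))*f c <= ln(3/s)*f c" using f_pos[of c] by(intro mult_right_mono) auto
    thus ?thesis using 2 tri by(simp add: dist_norm)
   next
    case 3
    thus ?thesis using l f_pos[of c] s by(simp add: dist_norm indicator_def)
   qed
  qed
 qed
 also have "... = ln(3/s)*tail (norm x - 2) + M * s^2*(LINT c. indicator (cball x s) c/norm(x - c)^2)"
  by(simp only: integral_add[OF i] tail_def integral_mult_right_zero)
 also have "... <= ln(3/s)*tail (norm x - 2) + M * s^2*inverse_square_mass s"
  using M0 by(intro add_left_mono mult_left_mono inverse_square_mass_bound) auto
 finally show ?thesis
  unfolding inverse_square_mass_scale[OF s(1)] by(simp add: power3_eq_cube power2_eq_square mult_ac)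
qed

text \<open>Maximise \<open>(4 - |y - x\<^sub>0|)\<^sup>3 f y\<close> over the ball of radius 4; near the maximum point \<open>f\<close> is at
 most 8 times its value there, and the mass nearby is small.\<close>

lemma f_bounded:
 obtains M where "0 < M" "!!x. f x <= M"
proof -
 obtain C0 where C0: "!!x. u x <= C0 + near_potential x/pi^2" by(rule u_le_near_potential) (rule that)
 define I where "I = inverse_square_mass 1"
 define C where "C = 2*C0 + ln 3 + 2*(8*I/pi^2)"
 have "\<forall>\<^sub>F r in at_top. tail r < pi^2/2" by(rule order_tendstoD(2)[OF tail_tendsto]) simp
 \<comment> \<open>With tail mass below \<open>pi^2/2\<close> the near potential gives back at most
   half of \<open>u y\<close> plus a constant, and the half is absorbed on the left.\<close>
 then obtain R where R: "!!r. R <= r ==> tail r < pi^2/2" unfolding eventually_at_top_linorder by blast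
 \<comment> \<open>The 6 is 4 for the ball in which the maximum is taken plus 2 for the argument of
   \<open>tail\<close>.\<close>
 have far: "f x <= 1 + exp(3*C)" if x: "R + 6 <= norm x" for x
 proof -
  define phi where "phi y = (4 - norm(y - x))^3*f y" for y
  have "continuous_on(cball x 4) phi"
   unfolding phi_def by(intro continuous_intros continuous_on_subset[OF f_continuous]) auto
  then obtain y where y: "y : cball x 4" "!!z. z : cball x 4 ==> phi z <= phi y"
   using continuous_attains_sup[of "cball x 4" phi] by auto
  define r where "r = (4 - norm(y - x))/2"
  have ny: "norm(y - x) <= 4" using y(1) by(simp add: dist_norm norm_minus_commute)
  have phiy: "phi y = 8*r^3*f y" unfolding phi_def r_def by(simp add: power_divide)
  have x0: "64*f x <= 8*r^3*f y" using y(2)[of x] by(simp add: phiy[symmetric]) (simp add: phi_def)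
  have r: "0 < r" "r <= 2"
  proof -
   have "r ~= 0" using x0 f_pos[of x] by auto
   thus "0 < r" "r <= 2" using ny by(auto simp: r_def)
  qed
  have near: "f z <= 8*f y" if z: "norm(y - z) <= r" for z
  proof -
   have zx: "r <= 4 - norm(z - x)"
    using z norm_triangle_ineq[of "z - y" "y - x"] unfolding r_def by(simp add: norm_minus_commute)
   have "r^3*f z <= phi z" unfolding phi_def using zx r f_pos[of z] by(intro mult_right_mono power_mono) auto
   also have "phi z <= phi y" using zx r by(intro y(2)) (simp add: dist_norm norm_minus_commute)
   finally have "r^3*f z <= r^3*(8*f y)" unfolding phiy by(simp add: mult_ac)
   thus ?thesis using r by simp
  qed
  show ?thesis
  proof(cases "r^3*f y <= 1")
   case True
   have "f x <= 1" using x0 True by linarith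
   thus ?thesis using exp_ge_zero[of "3*C"] by linarith
  next
   case False
   \<comment> \<open>The natural scale at \<open>y\<close>: \<open>f y * s^3 = 1\<close> and
     \<open>ln (3/s) = ln 3 + u y\<close>, so the estimate of the near potential closes on
     \<open>u y\<close>. That \<open>s <= r\<close> holds is exactly the failure of the case
     before.\<close>
   define s where "s = exp(- u y)"
   have s3: "f y * s^3 = 1" by(simp add: s_def f_def exp_of_nat_mult[symmetric] exp_add[symmetric])
   have "s <= r"
   proof(rule ccontr)
    assume "~ s <= r"
    hence "r^3*f y <= s^3*f y" using r f_pos[of y] by(intro mult_right_mono power_mono) auto
    thus False using s3 False by(simp add: mult.commute)
   qed
   hence s: "0 < s" "s <= r" "s <= 2" using r by(auto simp: s_def)
   have l: "ln(3/s) = ln 3 + u y" by(simp add: s_def ln_div)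
   have l0: "0 <= ln 3 + u y" unfolding l[symmetric] using s by(intro ln_ge_zero) simp
   have "near_potential y <= (ln 3 + u y)*tail (norm y - 2) + 8*f y * s^3*I"
    unfolding I_def l[symmetric] using s by(intro near_potential_le near) (auto simp: dist_norm)
   also have "... = (ln 3 + u y)*tail (norm y - 2) + 8*I" using s3 by(simp add: mult.assoc)
   also have "... <= (ln 3 + u y)*(pi^2/2) + 8*I"
   proof -
    have "R <= norm y - 2" using x ny norm_triangle_ineq2[of x y] by(simp add: norm_minus_commute)
    from mult_left_mono[OF less_imp_le[OF R[OF this]] l0] show ?thesis by simp
   qed
   finally have "near_potential y/pi^2 <= ((ln 3 + u y)*(pi^2/2) + 8*I)/pi^2" by(rule divide_right_mono) simp
   also have "... = (ln 3 + u y)/2 + 8*I/pi^2" by(simp add: add_divide_distrib)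
   finally have "near_potential y/pi^2 <= (ln 3 + u y)/2 + 8*I/pi^2" .
   moreover have "a <= 2 * c + l + 2 * k" if "q <= (l + a)/2 + k" "a <= c + q" for a c q l k :: real
    using that by argo
   ultimately have "u y <= C" using C0[of y] unfolding C_def by blast
   hence "f y <= exp(3*C)" by(simp add: f_def)
   moreover have "f x <= f y"
   proof -
    have "r^3*f y <= 2^3*f y" using r f_pos[of y] by(intro mult_right_mono power_mono) auto
    thus ?thesis using x0 by(simp add: mult.commute)
   qed
   ultimately show ?thesis by simp
  qed
 qed
 obtain M where M: "0 < M" "!!y. y : cball 0 (R + 6) ==> f y <= M" using f_bounded_ball by blast
 show thesis
 proof(rule that[of "M + (1 + exp(3*C))"])
  show "0 < M + (1 + exp(3*C))" using M(1) by(simp add: add_pos_pos)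
  show "f x <= M + (1 + exp(3*C))" for x
   using far[of x] M(1) M(2)[of x] exp_ge_zero[of "3*C"] by(cases "norm x <= R + 6") (auto simp del: exp_ge_zero)
 qed
qed

text \<open>Close to \<open>x\<close> the bound of \<open>f\<close> is used on a small ball, far
  from the origin the tail of \<open>f\<close>, and for \<open>|y| < |x|/2\<close> the distance to
  \<open>x\<close> is at least \<open>|x|/2\<close>.\<close>

lemma riesz_tendsto: "((%x. (LINT y. f y/norm(x - y)^2)) \<longlongrightarrow> 0) at_infinity"
proof(rule tendstoI)
 fix e :: real assume e: "0 < e"
 obtain M where M: "0 < M" "!!x. f x <= M" by(rule f_bounded) (rule that)
 define I where "I = inverse_square_mass 1"
 \<comment> \<open>This makes the contribution \<open>M * (\<delta> * I)\<close> of the small ball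
   less than \<open>e/2\<close>; the added 1 serves because \<open>M * I\<close> is only known to be
   nonnegative.\<close>
 define \<delta> where "\<delta> = e/(2*(M*I + 1))"
 have MI: "0 <= M*I" using M(1) inverse_square_mass_nonneg[of 1] by(simp add: I_def)
 have "e*(M*I) < e*(2*(M*I + 1))" using e MI by(intro mult_strict_left_mono) argo+
 moreover have "M*(\<delta>*I) = e*(M*I)/(2*(M*I + 1))" by(simp add: \<delta>_def)
 moreover have "0 < 2*(M*I + 1)" using MI by argo
 ultimately have \<delta>: "0 < \<delta>" "M*(\<delta>*I) < e" using e by(simp_all only: \<delta>_def pos_divide_less_eq divide_pos_pos)
 have bd: "(LINT y. f y/norm(x - y)^2) <= M*(\<delta>*I) + (1/\<delta>^2*tail (norm x/2) + 4/norm x^2*mass)" if x: "x ~= 0" for x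
 proof -
  have i: "L1 (%y. M*(indicator (cball x \<delta>) y/norm(x - y)^2))"
   "L1 (%y. 1/\<delta>^2*(indicator {y. norm x/2 <= norm y} y*f y))" "L1 (%y. 4/norm x^2*f y)"
   by(intro integrable_mult_right integrable_indicator_f integrable_inverse_square_ball f_integrable; measurable)+
  have "(LINT y. f y/norm(x - y)^2) <= (LINT y. M*(indicator (cball x \<delta>) y/norm(x - y)^2)
    + (1/\<delta>^2*(indicator {y. norm x/2 <= norm y} y*f y) + 4/norm x^2*f y))"
  proof(rule integral_mono[OF riesz_integrable integrable_add[OF i(1) integrable_add[OF i(2,3)]]])
   fix y
   have n0: "0 <= 4/norm x^2*f y" "0 <= 1/\<delta>^2*(indicator {y. norm x/2 <= norm y} y*f y)" "0 <= M*(indicator (cball x \<delta>) y/norm(x - y)^2)"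
    using f_pos[of y] M(1) by(auto simp: indicator_def)
   consider "norm(x - y) <= \<delta>" | "\<delta> < norm(x - y)" "norm x/2 <= norm y" | "norm y < norm x/2" by linarith
   thus "f y/norm(x - y)^2 <= M*(indicator (cball x \<delta>) y/norm(x - y)^2)
    + (1/\<delta>^2*(indicator {y. norm x/2 <= norm y} y*f y) + 4/norm x^2*f y)"
   proof cases
    case 1
    hence "f y/norm(x - y)^2 <= M*(indicator (cball x \<delta>) y/norm(x - y)^2)"
     using divide_right_mono[OF M(2)[of y], of "(norm(x - y))^2"] by(simp add: dist_norm)
    thus ?thesis using n0 by linarith
   next
    case 2
    have "f y/norm(x - y)^2 <= f y/\<delta>^2"
     using 2 \<delta> f_pos[of y] by(intro divide_left_mono power_mono mult_pos_pos zero_less_power) auto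
    hence "f y/norm(x - y)^2 <= 1/\<delta>^2*(indicator {y. norm x/2 <= norm y} y*f y)" using 2 by simp
    thus ?thesis using n0 by linarith
   next
    case 3
    have "norm x/2 <= norm(x - y)" using 3 norm_triangle_ineq2[of x y] by simp
    hence "f y/norm(x - y)^2 <= f y/(norm x/2)^2"
     using x f_pos[of y] by(intro divide_left_mono power_mono mult_pos_pos zero_less_power) auto
    hence "f y/norm(x - y)^2 <= 4/norm x^2*f y" by(simp add: power_divide mult.commute)
    thus ?thesis using n0 by linarith
   qed
  qed
  also have "... = M*(LINT y. indicator (cball x \<delta>) y/norm(x - y)^2) + (1/\<delta>^2*tail (norm x/2) + 4/norm x^2*mass)"
   unfolding tail_def mass_def by(simp only: integral_add[OF i(1) integrable_add[OF i(2,3)]]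
    integral_add[OF i(2,3)] integral_mult_right_zero)
  also have "... <= M*(\<delta>*I) + (1/\<delta>^2*tail (norm x/2) + 4/norm x^2*mass)"
   unfolding I_def inverse_square_mass_scale[OF \<delta>(1), symmetric]
   using M(1) by(intro add_right_mono mult_left_mono inverse_square_mass_bound) auto
  finally show ?thesis .
 qed
 have "((%r. M*(\<delta>*I) + (1/\<delta>^2*tail (r/2) + 4/r^2*mass)) \<longlongrightarrow> M*(\<delta>*I) + (1/\<delta>^2*0 + 0)) at_top"
 proof(intro tendsto_add tendsto_mult tendsto_const)
  show "((%r. tail (r/2)) \<longlongrightarrow> 0) at_top" by(rule filterlim_compose[OF tail_tendsto]) real_asymp
  show "((%r. 4/r^2*mass) \<longlongrightarrow> 0) at_top" by(rule tendsto_mult_left_zero) real_asymp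
 qed
 from order_tendstoD(2)[OF filterlim_compose[OF this filterlim_norm_at_top[where 'a="real^3"]], of e] \<delta>
 have "\<forall>\<^sub>F x :: real^3 in at_infinity. M*(\<delta>*I) + (1/\<delta>^2*tail (norm x/2) + 4/norm x^2*mass) < e" by simp
 moreover have "\<forall>\<^sub>F x :: real^3 in at_infinity. x ~= 0" by(rule eventually_not_equal_at_infinity)
 ultimately show "\<forall>\<^sub>F x in at_infinity. dist (LINT y. f y/norm(x - y)^2) 0 < e"
 proof eventually_elim
  case (elim x)
  have "0 <= (LINT y. f y/norm(x - y)^2)"
   using f_pos less_imp_le by(intro integral_nonneg_AE AE_I2 divide_nonneg_nonneg) auto
  thus ?case using elim bd[of x] by simp
 qed
qed

lemma laplacian_tendsto: "(laplacian u \<longlongrightarrow> - L) at_infinity"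
proof -
 have "laplacian u = (%x. - L - 1/pi^2*(LINT y. f y/norm(x - y)^2))"
 proof
  show "laplacian u x = - L - 1/pi^2*(LINT y. f y/norm(x - y)^2)" for x
   using lap[of x] unfolding f_def by linarith
 qed
 thus ?thesis using tendsto_diff[OF tendsto_const tendsto_mult[OF tendsto_const riesz_tendsto], of "- L" "1/pi^2"] by simp
qed

text \<open>The mean of \<open>u\<close> over radius \<open>R\<close> is at most a constant minus
  \<open>mean_slope * R^2\<close>, while a lower bound \<open>- e * |x|^2 - C\<close> of
  \<open>u\<close> costs only \<open>e * weight_mass * R^2\<close>; \<open>e\<close> makes this half
  of the former.\<close>

lemma L_zero_if_subquadratic:
 assumes u: "u : o[at_infinity](%x. (norm x)^2)"
 shows "L = 0"
proof(rule ccontr)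
 assume "L ~= 0"
 hence s: "0 < mean_slope" using L_nonneg mean_slope_cases(2) by simp
 define e where "e = mean_slope/(2*weight_mass)"
 have e: "0 < e" "e*weight_mass = mean_slope/2" unfolding e_def using s weight_mass_pos by auto
 from landau_o.smallD[OF u e(1)] obtain \<rho> where \<rho>: "!!x. \<rho> <= norm x ==> \<bar>u x\<bar> <= e*norm x^2"
  by(auto simp: eventually_at_infinity)
 have "bounded (u ` cball 0 \<rho>)"
  by(intro compact_imp_bounded compact_continuous_image continuous_on_subset[OF u_continuous]) auto
 then obtain C where C: "ALL z:u ` cball 0 \<rho>. norm z <= C" unfolding bounded_iff by blast
 have lo: "- (e*norm x^2 + \<bar>C\<bar>) <= u x" for x
 proof(cases "\<rho> <= norm x")
  case True
  thus ?thesis using \<rho>[of x] by simp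
 next
  case False
  hence "\<bar>u x\<bar> <= C" using C by auto
  moreover have "0 <= e*norm x^2" using e by simp
  ultimately show ?thesis by linarith
 qed
 have up: "mean_slope/2 * R^2 <= weight_mass*u 0 + \<bar>C\<bar>*weight_mass" if R: "0 < R" for R
 proof -
  have "- (e * R^2 + \<bar>C\<bar>)*weight_mass <= weighted_mean u 0 R"
   unfolding weight_mass_def weighted_mean_def integral_mult_right_zero[symmetric]
  proof(rule integral_mono[OF integrable_mult_right[OF mean_weight_integrable] integrable_mult_ball[OF u_continuous mean_weight_measurable mean_weight_bounds]])
   fix y :: "real^3"
   show "- (e * R^2 + \<bar>C\<bar>)*mean_weight y <= u (0 + R *\<^sub>R y)*mean_weight y"
   proof(cases "norm y <= 1")
    case True
    have "norm(0 + R *\<^sub>R y) <= R" using mult_left_mono[OF True, of R] R by simp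
    hence "e*norm(0 + R *\<^sub>R y)^2 <= e * R^2" using e by(intro mult_left_mono power_mono) auto
    thus ?thesis using lo[of "0 + R *\<^sub>R y"] mean_weight_bounds(1) by(intro mult_right_mono) linarith+
   qed(simp add: mean_weight_outside)
  qed
  hence "- (e * R^2 + \<bar>C\<bar>)*weight_mass <= weight_mass*u 0 - mean_slope * R^2"
   using weighted_mean_u_le[OF R, of 0] by linarith
  moreover have "(e * R^2 + \<bar>C\<bar>)*weight_mass = mean_slope/2 * R^2 + \<bar>C\<bar>*weight_mass"
   unfolding e(2)[symmetric] by(simp add: algebra_simps)
  ultimately show ?thesis unfolding mult_minus_left by linarith
 qed
 have "filterlim (%R. mean_slope/2 * R^2) at_top at_top" using s by real_asymp
 hence "\<forall>\<^sub>F R in at_top. weight_mass*u 0 + \<bar>C\<bar>*weight_mass < mean_slope/2 * R^2" by(simp only: filterlim_at_top_dense)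
 with eventually_gt_at_top[of 0] have "\<forall>\<^sub>F R::real in at_top. False"
  by eventually_elim (use up in force)
 thus False by simp
qed

end

section \<open>Moving spheres and classification\<close>

section \<open>Inversion in the unit sphere\<close>

text \<open>Division by zero sends the origin to itself, so the map is an involution of the whole
  space.\<close>

definition inversion :: "'a::real_inner => 'a" where "inversion x = (1/norm x^2) *\<^sub>R x"

lemma norm_inversion: "norm(inversion x) = 1/norm x"
 by(cases "x = 0") (simp_all add: inversion_def power2_eq_square)

lemma inversion_0 [simp]: "inversion 0 = 0" by(simp add: inversion_def)

lemma inversion_inversion [simp]: "inversion(inversion x) = x"
proof(cases "x = 0")
 case False
 thus ?thesis
  unfolding inversion_def[of "inversion x"] norm_inversion by(simp add: inversion_def power_divide)
qed simp

lemma inversion_eq_0 [simp]: "inversion x = 0 \<longleftrightarrow> x = 0" by(metis inversion_0 inversion_inversion)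

lemma norm_inversion_diff_inversion:
 assumes "x ~= 0" "y ~= 0"
 shows "norm(inversion x - inversion y) = norm(x - y)/(norm x*norm y)"
proof -
 have "(norm(inversion x - inversion y))^2 = norm(inversion x)^2 + norm(inversion y)^2 - 2*(inversion x \<bullet> inversion y)"
  by(simp add: power2_norm_eq_inner algebra_simps inner_commute)
 also have "... = (norm x^2 + norm y^2 - 2*(x \<bullet> y))/(norm x^2*norm y^2)"
  unfolding norm_inversion using assms by(simp add: inversion_def power_divide) (simp add: field_simps)
 also have "(norm x)^2 + norm y^2 - 2*(x \<bullet> y) = norm(x - y)^2"
  by(simp add: power2_norm_eq_inner algebra_simps inner_commute)
 finally have "(norm(inversion x - inversion y))^2 = (norm(x - y)/(norm x*norm y))^2"
  by(simp add: power_divide power_mult_distrib)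
 thus ?thesis by(rule power2_eq_imp_eq) simp_all
qed

lemma norm_diff_inversion:
 assumes "x ~= 0" "y ~= 0"
 shows "norm y*norm(x - inversion y) = norm x*norm(inversion x - y)"
 using norm_inversion_diff_inversion[of "inversion x" y] assms by(simp add: norm_inversion)

text \<open>The origin of \<open>green\<close>: divided by \<open>|x - y|^2\<close>, the left side
  is the squared quotient of the logarithmic kernels up to \<open>|x|^2\<close>, and the right side
  exceeds 1 when both points lie outside the unit ball.\<close>

lemma inversion_dist:
 assumes "x ~= 0"
 shows "(norm x*norm(inversion x - y))^2 = norm(x - y)^2 + (norm x^2 - 1)*(norm y^2 - 1)"
proof -
 have "(norm x*norm(inversion x - y))^2 = norm x^2*(norm(inversion x)^2 + norm y^2 - 2*(inversion x \<bullet> y))"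
  unfolding power_mult_distrib power2_norm_eq_inner[of "inversion x - y"] by(simp add: power2_norm_eq_inner algebra_simps inner_commute)
 also have "... = 1 + norm x^2*norm y^2 - 2*(x \<bullet> y)"
  unfolding norm_inversion using assms by(simp add: inversion_def field_simps)
 also have "... = norm(x - y)^2 + (norm x^2 - 1)*(norm y^2 - 1)"
  by(simp add: power2_norm_eq_inner algebra_simps inner_commute)
 finally show ?thesis .
qed

lemma inversion_measurable [measurable]: "inversion : borel_measurable (borel :: (real^3) measure)"
 unfolding inversion_def[abs_def] by measurable

lemma inversion_continuous_on: "0 \<notin> S ==> continuous_on S inversion"
 unfolding inversion_def[abs_def] by(intro continuous_intros) auto

text \<open>The derivative is \<open>1/|x|^2\<close> times the reflection in the plane orthogonal to
  \<open>x\<close>; in dimension three this gives the sixth power and the sign.\<close>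

lemma det_inversion:
 fixes x :: "real^3"
 assumes "x ~= 0"
 shows "det (matrix (%h. (1/norm x^2) *\<^sub>R h - (2*(x \<bullet> h)/(norm x^2)^2) *\<^sub>R x)) = - (1/norm x^6)"
proof -
 define a where "a = 1/norm x^2"
 have n: "(norm x)^2 = x$1*x$1 + x$2*x$2 + x$3*x$3"
  by(simp add: power2_norm_eq_inner inner_vec_def sum_3)
 have an: "a*(x$1*x$1 + x$2*x$2 + x$3*x$3) = 1" unfolding n[symmetric] a_def using assms by simp
 have e: "matrix (%h. (1/norm x^2) *\<^sub>R h - (2*(x \<bullet> h)/(norm x^2)^2) *\<^sub>R x) $ i $ j
   = a*axis j 1 $ i - 2*a^2*(x $ j)*(x $ i)" for i j
  by(simp add: matrix_def a_def inner_axis power_divide)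
 have "det (matrix (%h. (1/norm x^2) *\<^sub>R h - (2*(x \<bullet> h)/(norm x^2)^2) *\<^sub>R x))
   = a^3 - 2*a^3*(a*(x$1*x$1 + x$2*x$2 + x$3*x$3))"
  unfolding det_3 e by(simp add: axis_def) algebra
 also have "... = - (a^3)" unfolding an by simp
 also have "a^3 = 1/norm x^6" by(simp add: a_def power_divide flip: power_mult)
 finally show ?thesis .
qed

lemma inversion_has_derivative:
 fixes x :: "'a::real_inner"
 assumes "x ~= 0"
 shows "(inversion has_derivative (%h. (1/norm x^2) *\<^sub>R h - (2*(x \<bullet> h)/(norm x^2)^2) *\<^sub>R x)) (at x within S)"
proof -
 have i: "((%y. inverse(y \<bullet> y)) has_derivative (%h. - (inverse(x \<bullet> x)*(x \<bullet> h + h \<bullet> x)*inverse(x \<bullet> x)))) (at x within S)"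
  by(rule Deriv.has_derivative_inverse[OF _ has_derivative_inner[OF has_derivative_ident has_derivative_ident]]) (use assms in simp)
 have e1: "(%y. inverse(y \<bullet> y) *\<^sub>R y) = (inversion :: 'a => 'a)"
  by(simp add: fun_eq_iff inversion_def power2_norm_eq_inner inverse_eq_divide)
 have e2: "inverse(x \<bullet> x) *\<^sub>R h + (- (inverse(x \<bullet> x)*(x \<bullet> h + h \<bullet> x)*inverse(x \<bullet> x))) *\<^sub>R x
   = (1/norm x^2) *\<^sub>R h - (2*(x \<bullet> h)/(norm x^2)^2) *\<^sub>R x" for h
  by(simp add: power2_norm_eq_inner inner_commute divide_inverse power2_eq_square[of "x \<bullet> x"] mult_ac)
 from has_derivative_scaleR[OF i has_derivative_ident] show ?thesis unfolding e1 e2 .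
qed

lemma integral_inversion:
 fixes h :: "real^3 => real"
 assumes i: "L1 h"
 shows "L1 (%y. h(inversion y)/norm y^6)"
  and "(LINT y. h(inversion y)/norm y^6) = LI h"
proof -
 have m: "h : borel_measurable borel" using borel_measurable_integrable[OF i] by simp
 note [measurable] = m
 define q where "q y = h(inversion y)/norm y^6" for y
 define S :: "(real^3) set" where "S = - {0}"
 have S: "S : sets lebesgue" "S : sets borel" unfolding S_def by auto
 have im: "inversion ` S = S"
 proof(intro equalityI subsetI)
  show "y : inversion ` S" if "y : S" for y
   using that by(intro image_eqI[of _ _ "inversion y"]) (simp_all add: S_def)
 qed(auto simp: S_def)
 have inj: "inj_on inversion S" by(metis inj_onI inversion_inversion)
 have conv: "set_integrable lebesgue S r \<longleftrightarrow> L1 r" "set_lebesgue_integral lebesgue S r = LI r"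
  if [measurable]: "r : borel_measurable borel" for r :: "real^3 => real"
 proof -
  have ae: "AE y in lebesgue. indicator S y *\<^sub>R r y = r y"
   using AE_completion[OF AE_lborel_singleton[of "0::real^3"]] by eventually_elim (simp add: S_def)
  have rm: "r : borel_measurable lebesgue" by(rule measurable_completion) simp
  have sm: "(%y. indicator S y *\<^sub>R r y) : borel_measurable lebesgue" using S(1) rm by(intro borel_measurable_scaleR borel_measurable_indicator)
  show "set_integrable lebesgue S r \<longleftrightarrow> L1 r"
   unfolding set_integrable_def integrable_cong_AE[OF sm rm ae] by(rule integrable_completion) simp
  show "set_lebesgue_integral lebesgue S r = LI r"
   unfolding set_lebesgue_integral_def integral_cong_AE[OF sm rm ae] by(rule integral_completion) simp
 qed
 have qm: "q : borel_measurable borel" unfolding q_def[abs_def] by measurable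
 have hS: "h absolutely_integrable_on S" using conv(1)[OF m] i by simp
 define D where "D x = (%k. (1/norm x^2) *\<^sub>R k - (2*(x \<bullet> k)/(norm x^2)^2) *\<^sub>R x)" for x :: "real^3"
 \<comment> \<open>The change of variables is applied to a vector-valued function, so
   \<open>h\<close> is carried to \<open>real^1\<close> and back.\<close>
 define F :: "real^3 => real^1" where "F x = vec (h x)" for x
 have der: "(inversion has_derivative D x) (at x within S)" if "x : S" for x
  unfolding D_def using that by(intro inversion_has_derivative) (simp add: S_def)
 have "F absolutely_integrable_on inversion ` S & integral (inversion ` S) F = vec (integral S h)"
  unfolding im F_def using hS by(simp add: absolutely_integrable_on_1_iff integral_on_1_eq)
 hence "(%x. \<bar>det (matrix (D x))\<bar> *\<^sub>R F (inversion x)) absolutely_integrable_on S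
   & integral S (%x. \<bar>det (matrix (D x))\<bar> *\<^sub>R F (inversion x)) = vec (integral S h)"
  using has_absolute_integral_change_of_variables[OF S(1) _ inj, of D F "vec (integral S h)"] der by blast
 moreover have e: "\<bar>det (matrix (D x))\<bar> *\<^sub>R F (inversion x) = vec (q x)" if "x : S" for x
  unfolding D_def using that by(subst det_inversion) (simp_all add: S_def q_def F_def vec_eq_iff)
 have "set_integrable lebesgue S (%x. \<bar>det (matrix (D x))\<bar> *\<^sub>R F (inversion x)) = set_integrable lebesgue S (%x. vec (q x) :: real^1)"
  by(rule set_integrable_cong) (simp_all only: e)
 moreover have "integral S (%x. \<bar>det (matrix (D x))\<bar> *\<^sub>R F (inversion x)) = integral S (%x. vec (q x) :: real^1)"
  by(rule Henstock_Kurzweil_Integration.integral_cong) (simp only: e)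
 ultimately have "(%x. vec (q x) :: real^1) absolutely_integrable_on S & integral S (%x. vec (q x) :: real^1) = vec (integral S h)"
  by(simp only:)
 hence qS: "q absolutely_integrable_on S" "integral S q = integral S h"
  by(simp_all add: absolutely_integrable_on_1_iff integral_on_1_eq)
 show "L1 (%y. h(inversion y)/norm y^6)" using qS(1) conv(1)[OF qm] by(simp add: q_def[abs_def])
 show "(LINT y. h(inversion y)/norm y^6) = LI h"
  using qS(2) unfolding set_lebesgue_integral_eq_integral(2)[OF hS, symmetric] set_lebesgue_integral_eq_integral(2)[OF qS(1), symmetric]
   conv(2)[OF m] conv(2)[OF qm] by(simp add: q_def[abs_def])
qed

text \<open>Green's function of the exterior of the unit ball, up to a constant factor.\<close>

definition green :: "real^3 => real^3 => real" where
 "green x y = ln(1 + (norm x^2 - 1)*(norm y^2 - 1)/norm(x - y)^2)/2"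

lemma green_measurable [measurable]:
 assumes [measurable]: "g : borel_measurable M" "h : borel_measurable M"
 shows "(%x. green (g x) (h x)) : borel_measurable M" unfolding green_def by measurable

lemma green_eq:
 assumes x: "1 < norm x" and y: "1 < norm y" "x ~= y"
 shows "ln(norm(inversion x - y)/norm(x - y)) = green x y - ln(norm x)" (is ?A)
  and "ln(norm(inversion x - inversion y)/norm(x - inversion y)) = - green x y - ln(norm x)"
proof -
 have 0: "x ~= 0" "y ~= 0" "0 < norm(x - y)" using x y by auto
 define q where "q = norm(inversion x - y)"
 have "1 + (norm x^2 - 1)*(norm y^2 - 1)/norm(x - y)^2 = (norm x*q/norm(x - y))^2"
  using inversion_dist[OF 0(1), of y] 0(3) by(simp add: q_def power_divide add_divide_distrib)
 moreover have q: "0 < q"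
 proof -
  have "norm(inversion x) < norm y" unfolding norm_inversion using x y by(smt (verit) divide_less_eq_1_pos)
  thus ?thesis unfolding q_def by auto
 qed
 ultimately have g: "green x y = ln(norm x) + ln q - ln(norm(x - y))"
  unfolding green_def using 0 by(simp add: ln_realpow ln_mult ln_div)
 show ?A unfolding q_def[symmetric] g using q 0 by(simp add: ln_div)
 have "norm(x - inversion y) = norm x*q/norm y" using norm_diff_inversion[OF 0(1,2)] 0 by(simp add: q_def field_simps)
 thus "ln(norm(inversion x - inversion y)/norm(x - inversion y)) = - green x y - ln(norm x)"
  unfolding norm_inversion_diff_inversion[OF 0(1,2)] g using q 0 by(simp add: ln_div ln_mult)
qed

lemma green_pos:
 assumes "1 < norm x" "1 < norm y" "x ~= y"
 shows "0 < green x y"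
proof -
 have "0 < (norm x^2 - 1)*(norm y^2 - 1)/norm(x - y)^2"
  using assms by(intro divide_pos_pos mult_pos_pos) (auto simp: one_less_power)
 thus ?thesis by(simp add: green_def)
qed

text \<open>The logarithm is weakened to a bound in which \<open>x\<close> occurs only through
  \<open>|x - y|\<close>; this uniformity lets one estimate hold on the whole exterior. The factor
  \<open>|y|^2\<close> is compensated by densities that decay like \<open>|y|^(-6)\<close>.\<close>

lemma green_le:
 assumes "1 < norm x" "1 < norm y" "x ~= y"
 shows "green x y <= 2*norm y^2*(1 + 1/norm(x - y))"
proof -
 define s r where "s = norm(x - y)" and "r = norm y"
 have s: "0 < s" and r: "1 < r" using assms by(auto simp: s_def r_def)
 have "norm x <= r + s" using norm_triangle_ineq[of y "x - y"] by(simp add: s_def r_def)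
 hence "(norm x)^2 <= (r + s)^2" by(intro power_mono) auto
 also have "... <= 2*r^2 + 2 * s^2" using sum_squares_bound[of r s] by(simp add: power2_sum)
 finally have "(norm x^2 - 1)*(r^2 - 1) <= (2*r^2 + 2 * s^2)*r^2"
  using r by(intro mult_mono) (auto simp: one_le_power less_imp_le)
 hence "(norm x^2 - 1)*(r^2 - 1)/s^2 <= (2*r^2 + 2 * s^2)*r^2/s^2" by(rule divide_right_mono) simp
 also have "... = 2*(r^2/s)^2 + 2*r^2" using s by(simp add: field_simps power2_eq_square)
 finally have "(norm x^2 - 1)*(r^2 - 1)/s^2 <= 2*(r^2/s)^2 + 2*r^2" .
 moreover have "1 + (2*t^2 + 2*r^2) <= (1 + 2*r + 2*t)^2" if "0 <= t" for t
 proof -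
  have "0 <= 2*(r*r) + 2*(t*t) + 4*r + 4*t + 8*(r*t)" using that r by(intro add_nonneg_nonneg mult_nonneg_nonneg) auto
  thus ?thesis by(simp add: power2_eq_square algebra_simps)
 qed
 from this[of "r^2/s"] have "1 + (2*(r^2/s)^2 + 2*r^2) <= (1 + 2*r + 2*(r^2/s))^2" using s by simp
 ultimately have "1 + (norm x^2 - 1)*(r^2 - 1)/s^2 <= (1 + 2*r + 2*(r^2/s))^2" by linarith
 moreover have "0 <= (norm x^2 - 1)*(r^2 - 1)/s^2"
  using assms r by(intro divide_nonneg_nonneg mult_nonneg_nonneg) (auto simp: one_le_power less_imp_le)
 ultimately have "green x y <= ln((1 + 2*r + 2*(r^2/s))^2)/2"
  unfolding green_def s_def[symmetric] r_def[symmetric] by(intro divide_right_mono ln_mono) auto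
 also have "... = ln(1 + (2*r + 2*(r^2/s)))" using r s by(subst ln_realpow) (auto simp: add_pos_nonneg add.assoc)
 also have "... <= 2*r + 2*(r^2/s)" using r s by(intro ln_add_one_self_le_self add_nonneg_nonneg) auto
 also have "... <= 2*r^2*(1 + 1/s)" using r self_le_power[of r 2] by(simp add: distrib_left)
 finally show ?thesis unfolding s_def r_def .
qed

section \<open>Moving spheres\<close>

text \<open>The weight is the growth \<open>|y|^2\<close> of the Green function times the decay
  \<open>|y|^(-6)\<close> of the densities. It is integrable over the exterior, so the value tends
  to 0 along sets that shrink to nothing.\<close>

definition outer_mass :: "(real^3) set => real" where
 "outer_mass E = (LINT y. indicator E y/norm y^4)"

definition exterior :: "(real^3) set" where "exterior = {y. 1 < norm y}"

lemma exterior_measurable [measurable]: "exterior : sets borel"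
 unfolding exterior_def by measurable

lemma integrable_outer:
 assumes [measurable]: "E : sets borel" and E: "E \<subseteq> exterior"
 shows "L1 (%y. indicator E y/norm y^4)"
proof(rule integrable_bound[OF integrable_mult_right[OF integrable_inverse_fourth, of 4]])
 show "AE y in lborel. norm(indicator E y/norm y^4) <= norm(4*(1/(1 + norm(y::real^3)^2)^2))"
 proof(rule AE_I2)
  fix y :: "real^3"
  show "norm(indicator E y/norm y^4) <= norm(4*(1/(1 + norm y^2)^2))"
  proof(cases "y : E")
   case True
   hence r: "1 < norm y" using E by(auto simp: exterior_def)
   hence "(1 + norm y^2)^2 <= (2*norm y^2)^2" by(intro power_mono) (auto simp: one_le_power less_imp_le)
   also have "... = 4*norm y^4" by(simp add: power_mult_distrib flip: power_mult)
   finally have "4/(4*norm y^4) <= 4/(1 + norm y^2)^2"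
    using r by(intro divide_left_mono mult_pos_pos zero_less_power) (auto simp: add_pos_nonneg)
   thus ?thesis using True by simp
  qed simp
 qed
qed measurable

lemma green_nonneg: "x : exterior ==> y : exterior ==> 0 <= green x y"
 using green_pos[of x y] by(cases "x = y") (auto simp: exterior_def green_def)

text \<open>The integral is split at distance \<open>\<delta>\<close> from \<open>x\<close>: the
  near part is small with \<open>\<delta>\<close> whatever \<open>E\<close> is, the far part is
  small with \<open>outer_mass E\<close>.\<close>

lemma exterior_estimate:
 assumes x: "x : exterior" and E [measurable]: "E : sets borel" "E \<subseteq> exterior" and \<delta>: "0 < \<delta>" "\<delta> <= 1"
  and g: "!!y. y : E ==> 0 <= g y" "!!y. y : E ==> g y <= B/norm y^6" and B: "0 <= B"
  and h: "!!y. h y <= indicator E y*(green x y*g y)"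
 shows "LI h <= B*(4*\<delta>*inverse_square_mass 1 + 4/\<delta> * outer_mass E)"
proof -
 have i: "L1 (%y. 4*B*(indicator (cball x \<delta>) y/norm(x - y)^2))"
  "L1 (%y. 4*B/\<delta>*(indicator E y/norm y^4))"
  by(intro integrable_mult_right integrable_inverse_square_ball integrable_outer E)+
 have "LI h <= (LINT y. 4*B*(indicator (cball x \<delta>) y/norm(x - y)^2) + 4*B/\<delta>*(indicator E y/norm y^4))"
 proof(rule integral_mono'[OF integrable_add[OF i]])
  fix y
  show nn: "0 <= 4*B*(indicator (cball x \<delta>) y/norm(x - y)^2) + 4*B/\<delta>*(indicator E y/norm y^4)"
   using B \<delta> by(intro add_nonneg_nonneg mult_nonneg_nonneg) auto
  show "h y <= 4*B*(indicator (cball x \<delta>) y/norm(x - y)^2) + 4*B/\<delta>*(indicator E y/norm y^4)"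
  proof(cases "y : E & x ~= y")
   case True
   define s r where "s = norm(x - y)" and "r = norm y"
   have s: "0 < s" and r: "1 < r" using True E by(auto simp: s_def r_def exterior_def)
   have "green x y*g y <= (2*r^2*(1 + 1/s))*(B/r^6)"
    unfolding s_def r_def using True E x by(intro mult_mono green_le g) (auto simp: exterior_def intro!: mult_nonneg_nonneg)
   also have "... = 2*B*((1 + 1/s)*(1/r^4))" using r by(simp add: field_simps flip: power_add)
   finally have b: "green x y*g y <= 2*B*((1 + 1/s)*(1/r^4))" .
   show ?thesis
   proof(cases "s <= \<delta>")
    case 1: True
    have "s^2 <= s" "s^2 <= 1" using 1 s \<delta> by(auto simp: power2_eq_square mult_left_le power_le_one mult_le_one)
    hence "1 <= 1/s^2" "1/s <= 1/s^2" using s by(auto simp: divide_simps)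
    hence "1 + 1/s <= 2/s^2" by(simp add: field_simps)
    hence "(1 + 1/s)*(1/r^4) <= (2/s^2)*1"
     using r s by(intro mult_mono) (auto simp: one_le_power less_imp_le)
    hence "2*B*((1 + 1/s)*(1/r^4)) <= 2*B*((2/s^2)*1)" using B by(intro mult_left_mono) auto
    hence "green x y*g y <= 4*B*(indicator (cball x \<delta>) y/s^2)" using b 1 by(simp add: s_def dist_norm)
    moreover have "0 <= 4*B/\<delta>*(indicator E y/norm y^4)" using B \<delta> by(intro mult_nonneg_nonneg) auto
    ultimately show ?thesis using h[of y] True by(simp add: s_def)
   next
    case False
    have "1/s <= 1/\<delta>" "1 <= 1/\<delta>" using False \<delta> by(auto simp: divide_simps)
    hence "1 + 1/s <= 2/\<delta>" by simp
    hence "2*B*((1 + 1/s)*(1/r^4)) <= 2*B*((2/\<delta>)*(1/r^4))"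
     using B r by(intro mult_left_mono mult_right_mono) auto
    hence "green x y*g y <= 4*B/\<delta>*(1/r^4)" using b by simp
    thus ?thesis using h[of y] True False by(simp add: r_def s_def dist_norm)
   qed
  next
   case False
   hence "h y <= 0" using h[of y] by(auto simp: green_def)
   thus ?thesis using nn by linarith
  qed
 qed
 also have "... = 4*B*(LINT y. indicator (cball x \<delta>) y/norm(x - y)^2) + 4*B/\<delta> * outer_mass E"
  by(simp only: integral_add[OF i] outer_mass_def integral_mult_right_zero)
 also have "... <= 4*B*inverse_square_mass \<delta> + 4*B/\<delta> * outer_mass E"
  using B by(intro add_right_mono mult_left_mono inverse_square_mass_bound) auto
 finally show ?thesis unfolding inverse_square_mass_scale[OF \<delta>(1)] by(simp add: algebra_simps)
qed

text \<open>The integral equation in difference form. It is free of the additive constant and of the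
  distinguished origin in \<open>log_kernel\<close>, hence preserved by translations and by
  dilations with \<open>ln r\<close> added.\<close>

locale log_solution =
 fixes w :: "real^3 => real" and a :: real
 assumes continuous: "continuous_on UNIV w" and exp_integrable: "L1 (%y. exp(3*w y))"
  and exp_mass: "(LINT y. exp(3*w y)) = pi^2*a"
  and kernel_integrable: "!!x z. L1 (%y. ln(norm(z - y)/norm(x - y))*exp(3*w y))"
  and equation: "!!x z. w x - w z = 1/pi^2*(LINT y. ln(norm(z - y)/norm(x - y))*exp(3*w y))"
begin

lemma w_measurable [measurable]: "w : borel_measurable borel"
 by(rule borel_measurable_continuous_onI[OF continuous])

lemma affine:
 assumes r: "0 < r"
 shows "log_solution (%y. w (c + r *\<^sub>R y) + ln r) a"
proof
 have e: "exp(3*(w (c + r *\<^sub>R y) + ln r)) = r^3*exp(3*w (c + r *\<^sub>R y))" for y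
  using r by(simp add: distrib_left exp_add exp_of_nat_mult[of 3, simplified])
 have k: "ln(norm(z - y)/norm(x - y)) = ln(norm((c + r *\<^sub>R z) - (c + r *\<^sub>R y))/norm((c + r *\<^sub>R x) - (c + r *\<^sub>R y)))" for x y z
  using r by(simp flip: scaleR_diff_right)
 show "continuous_on UNIV (%y. w (c + r *\<^sub>R y) + ln r)"
  by(intro continuous_intros continuous_on_compose2[OF continuous]) auto
 show "L1 (%y. exp(3*(w (c + r *\<^sub>R y) + ln r)))"
  unfolding e using r by(intro integrable_mult_right integrable_lborel_affine[OF exp_integrable]) simp
 show "(LINT y. exp(3*(w (c + r *\<^sub>R y) + ln r))) = pi^2*a"
  unfolding e exp_mass[symmetric] using r by(subst integral_lborel_affine[of r _ c]) simp_all
 fix x z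
 define h where "h y = ln(norm((c + r *\<^sub>R z) - y)/norm((c + r *\<^sub>R x) - y))*exp(3*w y)" for y
 have h: "ln(norm(z - y)/norm(x - y))*exp(3*(w (c + r *\<^sub>R y) + ln r)) = r^3*h(c + r *\<^sub>R y)" for y
  unfolding e k[of z y x] h_def by simp
 have hi: "L1 h" unfolding h_def by(rule kernel_integrable)
 show "L1 (%y. ln(norm(z - y)/norm(x - y))*exp(3*(w (c + r *\<^sub>R y) + ln r)))"
  unfolding h using r by(intro integrable_mult_right integrable_lborel_affine[OF hi]) simp
 show "w (c + r *\<^sub>R x) + ln r - (w (c + r *\<^sub>R z) + ln r)
   = 1/pi^2*(LINT y. ln(norm(z - y)/norm(x - y))*exp(3*(w (c + r *\<^sub>R y) + ln r)))"
  unfolding h using r equation[of "c + r *\<^sub>R x" "c + r *\<^sub>R z"] integral_lborel_affine[of r h c]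
  by(simp add: h_def)
qed

text \<open>\<open>w\<close> minus its reflection \<open>w (inversion x) - 2 * ln |x|\<close> in the
  unit sphere; the logarithm is the one for which \<open>exp (3 * w)\<close> transforms as a
  density.\<close>

definition gap :: "real^3 => real" where "gap x = w x - w (inversion x) + 2*ln(norm x)"

lemma gap_measurable [measurable]: "gap : borel_measurable borel"
 unfolding gap_def[abs_def] by measurable

lemma gap_continuous_on: "continuous_on exterior gap"
proof -
 have "continuous_on exterior inversion" by(rule inversion_continuous_on) (simp add: exterior_def)
 hence "continuous_on exterior (%x. w (inversion x))" by(rule continuous_on_compose2[OF continuous]) simp
 moreover have "continuous_on exterior (%x. ln(norm x))"
  by(intro continuous_on_ln continuous_on_norm continuous_on_id) (auto simp: exterior_def)
 ultimately show ?thesis unfolding gap_def[abs_def]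
  by(intro continuous_on_add continuous_on_diff continuous_on_mult continuous_on_const continuous_on_subset[OF continuous]) auto
qed

abbreviation gap_source :: "real^3 => real^3 => real"
 where "gap_source x y \<equiv> indicator exterior y*(green x y*(exp(3*w y) - exp(3*(w y - gap y))))"

lemma exp_reflected: "y : exterior ==> exp(3*w (inversion y))/norm y^6 = exp(3*(w y - gap y))"
proof -
 assume "y : exterior"
 hence "0 < norm y" by(auto simp: exterior_def)
 hence "norm y^6 = exp(6*ln(norm y))" by(simp add: exp_of_nat_mult[of 6, simplified])
 thus ?thesis by(simp add: gap_def exp_diff[symmetric] algebra_simps)
qed

text \<open>The equation between \<open>x\<close> and \<open>inversion x\<close>, with the unit ball
  folded onto the exterior: the kernels at \<open>y\<close> and at its reflection are plus and minus
  \<open>green x y\<close>, both minus \<open>ln |x|\<close>. The latter terms collect the total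
  mass and combine with \<open>2 * ln |x|\<close> to the factor \<open>2 - a\<close>.\<close>

lemma gap_eq:
 assumes x: "x : exterior"
 shows "L1 (%y. gap_source x y)"
  and "gap x = 1/pi^2*(LINT y. gap_source x y) + (2 - a)*ln(norm x)"
proof -
 define k where "k y = ln(norm(inversion x - y)/norm(x - y))*exp(3*w y)" for y
 define A :: "(real^3) set" where "A = ball 0 1"
 have A [measurable]: "A : sets borel" by(simp add: A_def)
 have ki: "L1 k" unfolding k_def by(rule kernel_integrable)
 define h where "h y = indicator A y * k y" for y
 define h' where "h' y = indicator A y*exp(3*w y)" for y
 have i: "L1 h" "L1 h'" "L1 (%y. indicator exterior y * k y)" "L1 (%y. indicator exterior y*exp(3*w y))"
  using integrable_mult_indicator[OF _ ki, of A] integrable_mult_indicator[OF _ exp_integrable, of A]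
   integrable_mult_indicator[OF _ ki, of exterior] integrable_mult_indicator[OF _ exp_integrable, of exterior]
  by(simp_all add: h_def[abs_def] h'_def[abs_def])
 define l where "l = ln(norm x)"
 define G where "G y = (indicator exterior y * k y + h(inversion y)/norm y^6) + l*(indicator exterior y*exp(3*w y) + h' (inversion y)/norm y^6)" for y
 have iG: "L1 G" unfolding G_def
  by(intro integrable_add integrable_mult_right integral_inversion(1) i)
 have n1: "AE y :: real^3 in lborel. norm y ~= 1"
 proof(rule AE_I[of _ _ "sphere 0 1"])
  show "emeasure lborel (sphere (0::real^3) 1) = 0"
   using negligible_sphere[of "0::real^3" 1] by(simp add: negligible_iff_null_sets null_sets_def)
 qed auto
 have ae: "AE y in lborel. gap_source x y = G y" using AE_lborel_singleton[of x]
 proof eventually_elim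
  case (elim y)
  show ?case
  proof(cases "y : exterior")
   case True
   hence y: "1 < norm y" "inversion y : A" by(auto simp: exterior_def A_def norm_inversion divide_less_eq)
   have "k y = (green x y - l)*exp(3*w y)"
    using green_eq(1)[of x y] x y elim by(simp add: k_def l_def exterior_def)
   moreover have "k (inversion y) = (- green x y - l)*exp(3*w (inversion y))"
    using green_eq(2)[of x y] x y elim by(simp add: k_def l_def exterior_def)
   moreover have "exp(3*w (inversion y)) = exp(3*(w y - gap y))*norm y^6"
    unfolding exp_reflected[OF True, symmetric] using y(1) by auto
   moreover have "y ~= 0" using y(1) by auto
   ultimately show ?thesis using True y by(simp add: G_def h_def h'_def) (simp add: algebra_simps)
  next
   case False
   have z: "h(inversion y)/norm y^6 = 0" "h' (inversion y)/norm y^6 = 0"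
    using False by(auto simp: h_def h'_def A_def norm_inversion exterior_def indicator_def divide_simps)
   show ?thesis unfolding G_def z using False by simp
  qed
 qed
 have m: "(%y. gap_source x y) : borel_measurable lborel" by measurable
 show "L1 (%y. gap_source x y)"
  using integrable_cong_AE[OF m borel_measurable_integrable[OF iG] ae] iG by simp
 have "(LINT y. gap_source x y) = LI G"
  by(rule integral_cong_AE[OF m borel_measurable_integrable[OF iG] ae])
 also have "... = ((LINT y. indicator exterior y * k y) + LI h) + l*((LINT y. indicator exterior y*exp(3*w y)) + LI h')"
  unfolding G_def
  by(subst integral_add integral_mult_right_zero integral_inversion(2)[OF i(1)] integral_inversion(2)[OF i(2)] |
    (intro integrable_add integrable_mult_right integral_inversion(1) i; fail))+ simp
 also have "(LINT y. indicator exterior y * k y) + LI h = LI k"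
 proof -
  have "(LINT y. indicator exterior y * k y) + LI h = (LINT y. indicator exterior y * k y + h y)"
   using i by simp
  also have "... = LI k"
  proof(rule integral_cong_AE)
   show "AE y in lborel. indicator exterior y * k y + h y = k y"
    using n1 by eventually_elim (auto simp: h_def A_def exterior_def indicator_def)
  qed(use i ki in auto)
  finally show ?thesis .
 qed
 also have "(LINT y. indicator exterior y*exp(3*w y)) + LI h' = pi^2*a"
 proof -
  have "(LINT y. indicator exterior y*exp(3*w y)) + LI h' = (LINT y. indicator exterior y*exp(3*w y) + h' y)"
   using i by simp
  also have "... = (LINT y. exp(3*w y))"
  proof(rule integral_cong_AE)
   show "AE y in lborel. indicator exterior y*exp(3*w y) + h' y = exp(3*w y)"
    using n1 by eventually_elim (auto simp: h'_def A_def exterior_def indicator_def)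
  qed(use i exp_integrable in auto)
  finally show ?thesis unfolding exp_mass .
 qed
 finally show "gap x = 1/pi^2*(LINT y. gap_source x y) + (2 - a)*ln(norm x)"
  using equation[of x "inversion x"] unfolding gap_def k_def l_def by(simp add: algebra_simps add_divide_distrib)
qed

text \<open>Moving spheres outwards (\<open>\<sigma> = 1\<close>) or inwards (\<open>\<sigma> = -1\<close>); \<open>g\<close> is the smaller one of the two densities
 where \<open>\<sigma> * gap\<close> is negative. A bounded solution of the integral inequality on a small set vanishes.\<close>

lemma sigma_gap:
 assumes x: "x : exterior" and \<sigma>: "\<sigma> = 1 \<or> \<sigma> = -1"
  and g: "!!y. g y = (if \<sigma> = 1 then exp(3*(w y - gap y)) else exp(3*w y))"
 shows "\<sigma>*gap x = 1/pi^2*(LINT y. indicator exterior y*(green x y*(g y*(exp(3*(\<sigma>*gap y)) - 1)))) + \<sigma>*(2 - a)*ln(norm x)"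
  and "L1 (%y. indicator exterior y*(green x y*(g y*(exp(3*(\<sigma>*gap y)) - 1))))"
proof -
 have e: "indicator exterior y*(green x y*(g y*(exp(3*(\<sigma>*gap y)) - 1)))
   = \<sigma>*gap_source x y" for y
  using \<sigma> unfolding g by(elim disjE) (auto simp: algebra_simps simp flip: exp_add)
 show "L1 (%y. indicator exterior y*(green x y*(g y*(exp(3*(\<sigma>*gap y)) - 1))))"
  unfolding e by(intro integrable_mult_right gap_eq(1)[OF x])
 show "\<sigma>*gap x = 1/pi^2*(LINT y. indicator exterior y*(green x y*(g y*(exp(3*(\<sigma>*gap y)) - 1)))) + \<sigma>*(2 - a)*ln(norm x)"
  unfolding e integral_mult_right_zero by(subst gap_eq(2)[OF x]) (simp add: algebra_simps)
qed

text \<open>Let \<open>S\<close> be the supremum of \<open>- \<sigma> * gap\<close> over the bad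
  set. The integral inequality and \<open>1 - exp t <= - t\<close> bound it by
  \<open>3 * S/pi^2\<close> times the quantity in \<open>small\<close>, which is less than
  \<open>S\<close>; so the bad set is empty.\<close>

lemma moving_step:
 assumes \<sigma>: "\<sigma> = 1 \<or> \<sigma> = -1" "0 <= \<sigma>*(2 - a)" and B: "0 <= B"
  and gB: "!!y. y : exterior ==> (if \<sigma> = 1 then exp(3*(w y - gap y)) else exp(3*w y)) <= B/norm y^6"
  and \<delta>: "0 < \<delta>" "\<delta> <= 1"
  and small: "B*(4*\<delta>*inverse_square_mass 1 + 4/\<delta> * outer_mass {y : exterior. \<sigma>*gap y < 0}) < pi^2/3"
  and x: "x : exterior"
 shows "0 <= \<sigma>*gap x"
proof(rule ccontr)
 assume neg: "~ 0 <= \<sigma>*gap x"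
 define g where "g y = (if \<sigma> = 1 then exp(3*(w y - gap y)) else exp(3*w y))" for y
 define E where "E = {y : exterior. \<sigma>*gap y < 0}"
 have "E = exterior \<inter> {y. \<sigma>*gap y < 0}" by(auto simp: E_def)
 hence [measurable]: "E : sets borel" and E: "E \<subseteq> exterior" by simp_all
 define K where "K h z = (LINT y. indicator exterior y*(green z y*h y))" for h z
 have g0: "0 <= g y" for y by(simp add: g_def)
 have bnd: "- (\<sigma>*gap z) <= 3*S/pi^2*(B*(4*d*inverse_square_mass 1 + 4/d * outer_mass F))"
  if z: "z : exterior" and d: "0 < d" "d <= 1" and F: "F : sets borel" "F \<subseteq> exterior" "0 <= S"
   and S: "!!y. y : exterior ==> 1 - exp(3*(\<sigma>*gap y)) <= 3*S*indicator F y" for z d F S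
 proof -
  have "(LINT y. - (indicator exterior y*(green z y*(g y*(exp(3*(\<sigma>*gap y)) - 1)))))
    <= 3*S*B*(4*d*inverse_square_mass 1 + 4/d * outer_mass F)"
  proof(rule exterior_estimate[OF z F(1,2) d, where g="%y. 3*S*g y"])
   show "0 <= 3*S*g y" for y using F(3) g0 by simp
   show "3*S*g y <= 3*S*B/norm y^6" if "y : F" for y
    using mult_left_mono[OF gB, of y "3*S"] that F by(auto simp: g_def)
   show "0 <= 3*S*B" using F(3) B by simp
   fix y
   show "- (indicator exterior y*(green z y*(g y*(exp(3*(\<sigma>*gap y)) - 1)))) <= indicator F y*(green z y*(3*S*g y))"
   proof(cases "y : exterior")
    case True
    have "green z y*g y*(1 - exp(3*(\<sigma>*gap y))) <= green z y*g y*(3*S*indicator F y)"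
     using S[OF True] green_nonneg[OF z True] g0[of y] by(intro mult_left_mono mult_nonneg_nonneg)
    thus ?thesis using True by(simp add: algebra_simps)
   next
    case False
    thus ?thesis using F by(auto simp: indicator_def)
   qed
  qed
  hence "- (LINT y. indicator exterior y*(green z y*(g y*(exp(3*(\<sigma>*gap y)) - 1))))/pi^2
    <= 3*S*B*(4*d*inverse_square_mass 1 + 4/d * outer_mass F)/pi^2"
   by(intro divide_right_mono) auto
  moreover have "0 <= \<sigma>*(2 - a)*ln(norm z)" using mult_nonneg_nonneg[OF \<sigma>(2), of "ln(norm z)"] z by(simp add: exterior_def)
  ultimately show ?thesis unfolding sigma_gap(1)[OF z \<sigma>(1) g_def] by(simp add: mult_ac)
 qed
 \<comment> \<open>A crude first application, over the whole exterior and with \<open>S = 1\<close>,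
   shows that the supremum taken next is finite.\<close>
 have ub: "- (\<sigma>*gap z) <= 3*1/pi^2*(B*(4*1*inverse_square_mass 1 + 4/1 * outer_mass exterior))" if "z : exterior" for z
 proof(rule bnd[OF that])
  show "1 - exp(3*(\<sigma>*gap y)) <= 3*1*indicator exterior y" if "y : exterior" for y
   using that exp_ge_zero[of "3*(\<sigma>*gap y)"] by(simp del: exp_ge_zero)
 qed auto
 define S where "S = (SUP z\<in>E. - (\<sigma>*gap z))"
 have bdd: "bdd_above ((%z. - (\<sigma>*gap z)) ` E)" by(rule bdd_aboveI2[OF ub]) (use E in blast)
 have xE: "x : E" using x neg by(simp add: E_def)
 have le: "- (\<sigma>*gap z) <= S" if "z : E" for z unfolding S_def by(rule cSUP_upper[OF that bdd])
 have S: "0 < S" using le[OF xE] neg by linarith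
 have "- (\<sigma>*gap z) <= 3*S/pi^2*(B*(4*\<delta>*inverse_square_mass 1 + 4/\<delta> * outer_mass E))" if "z : E" for z
 proof(rule bnd[OF _ \<delta>])
  show "z : exterior" using that E by auto
  fix y assume y: "y : exterior"
  show "1 - exp(3*(\<sigma>*gap y)) <= 3*S*indicator E y"
  proof(cases "y : E")
   case True
   have "1 - exp(3*(\<sigma>*gap y)) <= 3*S"
    using exp_ge_add_one_self[of "3*(\<sigma>*gap y)"] le[OF True] by linarith
   thus ?thesis using True by simp
  next
   case False
   hence "0 <= \<sigma>*gap y" using y by(auto simp: E_def)
   thus ?thesis using False by simp
  qed
 qed(use E S in auto)
 hence "S <= 3*S/pi^2*(B*(4*\<delta>*inverse_square_mass 1 + 4/\<delta> * outer_mass E))"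
  unfolding S_def using xE by(intro cSUP_least) auto
 also have "... < 3*S/pi^2*(pi^2/3)" using S small unfolding E_def by(intro mult_strict_left_mono) auto
 finally show False by simp
qed

text \<open>The strong maximum principle for the integral equation.\<close>

lemma gap_strict:
 assumes \<sigma>: "\<sigma> = 1 \<or> \<sigma> = -1" "0 <= \<sigma>*(2 - a)" and nn: "!!y. y : exterior ==> 0 <= \<sigma>*gap y"
  and x: "x : exterior" "gap x = 0"
 shows "a = 2" and "!!y. y : exterior ==> gap y = 0"
proof -
 define g where "g y = (if \<sigma> = 1 then exp(3*(w y - gap y)) else exp(3*w y))" for y
 define G where "G y = indicator exterior y*(green x y*(g y*(exp(3*(\<sigma>*gap y)) - 1)))" for y
 have g0: "0 < g y" for y by(simp add: g_def)
 have G0: "0 <= G y" for y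
  unfolding G_def using green_nonneg[OF x(1), of y] less_imp_le[OF g0, of y] nn[of y]
  by(cases "y : exterior") (auto intro!: mult_nonneg_nonneg)
 have i: "L1 G" unfolding G_def by(rule sigma_gap(2)[OF x(1) \<sigma>(1) g_def])
 have l: "0 < ln(norm x)" using x(1) by(intro ln_gt_zero) (simp add: exterior_def)
 have "0 = 1/pi^2*LI G + \<sigma>*(2 - a)*ln(norm x)"
  using sigma_gap(1)[OF x(1) \<sigma>(1) g_def] x(2) by(simp add: G_def[abs_def])
 moreover have "0 <= LI G" using G0 by(intro integral_nonneg_AE AE_I2)
 moreover have "0 <= \<sigma>*(2 - a)*ln(norm x)" using \<sigma>(2) l by simp
 ultimately have z: "LI G = 0" "\<sigma>*(2 - a)*ln(norm x) = 0"
  by(simp_all add: add_nonneg_eq_0_iff eq_commute[of 0])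
 thus "a = 2" using l \<sigma>(1) by auto
 have "AE y in lborel. G y = 0" using z(1) integral_nonneg_eq_0_iff_AE[OF i] G0 by simp
 hence ae: "AE y in lborel. y : exterior --> gap y = 0"
  using AE_lborel_singleton[of x]
 proof eventually_elim
  case (elim y)
  show ?case
  proof
   assume y: "y : exterior"
   have "green x y ~= 0" using green_pos[of x y] x(1) y elim by(auto simp: exterior_def)
   hence "exp(3*(\<sigma>*gap y)) = 1" using elim(1) y g0[of y] by(simp add: G_def)
   thus "gap y = 0" using \<sigma>(1) by auto
  qed
 qed
 define U where "U = {y : exterior. gap y ~= 0}"
 have "open U"
 proof -
  have "open exterior" unfolding exterior_def by(intro open_Collect_less continuous_intros)
  hence "open (exterior \<inter> gap -` (- {0}))" by(intro continuous_open_preimage gap_continuous_on) auto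
  moreover have "exterior \<inter> gap -` (- {0}) = U" by(auto simp: U_def)
  ultimately show ?thesis by simp
 qed
 moreover have "negligible U"
 proof -
  have [measurable]: "U : sets borel" using \<open>open U\<close> by simp
  have "AE y in lborel. y \<notin> U" using ae by eventually_elim (auto simp: U_def)
  hence "U : null_sets lborel" by(subst AE_iff_null_sets) auto
  thus ?thesis by(simp add: negligible_iff_null_sets null_sets_completionI)
 qed
 ultimately have "U = {}" using open_not_negligible by blast
 thus "!!y. y : exterior ==> gap y = 0" by(auto simp: U_def)
qed

definition scaled_gap :: "real => real^3 => real" where
 "scaled_gap r y = w (r *\<^sub>R y) - w (r *\<^sub>R inversion y) + 2*ln(norm y)"

lemma gap_affine: "0 < r ==> log_solution.gap (%y. w (0 + r *\<^sub>R y) + ln r) y = scaled_gap r y"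
 unfolding log_solution.gap_def[OF affine] scaled_gap_def by simp

text \<open>Continuity method in \<open>t\<close> with radius \<open>exp (\<sigma> * t)\<close>;
  \<open>bound\<close> gives the rescaled density the factor \<open>exp (3 * t)\<close>, so the
  inequality holds for \<open>t\<close> near minus infinity. At a last admissible \<open>t\<close>
  the gap vanishes identically, since otherwise it is positive and \<open>moving_step\<close>
  reaches beyond.\<close>

lemma moving_spheres:
 assumes \<sigma>: "\<sigma> = 1 \<or> \<sigma> = -1" "0 <= \<sigma>*(2 - a)" and M: "0 < M"
  and bound: "!!r y. 0 < r ==> y : exterior ==> (if \<sigma> = 1 then exp(3*w (r *\<^sub>R inversion y))/norm y^6 else exp(3*w (r *\<^sub>R y)))*r^3
   <= M*exp(3*\<sigma>*ln r)/norm y^6"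
 shows "(ALL r>0. ALL y:exterior. 0 <= \<sigma> * scaled_gap r y) \<or> a = 2 & (EX r>0. ALL y:exterior. scaled_gap r y = 0)"
proof -
 define G where "G t = scaled_gap (exp(\<sigma>*t))" for t
 define E where "E t = {y : exterior. \<sigma>*G t y < 0}" for t
 define P where "P t \<longleftrightarrow> (ALL y:exterior. 0 <= \<sigma>*G t y)" for t
 have ls: "log_solution (%y. w (0 + exp(\<sigma>*t) *\<^sub>R y) + ln(exp(\<sigma>*t))) a" for t by(rule affine) simp
 have gap: "log_solution.gap (%y. w (0 + exp(\<sigma>*t) *\<^sub>R y) + ln(exp(\<sigma>*t))) = G t" for t
  unfolding fun_eq_iff G_def using gap_affine[of "exp(\<sigma>*t)"] by simp
 have Gm: "G t : borel_measurable borel" for t using log_solution.gap_measurable[OF ls] unfolding gap .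
 have Em: "E t : sets borel" "E t \<subseteq> exterior" for t
 proof -
  have "E t = exterior \<inter> {y. \<sigma>*G t y < 0}" by(auto simp: E_def)
  thus "E t : sets borel" "E t \<subseteq> exterior" using Gm[of t] by(simp_all, measurable)
 qed
 have \<sigma>2: "\<sigma>*(\<sigma>*t) = t" for t using \<sigma>(1) by auto
 have step: "P t" if \<delta>: "0 < \<delta>" "\<delta> <= 1" and s: "M*exp(3*t)*(4*\<delta>*inverse_square_mass 1 + 4/\<delta> * outer_mass (E t)) < pi^2/3" for t \<delta>
  unfolding P_def
 proof
  fix x assume x: "x : exterior"
  have g: "(if \<sigma> = 1 then exp(3*(w (0 + exp(\<sigma>*t) *\<^sub>R y) + ln(exp(\<sigma>*t)) - G t y)) else exp(3*(w (0 + exp(\<sigma>*t) *\<^sub>R y) + ln(exp(\<sigma>*t)))))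
    <= M*exp(3*t)/norm y^6" if y: "y : exterior" for y
  proof -
   have "exp(3*(b + \<sigma>*t)) = exp(3*b)*exp(\<sigma>*t)^3" for b
    by(simp add: distrib_left exp_add exp_of_nat_mult[of 3, simplified])
   thus ?thesis
    using bound[of "exp(\<sigma>*t)" y] y log_solution.exp_reflected[OF ls, of y t] \<sigma>2[of t] unfolding gap
    by(auto simp: mult.assoc split: if_splits)
  qed
  show "0 <= \<sigma>*G t x"
   using log_solution.moving_step[OF ls \<sigma>, of "M*exp(3*t)" t \<delta> x] g M \<delta> s x unfolding gap E_def by auto
 qed
 have outer_mono: "outer_mass (E t) <= outer_mass exterior" for t
  unfolding outer_mass_def using Em[of t]
  by(intro integral_mono integrable_outer divide_right_mono) (auto simp: indicator_def)
 have I0: "0 <= inverse_square_mass 1" by(rule inverse_square_mass_nonneg)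
 obtain T where T: "!!t. t <= T ==> P t"
 proof -
  define c where "c = 4*inverse_square_mass 1 + 4 * outer_mass exterior"
  have "((%t. M*exp(3*t) * c) \<longlongrightarrow> M*0 * c) at_bot"
   by(intro tendsto_mult tendsto_const) real_asymp
  hence "\<forall>\<^sub>F t in at_bot. M*exp(3*t) * c < pi^2/3" by(rule order_tendstoD) simp
  then obtain T where T: "!!t. t <= T ==> M*exp(3*t) * c < pi^2/3" by(auto simp: eventually_at_bot_linorder)
  show thesis
  proof(rule that[of T], rule step[of 1])
   fix t assume "t <= T"
   have "M*exp(3*t)*(4*1*inverse_square_mass 1 + 4/1 * outer_mass (E t)) <= M*exp(3*t) * c"
    unfolding c_def using outer_mono[of t] M by(intro mult_left_mono) auto
   thus "M*exp(3*t)*(4*1*inverse_square_mass 1 + 4/1 * outer_mass (E t)) < pi^2/3"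
    using T[OF \<open>t <= T\<close>] by linarith
  qed simp_all
 qed
 have cont: "isCont (%t. \<sigma>*G t y) t" for y t unfolding G_def scaled_gap_def
  by(intro continuous_intros isCont_o2[OF _ continuous_on_interior[OF continuous]]) auto
 have fin: "(ALL r>0. ALL y:exterior. 0 <= \<sigma> * scaled_gap r y)" if "ALL t. P t"
 proof(intro allI impI ballI)
  fix r :: real and y assume r: "0 < r" and y: "y : exterior"
  have "exp(\<sigma>*(\<sigma>*ln r)) = r" unfolding \<sigma>2 using r by simp
  thus "0 <= \<sigma> * scaled_gap r y" using that y unfolding P_def G_def by metis
 qed
 show ?thesis
 proof(rule ccontr)
  assume neg: "~ ?thesis"
  obtain t' where t': "~ P t'" using fin neg by blast
  define A where "A = {t. ALL s<=t. P s}"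
  have A: "T : A" "bdd_above A" using T t' unfolding A_def by(auto intro!: bdd_aboveI[of _ t'] simp: not_le[symmetric]) (meson linear)
  define s where "s = Sup A"
  have below: "P t" if t: "t < s" for t
  proof -
   obtain t1 where "t1 : A" "t < t1" using less_cSupD[OF _ t[unfolded s_def]] A by auto
   thus ?thesis by(auto simp: A_def)
  qed
  have Ps: "P s" unfolding P_def
  proof
   fix y assume y: "y : exterior"
   have "((%t. \<sigma>*G t y) \<longlongrightarrow> \<sigma>*G s y) (at_left s)"
    using cont[where y=y and t=s] unfolding isCont_def by(rule filterlim_mono) (auto simp: at_le)
   moreover have "\<forall>\<^sub>F t in at_left s. 0 <= \<sigma>*G t y"
    using below y by(auto simp: P_def eventually_at_left_field intro!: exI[of _ "s - 1"])
   ultimately show "0 <= \<sigma>*G s y" by(rule tendsto_lowerbound) simp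
  qed
  have pos: "0 < \<sigma>*G s y" if y: "y : exterior" for y
  proof(rule ccontr)
   assume "~ 0 < \<sigma>*G s y"
   hence "G s y = 0" using Ps y \<sigma>(1) by(force simp: P_def)
   have nn: "0 <= \<sigma>*G s y" if "y : exterior" for y using Ps that by(simp add: P_def)
   note gs = log_solution.gap_strict[OF ls[of s] \<sigma>, unfolded gap, OF nn y \<open>G s y = 0\<close>]
   have "ALL y:exterior. G s y = 0" using gs(2) by blast
   hence "a = 2 & (EX r>0. ALL y:exterior. scaled_gap r y = 0)" using gs(1) unfolding G_def by(intro conjI exI[of _ "exp(\<sigma> * s)"]) auto
   thus False using neg by blast
  qed
  \<comment> \<open>Failures just beyond \<open>s\<close>. As they approach \<open>s\<close> their
    bad sets shrink to nothing, because the gap at \<open>s\<close> is positive pointwise; so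
    \<open>outer_mass\<close> tends to 0 and \<open>moving_step\<close> refutes one of them.\<close>
  have "EX t. s < t & t <= s + 1/Suc n & ~ P t" for n
  proof(rule ccontr)
   assume no: "~ ?thesis"
   have "P q" if "q <= s + 1/Suc n" for q
   proof(cases q s rule: linorder_cases)
    case greater
    thus ?thesis using no that by auto
   qed(simp_all add: below Ps)
   hence "s + 1/Suc n : A" unfolding A_def by simp
   hence "s + 1/Suc n <= s" unfolding s_def using A(2) by(rule cSup_upper)
   thus False by simp
  qed
  then obtain t where t: "!!n. s < t n" "!!n. t n <= s + 1/Suc n" "!!n. ~ P (t n)" by metis
  have tl: "t \<longlonglongrightarrow> s"
  proof(rule tendsto_sandwich[of "%_. s" _ _ "%n. s + 1/Suc n"])
   show "(%n. s + 1/Suc n) \<longlonglongrightarrow> s" using tendsto_add[OF tendsto_const LIMSEQ_inverse_real_of_nat, of s] by(simp add: inverse_eq_divide)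
  qed(use t in \<open>auto intro!: always_eventually less_imp_le\<close>)
  have lim: "(%n. outer_mass (E (t n))) \<longlonglongrightarrow> (\<integral>y. 0 \<partial>(lborel :: (real^3) measure))"
   unfolding outer_mass_def
  proof(rule integral_dominated_convergence[where w="%y. indicator exterior y/norm y^4"])
   show "AE y in lborel. (%n. indicator (E (t n)) y/norm y^4) \<longlonglongrightarrow> (0 :: real)"
   proof(intro AE_I2 tendsto_eventually)
    fix y :: "real^3"
    show "\<forall>\<^sub>F n in sequentially. indicator (E (t n)) y/norm y^4 = (0 :: real)"
    proof(cases "y : exterior")
     case True
     from order_tendstoD(1)[OF isCont_tendsto_compose[OF cont[where y=y and t=s] tl] pos[OF True]]
     show ?thesis by eventually_elim (simp add: E_def)
    qed(simp add: E_def)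
   qed
   show "AE y in lborel. norm(indicator (E (t n)) y/norm y^4 :: real) <= indicator exterior y/norm y^4" for n
    using Em(2)[of "t n"] by(intro AE_I2) (auto simp: indicator_def)
  qed(use Em integrable_outer[of exterior] in auto)
  define c where "c = M*exp(3*(s + 1))"
  \<comment> \<open>Makes the near part at most 1; the far part is below 1 for a suitable
    \<open>n\<close>, and \<open>2 < pi^2/3\<close>.\<close>
  define \<delta> where "\<delta> = 1/(1 + 16*(c*inverse_square_mass 1))"
  have c: "0 < c" using M by(simp add: c_def)
  have cI: "0 <= c*inverse_square_mass 1" using c I0 by simp
  have \<delta>: "0 < \<delta>" "\<delta> <= 1" "4*\<delta>*(c*inverse_square_mass 1) <= 1" using cI by(auto simp: \<delta>_def divide_simps)
  have "(%n. c*(4/\<delta>) * outer_mass (E (t n))) \<longlonglongrightarrow> c*(4/\<delta>)*0" using lim by(intro tendsto_mult tendsto_const) simp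
  hence "\<forall>\<^sub>F n in sequentially. c*(4/\<delta>) * outer_mass (E (t n)) < 1" by(rule order_tendstoD) simp
  then obtain n where n: "c*(4/\<delta>) * outer_mass (E (t n)) < 1" by(auto simp: eventually_sequentially)
  have o0: "0 <= outer_mass (E (t n))" unfolding outer_mass_def by(intro integral_nonneg_AE AE_I2) simp
  have "t n <= s + 1" using t(2)[of n] by(rule order_trans) simp
  hence "M*exp(3*t n)*(4*\<delta>*inverse_square_mass 1 + 4/\<delta> * outer_mass (E (t n))) <= c*(4*\<delta>*inverse_square_mass 1 + 4/\<delta> * outer_mass (E (t n)))"
   unfolding c_def using M \<delta> I0 o0 by(intro mult_right_mono mult_left_mono add_nonneg_nonneg mult_nonneg_nonneg) auto
  also have "... < 2" using n \<delta>(3) by(simp add: distrib_left mult_ac)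
  also have "2 < pi^2/3" using power_strict_mono[OF pi_gt3, of 2] by simp
  finally have "P (t n)" by(rule step[OF \<delta>(1,2)])
  thus False using t(3) by blast
 qed
qed

end

section \<open>Classification\<close>

text \<open>The cube comes from the second moment in \<open>t\<close>, the value from
  \<open>Gamma (3/2) = sqrt pi/2\<close>. At the end of the classification it converts the total
  mass into the scale of the solution.\<close>

lemma integral_inverse_cube:
 assumes d: "0 < d"
 shows "(LINT x. 1/(d + norm(x :: real^3)^2)^3) = pi^2/(4*(d * sqrt d))"
proof -
 have "(NINT x. ennreal(1/(d + norm(x :: real^3)^2)^3))
   = (NINT x. (NINT t. ennreal(t^2/2*exp(- (t*(d + norm(x :: real^3)^2))))*indicator {0..} t))"
 proof(rule nn_integral_cong)
  fix x :: "real^3"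
  have p: "0 < d + norm x^2" using d by(simp add: add_pos_nonneg)
  have "(NINT t. ennreal(t^2/2*exp(- (t*(d + norm x^2))))*indicator {0..} t)
    = (NINT t. ennreal(1/2)*(ennreal(t^2*exp(- (t*(d + norm x^2))))*indicator {0..} t))"
   unfolding mult.assoc[of "ennreal(1/2)", symmetric] by(subst ennreal_mult'[symmetric]) simp_all
  also have "... = ennreal(1/2)*ennreal(2/(d + norm x^2)^3)"
   unfolding nn_integral_exp_moment2_Ioi[OF p, symmetric] by(rule nn_integral_cmult) measurable
  also have "... = ennreal(1/2*(2/(d + norm x^2)^3))" by(rule ennreal_mult'[symmetric]) simp
  finally show "ennreal(1/(d + norm x^2)^3) = (NINT t. ennreal(t^2/2*exp(- (t*(d + norm x^2))))*indicator {0..} t)"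
   by simp
 qed
 also have "... = (NINT t. (NINT x. ennreal(t^2/2*exp(- (t*(d + norm(x :: real^3)^2))))*indicator {0..} t))"
  by(rule lborel_pair.Fubini') measurable
 also have "... = (NINT t. ennreal(sqrt pi^3/2)*(ennreal(t powr (3/2 - 1)*exp(- (t*d)))*indicator {0..} t))"
 proof(rule nn_integral_cong)
  fix t :: real
  show "(NINT x. ennreal(t^2/2*exp(- (t*(d + norm(x :: real^3)^2))))*indicator {0..} t)
   = ennreal(sqrt pi^3/2)*(ennreal(t powr (3/2 - 1)*exp(- (t*d)))*indicator {0..} t)"
  proof(cases "0 < t")
   case True
   have "(NINT x. ennreal(t^2/2*exp(- (t*(d + norm(x :: real^3)^2))))*indicator {0..} t)
     = (NINT x. ennreal(t^2/2*exp(- (t*d)))*ennreal(exp(- (t*norm(x :: real^3)^2))))"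
   proof(rule nn_integral_cong)
    fix x :: "real^3"
    have "exp(- (t*(d + norm x^2))) = exp(- (t*d))*exp(- (t*norm x^2))"
     by(simp add: distrib_left flip: exp_add)
    hence "t^2/2*exp(- (t*(d + norm x^2))) = t^2/2*exp(- (t*d))*exp(- (t*norm x^2))" by simp
    thus "ennreal(t^2/2*exp(- (t*(d + norm x^2))))*indicator {0..} t = ennreal(t^2/2*exp(- (t*d)))*ennreal(exp(- (t*norm x^2)))"
     using True by(simp only: indicator_simps atLeast_iff less_imp_le mult_1_right if_True) (rule ennreal_mult', simp)
   qed
   also have "... = ennreal(t^2/2*exp(- (t*d)))*ennreal(sqrt(pi/t)^3)"
    using nn_integral_gaussian[OF True, where 'a="real^3"] by(subst nn_integral_cmult) simp_all
   also have "... = ennreal(t^2/2*exp(- (t*d)) * sqrt(pi/t)^3)" by(rule ennreal_mult'[symmetric]) simp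
   also have "t^2/2*exp(- (t*d)) * sqrt(pi/t)^3 = sqrt pi^3/2*(t powr (3/2 - 1)*exp(- (t*d)))"
   proof -
    have "t^2*t powr (- (3/2)) = t powr 2*t powr (- (3/2))" using True by(simp add: powr_numeral)
    also have "... = t powr (3/2 - 1)" unfolding powr_add[symmetric] by simp
    finally show ?thesis unfolding sqrt_divide_power3[OF True] by(simp add: algebra_simps)
   qed
   also have "ennreal(sqrt pi^3/2*(t powr (3/2 - 1)*exp(- (t*d)))) = ennreal(sqrt pi^3/2)*ennreal(t powr (3/2 - 1)*exp(- (t*d)))"
    by(rule ennreal_mult') simp
   finally show ?thesis using True by(simp only: indicator_simps atLeast_iff less_imp_le mult_1_right if_True)
  qed(cases "t = 0"; simp)
 qed
 also have "... = ennreal(sqrt pi^3/2)*(NINT t. ennreal(t powr (3/2 - 1)*exp(- (t*d)))*indicator {0..} t)"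
  by(rule nn_integral_cmult) measurable
 also have "... = ennreal(sqrt pi^3/2)*ennreal(Gamma(3/2)/d powr (3/2))"
  using d by(subst nn_integral_powr_exp_Ioi) auto
 also have "... = ennreal(pi^2/(4*(d * sqrt d)))"
 proof -
  have G: "Gamma(3/2 :: real) = sqrt pi/2" using Gamma_plus1[of "1/2 :: real"] nonpos_Ints_nonpos[of "1/2 :: real"] by(auto simp: Gamma_one_half_real)
  have D: "d powr (3/2) = d * sqrt d" using powr_add[of d 1 "1/2"] d by(simp add: powr_half_sqrt)
  have "sqrt pi^3 * sqrt pi = pi^2" by(simp add: power3_eq_cube power2_eq_square)
  thus ?thesis unfolding G D using d by(simp add: ennreal_mult'[symmetric])
 qed
 finally have "(NINT x. ennreal(1/(d + norm(x :: real^3)^2)^3)) = ennreal(pi^2/(4*(d * sqrt d)))" .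
 thus ?thesis using d by(subst integral_eq_nn_integral) (auto intro!: AE_I2 simp: add_pos_nonneg)
qed

context log_solution
begin

text \<open>The reflection of \<open>w\<close> in the sphere of radius \<open>r\<close> around
  \<open>c\<close>, with \<open>2 * ln |x|\<close> added, as it is to \<open>w\<close> in the
  comparison. In this form it has the finite limit \<open>w c + 2 * ln r\<close> at
  infinity.\<close>

definition reflected :: "real^3 => real => real^3 => real" where
 "reflected c r x = w (c + r^2 *\<^sub>R inversion (x - c)) + 2*ln r + 2*(ln(norm x) - ln(norm(x - c)))"

lemma inversion_tendsto: "((%x. inversion(x - c)) \<longlongrightarrow> 0) (at_infinity :: (real^3) filter)"
proof(rule tendsto_norm_zero_cancel)
 have "filterlim (%x. norm(x - c)) at_top (at_infinity :: (real^3) filter)"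
  by(rule filterlim_at_top_mono[OF filterlim_tendsto_add_at_top[OF tendsto_const[of "- norm c"] filterlim_norm_at_top]])
   (auto intro!: always_eventually norm_triangle_ineq2[THEN order_trans[rotated]])
 from tendsto_inverse_0_at_top[OF this] show "((%x. norm(inversion(x - c))) \<longlongrightarrow> 0) at_infinity"
  by(simp add: norm_inversion inverse_eq_divide)
qed

lemma norm_ratio_tendsto: "((%x. norm x/norm(x - c)) \<longlongrightarrow> 1) (at_infinity :: (real^3) filter)"
proof -
 have "((%x. norm x/norm(x - c) - 1) \<longlongrightarrow> 0) (at_infinity :: (real^3) filter)"
 proof(rule Lim_null_comparison)
  show "((%x. norm c*norm(inversion(x - c))) \<longlongrightarrow> 0) at_infinity"
   by(intro tendsto_mult_right_zero tendsto_norm_zero inversion_tendsto)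
  show "\<forall>\<^sub>F x in at_infinity. norm(norm x/norm(x - c) - 1) <= norm c*norm(inversion(x - c))"
   using eventually_not_equal_at_infinity[of c]
  proof eventually_elim
   case (elim x)
   have "norm x/norm(x - c) - 1 = (norm x - norm(x - c))/norm(x - c)" using elim by(simp add: diff_divide_distrib)
   thus ?case using divide_right_mono[OF norm_triangle_ineq3[of x "x - c"], of "norm(x - c)"] by(simp add: norm_inversion)
  qed
 qed
 from tendsto_add[OF this tendsto_const[of 1]] show ?thesis by simp
qed

lemma reflected_tendsto: "(reflected c r \<longlongrightarrow> w c + 2*ln r) at_infinity"
proof -
 have "((%x. c + r^2 *\<^sub>R inversion (x - c)) \<longlongrightarrow> c + r^2 *\<^sub>R 0) at_infinity"
  by(intro tendsto_intros inversion_tendsto)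
 hence "((%x. w (c + r^2 *\<^sub>R inversion (x - c))) \<longlongrightarrow> w c) at_infinity"
  using isCont_tendsto_compose[OF continuous_on_interior[OF continuous]] by simp
 moreover have "((%x. ln(norm x/norm(x - c))) \<longlongrightarrow> ln 1) at_infinity" by(intro tendsto_ln norm_ratio_tendsto) simp
 ultimately have l: "((%x. w (c + r^2 *\<^sub>R inversion (x - c)) + 2*ln r + 2*ln(norm x/norm(x - c))) \<longlongrightarrow> w c + 2*ln r + 2*ln 1) at_infinity"
  by(intro tendsto_add tendsto_mult tendsto_const)
 have "(reflected c r \<longlongrightarrow> w c + 2*ln r + 2*ln 1) at_infinity"
 proof(rule Lim_transform_eventually[OF l])
  show "\<forall>\<^sub>F x in at_infinity. w (c + r^2 *\<^sub>R inversion (x - c)) + 2*ln r + 2*ln(norm x/norm(x - c)) = reflected c r x"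
   using eventually_not_equal_at_infinity[of c] eventually_not_equal_at_infinity[of 0]
   by eventually_elim (simp add: reflected_def ln_div)
 qed
 thus ?thesis by simp
qed

lemma center: "log_solution (%y. w (c + y)) a" using affine[of 1 c] by simp

lemma scaled_gap_center:
 assumes "0 < r" "r < norm(x - c)"
 shows "(1/r) *\<^sub>R (x - c) : exterior"
  and "log_solution.scaled_gap (%y. w (c + y)) r ((1/r) *\<^sub>R (x - c)) = w x + 2*ln(norm x) - reflected c r x"
proof -
 have "x ~= c" using assms by auto
 moreover have "r *\<^sub>R inversion ((1/r) *\<^sub>R (x - c)) = r^2 *\<^sub>R inversion (x - c)"
  using assms by(simp add: inversion_def power_divide power2_eq_square)
 ultimately show "log_solution.scaled_gap (%y. w (c + y)) r ((1/r) *\<^sub>R (x - c)) = w x + 2*ln(norm x) - reflected c r x"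
  unfolding log_solution.scaled_gap_def[OF center] reflected_def using assms by(simp add: ln_div ln_mult)
 show "(1/r) *\<^sub>R (x - c) : exterior" using assms by(simp add: exterior_def)
qed

lemma eventually_far: "\<forall>\<^sub>F x in at_infinity. r < norm(x - c :: real^3)"
proof -
 have "\<forall>\<^sub>F x in at_infinity. \<bar>r\<bar> + norm c + 1 <= norm x" by(auto simp: eventually_at_infinity)
 thus ?thesis
 proof eventually_elim
  case (elim x)
  thus ?case using norm_triangle_ineq2[of x c] by linarith
 qed
qed

text \<open>The inward motion cannot stop, as stopping forces \<open>a = 2\<close>. Comparison
  across ever smaller spheres around 0 then makes \<open>w\<close> exceed its upper bound near the
  origin.\<close>

lemma not_supercritical:
 assumes M: "0 < M" "!!x. exp(3*w x) <= M" and decay: "!!x. x ~= 0 ==> exp(3*w x) <= K/norm x^6"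
 shows "a <= 2"
proof(rule ccontr)
 assume a: "~ a <= 2"
 define K' where "K' = \<bar>K\<bar> + 1"
 have K': "0 < K'" "K <= K'" by(auto simp: K'_def)
 have "(ALL r>0. ALL y:exterior. 0 <= -1 * scaled_gap r y) \<or> a = 2 & (EX r>0. ALL y:exterior. scaled_gap r y = 0)"
 proof(rule moving_spheres[OF _ _ K'(1)])
  fix r :: real and y assume r: "0 < r" and y: "y : exterior"
  have y0: "y ~= 0" using y by(auto simp: exterior_def)
  have "exp(3*w (r *\<^sub>R y))*r^3 <= K/norm(r *\<^sub>R y)^6*r^3"
   using decay[of "r *\<^sub>R y"] r y0 by(intro mult_right_mono) auto
  also have "... <= K'/norm(r *\<^sub>R y)^6*r^3" using K' r by(intro mult_right_mono divide_right_mono) auto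
  also have "... = K'*(1/r^3)/norm y^6"
  proof -
   have "norm(r *\<^sub>R y)^6 = r^3*r^3*norm y^6" using r by(simp add: power_mult_distrib flip: power_add)
   moreover have "k/(s * s*q) * s = k*(1/s)/q" if "0 < s" for k s q :: real using that by simp
   ultimately show ?thesis using r by(simp only: zero_less_power)
  qed
  also have "1/r^3 = exp(3*- 1*ln r)" using r by(simp add: exp_minus exp_of_nat_mult[of 3, simplified] inverse_eq_divide)
  finally show "(if (- 1 :: real) = 1 then exp(3*w (r *\<^sub>R inversion y))/norm y^6 else exp(3*w (r *\<^sub>R y)))*r^3 <= K'*exp(3*- 1*ln r)/norm y^6"
   by simp
 qed(use a in auto)
 hence neg: "scaled_gap r y <= 0" if "0 < r" "y : exterior" for r y using that a by fastforce
 define e :: "real^3" where "e = axis 1 1"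
 \<comment> \<open>So small that \<open>2 * ln (1/r)\<close> exceeds
   \<open>ln M/3 - w e\<close>.\<close>
 define r where "r = exp(- (1 + \<bar>ln M - 3*w e\<bar>))"
 have r: "0 < r" "r < 1" by(auto simp: r_def)
 have e: "norm e = 1" by(simp add: e_def)
 have "scaled_gap r ((1/r) *\<^sub>R e) <= 0" using r e by(intro neg) (auto simp: exterior_def)
 hence "w e + 2*ln(1/r) <= w (r *\<^sub>R inversion ((1/r) *\<^sub>R e))" using r e by(simp add: scaled_gap_def)
 also have "... <= ln M/3" using M(2)[of "r *\<^sub>R inversion ((1/r) *\<^sub>R e)"] M(1) by(simp add: ln_ge_iff[symmetric])
 finally have "w e + 2*ln(1/r) <= ln M/3" .
 moreover have "ln(1/r) = 1 + \<bar>ln M - 3*w e\<bar>" by(simp add: r_def ln_div)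
 ultimately show False using abs_ge_self[of "ln M - 3*w e"] abs_ge_zero[of "ln M - 3*w e"] by argo
qed

text \<open>Around each centre the spheres either never stop (\<open>P\<close>) or there is a radius
  of exact symmetry (\<open>Q\<close>). \<open>P\<close> everywhere would make \<open>w\<close>
  constant, so \<open>a = 2\<close> and \<open>Q\<close> holds somewhere; the limit at infinity that
  comes with \<open>Q\<close> then excludes \<open>P\<close> at every centre. Symmetry about all
  centres determines \<open>w\<close>.\<close>

theorem spherical:
 assumes M: "0 < M" "!!x. exp(3*w x) <= M" and a: "a <= 2" and diff: "!!x. w differentiable (at x)"
 shows "spherical_solution w"
proof -
 define P where "P c \<longleftrightarrow> (ALL r>0. ALL x. r < norm(x - c) --> reflected c r x <= w x + 2*ln(norm x))" for c
 define Q where "Q c r \<longleftrightarrow> 0 < r & (ALL x. r < norm(x - c) --> reflected c r x = w x + 2*ln(norm x))" for c r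
 have alt: "P c \<or> a = 2 & (EX r. Q c r)" for c
 proof -
  have "(ALL r>0. ALL y:exterior. 0 <= 1*log_solution.scaled_gap (%y. w (c + y)) r y)
    \<or> a = 2 & (EX r>0. ALL y:exterior. log_solution.scaled_gap (%y. w (c + y)) r y = 0)"
  proof(rule log_solution.moving_spheres[OF center _ _ M(1)])
   fix r :: real and y assume r: "0 < r"
   have "exp(3*ln r) = r^3" using r by(simp add: exp_of_nat_mult[of 3, simplified])
   thus "(if (1::real) = 1 then exp(3*w (c + r *\<^sub>R inversion y))/norm y^6 else exp(3*w (c + r *\<^sub>R y)))*r^3 <= M*exp(3*1*ln r)/norm y^6"
    using divide_right_mono[OF mult_right_mono[OF M(2), of "r^3"], of "norm y^6" "c + r *\<^sub>R inversion y"] r by simp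
  qed(use a in auto)
  thus ?thesis
  proof
   assume *: "ALL r>0. ALL y:exterior. 0 <= 1*log_solution.scaled_gap (%y. w (c + y)) r y"
   have "reflected c r x <= w x + 2*ln(norm x)" if "0 < r" "r < norm(x - c)" for r x
    using * scaled_gap_center[OF that] that by force
   thus ?thesis unfolding P_def by blast
  next
   assume *: "a = 2 & (EX r>0. ALL y:exterior. log_solution.scaled_gap (%y. w (c + y)) r y = 0)"
   then obtain r where r: "0 < r" "ALL y:exterior. log_solution.scaled_gap (%y. w (c + y)) r y = 0" by blast
   have "reflected c r x = w x + 2*ln(norm x)" if "r < norm(x - c)" for x
    using r(2) scaled_gap_center[OF r(1) that] by force
   thus ?thesis using * r(1) unfolding Q_def by blast
  qed
 qed
 have lim: "((%x. w x + 2*ln(norm x)) \<longlongrightarrow> w c + 2*ln r) at_infinity" if "Q c r" for c r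
  by(rule Lim_transform_eventually[OF reflected_tendsto eventually_mono[OF eventually_far[of r c]]]) (use that in \<open>auto simp: Q_def\<close>)
 have "EX c. ~ P c"
 proof(rule ccontr)
  assume "~ ?thesis"
  hence P: "P c" for c by blast
  have le: "w z <= w x" if "x ~= z" for x z
  proof -
   define D where "D = x - z"
   have D: "0 < norm D" using that by(simp add: D_def)
   have le: "w z <= w x + ln((1 + t)/t)" if t: "0 < t" for t :: real
   proof -
    \<comment> \<open>The sphere around \<open>c\<close> whose reflection maps \<open>x\<close> to
      \<open>z\<close>: \<open>r^2\<close> is the product of the distances
      \<open>(1 + t) * |D|\<close> and \<open>t * |D|\<close>. As \<open>t\<close> tends to infinity
      the sphere flattens to a plane and the logarithmic error disappears.\<close>
    define c where "c = z - t *\<^sub>R D"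
    define r where "r = sqrt(t*(1 + t))*norm D"
    have xc: "x - c = (1 + t) *\<^sub>R D" by(simp add: c_def D_def algebra_simps)
    have r: "0 < r" "r^2 = t*(1 + t)*norm D^2" using t D by(auto simp: r_def power_mult_distrib)
    have rl: "r < norm(x - c)"
    proof(rule power2_less_imp_less)
     show "r^2 < norm(x - c)^2" unfolding r xc using t D by(simp add: power_mult_distrib power2_eq_square)
    qed simp
    have z: "c + r^2 *\<^sub>R inversion (x - c) = z"
     unfolding xc r inversion_def using t D by(simp add: c_def power_mult_distrib power2_eq_square)
    have l: "2*ln r = ln t + ln(1 + t) + 2*ln(norm D)"
     unfolding r_def using t D by(simp add: ln_mult ln_sqrt)
    have "reflected c r x <= w x + 2*ln(norm x)" using P[of c] r(1) rl unfolding P_def by blast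
    thus ?thesis unfolding reflected_def z l unfolding xc using t D by(simp add: ln_mult ln_div)
   qed
   have "\<forall>\<^sub>F t in at_top. w z <= w x + ln((1 + t)/t)" by(rule eventually_mono[OF eventually_gt_at_top le])
   moreover have "((%t. w x + ln((1 + t)/t)) \<longlongrightarrow> w x + 0) at_top" by(intro tendsto_add tendsto_const) real_asymp
   ultimately have "w z <= w x + 0" by(intro tendsto_lowerbound) auto
   thus ?thesis by simp
  qed
  have "w x = w 0" for x using le[of x 0] le[of 0 x] by(cases "x = 0") auto
  hence "(%x. exp(3*w x)) = (%_. exp(3*w 0))" by(intro ext) simp
  with exp_integrable have "L1 (%_::real^3. exp(3*w 0))" by simp
  thus False by(simp add: integrable_iff_bounded ennreal_mult_eq_top_iff emeasure_lborel_UNIV)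
 qed
 then obtain c0 r0 where a2: "a = 2" and Q0: "Q c0 r0" using alt by blast
 define A where "A = w c0 + 2*ln r0"
 have Q: "EX r. Q c r" for c
 proof(rule ccontr)
  assume "~ ?thesis"
  hence P: "P c" using alt by blast
  \<comment> \<open>Comparison at infinity: if the spheres around \<open>c\<close> never stop, the
    limit \<open>A\<close> obtained at \<open>c0\<close> dominates \<open>w c + 2 * ln r\<close> for
    every \<open>r\<close>, which is absurd.\<close>
  have "w c + 2*ln r <= A" if r: "0 < r" for r
  proof(rule tendsto_le[OF _ lim[OF Q0, folded A_def] reflected_tendsto])
   show "\<forall>\<^sub>F x in at_infinity. reflected c r x <= w x + 2*ln(norm x)"
    using eventually_far[of r c] by eventually_elim (use P r in \<open>auto simp: P_def\<close>)
  qed(rule trivial_limit_at_infinity)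
  from this[OF exp_gt_zero, of "A - w c + \<bar>A - w c\<bar> + 1", unfolded ln_exp] show False
   using abs_ge_minus_self[of "A - w c"] abs_ge_zero[of "A - w c"] by argo
 qed
 \<comment> \<open>This turns out to be a quadratic polynomial. The common limit \<open>A\<close>
   gives \<open>r^2 = E c\<close> for the radius of symmetry at \<open>c\<close>, so the symmetry
   becomes a functional equation for \<open>E\<close> alone.\<close>
 define E where "E x = exp(A - w x)" for x
 have E0: "0 < E x" for x by(simp add: E_def)
 have E: "E x = norm(x - c)^2*(E (c + E c *\<^sub>R inversion (x - c))/E c)" if x: "sqrt(E c) < norm(x - c)" for c x
 proof -
  obtain r where r: "Q c r" using Q by blast
  have "w c + 2*ln r = A"
   by(rule tendsto_unique[OF trivial_limit_at_infinity lim[OF r] lim[OF Q0, folded A_def]])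
  hence l: "2*ln r = A - w c" by simp
  have r2: "r^2 = E c" "0 < r"
   using r unfolding Q_def by(auto simp: E_def l[symmetric] exp_double power2_eq_square)
  have "0 <= sqrt(E c)" using E0[of c] by(simp add: less_imp_le)
  hence n: "0 < norm(x - c)" using x by linarith
  hence xc: "x ~= c" by auto
  have "sqrt(E c) = r" using r2 by(intro real_sqrt_unique) auto
  hence "reflected c r x = w x + 2*ln(norm x)" using r x unfolding Q_def by blast
  hence "w x = w (c + E c *\<^sub>R inversion (x - c)) + (A - w c) - 2*ln(norm(x - c))"
   unfolding reflected_def r2(1) l by argo
  hence "E x = exp((A - w (c + E c *\<^sub>R inversion (x - c))) - (A - w c) + 2*ln(norm(x - c)))"
   unfolding E_def by simp
  thus ?thesis unfolding exp_add exp_diff E_def exp_double using n by(simp add: mult.commute)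
 qed
 obtain E' where E': "!!c. (E has_derivative E' c) (at c)"
 proof -
  have "EX D. (E has_derivative D) (at c)" for c
  proof -
   obtain D where "(w has_derivative D) (at c)" using diff unfolding differentiable_def by blast
   hence "(E has_derivative (%h. exp(A - w c)*(0 - D h))) (at c)"
    unfolding E_def[abs_def] by(auto intro!: derivative_eq_intros simp: mult.commute)
   thus ?thesis by blast
  qed
  thus thesis using that by metis
 qed
 have lin: "bounded_linear (E' c)" for c by(rule has_derivative_bounded_linear[OF E'])
 \<comment> \<open>The symmetry at \<open>c\<close> carries differentiability of \<open>E\<close> at
   \<open>c\<close> to an expansion at infinity,
   \<open>E x = |x - c|^2 + E' c (x - c) + o(|x|)\<close>.\<close>
 have exp1: "((%x. (E x - (norm(x - c))^2 - E' c (x - c))/norm(x - c)) \<longlongrightarrow> 0) at_infinity" for c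
 proof -
  define k where "k x = E c *\<^sub>R inversion (x - c)" for x
  have k0: "(k \<longlongrightarrow> 0) at_infinity"
   unfolding k_def using tendsto_scaleR[OF tendsto_const inversion_tendsto, of "E c" c] by simp
  have nk: "\<forall>\<^sub>F x in at_infinity. k x ~= 0"
   using eventually_not_equal_at_infinity[of c] by eventually_elim (use E0[of c] in \<open>auto simp: k_def\<close>)
  have "((%h. norm(E (c + h) - E c - E' c h)/norm h) \<longlongrightarrow> 0) (at 0)"
   using E'[of c] by(simp add: has_derivative_at)
  from filterlim_compose[OF this filterlim_atI[OF k0 nk]]
  have "((%x. norm(E (c + k x) - E c - E' c (k x))/norm(k x)) \<longlongrightarrow> 0) at_infinity" .
  hence l: "((%x. (E (c + k x) - E c - E' c (k x))/norm(k x)) \<longlongrightarrow> 0) at_infinity"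
   by(rule tendsto_norm_zero_cancel[OF Lim_transform_eventually]) simp
  show ?thesis
  proof(rule Lim_transform_eventually[OF l])
   show "\<forall>\<^sub>F x in at_infinity. (E (c + k x) - E c - E' c (k x))/norm(k x) = (E x - (norm(x - c))^2 - E' c (x - c))/norm(x - c)"
    using eventually_far[of "sqrt(E c)" c] eventually_not_equal_at_infinity[of c]
   proof eventually_elim
    case (elim x)
    define n e where "n = norm(x - c)" and "e = E c"
    have ne: "0 < n" "0 < e" using elim E0 by(auto simp: n_def e_def)
    have kx: "E' c (k x) = e/n^2*E' c (x - c)" "norm(k x) = e/n"
     using ne linear_scale[OF bounded_linear.linear[OF lin], of c "e/n^2" "x - c"]
     by(auto simp: k_def inversion_def n_def[symmetric] e_def[symmetric] power2_eq_square)
    have "E (c + k x) = e/n^2*E x" using E[OF elim(1)] ne by(simp add: k_def n_def e_def)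
    thus ?case unfolding kx n_def[symmetric] e_def[symmetric] using ne by(simp add: field_simps power2_eq_square)
   qed
  qed
 qed
 \<comment> \<open>The expansions around \<open>c\<close> and around 0 describe the same function at
   infinity, so their linear parts agree; this is tested along the ray in direction
   \<open>h\<close>.\<close>
 have E'_eq: "E' c h = 2*(c \<bullet> h) + E' 0 h" for c h
 proof(rule ccontr)
  define l where "l h = 2*(c \<bullet> h) + E' 0 h - E' c h" for h
  assume ne: "E' c h ~= 2*(c \<bullet> h) + E' 0 h"
  hence lh: "l h ~= 0" by(simp add: l_def)
  hence h0: "h ~= 0" using linear_0[OF bounded_linear.linear[OF lin]] by(auto simp: l_def)
  have ratio: "((%x. (E x - (norm(x - c))^2 - E' c (x - c))/norm(x - c)*(norm(x - c)/norm x)) \<longlongrightarrow> 0*inverse 1) at_infinity"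
   using tendsto_mult[OF exp1[of c] tendsto_inverse[OF norm_ratio_tendsto[of c]]] by(simp add: divide_inverse mult_ac)
  have "((%x. (l x - (norm c^2 - E' c c))/norm x) \<longlongrightarrow> 0*inverse 1 - 0) at_infinity"
  proof(rule Lim_transform_eventually[OF tendsto_diff[OF ratio exp1[of 0, simplified]]])
   show "\<forall>\<^sub>F x in at_infinity. (E x - (norm(x - c))^2 - E' c (x - c))/norm(x - c)*(norm(x - c)/norm x) - (E x - (norm x)^2 - E' 0 x)/norm x
     = (l x - (norm c^2 - E' c c))/norm x" using eventually_not_equal_at_infinity[of c]
   proof eventually_elim
    case (elim x)
    have "(norm(x - c))^2 = norm x^2 + norm c^2 - 2*(c \<bullet> x)" by(simp add: power2_norm_eq_inner algebra_simps inner_commute)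
    moreover have "E' c (x - c) = E' c x - E' c c" by(rule linear_diff[OF bounded_linear.linear[OF lin]])
    moreover have "q/norm(x - c)*(norm(x - c)/norm x) = q/norm x" for q using elim by simp
    ultimately show ?case by(simp only:) (simp add: l_def diff_divide_distrib add_divide_distrib)
   qed
  qed
  moreover have "filterlim (%t. t *\<^sub>R h) at_infinity at_top"
   using h0 by(subst filterlim_at_infinity_conv_norm_at_top) (auto simp: intro!: filterlim_at_top_mult_tendsto_pos[OF tendsto_const] filterlim_abs_real)
  ultimately have "((%t. (l (t *\<^sub>R h) - (norm c^2 - E' c c))/norm(t *\<^sub>R h)) \<longlongrightarrow> 0*inverse 1 - 0) at_top"
   by(rule filterlim_compose)
  moreover have "l (t *\<^sub>R h) = t*l h" for t
   using linear_scale[OF bounded_linear.linear[OF lin]] by(simp add: l_def algebra_simps)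
  ultimately have z: "((%t. (t*l h - (norm c^2 - E' c c))/(\<bar>t\<bar>*norm h)) \<longlongrightarrow> 0) at_top" by simp
  have "((%t. (t*m - q)/(\<bar>t\<bar>*n)) \<longlongrightarrow> m/n) at_top" if "0 < n" for m q n :: real
   unfolding divide_inverse using that by real_asymp
  from tendsto_unique[OF trivial_limit_at_top_linorder this z] have "l h/norm h = 0" using h0 by simp
  thus False using lh h0 by simp
 qed
 have "EX k. ALL x:UNIV. E x - (norm x^2 + E' 0 x) = k"
 proof(rule has_derivative_zero_constant)
  fix x :: "real^3"
  have "((%x. E x - (x \<bullet> x + E' 0 x)) has_derivative (%h. E' x h - (x \<bullet> h + h \<bullet> x + E' 0 h))) (at x)"
   by(intro has_derivative_diff has_derivative_add has_derivative_inner has_derivative_ident E' bounded_linear_imp_has_derivative lin)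
  moreover have "(%h. E' x h - (x \<bullet> h + h \<bullet> x + E' 0 h)) = (%h. 0)" unfolding E'_eq[of x] by(simp add: inner_commute)
  ultimately show "((%x. E x - (norm x^2 + E' 0 x)) has_derivative (%h. 0)) (at x within UNIV)"
   by(simp add: power2_norm_eq_inner)
 qed simp
 then obtain k where k: "!!x. E x = norm x^2 + E' 0 x + k" by(auto simp: algebra_simps)
 define g where "g = (\<Sum>b\<in>Basis. E' 0 b *\<^sub>R b)"
 have g: "E' 0 x = g \<bullet> x" for x
 proof -
  have "E' 0 x = E' 0 (\<Sum>b\<in>Basis. (x \<bullet> b) *\<^sub>R b)" by(simp add: euclidean_representation)
  also have "... = (\<Sum>b\<in>Basis. (x \<bullet> b)*E' 0 b)"
   using bounded_linear.linear[OF lin[of 0]] by(simp add: linear_sum linear_scale)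
  finally show ?thesis by(simp add: g_def inner_sum_left inner_commute[of x] mult.commute)
 qed
 define x1 d where "x1 = - (1/2) *\<^sub>R g" and "d = k - (norm x1)^2"
 have Ed: "E x = d + norm(x - x1)^2" for x
 proof -
  have "(norm x1)^2 = (g \<bullet> g)/4" by(simp add: x1_def power_divide power2_norm_eq_inner)
  thus ?thesis unfolding k g d_def by(simp add: x1_def power2_norm_eq_inner algebra_simps inner_commute)
 qed
 have d: "0 < d" using E0[of x1] unfolding Ed by simp
 have f: "exp(3*w (x1 + x)) = exp A^3*(1/(d + norm x^2)^3)" for x
 proof -
  have "exp(w (x1 + x)) = exp A/E (x1 + x)" by(simp add: E_def exp_diff)
  hence "exp(w (x1 + x))^3 = exp A^3*(1/(d + norm x^2)^3)" unfolding Ed by(simp add: power_divide)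
  thus ?thesis by(simp add: exp_of_nat_mult[of 3, simplified])
 qed
 \<comment> \<open>The mass \<open>2 * pi^2\<close> ties the two remaining parameters together:
   \<open>exp A = 2 * sqrt d\<close>, which is the form of a spherical solution with
   \<open>l = 1/sqrt d\<close>.\<close>
 have "pi^2*2 = (LINT x. exp(3*w (x1 + x)))"
  unfolding integral_translate(1)[of "%x. exp(3*w x)"] exp_mass a2 ..
 also have "... = exp A^3*(pi^2/(4*(d * sqrt d)))" unfolding f by(simp only: integral_mult_right_zero integral_inverse_cube[OF d])
 finally have m: "pi^2*2 = exp A^3*(pi^2/(4*(d * sqrt d)))" .
 have gen: "t = 8*q" if "P*2 = t*(P/(4*q))" "0 < P" "0 < q" for t P q :: real
  using that by(simp add: field_simps)
 have "exp A^3 = 8*(d * sqrt d)" by(rule gen[OF m]) (use d in simp_all)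
 also have "... = (2 * sqrt d)^3"
 proof -
  have "(2*q)^3 = 8*(q*q*q)" for q :: real by(simp add: power3_eq_cube)
  from this[of "sqrt d"] show ?thesis using d by(simp only: real_sqrt_mult_self abs_of_pos)
 qed
 finally have eA: "exp A = 2 * sqrt d" by(rule power_eq_imp_eq_base[of _ 3]) (use d in simp_all)
 define l where "l = 1/sqrt d"
 have "w x = ln(2*l/(1 + l^2*norm(x - x1)^2))" for x
 proof -
  have "1 + l^2*norm(x - x1)^2 = (d + norm(x - x1)^2)/d" using d by(simp add: l_def power_divide add_divide_distrib)
  moreover have "l = sqrt d/d" using real_sqrt_mult_self[of d] d by(simp add: l_def eq_divide_eq divide_eq_eq)
  ultimately have "2*l/(1 + l^2*norm(x - x1)^2) = exp A/E x"
   unfolding eA Ed using d by simp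
  also have "... = exp(w x)" by(simp add: E_def exp_diff)
  finally show ?thesis by simp
 qed
 thus ?thesis unfolding spherical_solution_def using d by(intro exI[of _ l]) (auto simp: l_def)
qed

end

lemma subquadratic:
 fixes u :: "real^3 => real"
 assumes "\<forall>\<^sub>F x in at_infinity. \<bar>u x\<bar> <= C*(1 + norm x)"
 shows "u : o[at_infinity](%x. (norm x)^2)"
proof -
 have "u : O[at_infinity](%x. 1 + norm x)"
  by(rule bigoI[of _ C]) (use assms in eventually_elim, simp)
 moreover have "(%r::real. 1 + r) : o(%r. r^2)" by real_asymp
 hence "(%x. 1 + norm x) : o[at_infinity](%x::real^3. (norm x)^2)"
  by(rule landau_o.small.compose[OF _ filterlim_norm_at_top])
 ultimately show ?thesis by(rule landau_o.big_small_trans)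
qed

lemma ln_one_plus_square_le: "ln(1 + t^2) <= 2*t" if "0 <= t" for t :: real
proof -
 have "ln(1 + t^2) <= ln((1 + t)^2)" using that by(intro ln_mono) (auto simp: power2_sum add_pos_nonneg)
 also have "... = 2*ln(1 + t)" using that by(simp add: ln_realpow)
 also have "... <= 2*t" using ln_add_one_self_le_self[of t] that by simp
 finally show ?thesis .
qed

lemma spherical_solution_subquadratic:
 assumes "spherical_solution u"
 shows "u : o[at_infinity](%x. (norm x)^2)"
proof -
 obtain l x0 where l: "0 < l" and u: "!!x. u x = ln(2*l/(1 + l^2*norm(x - x0)^2))"
  using assms unfolding spherical_solution_def by blast
 define C where "C = \<bar>ln(2*l)\<bar> + 2*l*(1 + norm x0)"
 have "\<bar>u x\<bar> <= C*(1 + norm x)" for x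
 proof -
  define t where "t = l*norm(x - x0)"
  have t: "0 <= t" "t <= l*(1 + norm x0)*(1 + norm x)"
  proof -
   have "norm(x - x0) <= (1 + norm x0)*(1 + norm x)"
    using norm_triangle_ineq4[of x x0] mult_nonneg_nonneg[OF norm_ge_zero[of x0] norm_ge_zero[of x]]
    unfolding distrib_left distrib_right by linarith
   thus "0 <= t" "t <= l*(1 + norm x0)*(1 + norm x)" using l by(simp_all add: t_def mult.assoc)
  qed
  have "0 < 1 + t^2" by(simp add: add_pos_nonneg)
  moreover have "u x = ln(2*l/(1 + t^2))" by(simp add: u t_def power_mult_distrib)
  ultimately have "u x = ln(2*l) - ln(1 + t^2)" using l by(simp add: ln_div)
  moreover have "0 <= ln(1 + t^2)" by(intro ln_ge_zero) simp
  ultimately have "\<bar>u x\<bar> <= \<bar>ln(2*l)\<bar> + 2*t" using ln_one_plus_square_le[OF t(1)] by linarith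
  also have "... <= \<bar>ln(2*l)\<bar>*(1 + norm x) + 2*(l*(1 + norm x0)*(1 + norm x))"
   using t(2) by(intro add_mono) (auto simp: mult_le_cancel_left1)
  finally show ?thesis by(simp add: C_def algebra_simps)
 qed
 thus ?thesis by(intro subquadratic always_eventually allI)
qed

context riesz_solution
begin

lemma log_kernel_diff:
 "AE y in lborel. log_kernel x y*f y - log_kernel z y*f y = ln(norm(z - y)/norm(x - y))*f y"
 using AE_lborel_singleton[of "0::real^3"] AE_lborel_singleton[of x] AE_lborel_singleton[of z]
proof eventually_elim
 case (elim y)
 thus ?case by(simp add: log_kernel_eq ln_div left_diff_distrib[symmetric])
qed

lemma log_solution:
 assumes L: "L = 0"
 shows "log_solution u \<alpha>"
proof
 show "continuous_on UNIV u" "L1 (%y. exp(3*u y))" by(rule u_continuous int_exp)+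
 show "(LINT y. exp(3*u y)) = pi^2*\<alpha>" by(simp add: \<alpha>_def mass_def f_def[abs_def])
 fix x z
 have i: "L1 (%y. log_kernel x y*f y - log_kernel z y*f y)"
  by(intro integrable_diff log_kernel_integrable)
 have m: "(%y. ln(norm(z - y)/norm(x - y))*f y) : borel_measurable lborel" by measurable
 show "L1 (%y. ln(norm(z - y)/norm(x - y))*exp(3*u y))"
  using integrable_cong_AE[OF borel_measurable_integrable[OF i] m log_kernel_diff] i by(simp add: f_def)
 have "(LINT y. ln(norm(z - y)/norm(x - y))*f y) = (LINT y. log_kernel x y*f y - log_kernel z y*f y)"
  by(rule integral_cong_AE[OF borel_measurable_integrable[OF i] m log_kernel_diff, symmetric])
 also have "... = (LINT y. log_kernel x y*f y) - (LINT y. log_kernel z y*f y)"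
  by(rule integral_diff[OF log_kernel_integrable log_kernel_integrable])
 finally have "1/pi^2*(LINT y. ln(norm(z - y)/norm(x - y))*f y) = v x - v z"
  by(simp add: v_def right_diff_distrib)
 moreover have "u x - u z = v x - v z" using p_constant[OF L, of x] p_constant[OF L, of z] by(simp add: p_def)
 ultimately show "u x - u z = 1/pi^2*(LINT y. ln(norm(z - y)/norm(x - y))*exp(3*u y))"
  by(simp add: f_def)
qed

text \<open>Mass within radius \<open>R\<close> pulls \<open>v\<close> down by its share of
  \<open>ln |x|\<close>, mass outside pushes it up by at most its share. If the outer mass is below
  half of the excess of \<open>mass\<close> over \<open>2 * pi^2\<close>, the rate of decay is still
  at least 2.\<close>

lemma v_decay:
 assumes a: "2 < \<alpha>"
 obtains C R where "1 <= R" "!!x. R <= norm x ==> v x <= C - 2*ln(norm x)"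
proof -
 obtain M where M: "0 < M" "!!x. f x <= M" by(rule f_bounded) (rule that)
 have "\<forall>\<^sub>F r in at_top. tail r < pi^2*(\<alpha> - 2)/2" using a by(intro order_tendstoD(2)[OF tail_tendsto]) simp
 then obtain R0 where R0: "!!r. R0 <= r ==> tail r < pi^2*(\<alpha> - 2)/2" unfolding eventually_at_top_linorder by blast
 define R T where "R = max 1 R0" and "T = tail R"
 have R: "1 <= R" and T: "2*T <= pi^2*(\<alpha> - 2)" using R0[of R] by(auto simp: R_def T_def)
 define C where "C = (\<bar>ln(2 * R)\<bar>*mass + 2*ln 2*T + M*inverse_square_mass 1)/pi^2"
 define I where "I y = indicator {y. R <= norm y} y*f y" for y
 have iI: "L1 I" unfolding I_def by(intro integrable_indicator_f) measurable
 have T_eq: "LI I = T" by(simp add: T_def tail_def I_def[abs_def])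
 have "v x <= C - 2*ln(norm x)" if x: "2 * R <= norm x" for x
 proof -
  define q where "q = ln(norm x)"
  have x1: "1 <= norm x" using x R by linarith
  have q: "0 <= q" unfolding q_def using x1 by(rule ln_ge_zero)
  have i: "L1 (%y. (ln(2 * R) - q)*(f y - I y))" "L1 (%y. (2*ln 2 + q)*I y)"
   "L1 (%y. M*(indicator (cball x 1) y/norm(x - y)^2))"
   by(intro integrable_mult_right integrable_diff f_integrable iI integrable_inverse_square_ball)+
  have "(LINT y. log_kernel x y*f y) <= (LINT y. (ln(2 * R) - q)*(f y - I y) + ((2*ln 2 + q)*I y + M*(indicator (cball x 1) y/norm(x - y)^2)))"
  proof(rule integral_mono_AE[OF log_kernel_integrable integrable_add[OF i(1) integrable_add[OF i(2,3)]]])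
   show "AE y in lborel. log_kernel x y*f y <= (ln(2 * R) - q)*(f y - I y) + ((2*ln 2 + q)*I y + M*(indicator (cball x 1) y/norm(x - y)^2))"
    using AE_lborel_singleton[of "0::real^3"] AE_lborel_singleton[of x]
   proof eventually_elim
    case (elim y)
    define s where "s = norm(x - y)"
    have p: "0 < norm y" "0 < s" using elim by(auto simp: s_def)
    have k: "log_kernel x y = ln(norm y) - ln s" using elim by(simp add: log_kernel_eq s_def)
    have j0: "0 <= M*(indicator (cball x 1) y/s^2)" using M(1) by simp
    show ?case
    proof(cases "R <= norm y")
     case False
     have "norm x/2 <= s" using False x norm_triangle_ineq2[of x y] unfolding s_def by argo
     with x1 have "ln(norm x/2) <= ln s" using x1 by(intro ln_mono) auto
     have "ln(norm y) <= ln R" using False p by(intro ln_mono) auto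
     have "log_kernel x y <= ln(2 * R) - q"
     proof -
      have "ln(norm x/2) = q - ln 2" "ln(2 * R) = ln 2 + ln R" unfolding q_def using x1 R by(auto simp: ln_div ln_mult)
      thus ?thesis unfolding k using \<open>ln (norm x / 2) <= ln s\<close> \<open>ln (norm y) <= ln R\<close> by linarith
     qed
     hence "log_kernel x y*f y <= (ln(2 * R) - q)*f y" using f_pos[of y] by(intro mult_right_mono) auto
     thus ?thesis using False j0 unfolding s_def I_def by simp
    next
     case True
     have "log_kernel x y*f y <= (2*ln 2 + q)*f y + M*(indicator (cball x 1) y/s^2)"
     proof(cases "norm y/2 <= s")
      case 1: True
      have "ln(norm y/2) <= ln s" using 1 p by(intro ln_mono) auto
      hence "log_kernel x y <= ln 2" unfolding k using p by(simp add: ln_div)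
      moreover have "0 <= ln(2::real)" by simp
      ultimately have "log_kernel x y <= 2*ln 2 + q" using q by linarith
      hence "log_kernel x y*f y <= (2*ln 2 + q)*f y" using f_pos[of y] by(intro mult_right_mono) auto
      thus ?thesis using j0 by linarith
     next
      case 2: False
      have "norm y <= 2*norm x" using 2 norm_triangle_ineq2[of y x] unfolding s_def norm_minus_commute[of x y] by argo
      hence "ln(norm y) <= ln(2*norm x)" using p by(intro ln_mono) auto
      moreover have "ln(2*norm x) = ln 2 + q" "0 <= ln(2 :: real)" unfolding q_def using x1 by(auto simp: ln_mult)
      ultimately have "ln(norm y) <= 2*ln 2 + q" by linarith
      moreover have "- ln s <= indicator (cball x 1) y/s^2"
      proof(cases "s <= 1")
       case True
       have "- ln s = ln(1/s)" using p by(simp add: ln_div)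
       also have "... <= 1/s" using ln_le_minus_one[of "1/s"] p by simp
       also have "... <= 1/s^2" using True p by(intro divide_left_mono) (auto simp: power2_eq_square mult_left_le)
       finally show ?thesis using True by(simp add: s_def dist_norm)
      next
       case False
       thus ?thesis by(simp add: s_def[symmetric] dist_norm)
      qed
      ultimately have "log_kernel x y*f y <= (2*ln 2 + q + indicator (cball x 1) y/s^2)*f y"
       unfolding k using f_pos[of y] by(intro mult_right_mono) auto
      moreover have "indicator (cball x 1) y/s^2*f y <= indicator (cball x 1) y/s^2*M" using M by(intro mult_left_mono) auto
      ultimately show ?thesis unfolding distrib_right mult.commute[of M] by linarith
     qed
     thus ?thesis using True unfolding s_def I_def by simp
    qed
   qed
  qed
  also have "... = (ln(2 * R) - q)*(mass - T) + ((2*ln 2 + q)*T + M*(LINT y. indicator (cball x 1) y/norm(x - y)^2))"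
   by(simp only: integral_add[OF i(1) integrable_add[OF i(2,3)]] integral_add[OF i(2,3)]
    integral_mult_right_zero integral_diff[OF f_integrable iI] T_eq mass_def)
  also have "... <= (ln(2 * R) - q)*(mass - T) + ((2*ln 2 + q)*T + M*inverse_square_mass 1)"
   using M(1) by(intro add_left_mono mult_left_mono inverse_square_mass_bound) auto
  finally have "(LINT y. log_kernel x y*f y) <= (ln(2 * R) - q)*(mass - T) + ((2*ln 2 + q)*T + M*inverse_square_mass 1)" .
  moreover have "ln(2 * R)*(mass - T) <= \<bar>ln(2 * R)\<bar>*mass"
  proof(intro mult_mono)
   have "0 <= T" unfolding T_eq[symmetric] I_def using f_pos less_imp_le by(intro integral_nonneg_AE AE_I2 mult_nonneg_nonneg) auto
   thus "mass - T <= mass" by simp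
   have "T <= mass" unfolding T_eq[symmetric] mass_def
    by(rule integral_mono[OF iI f_integrable]) (use f_pos less_imp_le in \<open>auto simp: I_def indicator_def\<close>)
   thus "0 <= mass - T" by simp
  qed auto
  moreover have "2*pi^2*q <= q*(mass - 2*T)"
  proof -
   have "q*(2*pi^2) <= q*(mass - 2*T)"
    using T q by(intro mult_left_mono) (simp_all add: \<alpha>_def right_diff_distrib)
   thus ?thesis by(simp add: mult_ac)
  qed
  ultimately have "(LINT y. log_kernel x y*f y) <= (\<bar>ln(2 * R)\<bar>*mass + 2*ln 2*T + M*inverse_square_mass 1) - 2*pi^2*q"
   by(simp add: algebra_simps)
  hence "1/pi^2*(LINT y. log_kernel x y*f y) <= 1/pi^2*((\<bar>ln(2 * R)\<bar>*mass + 2*ln 2*T + M*inverse_square_mass 1) - 2*pi^2*q)"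
   by(rule mult_left_mono) simp
  thus ?thesis unfolding v_def C_def q_def by(simp add: diff_divide_distrib)
 qed
 moreover have "1 <= 2 * R" using R by simp
 ultimately show thesis by(rule that[rotated])
qed

text \<open>For \<open>L = 0\<close> the function \<open>p\<close> is constant, which yields the
  integral equation. If \<open>\<alpha>\<close> exceeded 2, the decay of \<open>v\<close> would
  supply the bound of order six for the inward motion, and \<open>not_supercritical\<close> gives
  the contradiction.\<close>

lemma spherical_iff: "spherical_solution u \<longleftrightarrow> L = 0"
proof
 show "L = 0" if "spherical_solution u" using that by(intro L_zero_if_subquadratic spherical_solution_subquadratic)
 assume L: "L = 0"
 obtain M where M: "0 < M" "!!x. f x <= M" by(rule f_bounded) (rule that)
 have M': "exp(3*u x) <= M" for x using M(2)[of x] by(simp add: f_def)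
 have "\<alpha> <= 2"
 proof(rule ccontr)
  assume "~ \<alpha> <= 2"
  then obtain C R where R: "1 <= R" "!!x. R <= norm x ==> v x <= C - 2*ln(norm x)" by(rule v_decay[OF not_le_imp_less]) (rule that)
  define K where "K = max (exp(3*(C + p 0))) (M * R^6)"
  have "\<alpha> <= 2"
  proof(rule log_solution.not_supercritical[OF log_solution[OF L] M(1) M', of K])
   fix x :: "real^3" assume x: "x ~= 0"
   have "exp(3*u x)*norm x^6 <= K"
   proof(cases "R <= norm x")
    case True
    have "norm x^6 = exp(6*ln(norm x))" using x by(simp add: exp_of_nat_mult[of 6, simplified])
    hence "exp(3*u x)*norm x^6 = exp(3*u x + 6*ln(norm x))" by(simp add: exp_add)
    also have "... <= exp(3*(C + p 0))"
    proof -
     have "v x <= C - 2*ln(norm x)" "u x = v x + p 0" using R(2)[OF True] p_constant[OF L, of x] by(auto simp: p_def)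
     thus ?thesis by(subst exp_le_cancel_iff) argo
    qed
    finally show ?thesis by(simp add: K_def)
   next
    case False
    hence "exp(3*u x)*norm x^6 <= M * R^6" using M(1) R(1) by(intro mult_mono M' power_mono) auto
    thus ?thesis by(simp add: K_def)
   qed
   thus "exp(3*u x) <= K/norm x^6" using x by(simp add: pos_le_divide_eq)
  qed
  with \<open>~ \<alpha> <= 2\<close> show False by simp
 qed
 thus "spherical_solution u"
  by(rule log_solution.spherical[OF log_solution[OF L] M(1) M']) (rule smooth_on_differentiable[OF smooth], simp)
qed

lemma p_constant_iff: "(EX c. ALL x. p x = c) \<longleftrightarrow> L = 0"
proof
 assume "EX c. ALL x. p x = c"
 then obtain c where c: "!!x. p x = c" by blast
 have "weighted_mean p 0 1 = weight_mass * c" unfolding weighted_mean_def weight_mass_def c by simp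
 hence "mean_slope = 0" using weighted_mean_p(2)[of 1 0] c by simp
 thus "L = 0" using L_nonneg mean_slope_cases(2) by fastforce
qed(use p_constant in blast)

text \<open>\<open>is_polynomial\<close> gives \<open>polynomial_degree\<close> its meaning, as
  \<open>LEAST\<close> over an empty set is unspecified; with it, degree 0 amounts to
  \<open>p\<close> being constant.\<close>

lemma polynomial_degree_0_iff: "is_polynomial p & polynomial_degree p = 0 \<longleftrightarrow> L = 0"
proof -
 have z: "{\<beta> :: 3 => nat. (\<Sum>i\<in>UNIV. \<beta> i) <= 0} = {%_. 0}" by(auto simp: fun_eq_iff)
 have "polynomial_le 0 p \<longleftrightarrow> L = 0"
  unfolding p_constant_iff[symmetric] polynomial_le_def z by(auto intro: exI[of _ "%_. _"])
 moreover have "is_polynomial p & polynomial_degree p = 0 \<longleftrightarrow> polynomial_le 0 p"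
  unfolding is_polynomial_def polynomial_degree_def by(metis LeastI_ex Least_eq_0)
 ultimately show ?thesis by simp
qed

end

section \<open>Geometric conditions: scalar curvature and extension to the sphere\<close>

section \<open>Scalar curvature of a conformally flat metric\<close>

lemma sum_Basis_vec:
 fixes F :: "real^'n => 'b::comm_monoid_add"
 shows "(\<Sum>b\<in>(Basis :: (real^'n) set). F b) = (\<Sum>i\<in>UNIV. F(axis i 1))"
proof -
 have B: "(Basis :: (real^'n) set) = range (%i. axis i 1)" by(auto simp: Basis_vec_def)
 have I: "inj (%i :: 'n. axis i (1 :: real))" by(auto intro!: injI simp: axis_eq_axis)
 show ?thesis unfolding B sum.reindex[OF I] by simp
qed

lemma matrix_inv_scaleR_mat:
 assumes "c ~= 0"
 shows "matrix_inv (c *\<^sub>R (mat 1 :: real^'n^'n)) = (1/c) *\<^sub>R mat 1"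
proof -
 let ?A = "c *\<^sub>R (mat 1 :: real^'n^'n)"
 have s: "(a *\<^sub>R (mat 1 :: real^'n^'n)) ** B = a *\<^sub>R B" "B ** (a *\<^sub>R (mat 1 :: real^'n^'n)) = a *\<^sub>R B" for a and B :: "real^'n^'n"
  by(simp_all add: matrix_scalar_ac flip: scalar_matrix_assoc)
 have "EX B. ?A ** B = mat 1 & B ** ?A = mat 1" using assms by(intro exI[of _ "(1/c) *\<^sub>R mat 1"]) (simp add: s)
 hence "?A ** matrix_inv ?A = mat 1" unfolding matrix_inv_def by(rule someI2_ex) simp
 hence "(1/c) *\<^sub>R (c *\<^sub>R matrix_inv ?A) = (1/c) *\<^sub>R mat 1" by(simp add: s)
 thus ?thesis using assms by simp
qed

text \<open>The coefficients are \<open>2 * (n - 1)\<close> and \<open>(n - 1) * (n - 2)\<close> for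
  \<open>n = 3\<close>. Once the Christoffel symbols are written with Kronecker deltas, expanding
  all indices leaves pure algebra.\<close>

lemma scalar_curvature_conformal:
 fixes u :: "real^3 => real"
 assumes u: "smooth_on UNIV u"
 shows "scalar_curvature (conformal_metric u) x
  = - exp(- 2*u x)*(4*laplacian u x + 2*(\<Sum>b\<in>Basis. (dir_deriv b u x)^2))"
proof -
 define D where "D i = dir_deriv (axis i 1) u" for i :: 3
 have ax: "axis i 1 : (Basis :: (real^3) set)" for i by(auto simp: Basis_vec_def)
 have dD: "(D i has_derivative (%b. dir_deriv b (D i) x)) (at x)" for i x
  unfolding D_def by(rule smooth_on_has_derivative[OF smooth_on_dir_deriv[OF u ax]]) simp
 have inv: "matrix_inv (conformal_metric u x) = exp(- 2*u x) *\<^sub>R mat 1" for x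
  by(simp add: conformal_metric_def matrix_inv_scaleR_mat exp_minus inverse_eq_divide)
 have met: "dir_deriv (axis i 1) (%y. conformal_metric u y $ j $ l) x = of_bool (j = l)*(2*exp(2*u x)*D i x)" for i j l x
 proof -
  have d: "((%y. of_bool (j = l)*exp(2*u y)) has_derivative (%b. of_bool (j = l)*(2*dir_deriv b u x*exp(2*u x)))) (at x)"
   using smooth_on_has_derivative[OF u, of x] by(auto intro!: derivative_eq_intros)
  have e: "(%y. conformal_metric u y $ j $ l) = (%y. of_bool (j = l)*exp(2*u y))"
   by(auto simp: conformal_metric_def mat_def fun_eq_iff)
  show ?thesis unfolding e D_def dir_deriv_eqI[OF d] by simp
 qed
 have ch: "christoffel (conformal_metric u) k i j = (%x. of_bool (k = j)*D i x + of_bool (k = i)*D j x - of_bool (i = j)*D k x)" for k i j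
 proof
  fix x
  have "christoffel (conformal_metric u) k i j x = 1/2*(\<Sum>l\<in>UNIV. of_bool (k = l)*(exp(- 2*u x)
   * (2*exp(2*u x)*(of_bool (j = l)*D i x + of_bool (i = l)*D j x - of_bool (i = j)*D l x))))"
  proof -
   have "matrix_inv (conformal_metric u x) $ k $ l*(dir_deriv (axis i 1) (%y. conformal_metric u y $ j $ l) x
     + dir_deriv (axis j 1) (%y. conformal_metric u y $ i $ l) x - dir_deriv (axis l 1) (%y. conformal_metric u y $ i $ j) x)
    = of_bool (k = l)*(exp(- 2*u x)*(2*exp(2*u x)*(of_bool (j = l)*D i x + of_bool (i = l)*D j x - of_bool (i = j)*D l x)))" for l
    unfolding inv met by(simp add: mat_def algebra_simps)
   thus ?thesis unfolding christoffel_def by(simp only:)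
  qed
  also have "... = 1/2*(exp(- 2*u x)*(2*exp(2*u x)*(of_bool (j = k)*D i x + of_bool (i = k)*D j x - of_bool (i = j)*D k x)))"
   by(subst sum.mono_neutral_right[of _ "{k}"]) auto
  also have "... = of_bool (k = j)*D i x + of_bool (k = i)*D j x - of_bool (i = j)*D k x"
  proof -
   have "1/2*(exp(- 2*u x)*(2*exp(2*u x)*Z)) = Z" for Z by(simp flip: exp_add mult.assoc)
   thus ?thesis by(simp only: eq_commute[of j k] eq_commute[of i k])
  qed
  finally show "christoffel (conformal_metric u) k i j x = ..." .
 qed
 have dch: "dir_deriv b (christoffel (conformal_metric u) k i j) x
   = of_bool (k = j)*dir_deriv b (D i) x + of_bool (k = i)*dir_deriv b (D j) x - of_bool (i = j)*dir_deriv b (D k) x" for b k i j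
  unfolding ch by(rule dir_deriv_eqI) (intro has_derivative_diff has_derivative_add has_derivative_mult_right dD)
 have "scalar_curvature (conformal_metric u) x = exp(- 2*u x)*(\<Sum>k\<in>UNIV. ricci (conformal_metric u) k k x)"
  unfolding scalar_curvature_def inv sum_3 by(simp add: mat_def algebra_simps)
 also have "(\<Sum>k\<in>UNIV. ricci (conformal_metric u) k k x)
   = - 4*(\<Sum>i\<in>UNIV. dir_deriv (axis i 1) (D i) x) - 2*(\<Sum>i\<in>UNIV. (D i x)^2)"
  unfolding ricci_def riemann_def dch unfolding ch sum_3 by(simp add: power2_eq_square algebra_simps)
 finally show ?thesis by(simp add: laplacian_def sum_Basis_vec D_def algebra_simps)
qed

context riesz_solution
begin

lemma linear_growth:
 assumes G: "!!x. (\<Sum>b\<in>Basis. (dir_deriv b u x)^2) <= G^2" and G0: "0 <= G"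
 shows "\<bar>u x - u 0\<bar> <= 3*G*norm x"
proof -
 have "norm(u x - u 0) <= 3*G*norm(x - 0)"
 proof(rule differentiable_bound[of UNIV])
  show "(u has_derivative (%b. dir_deriv b u y)) (at y within UNIV)" for y
   using smooth_on_has_derivative[OF smooth, of y] by simp
  fix y
  have d: "\<bar>dir_deriv b u y\<bar> <= G" if "b : Basis" for b
  proof -
   have "(dir_deriv b u y)^2 <= (\<Sum>b\<in>Basis. (dir_deriv b u y)^2)" by(rule member_le_sum) (use that in auto)
   hence "(dir_deriv b u y)^2 <= G^2" using G[of y] by linarith
   thus ?thesis using G0 abs_le_square_iff[of "dir_deriv b u y" G] by simp
  qed
  have lin: "linear (%b. dir_deriv b u y)"
   by(rule has_derivative_linear[OF smooth_on_has_derivative[OF smooth]]) simp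
  show "onorm (%b. dir_deriv b u y) <= 3*G"
  proof(rule onorm_le)
   fix b :: "real^3"
   have "dir_deriv b u y = (\<Sum>i\<in>Basis. (b \<bullet> i)*dir_deriv i u y)"
    using linear_sum[OF lin, of "%i. (b \<bullet> i) *\<^sub>R i" Basis] linear_scale[OF lin] by(simp add: euclidean_representation)
   also have "\<bar>...\<bar> <= (\<Sum>i\<in>(Basis :: (real^3) set). norm b*G)"
    by(rule order_trans[OF sum_abs sum_mono]) (auto simp: abs_mult intro!: mult_mono d Basis_le_norm)
   finally show "norm(dir_deriv b u y) <= 3*G*norm b" by(simp add: mult_ac)
  qed
 qed auto
 thus ?thesis by simp
qed

text \<open>As \<open>u\<close> is bounded above and its Laplacian converges, a lower bound of the
  curvature bounds the gradient, and \<open>u\<close> grows at most linearly. Conversely, a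
  spherical solution has constant curvature 6.\<close>

lemma curvature_iff: "Liminf at_infinity (%x. ereal (scalar_curvature (conformal_metric u) x)) > - \<infinity> \<longleftrightarrow> L = 0"
proof
 define S where "S x = (\<Sum>b\<in>Basis. (dir_deriv b u x)^2)" for x
 note curv = scalar_curvature_conformal[OF smooth, folded S_def]
 assume "Liminf at_infinity (%x. ereal (scalar_curvature (conformal_metric u) x)) > - \<infinity>"
 from ereal_dense2[OF this] obtain c where "ereal c < Liminf at_infinity (%x. ereal (scalar_curvature (conformal_metric u) x))" by blast
 from less_LiminfD[OF this] have c: "\<forall>\<^sub>F x in at_infinity. c < scalar_curvature (conformal_metric u) x" by simp
 obtain M where M: "0 < M" "!!x. f x <= M" by(rule f_bounded) (rule that)
 define m where "m = exp(2*(ln M/3))"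
 have m: "exp(2*u x) <= m" for x
  using M(2)[of x] M(1) by(simp add: f_def m_def ln_ge_iff[symmetric])
 have "\<forall>\<^sub>F x in at_infinity. - L - 1 < laplacian u x" by(rule order_tendstoD(1)[OF laplacian_tendsto]) simp
 with c have "\<forall>\<^sub>F x in at_infinity. S x <= \<bar>c\<bar>*m + 2*(L + 1)"
 proof eventually_elim
  case (elim x)
  define Q where "Q = 4*laplacian u x + 2*S x"
  have "c*exp(2*u x) < - exp(- 2*u x)*Q*exp(2*u x)"
   using elim(1) unfolding curv Q_def by(intro mult_strict_right_mono) auto
  also have "... = - Q*(exp(- 2*u x)*exp(2*u x))" by simp
  also have "... = - Q" by(simp flip: exp_add)
  finally have "c*exp(2*u x) < - Q" .
  moreover have "- (c*exp(2*u x)) <= \<bar>c\<bar>*m"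
   using mult_mono[OF abs_ge_minus_self[of c] m[of x]] by simp
  ultimately show ?case using elim(2) L_nonneg unfolding Q_def
   by(smt (verit) mult_nonneg_nonneg abs_ge_zero exp_ge_zero m)
 qed
 then obtain \<rho> where \<rho>: "!!x. \<rho> <= norm x ==> S x <= \<bar>c\<bar>*m + 2*(L + 1)" by(auto simp: eventually_at_infinity)
 have "continuous_on UNIV S"
  unfolding S_def by(intro continuous_intros smooth_on_continuous_on[OF smooth_on_dir_deriv[OF smooth]])
 hence "bounded (S ` cball 0 \<rho>)"
  by(intro compact_imp_bounded compact_continuous_image) (auto intro: continuous_on_subset)
 then obtain C where C: "ALL z:S ` cball 0 \<rho>. norm z <= C" unfolding bounded_iff by blast
 define G where "G = 1 + \<bar>C\<bar> + \<bar>\<bar>c\<bar>*m + 2*(L + 1)\<bar>"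
 have G: "1 <= G" by(simp add: G_def)
 have "S x <= G^2" for x
 proof -
  have "S x <= G"
  proof(cases "\<rho> <= norm x")
   case True
   thus ?thesis using \<rho>[OF True] unfolding G_def by linarith
  next
   case False
   hence "norm(S x) <= C" using C by auto
   thus ?thesis unfolding G_def by simp
  qed
  also have "... <= G^2" using G self_le_power[of G 2] by simp
  finally show ?thesis .
 qed
 hence lg: "\<bar>u x - u 0\<bar> <= 3*G*norm x" for x using linear_growth[of G] G by(simp add: S_def)
 show "L = 0"
 proof(rule L_zero_if_subquadratic[OF subquadratic[of _ "\<bar>u 0\<bar> + 3*G"]], intro always_eventually allI)
  fix x :: "real^3"
  have "\<bar>u x\<bar> <= \<bar>u 0\<bar>*1 + 3*G*norm x" using lg[of x] by linarith
  also have "... <= \<bar>u 0\<bar>*(1 + norm x) + 3*G*(1 + norm x)" using G by(intro add_mono mult_left_mono) auto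
  finally show "\<bar>u x\<bar> <= (\<bar>u 0\<bar> + 3*G)*(1 + norm x)" by(simp add: distrib_right)
 qed
next
 assume "L = 0"
 then obtain l x0 where l: "0 < l" and u: "!!x. u x = ln(2*l/(1 + l^2*norm(x - x0)^2))"
  using spherical_iff unfolding spherical_solution_def by blast
 \<comment> \<open>With \<open>e = 1/l\<close> the solution is a logarithmic profile with
   \<open>B = -1\<close>, whose derivatives are already known.\<close>
 define e where "e = 1/l"
 have e: "0 < e" using l by(simp add: e_def)
 have u_eq: "u = (%z. ln(2*e) + - 1*ln(e^2 + norm(z - x0)^2))"
 proof
  fix z
  have p: "0 < e^2 + norm(z - x0)^2" using e by(simp add: add_pos_nonneg)
  have "1 + l^2*norm(z - x0)^2 = l^2*(e^2 + norm(z - x0)^2)" using l by(simp add: e_def power_divide distrib_left)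
  moreover have "2*l/(l^2*q) = 2*e/q" for q using l by(simp add: e_def power2_eq_square)
  ultimately show "u z = ln(2*e) + - 1*ln(e^2 + norm(z - x0)^2)" unfolding u using p e by(simp add: ln_div)
 qed
 have "scalar_curvature (conformal_metric u) x = 6" for x
 proof -
  define Q where "Q = e^2 + norm(x - x0)^2"
  have Q: "0 < Q" using e by(simp add: Q_def add_pos_nonneg)
  have ex: "exp(- 2*u x) = Q^2/(4*e^2)"
  proof -
   have "- 2*u x = 2*(ln Q - ln(2*e))" unfolding u_eq Q_def by simp
   hence "exp(- 2*u x) = (Q/(2*e))^2" using Q e by(simp only: exp_double exp_diff exp_ln mult_pos_pos zero_less_numeral)
   thus ?thesis by(simp add: power_divide power_mult_distrib)
  qed
  have lapl: "laplacian u x = - 2*((3*e^2 + norm(x - x0)^2)/Q^2)"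
   using laplacian_log_profile[of e "ln(2*e)" "- 1" x0 x] e unfolding u_eq Q_def by simp
  have "(\<Sum>b\<in>Basis. (dir_deriv b u x)^2) = (\<Sum>b\<in>Basis. 4*((x - x0) \<bullet> b)^2/Q^2)"
  proof(rule sum.cong)
   fix b :: "real^3"
   show "(dir_deriv b u x)^2 = 4*((x - x0) \<bullet> b)^2/Q^2"
    using dir_deriv_log_profile[of e b "ln(2*e)" "- 1" x0 x] e unfolding u_eq Q_def
    by(simp only: power_mult_distrib) (simp add: power_inverse divide_inverse)
  qed simp
  also have "... = 4*norm(x - x0)^2/Q^2"
   unfolding norm_sq_Basis by(simp add: sum_distrib_left sum_divide_distrib)
  finally have "scalar_curvature (conformal_metric u) x = - (Q^2/(4*e^2))*(4*(- 2*((3*e^2 + norm(x - x0)^2)/Q^2)) + 2*(4*norm(x - x0)^2/Q^2))"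
   unfolding scalar_curvature_conformal[OF smooth] ex lapl by simp
  also have "4*(- 2*((3*e^2 + norm(x - x0)^2)/Q^2)) + 2*(4*norm(x - x0)^2/Q^2) = - 24*e^2/Q^2"
   by(simp add: add_divide_distrib diff_divide_distrib algebra_simps)
  finally show ?thesis using Q e by simp
 qed
 hence "6 <= Liminf at_infinity (%x. ereal (scalar_curvature (conformal_metric u) x))" by(intro Liminf_bounded) simp
 thus "Liminf at_infinity (%x. ereal (scalar_curvature (conformal_metric u) x)) > - \<infinity>" by(rule less_le_trans[rotated]) simp
qed

end

section \<open>Extension to the sphere\<close>

lemma vector_4:
 "(vector [a, b, c, d] :: 'a::zero^4) $ 1 = a" "(vector [a, b, c, d] :: 'a^4) $ 2 = b"
 "(vector [a, b, c, d] :: 'a^4) $ 3 = c" "(vector [a, b, c, d] :: 'a^4) $ 4 = d"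
 by(simp_all add: vector_def)

definition spatial :: "real^4 => real^3" where "spatial q = vector [q $ 1, q $ 2, q $ 3]"

lemma inner_spatial: "spatial v \<bullet> spatial w = v \<bullet> w - v $ 4*w $ 4"
 by(simp add: spatial_def inner_vec_def sum_3 sum_4)

lemma bounded_linear_spatial: "bounded_linear spatial"
 by(intro linear_conv_bounded_linear[THEN iffD1] linearI) (simp_all add: spatial_def vec_eq_iff forall_3)

lemma sphere_upper:
 assumes "q : sphere 0 1 - {south_pole}"
 shows "0 < 1 + q $ 4"
proof -
 have n: "q \<bullet> q = 1" using assms by(simp add: dot_square_norm)
 hence s: "spatial q \<bullet> spatial q = 1 - (q $ 4)^2" by(simp add: inner_spatial power2_eq_square)
 hence "(q $ 4)^2 <= 1^2" using inner_ge_zero[of "spatial q"] by simp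
 hence "\<bar>q $ 4\<bar> <= 1" using abs_le_square_iff[of "q $ 4" 1] by simp
 hence "- 1 <= q $ 4" by linarith
 moreover have "q $ 4 ~= - 1"
 proof
  assume 4: "q $ 4 = - 1"
  hence "spatial q = 0" using s by simp
  hence "q = south_pole" using 4 by(simp add: spatial_def south_pole_def vec_eq_iff forall_3 forall_4 axis_def)
  thus False using assms by simp
 qed
 ultimately show ?thesis by linarith
qed

text \<open>Stereographic projection is conformal: the terms with \<open>v $ 4 * w $ 4\<close>
  cancel because \<open>q\<close> has norm 1 and is orthogonal to both vectors. What remains is the
  factor \<open>1/(1 + q $ 4)^2\<close>.\<close>

lemma pullback_stereographic:
 assumes q: "q : sphere 0 1 - {south_pole}" and v: "v : tangent_sphere q" "w : tangent_sphere q"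
 shows "pullback_metric stereographic (conformal_metric u) q v w = exp(2*u (stereographic q))/(1 + q $ 4)^2*(v \<bullet> w)"
proof -
 define a where "a = 1/(1 + q $ 4)"
 have p: "0 < 1 + q $ 4" by(rule sphere_upper[OF q])
 have st: "stereographic = (%q. inverse(1 + q $ 4) *\<^sub>R spatial q)" by(simp add: stereographic_def[abs_def] spatial_def inverse_eq_divide)
 have "((%q. inverse(1 + q $ 4) *\<^sub>R spatial q) has_derivative (%v. inverse(1 + q $ 4) *\<^sub>R spatial v + (- (inverse(1 + q $ 4)*(0 + v $ 4)*inverse(1 + q $ 4))) *\<^sub>R spatial q)) (at q)"
  using p by(intro has_derivative_scaleR Deriv.has_derivative_inverse has_derivative_add has_derivative_const bounded_linear_imp_has_derivative bounded_linear_spatial bounded_linear_vec_nth) auto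
 hence d: "frechet_derivative stereographic (at q) v = a *\<^sub>R (spatial v - (a * v $ 4) *\<^sub>R spatial q)" for v
  unfolding st by(subst frechet_derivative_at[symmetric], assumption) (simp add: a_def inverse_eq_divide algebra_simps)
 have n: "q \<bullet> q = 1" "q \<bullet> v = 0" "q \<bullet> w = 0" "v \<bullet> q = 0" "w \<bullet> q = 0"
  using assms by(auto simp: dot_square_norm tangent_sphere_def inner_commute)
 have "(spatial v - (a * v $ 4) *\<^sub>R spatial q) \<bullet> (spatial w - (a*w $ 4) *\<^sub>R spatial q)
   = v \<bullet> w - v $ 4*w $ 4*(1 - 2*(a*q $ 4) - a^2*(1 - (q $ 4)^2))"
  by(simp add: inner_diff_left inner_diff_right inner_spatial n power2_eq_square algebra_simps)
 also have "1 - 2*(a*q $ 4) - a^2*(1 - (q $ 4)^2) = 0"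
 proof -
  have "a*(1 + q $ 4) = 1" using p by(simp add: a_def)
  moreover have "a^2*(1 - (q $ 4)^2) = (a*(1 + q $ 4))*(a*(1 - q $ 4))" by(simp add: power2_eq_square algebra_simps)
  ultimately show ?thesis by(simp add: algebra_simps)
 qed
 finally show ?thesis unfolding pullback_metric_def d conformal_metric_def
  by(simp add: a_def power2_eq_square flip: scaleR_matrix_vector_assoc)
qed

text \<open>The extended metric, evaluated on a tangent field without zeros, is a positive
  continuous function on a compact set, so its logarithm is bounded. Away from the pole this
  function is the conformal factor.\<close>

lemma extends_imp_bounded:
 assumes "extends_to_sphere (pullback_metric stereographic (conformal_metric u))"
 obtains C where "!!x. \<bar>2*u x + 2*ln(1 + norm x^2)\<bar> <= C"
proof -
 obtain h where h: "riemannian_metric_on_sphere h" and ext: "!!q v w. q : sphere 0 1 - {south_pole} ==> v : tangent_sphere q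
   ==> w : tangent_sphere q ==> h q v w = pullback_metric stereographic (conformal_metric u) q v w"
  using assms unfolding extends_to_sphere_def by blast
 obtain U G where U: "sphere 0 1 \<subseteq> U" "smooth_on U (G :: real^4 => real^4^4)"
  and hG: "!!q v w. q : sphere 0 1 ==> v : tangent_sphere q ==> w : tangent_sphere q ==> h q v w = v \<bullet> (G q *v w)"
  using h unfolding riemannian_metric_on_sphere_def by metis
 have pos: "!!q v. q : sphere 0 1 ==> v : tangent_sphere q ==> v ~= 0 ==> 0 < h q v v"
  using h unfolding riemannian_metric_on_sphere_def by blast
 \<comment> \<open>Multiplication by a quaternion unit: a global tangent field with
   \<open>|J q| = |q|\<close>, which replaces local frames at the pole.\<close>
 define J :: "real^4 => real^4" where "J q = vector [- q $ 2, q $ 1, - q $ 4, q $ 3]" for q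
 have J: "J q \<bullet> J q = q \<bullet> q" "J q : tangent_sphere q" for q
  by(simp_all add: J_def tangent_sphere_def inner_vec_def sum_4 vector_4)
 have linJ: "continuous_on UNIV J"
  by(intro linear_continuous_on linear_conv_bounded_linear[THEN iffD1] linearI) (simp_all add: J_def vec_eq_iff forall_4 vector_4)
 define k where "k q = J q \<bullet> (G q *v J q)" for q
 have "continuous_on (sphere 0 1) k" unfolding k_def matrix_vector_mult_def inner_vec_def
  by(intro continuous_intros continuous_on_subset[OF linJ] continuous_on_subset[OF smooth_on_continuous_on[OF U(2)] U(1)]) auto
 moreover have k0: "0 < k q" if "q : sphere 0 1" for q
 proof -
  have "J q ~= 0" using J(1)[of q] that by(auto simp: dot_square_norm)
  thus ?thesis unfolding k_def using pos[OF that J(2)] hG[OF that J(2) J(2)] by simp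
 qed
 ultimately have "continuous_on (sphere 0 1) (%q. ln(k q))" by(intro continuous_on_ln) (auto simp: less_le)
 hence "bounded ((%q. ln(k q)) ` sphere 0 1)" by(intro compact_imp_bounded compact_continuous_image) auto
 then obtain C where "ALL y:(%q. ln(k q)) ` sphere 0 1. norm y <= C" unfolding bounded_iff by blast
 hence C: "!!q. q : sphere 0 1 ==> \<bar>ln(k q)\<bar> <= C" by auto
 have "\<bar>2*u x + 2*ln(1 + norm x^2)\<bar> <= C + 2*ln 2" for x
 proof -
  define s where "s = 1 + norm x^2"
  have s: "0 < s" by(simp add: s_def add_pos_nonneg)
  \<comment> \<open>The inverse stereographic projection of \<open>x\<close>.\<close>
  define q :: "real^4" where "q = vector [2*x $ 1/s, 2*x $ 2/s, 2*x $ 3/s, 2/s - 1]"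
  have nx: "x $ 1*x $ 1 + x $ 2*x $ 2 + x $ 3*x $ 3 = s - 1"
   by(simp add: s_def power2_norm_eq_inner inner_vec_def sum_3)
  have q4: "1 + q $ 4 = 2/s" by(simp add: q_def vector_4)
  have "q \<bullet> q = 4*(x $ 1*x $ 1 + x $ 2*x $ 2 + x $ 3*x $ 3)/s^2 + (2/s - 1)^2"
   by(simp add: q_def inner_vec_def sum_4 vector_4 power2_eq_square add_divide_distrib)
  also have "... = (4/s - 4/s^2) + (4/s^2 - 4/s + 1)"
   unfolding nx using s by(simp add: power2_diff power_divide diff_divide_distrib right_diff_distrib) (simp add: power2_eq_square)
  also have "... = 1" by simp
  finally have qs: "q : sphere 0 1" by(simp add: norm_eq_1)
  moreover have "q ~= south_pole" using q4 s by(auto simp: south_pole_def)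
  ultimately have q: "q : sphere 0 1 - {south_pole}" by simp
  have st: "stereographic q = x" unfolding stereographic_def q4 using s by(simp add: q_def vec_eq_iff forall_3 vector_4)
  have "k q = exp(2*u x)/(2/s)^2*1"
   unfolding k_def using hG[OF qs J(2) J(2)] ext[OF q J(2) J(2)] pullback_stereographic[OF q J(2) J(2), of u] J(1)[of q] qs
   by(simp add: st q4 dot_square_norm)
  hence "k q = exp(2*u x)*(s/2)^2" by(simp add: power_divide)
  hence "ln(k q) = 2*u x + 2*(ln s - ln 2)" using s by(simp add: ln_mult ln_realpow ln_div)
  moreover have "0 <= ln(2 :: real)" by simp
  ultimately show ?thesis using C[OF qs] unfolding s_def[symmetric] by argo
 qed
 thus thesis by(rule that)
qed

lemma spherical_imp_extends:
 assumes "spherical_solution u"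
 shows "extends_to_sphere (pullback_metric stereographic (conformal_metric u))"
proof -
 obtain l x0 where l: "0 < l" and u: "!!x. u x = ln(2*l/(1 + l^2*norm(x - x0)^2))"
  using assms unfolding spherical_solution_def by blast
 \<comment> \<open>On the sphere without the pole this equals
   \<open>(1 + q $ 4) * (1 + l^2 * |stereographic q - x0|^2)\<close>, because \<open>q\<close> has
   norm 1. It is affine in \<open>q\<close> and positive on the whole sphere, so
   \<open>4 * l^2/A^2\<close> times the round metric is the extension.\<close>
 define A where "A q = (1 + l^2*norm x0^2 + l^2) + q \<bullet> ((1 + l^2*norm x0^2 - l^2) *\<^sub>R axis 4 1 - (2*l^2) *\<^sub>R vector [x0 $ 1, x0 $ 2, x0 $ 3, 0])" for q :: "real^4"
 have A: "A q = (1 + q $ 4)*(1 + l^2*norm x0^2) + l^2*(1 - q $ 4) - 2*l^2*(spatial q \<bullet> x0)" for q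
  by(simp add: A_def inner_diff_right inner_axis inner_vec_def sum_3 sum_4 vector_4 spatial_def axis_def algebra_simps)
 have fac: "A q = (1 + q $ 4)*(1 + l^2*norm(stereographic q - x0)^2)" if q: "q : sphere 0 1 - {south_pole}" for q
 proof -
  define a where "a = 1/(1 + q $ 4)"
  have a1: "(1 + q $ 4)*a = 1" using sphere_upper[OF q] by(simp add: a_def)
  have "q \<bullet> q = 1" using q by(simp add: dot_square_norm)
  hence s: "spatial q \<bullet> spatial q = (1 + q $ 4)*(1 - q $ 4)" by(simp add: inner_spatial algebra_simps)
  have N: "(norm(stereographic q - x0))^2 = a^2*((1 + q $ 4)*(1 - q $ 4)) - 2*a*(spatial q \<bullet> x0) + norm x0^2"
  proof -
   have "stereographic q = a *\<^sub>R spatial q" by(simp add: stereographic_def spatial_def a_def)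
   thus ?thesis unfolding s[symmetric] power2_norm_eq_inner
    by(simp add: inner_diff_left inner_diff_right inner_commute[of x0 "spatial q"] power2_eq_square[of a] algebra_simps)
  qed
  have "(1 + q $ 4)*norm(stereographic q - x0)^2
    = ((1 + q $ 4)*a)*(((1 + q $ 4)*a)*(1 - q $ 4)) - 2*(((1 + q $ 4)*a)*(spatial q \<bullet> x0)) + (1 + q $ 4)*norm x0^2"
   unfolding N by(simp add: power2_eq_square[of a] algebra_simps)
  hence e: "(1 + q $ 4)*norm(stereographic q - x0)^2 = (1 - q $ 4) - 2*(spatial q \<bullet> x0) + (1 + q $ 4)*norm x0^2"
   unfolding a1 by simp
  have dist: "(1 + q $ 4)*(1 + l^2*N) = (1 + q $ 4) + l^2*((1 + q $ 4)*N)" for N by(simp add: algebra_simps)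
  show ?thesis unfolding A dist e by(simp add: algebra_simps)
 qed
 have Apos: "0 < A q" if "q : sphere 0 1" for q
 proof(cases "q = south_pole")
  case True
  have "spatial south_pole = 0" by(simp add: spatial_def south_pole_def vec_eq_iff forall_3 axis_def)
  thus ?thesis unfolding A True using l by(simp add: south_pole_def)
 next
  case False
  hence "q : sphere 0 1 - {south_pole}" using that by simp
  thus ?thesis using sphere_upper fac by(simp add: add_pos_nonneg)
 qed
 define U where "U = {q. 0 < A q}"
 have Ac: "continuous_on UNIV A" unfolding A_def by(intro continuous_intros)
 have oU: "open U" unfolding U_def by(intro open_Collect_less continuous_on_const Ac)
 have sA: "smooth_on U A" unfolding A_def[abs_def] by(intro smooth_on_add smooth_on_const smooth_on_inner oU)
 define j :: "nat => real => real" where "j n t = (-1)^n*fact n/t^Suc n" for n t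
 have j: "(j n has_real_derivative j (Suc n) t) (at t)" if "t ~= 0" for n t
  unfolding j_def using that by(rule DERIV_fact_div_power)
 have "smooth_on U (%q. j 0 (A q))" by(rule smooth_on_comp[where h=j, OF sA j]) (auto simp: U_def)
 hence inv: "smooth_on U (%q. 1/A q)" by(simp add: j_def)
 define phi where "phi q = 4*l^2*(1/A q*(1/A q))" for q
 have sphi: "smooth_on U phi" unfolding phi_def by(intro smooth_on_mult smooth_on_const oU inv)
 have pull: "pullback_metric stereographic (conformal_metric u) q v w = phi q*(v \<bullet> w)"
  if q: "q : sphere 0 1 - {south_pole}" and v: "v : tangent_sphere q" "w : tangent_sphere q" for q v w
 proof -
  define B where "B = 1 + l^2*norm(stereographic q - x0)^2"
  have B: "0 < B" by(simp add: B_def add_pos_nonneg)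
  have "exp(2*u (stereographic q)) = (2*l/B)^2" unfolding u B_def[symmetric] using l B by(simp add: exp_double)
  thus ?thesis
   unfolding pullback_stereographic[OF q v] phi_def fac[OF q] B_def[symmetric] by(simp add: power2_eq_square mult_ac)
 qed
 have "riemannian_metric_on_sphere (%q v w. phi q*(v \<bullet> w))"
  unfolding riemannian_metric_on_sphere_def
 proof(intro conjI exI ballI impI)
  show "sphere 0 1 \<subseteq> U" using Apos by(auto simp: U_def)
  show "smooth_on U (%q. phi q *\<^sub>R (mat 1 :: real^4^4))"
   by(rule smooth_on_linear_compose(1)[OF sphi bounded_linear_scaleR_left])
  show "phi q*(v \<bullet> w) = v \<bullet> (phi q *\<^sub>R mat 1 *v w)" for q v w :: "real^4"
   by(simp flip: scaleR_matrix_vector_assoc)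
  show "phi q*(v \<bullet> w) = phi q*(w \<bullet> v)" for q v w :: "real^4" by(simp add: inner_commute)
  show "0 < phi q*(v \<bullet> v)" if "q : sphere 0 1" "v ~= 0" for q v :: "real^4"
   using Apos[OF that(1)] that(2) l by(simp add: phi_def)
 qed
 thus ?thesis unfolding extends_to_sphere_def using pull by(intro exI[of _ "%q v w. phi q*(v \<bullet> w)"]) auto
qed

lemma (in riesz_solution) extends_iff: "extends_to_sphere (pullback_metric stereographic (conformal_metric u)) \<longleftrightarrow> L = 0"
proof
 assume "extends_to_sphere (pullback_metric stereographic (conformal_metric u))"
 then obtain C where C: "!!x. \<bar>2*u x + 2*ln(1 + norm x^2)\<bar> <= C" by(rule extends_imp_bounded) (rule that)
 show "L = 0"
 proof(rule L_zero_if_subquadratic[OF subquadratic[of _ "C + 2"]], intro always_eventually allI)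
  fix x :: "real^3"
  have "0 <= ln(1 + norm x^2)" "0 <= C" using order_trans[OF abs_ge_zero C[of x]] by(auto intro: ln_ge_zero)
  hence "u x <= C + 2*norm x" "- u x <= C + 2*norm x"
   using C[of x] ln_one_plus_square_le[OF norm_ge_zero[of x]] norm_ge_zero[of x] unfolding abs_le_iff by argo+
  hence "\<bar>u x\<bar> <= C + 2*norm x" by simp
  also have "... <= (C + 2)*(1 + norm x)" using \<open>0 <= C\<close> by(simp add: algebra_simps)
  finally show "\<bar>u x\<bar> <= (C + 2)*(1 + norm x)" .
 qed
qed(use spherical_iff spherical_imp_extends in blast)

theorem theorem4:
  fixes u p :: "real^3 \<Rightarrow> real"
  assumes "smooth_on UNIV u"
    and "three_halves_laplace_solution u (distribution_of (\<lambda>x. 2 * exp (3 * u x)))"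
    and "integrable lebesgue (\<lambda>x. exp (3 * u x))"
    and "\<And>x. p x = u x - log_potential u x"
  shows "(spherical_solution u \<longleftrightarrow> is_polynomial p \<and> polynomial_degree p = 0) \<and>
         (spherical_solution u \<longleftrightarrow> (laplacian u \<longlongrightarrow> 0) at_infinity) \<and>
         (spherical_solution u \<longleftrightarrow> u \<in> o[at_infinity](\<lambda>x. (norm x)\<^sup>2)) \<and>
         (spherical_solution u \<longleftrightarrow>
            Liminf at_infinity (\<lambda>x. ereal (scalar_curvature (conformal_metric u) x)) > - \<infinity>) \<and>
         (spherical_solution u \<longleftrightarrow>
            extends_to_sphere (pullback_metric stereographic (conformal_metric u))) \<and>
         (\<not> spherical_solution u \<longrightarrow> (\<exists>a>0. (laplacian u \<longlongrightarrow> - a) at_infinity))"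
proof -
 have "u : borel_measurable borel"
  by(rule borel_measurable_continuous_onI[OF smooth_on_continuous_on[OF assms(1)]])
 hence "(%x. exp(3*u x)) : borel_measurable lborel" by measurable
 hence i: "L1 (%x. exp(3*u x))" using assms(3) by(simp add: integrable_completion)
 obtain L where L: "!!x. - laplacian u x = L + 1/pi^2*(LINT y. exp(3*u y)/norm(x - y)^2)"
  by(rule laplacian_eq_riesz_potential[OF assms(1,2) i]) (rule that)
 \<comment> \<open>Each clause is now an equivalence with \<open>L = 0\<close>, and \<open>L\<close>
   itself is the constant of the last one.\<close>
 interpret R: riesz_solution u L by unfold_locales (fact assms(1) i L)+
 have p: "p = R.p" using assms(4) by(simp add: fun_eq_iff R.p_def R.log_potential_eq_v)
 have "(laplacian u \<longlongrightarrow> 0) at_infinity \<longleftrightarrow> L = 0"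
  using R.laplacian_tendsto tendsto_unique[OF trivial_limit_at_infinity R.laplacian_tendsto, of 0] by auto
 moreover have "u : o[at_infinity](%x. (norm x)^2) \<longleftrightarrow> L = 0"
  using R.L_zero_if_subquadratic spherical_solution_subquadratic R.spherical_iff by blast
 moreover have "EX a>0. (laplacian u \<longlongrightarrow> - a) at_infinity" if "L ~= 0"
  using that R.L_nonneg R.laplacian_tendsto by(intro exI[of _ L]) simp
 ultimately show ?thesis
  unfolding R.spherical_iff p R.polynomial_degree_0_iff R.curvature_iff R.extends_iff by blast
qed

end
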